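(* Let $t>0$. For any bounded lower semicontinuous $F:\mathcal P(E)\to\mathbb R$, $$\liminf_{n\to\infty}\frac1{nt}\log\big\|\mathrm P^{nF\circ L_n}_{n,t}\big\|_{L^2(\mu^{\otimes n})}\ge\sup_{\nu\in\mathcal P(E)}\big(F(\nu)-I(\nu\,|\,\mu)\big).$$ If in addition the sub-level sets $\{\nu: I(\nu|\mu)\le c\}$, $c\in\mathbb R$, are compact in $\mathcal P(E)$, then for any bounded upper semicontinuous $F:\mathcal P(E)\to\mathbb R$, $$\limsup_{n\to\infty}\frac1{nt}\log\big\|\mathrm P^{nF\circ L_n}_{n,t}\big\|_{L^2(\mu^{\otimes n})}\le\sup_{\nu\in\mathcal P(E)}\big(F(\nu)-I(\nu\,|\,\mu)\big).$$
   Context: $(E,d)$ is a complete separable metric space; $\mathcal P(E)$ is the space of Borel probability measures with the weak topology. Standing assumptions: $(X_t)_{t\ge0}$ with laws $(\mathbb P_x)_{x\in E}$ is an $E$-valued continuous-time Markov process with semigroup $\mathrm P_tf(x)=\mathbb E_x[f(X_t)]$; $\mu\in\mathcal P(E)$ is ergodic and reversible for it; $(\mathrm P_t)$ is strongly continuous on $L^2(\mu)$. Let $\mathcal L$ be the generator, $\mathcal E(g,g)=-\int g\mathcal Lg\,\mathrm d\mu$ the Dirichlet form with closure $(\mathcal E,\mathbb D(\mathcal E))$. Fisher information: $I(\nu|\mu)=\mathcal E(\sqrt f,\sqrt f)$ if $\nu\ll\mu$, $f=\mathrm d\nu/\mathrm d\mu$, $\sqrt f\in\mathbb D(\mathcal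 E)$, else $+\infty$. For $n\in\mathbb N$, $(X^1_t,\dots,X^n_t)$ is the $E^n$-valued process (laws $\mathbb P^n_x$, expectations $\mathbb E^n_x$) whose coordinates evolve independently as copies of the original process given their starting points. For $f\in B(E^n)$ (bounded measurable), $\mathrm P^f_{n,t}g(x)=\mathbb E^n_x\big[g(X^1_t,\dots,X^n_t)\exp\big(\int_0^tf(X^1_s,\dots,X^n_s)\,\mathrm ds\big)\big]$ and $\|\mathrm P^f_{n,t}\|_{L^2(\mu^{\otimes n})}=\sup\{\|\mathrm P^f_{n,t}g\|_{L^2(\mu^{\otimes n})}: g\ge0,\int g^2\mathrm d\mu^{\otimes n}\le1\}$. $L_n:E^n\to\mathcal P(E)$ is the empirical measure map $L_n(x_1,\dots,x_n)=\frac1n\sum_{k=1}^n\delta_{x_k}$. *)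

theory Defs
  imports "HOL-Analysis.Analysis" "HOL-Probability.Probability"
begin

definition prob_measures :: "'a::polish_space measure set" where
  "prob_measures = {\<nu>. prob_space \<nu> \<and> sets \<nu> = sets borel}"

definition weak_topology :: "'a::polish_space measure topology" where
  "weak_topology = topology_generated_by
     {{\<nu> \<in> prob_measures. (\<integral>x. f x \<partial>\<nu>) \<in> (U :: real set)} | (f :: 'a \<Rightarrow> real) U.
        continuous_on UNIV f \<and> bounded (range f) \<and> open U}"

definition lsc_on :: "'b topology \<Rightarrow> ('b \<Rightarrow> real) \<Rightarrow> bool" where
  "lsc_on T F \<longleftrightarrow> (\<forall>c. openin T {\<nu> \<in> topspace T. c < F \<nu>})"

definition usc_on :: "'b topology \<Rightarrow> ('b \<Rightarrow> real) \<Rightarrow> bool" where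
  "usc_on T F \<longleftrightarrow> (\<forall>c. openin T {\<nu> \<in> topspace T. F \<nu> < c})"

definition Pt :: "('a \<Rightarrow> 'w measure) \<Rightarrow> (real \<Rightarrow> 'w \<Rightarrow> 'a) \<Rightarrow> real \<Rightarrow> ('a \<Rightarrow> real) \<Rightarrow> 'a \<Rightarrow> real" where
  "Pt Px X t f x = (\<integral>\<omega>. f (X t \<omega>) \<partial>(Px x))"

definition nat_filt :: "(real \<Rightarrow> 'w \<Rightarrow> 'a::topological_space) \<Rightarrow> 'w measure \<Rightarrow> real \<Rightarrow> 'w measure" where
  "nat_filt X M s = sigma (space M)
     {X r -` A \<inter> space M | r A. r \<in> {0..s} \<and> A \<in> sets borel}"

definition markov_process :: "('a::polish_space \<Rightarrow> 'w measure) \<Rightarrow> (real \<Rightarrow> 'w \<Rightarrow> 'a) \<Rightarrow> bool" where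
  "markov_process Px X \<longleftrightarrow>
     (\<forall>x. prob_space (Px x)) \<and>
     (\<forall>x y. sets (Px x) = sets (Px y)) \<and>
     (\<forall>x t. 0 \<le> t \<longrightarrow> X t \<in> measurable (Px x) borel) \<and>
     (\<forall>x. (\<lambda>(s, \<omega>). X s \<omega>) \<in> measurable (restrict_space borel {0..} \<Otimes>\<^sub>M Px x) borel) \<and>
     (\<forall>x. AE \<omega> in Px x. X 0 \<omega> = x) \<and>
     (\<forall>x0. \<forall>B \<in> sets (Px x0). (\<lambda>x. emeasure (Px x) B) \<in> borel_measurable borel) \<and>
     (\<forall>x s t f. 0 \<le> s \<longrightarrow> 0 \<le> t \<longrightarrow> f \<in> borel_measurable borel \<longrightarrow> bounded (range f) \<longrightarrow>
        (AE \<omega> in Px x. real_cond_exp (Px x) (nat_filt X (Px x) s) (\<lambda>\<omega>. f (X (s + t) \<omega>)) \<omega>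
                         = Pt Px X t f (X s \<omega>)))"

definition reversible :: "('a::polish_space \<Rightarrow> 'w measure) \<Rightarrow> (real \<Rightarrow> 'w \<Rightarrow> 'a) \<Rightarrow> 'a measure \<Rightarrow> bool" where
  "reversible Px X \<mu> \<longleftrightarrow>
     (\<forall>t f g. 0 \<le> t \<longrightarrow> f \<in> borel_measurable borel \<longrightarrow> bounded (range f) \<longrightarrow>
        g \<in> borel_measurable borel \<longrightarrow> bounded (range g) \<longrightarrow>
        (\<integral>x. f x * Pt Px X t g x \<partial>\<mu>) = (\<integral>x. Pt Px X t f x * g x \<partial>\<mu>))"

definition ergodic :: "('a::polish_space \<Rightarrow> 'w measure) \<Rightarrow> (real \<Rightarrow> 'w \<Rightarrow> 'a) \<Rightarrow> 'a measure \<Rightarrow> bool" where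
  "ergodic Px X \<mu> \<longleftrightarrow>
     (\<forall>A \<in> sets borel. (\<forall>t \<ge> 0. AE x in \<mu>. Pt Px X t (indicator A) x = indicator A x)
        \<longrightarrow> measure \<mu> A = 0 \<or> measure \<mu> A = 1)"

definition L2 :: "'a measure \<Rightarrow> ('a \<Rightarrow> real) \<Rightarrow> bool" where
  "L2 \<mu> f \<longleftrightarrow> f \<in> borel_measurable \<mu> \<and> integrable \<mu> (\<lambda>x. (f x)\<^sup>2)"

definition strongly_continuous_L2 :: "('a::polish_space \<Rightarrow> 'w measure) \<Rightarrow> (real \<Rightarrow> 'w \<Rightarrow> 'a) \<Rightarrow> 'a measure \<Rightarrow> bool" where
  "strongly_continuous_L2 Px X \<mu> \<longleftrightarrow>
     (\<forall>f. L2 \<mu> f \<longrightarrow> ((\<lambda>s. \<integral>x. (Pt Px X s f x - f x)\<^sup>2 \<partial>\<mu>) \<longlongrightarrow> 0) (at_right 0))"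

definition gen_rel :: "('a::polish_space \<Rightarrow> 'w measure) \<Rightarrow> (real \<Rightarrow> 'w \<Rightarrow> 'a) \<Rightarrow> 'a measure \<Rightarrow> ('a \<Rightarrow> real) \<Rightarrow> ('a \<Rightarrow> real) \<Rightarrow> bool" where
  "gen_rel Px X \<mu> g h \<longleftrightarrow> L2 \<mu> g \<and> L2 \<mu> h \<and>
     ((\<lambda>s. \<integral>x. ((Pt Px X s g x - g x) / s - h x)\<^sup>2 \<partial>\<mu>) \<longlongrightarrow> 0) (at_right 0)"

definition gen_dom :: "('a::polish_space \<Rightarrow> 'w measure) \<Rightarrow> (real \<Rightarrow> 'w \<Rightarrow> 'a) \<Rightarrow> 'a measure \<Rightarrow> ('a \<Rightarrow> real) \<Rightarrow> bool" where
  "gen_dom Px X \<mu> g \<longleftrightarrow> (\<exists>h. gen_rel Px X \<mu> g h)"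

definition generator :: "('a::polish_space \<Rightarrow> 'w measure) \<Rightarrow> (real \<Rightarrow> 'w \<Rightarrow> 'a) \<Rightarrow> 'a measure \<Rightarrow> ('a \<Rightarrow> real) \<Rightarrow> ('a \<Rightarrow> real)" where
  "generator Px X \<mu> g = (SOME h. gen_rel Px X \<mu> g h)"

definition dform0 :: "('a::polish_space \<Rightarrow> 'w measure) \<Rightarrow> (real \<Rightarrow> 'w \<Rightarrow> 'a) \<Rightarrow> 'a measure \<Rightarrow> ('a \<Rightarrow> real) \<Rightarrow> real" where
  "dform0 Px X \<mu> g = - (\<integral>x. g x * generator Px X \<mu> g x \<partial>\<mu>)"

definition dform_approx :: "('a::polish_space \<Rightarrow> 'w measure) \<Rightarrow> (real \<Rightarrow> 'w \<Rightarrow> 'a) \<Rightarrow> 'a measure \<Rightarrow> (nat \<Rightarrow> 'a \<Rightarrow> real) \<Rightarrow> ('a \<Rightarrow> real) \<Rightarrow> bool" where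
  "dform_approx Px X \<mu> gk g \<longleftrightarrow> L2 \<mu> g \<and> (\<forall>k. gen_dom Px X \<mu> (gk k)) \<and>
     (\<lambda>k. \<integral>x. (gk k x - g x)\<^sup>2 \<partial>\<mu>) \<longlonglongrightarrow> 0 \<and>
     (\<forall>\<epsilon>>0. \<exists>N. \<forall>k\<ge>N. \<forall>l\<ge>N. dform0 Px X \<mu> (\<lambda>x. gk k x - gk l x) < \<epsilon>)"

definition dform_dom :: "('a::polish_space \<Rightarrow> 'w measure) \<Rightarrow> (real \<Rightarrow> 'w \<Rightarrow> 'a) \<Rightarrow> 'a measure \<Rightarrow> ('a \<Rightarrow> real) \<Rightarrow> bool" where
  "dform_dom Px X \<mu> g \<longleftrightarrow> (\<exists>gk. dform_approx Px X \<mu> gk g)"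

definition dform :: "('a::polish_space \<Rightarrow> 'w measure) \<Rightarrow> (real \<Rightarrow> 'w \<Rightarrow> 'a) \<Rightarrow> 'a measure \<Rightarrow> ('a \<Rightarrow> real) \<Rightarrow> real" where
  "dform Px X \<mu> g = lim (\<lambda>k. dform0 Px X \<mu> ((SOME gk. dform_approx Px X \<mu> gk g) k))"

definition fisher :: "('a::polish_space \<Rightarrow> 'w measure) \<Rightarrow> (real \<Rightarrow> 'w \<Rightarrow> 'a) \<Rightarrow> 'a measure \<Rightarrow> 'a measure \<Rightarrow> ereal" where
  "fisher Px X \<mu> \<nu> =
     (let f = (\<lambda>x. enn2real (RN_deriv \<mu> \<nu> x)) in
      if absolutely_continuous \<mu> \<nu> \<and> dform_dom Px X \<mu> (\<lambda>x. sqrt (f x))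
      then ereal (dform Px X \<mu> (\<lambda>x. sqrt (f x))) else \<infinity>)"

text \<open>Points of E^n are represented as functions on {..<n} (extensional, as in PiM).\<close>
definition emp_measure :: "nat \<Rightarrow> (nat \<Rightarrow> 'a::polish_space) \<Rightarrow> 'a measure" where
  "emp_measure n x = measure_of UNIV (sets borel)
     (\<lambda>A. ennreal (real (card {i \<in> {..<n}. x i \<in> A}) / real n))"

text \<open>P^f_{n,t} g (x) for nonnegative g, as a nonnegative integral.\<close>
definition fk_op :: "('a::polish_space \<Rightarrow> 'w measure) \<Rightarrow> (real \<Rightarrow> 'w \<Rightarrow> 'a) \<Rightarrow> nat \<Rightarrow> real
     \<Rightarrow> ((nat \<Rightarrow> 'a) \<Rightarrow> real) \<Rightarrow> ((nat \<Rightarrow> 'a) \<Rightarrow> real) \<Rightarrow> (nat \<Rightarrow> 'a) \<Rightarrow> ennreal" where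
  "fk_op Px X n t f g x =
     (\<integral>\<^sup>+\<omega>. ennreal (g (\<lambda>i\<in>{..<n}. X t (\<omega> i)) *
        exp (\<integral>s\<in>{0..t}. f (\<lambda>i\<in>{..<n}. X s (\<omega> i)) \<partial>lborel)) \<partial>(PiM {..<n} (\<lambda>i. Px (x i))))"

text \<open>Operator norm on L2(mu^n) restricted to g >= 0 with norm at most 1;
  sqrt of the supremum of squared norms (= supremum of the norms).\<close>
definition fk_norm :: "('a::polish_space \<Rightarrow> 'w measure) \<Rightarrow> (real \<Rightarrow> 'w \<Rightarrow> 'a) \<Rightarrow> 'a measure \<Rightarrow> nat \<Rightarrow> real
     \<Rightarrow> ((nat \<Rightarrow> 'a) \<Rightarrow> real) \<Rightarrow> real" where
  "fk_norm Px X \<mu> n t f = sqrt (enn2real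
     (SUP g \<in> {g. g \<in> borel_measurable (PiM {..<n} (\<lambda>_. \<mu>)) \<and> (\<forall>y. 0 \<le> g y) \<and>
                  (\<integral>\<^sup>+y. ennreal ((g y)\<^sup>2) \<partial>(PiM {..<n} (\<lambda>_. \<mu>))) \<le> 1}.
        (\<integral>\<^sup>+y. (fk_op Px X n t f g y)\<^sup>2 \<partial>(PiM {..<n} (\<lambda>_. \<mu>)))))"

end

theory Submission
  imports Defs
begin

text \<open>The Fisher information enters through the approximate energies
  \<open>En s g = (\<parallel>g\<parallel>\<^sup>2 - \<langle>g, P\<^sub>s g\<rangle>) / s\<close>, which are dominated by the Dirichlet form.

  Lower bound: over a time block of length \<open>h\<close> the Feynman--Kac functional dominates the symmetric
  operator \<open>Q = P\<^sub>h + \<integral>\<^sub>0\<^sup>h P\<^sub>r f P\<^bsub>h-r\<^esub> dr\<close>, hence \<open>\<parallel>P\<^sup>f\<^sub>t\<parallel> \<ge> \<langle>G, Q G\<rangle>\<^bsup>t/h\<^esup>\<close> for unit \<open>G\<close>. With \<open>h \<rightarrow> 0\<close> and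
  \<open>G = g \<otimes> \<dots> \<otimes> g\<close>, \<open>g\<^sup>2 \<mu> = \<nu>\<close>, the exponential rate per particle is at least \<open>\<integral> F \<circ> L\<^sub>n d\<nu>\<^sup>n - I(\<nu>)\<close>, and the law of
  large numbers applies.

  Upper bound: comparing one short step of all particles with one longer step of a single particle
  reduces the norm to the quadratic form
  \<open>\<Sum>\<^sub>i \<langle>u, P\<^sup>(\<^sup>i\<^sup>)\<^sub>s u\<rangle> + s \<langle>u, n F(L\<^sub>n) u\<rangle>\<close>. A quadratic partition of unity in finitely many empirical means localizes
  \<open>u\<close>; then the averaged one-particle marginal of \<open>u\<^sup>2\<close> has energy bounded by that of \<open>u\<close>, and
  after mollification in time it becomes a competitor in the variational problem. Compactness of the
  sublevel sets makes the choice of the empirical means uniform.\<close>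

text \<open>The obstacle in the upper bound is that F is nonlinear in the measure, while the
  marginal of u^2 only records averages of empirical means. Once u is cut so that finitely many
  empirical means vary little on its support, every empirical measure seen by u lies close to that
  marginal, and F may be evaluated there. The square root of the marginal is only known to have
  bounded approximate energy at one fixed time s; its average along the semigroup over [0,s) lies in
  the generator domain, with no larger energy and at L2 distance at most sqrt(s \<open>En\<close>).
  Hence two time scales: s is fixed by the accuracy wanted, uniformly in n, while the step h tends
  to 0 at fixed n. Both are dyadic fractions of t, since the convexity inequality for time vectors
  and the squaring inequality for symmetric operators proceed by doubling. In each direction the
  functional is discretized by one elementary inequality: Jensen over a uniformly shifted grid from
  above, exp x \<ge> 1 + x on every block from below. Generator and Dirichlet form occur only for
  one particle; the n-particle system enters through its kernels at finite times.\<close>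

subsection \<open>Kernels and densities on finite products\<close>

text \<open>The locale \<open>product_prob_space\<close> asks for a probability measure at every
  index of the type. Point masses outside \<open>I\<close> meet this without changing
  \<open>PiM I M\<close>, so the product lemmas below can make assumptions on \<open>I\<close>
  alone.\<close>

lemma PiM_prob_cong_total:
  assumes "\<And>i. i \<in> I \<Longrightarrow> prob_space (M i)"
  obtains N where "PiM I N = PiM I M" "\<And>i. i \<in> I \<Longrightarrow> N i = M i" "product_prob_space N"
proof
  let ?N = "\<lambda>i. if i \<in> I then M i else return (count_space UNIV) undefined"
  show "PiM I ?N = PiM I M" by (intro PiM_cong) auto
  show "product_prob_space ?N"
    by (intro product_prob_spaceI) (auto intro: assms prob_space_return)
qed auto

lemma measurable_PiM_coordinate:
  assumes "i \<in> I" "f \<in> M i \<rightarrow>\<^sub>M N"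
  shows "(\<lambda>x. f (x i)) \<in> PiM I M \<rightarrow>\<^sub>M N"
  using measurable_component_singleton[OF assms(1)] assms(2) by (rule measurable_compose)

lemma emeasure_PiM_prob:
  assumes "finite I" "\<And>i. i \<in> I \<Longrightarrow> prob_space (M i)" "\<And>i. i \<in> I \<Longrightarrow> A i \<in> sets (M i)"
  shows "emeasure (PiM I M) (Pi\<^sub>E I A) = (\<Prod>i\<in>I. emeasure (M i) (A i))"
proof -
  obtain N where N: "PiM I N = PiM I M" "\<And>i. i \<in> I \<Longrightarrow> N i = M i" "product_prob_space N"
    using PiM_prob_cong_total[of I M] assms(2) by blast
  interpret product_prob_space N by fact
  show ?thesis
    using emeasure_PiM[OF assms(1), of A] assms(3) by (simp add: N)
qed

lemma nn_integral_PiM_prod: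
  assumes "finite I" "\<And>i. i \<in> I \<Longrightarrow> prob_space (M i)" "\<And>i. i \<in> I \<Longrightarrow> f i \<in> borel_measurable (M i)"
  shows "(\<integral>\<^sup>+x. (\<Prod>i\<in>I. f i (x i)) \<partial>PiM I M) = (\<Prod>i\<in>I. \<integral>\<^sup>+x. f i x \<partial>M i)"
proof -
  obtain N where N: "PiM I N = PiM I M" "\<And>i. i \<in> I \<Longrightarrow> N i = M i" "product_prob_space N"
    using PiM_prob_cong_total[of I M] assms(2) by blast
  interpret product_prob_space N by fact
  show ?thesis
    using product_nn_integral_prod[OF assms(1), of f] assms(3) by (simp add: N)
qed

lemma PiM_eqI_prob:
  assumes "finite I" "\<And>i. i \<in> I \<Longrightarrow> prob_space (M i)" "sets P = sets (PiM I M)"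
    and "\<And>A. (\<And>i. i \<in> I \<Longrightarrow> A i \<in> sets (M i)) \<Longrightarrow> emeasure P (Pi\<^sub>E I A) = (\<Prod>i\<in>I. emeasure (M i) (A i))"
  shows "P = PiM I M"
proof -
  obtain N where N: "PiM I N = PiM I M" "\<And>i. i \<in> I \<Longrightarrow> N i = M i" "product_prob_space N"
    using PiM_prob_cong_total[of I M] assms(2) by blast
  interpret product_prob_space N by fact
  have "P = PiM I N"
    by (rule PiM_eqI) (use assms(1,3,4) in \<open>simp_all add: N\<close>)
  then show ?thesis by (simp add: N)
qed

text \<open>Boxes form an intersection-stable generator of the product sigma-algebra, and on a box
  the product measure is a finite product of measurable functions of the parameter.\<close>

lemma measurable_PiM_kernel:
  assumes I: "finite I" and K: "\<And>i. i \<in> I \<Longrightarrow> K i \<in> M \<rightarrow>\<^sub>M prob_algebra (L i)"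
  shows "(\<lambda>x. PiM I (\<lambda>i. K i x)) \<in> M \<rightarrow>\<^sub>M prob_algebra (PiM I L)"
proof (rule measurable_prob_algebra_generated[where \<Omega>="\<Pi>\<^sub>E i\<in>I. space (L i)" and G="prod_algebra I L"])
  show "sets (PiM I L) = sigma_sets (\<Pi>\<^sub>E i\<in>I. space (L i)) (prod_algebra I L)"
    by (rule sets_PiM)
  show "Int_stable (prod_algebra I L)" by (rule Int_stable_prod_algebra)
  show "prod_algebra I L \<subseteq> Pow (\<Pi>\<^sub>E i\<in>I. space (L i))"
    using prod_algebra_sets_into_space by blast
  have KP: "prob_space (K i x)" "sets (K i x) = sets (L i)" if "i \<in> I" "x \<in> space M" for i x
    using measurable_space[OF K[OF that(1)] that(2)] by (auto simp: space_prob_algebra)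
  show "prob_space (PiM I (\<lambda>i. K i x))" if "x \<in> space M" for x
    using that by (intro prob_space_PiM KP)
  show "sets (PiM I (\<lambda>i. K i x)) = sets (PiM I L)" if "x \<in> space M" for x
    using that by (intro sets_PiM_cong KP) auto
  fix A assume "A \<in> prod_algebra I L"
  then obtain E where A: "A = Pi\<^sub>E I E" and E: "\<And>i. i \<in> I \<Longrightarrow> E i \<in> sets (L i)"
    using prod_algebraE_all[of A I L] by (metis PiE_iff Pi_iff)
  have "(\<lambda>x. \<Prod>i\<in>I. emeasure (K i x) (E i)) \<in> borel_measurable M"
  proof (rule borel_measurable_prod_ennreal)
    fix i assume i: "i \<in> I"
    show "(\<lambda>x. emeasure (K i x) (E i)) \<in> borel_measurable M"
      using measurable_prob_algebraD[OF K[OF i]] E[OF i]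
      by (rule measurable_emeasure_kernel)
  qed
  then show "(\<lambda>x. emeasure (PiM I (\<lambda>i. K i x)) A) \<in> borel_measurable M"
    by (rule measurable_cong[THEN iffD1, rotated])
       (simp add: A emeasure_PiM_prob[OF I] KP E)
qed

text \<open>On a box both sides are the product of the integrals of
  \<open>emeasure (K i y) (A i)\<close>, by independence of the starting coordinates. Through this
  identity every one-particle disintegration (semigroup law, past and future, stationary pair)
  passes to n independent particles.\<close>

lemma PiM_bind:
  assumes I: "finite I" and M: "\<And>i. i \<in> I \<Longrightarrow> prob_space (M i)"
    and K: "\<And>i. i \<in> I \<Longrightarrow> K i \<in> M i \<rightarrow>\<^sub>M prob_algebra (L i)"
  shows "PiM I (\<lambda>i. M i \<bind> K i) = PiM I M \<bind> (\<lambda>x. PiM I (\<lambda>i. K i (x i)))"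
proof -
  have M': "M i \<in> space (prob_algebra (M i))" if "i \<in> I" for i
    using M[OF that] by (simp add: space_prob_algebra)
  have PM: "PiM I M \<in> space (prob_algebra (PiM I M))"
    using M by (simp add: space_prob_algebra prob_space_PiM)
  have K': "(\<lambda>x. K i (x i)) \<in> PiM I M \<rightarrow>\<^sub>M prob_algebra (L i)" if "i \<in> I" for i
    using that K[OF that] by (rule measurable_PiM_coordinate)
  have KK: "(\<lambda>x. PiM I (\<lambda>i. K i (x i))) \<in> PiM I M \<rightarrow>\<^sub>M prob_algebra (PiM I L)"
    by (rule measurable_PiM_kernel[OF I K'])
  have KP: "prob_space (K i y)" "sets (K i y) = sets (L i)" if "i \<in> I" "y \<in> space (M i)" for i y
    using measurable_space[OF K[OF that(1)] that(2)] by (auto simp: space_prob_algebra)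
  have sb: "sets (M i \<bind> K i) = sets (L i)" if "i \<in> I" for i
    using M'[OF that] K[OF that] by (rule sets_bind')
  have sb2: "sets (PiM I M \<bind> (\<lambda>x. PiM I (\<lambda>i. K i (x i)))) = sets (PiM I L)"
    using PM KK by (rule sets_bind')
  have "PiM I M \<bind> (\<lambda>x. PiM I (\<lambda>i. K i (x i))) = PiM I (\<lambda>i. M i \<bind> K i)"
  proof (rule PiM_eqI_prob[OF I])
    show "prob_space (M i \<bind> K i)" if "i \<in> I" for i
      using M'[OF that] K[OF that] by (rule prob_space_bind')
    show "sets (PiM I M \<bind> (\<lambda>x. PiM I (\<lambda>i. K i (x i)))) = sets (PiM I (\<lambda>i. M i \<bind> K i))"
      unfolding sb2 by (rule sets_PiM_cong) (auto simp: sb)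
    fix A assume "\<And>i. i \<in> I \<Longrightarrow> A i \<in> sets (M i \<bind> K i)"
    then have A: "A i \<in> sets (L i)" if "i \<in> I" for i using that sb by auto
    have "emeasure (PiM I M \<bind> (\<lambda>x. PiM I (\<lambda>i. K i (x i)))) (Pi\<^sub>E I A)
        = (\<integral>\<^sup>+x. emeasure (PiM I (\<lambda>i. K i (x i))) (Pi\<^sub>E I A) \<partial>PiM I M)"
      by (rule emeasure_bind_prob_algebra[OF PM KK]) (intro sets_PiM_I_finite I A)
    also have "\<dots> = (\<integral>\<^sup>+x. (\<Prod>i\<in>I. emeasure (K i (x i)) (A i)) \<partial>PiM I M)"
    proof (rule nn_integral_cong)
      fix x assume "x \<in> space (PiM I M)"
      then have "x i \<in> space (M i)" if "i \<in> I" for i using that by (auto simp: space_PiM)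
      then show "emeasure (PiM I (\<lambda>i. K i (x i))) (Pi\<^sub>E I A) = (\<Prod>i\<in>I. emeasure (K i (x i)) (A i))"
        by (intro emeasure_PiM_prob I KP) (auto simp: KP A)
    qed
    also have "\<dots> = (\<Prod>i\<in>I. \<integral>\<^sup>+y. emeasure (K i y) (A i) \<partial>M i)"
    proof (rule nn_integral_PiM_prod[OF I M])
      fix i assume i: "i \<in> I"
      show "(\<lambda>y. emeasure (K i y) (A i)) \<in> borel_measurable (M i)"
        using measurable_prob_algebraD[OF K[OF i]] A[OF i] by (rule measurable_emeasure_kernel)
    qed
    also have "\<dots> = (\<Prod>i\<in>I. emeasure (M i \<bind> K i) (A i))"
      by (intro prod.cong refl emeasure_bind_prob_algebra[symmetric, OF M' K A])
    finally show "emeasure (PiM I M \<bind> (\<lambda>x. PiM I (\<lambda>i. K i (x i)))) (Pi\<^sub>E I A)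
      = (\<Prod>i\<in>I. emeasure (M i \<bind> K i) (A i))" .
  qed
  then show ?thesis ..
qed

lemma distr_PiM_componentwise:
  assumes I: "finite I" and M: "\<And>i. i \<in> I \<Longrightarrow> prob_space (M i)"
    and f: "\<And>i. i \<in> I \<Longrightarrow> f i \<in> M i \<rightarrow>\<^sub>M L i"
  shows "distr (PiM I M) (PiM I L) (\<lambda>x. \<lambda>i\<in>I. f i (x i)) = PiM I (\<lambda>i. distr (M i) (L i) (f i))"
proof (rule PiM_eqI_prob[OF I])
  show "prob_space (distr (M i) (L i) (f i))" if "i \<in> I" for i
    using M[OF that] f[OF that] by (rule prob_space.prob_space_distr)
  show "sets (distr (PiM I M) (PiM I L) (\<lambda>x. \<lambda>i\<in>I. f i (x i))) = sets (PiM I (\<lambda>i. distr (M i) (L i) (f i)))"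
    by (simp, intro sets_PiM_cong) auto
  fix A assume A': "\<And>i. i \<in> I \<Longrightarrow> A i \<in> sets (distr (M i) (L i) (f i))"
  have A: "A i \<in> sets (L i)" if "i \<in> I" for i using A'[OF that] by simp
  have fm: "(\<lambda>x. \<lambda>i\<in>I. f i (x i)) \<in> PiM I M \<rightarrow>\<^sub>M PiM I L"
  proof (rule measurable_restrict)
    fix i assume "i \<in> I"
    then show "(\<lambda>x. f i (x i)) \<in> PiM I M \<rightarrow>\<^sub>M L i"
      using f by (intro measurable_PiM_coordinate) auto
  qed
  have "emeasure (distr (PiM I M) (PiM I L) (\<lambda>x. \<lambda>i\<in>I. f i (x i))) (Pi\<^sub>E I A)
    = emeasure (PiM I M) ((\<lambda>x. \<lambda>i\<in>I. f i (x i)) -` Pi\<^sub>E I A \<inter> space (PiM I M))"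
    by (intro emeasure_distr fm sets_PiM_I_finite I A)
  also have "(\<lambda>x. \<lambda>i\<in>I. f i (x i)) -` Pi\<^sub>E I A \<inter> space (PiM I M) = Pi\<^sub>E I (\<lambda>i. f i -` A i \<inter> space (M i))"
    by (auto simp: space_PiM PiE_def Pi_def extensional_def)
  also have "emeasure (PiM I M) \<dots> = (\<Prod>i\<in>I. emeasure (M i) (f i -` A i \<inter> space (M i)))"
    by (intro emeasure_PiM_prob I M measurable_sets[OF f A])
  also have "\<dots> = (\<Prod>i\<in>I. emeasure (distr (M i) (L i) (f i)) (A i))"
    by (intro prod.cong refl emeasure_distr[symmetric] f A)
  finally show "emeasure (distr (PiM I M) (PiM I L) (\<lambda>x. \<lambda>i\<in>I. f i (x i))) (Pi\<^sub>E I A)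
    = (\<Prod>i\<in>I. emeasure (distr (M i) (L i) (f i)) (A i))" .
qed

text \<open>Unit mass of every factor keeps the weighted factors probability measures. In the lower
  bound this identifies \<nu>^n with \<mu>^n weighted by the squared tensor power of
  sqrt(d\<nu>/d\<mu>).\<close>

lemma PiM_density:
  assumes I: "finite I" and M: "\<And>i. i \<in> I \<Longrightarrow> prob_space (M i)"
    and f[measurable]: "\<And>i. i \<in> I \<Longrightarrow> f i \<in> borel_measurable (M i)"
    and f1: "\<And>i. i \<in> I \<Longrightarrow> (\<integral>\<^sup>+x. f i x \<partial>M i) = 1"
  shows "PiM I (\<lambda>i. density (M i) (f i)) = density (PiM I M) (\<lambda>x. \<Prod>i\<in>I. f i (x i))"
proof -
  have fm[measurable]: "(\<lambda>x. f i (x i)) \<in> borel_measurable (PiM I M)" if "i \<in> I" for i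
    using that f by (intro measurable_PiM_coordinate) auto
  have "density (PiM I M) (\<lambda>x. \<Prod>i\<in>I. f i (x i)) = PiM I (\<lambda>i. density (M i) (f i))"
  proof (rule PiM_eqI_prob[OF I])
    show "prob_space (density (M i) (f i))" if "i \<in> I" for i
      using f[OF that] f1[OF that] by (intro prob_spaceI) (simp add: emeasure_density cong: nn_integral_cong)
    show "sets (density (PiM I M) (\<lambda>x. \<Prod>i\<in>I. f i (x i))) = sets (PiM I (\<lambda>i. density (M i) (f i)))"
      by (simp, intro sets_PiM_cong) auto
    fix A assume A': "\<And>i. i \<in> I \<Longrightarrow> A i \<in> sets (density (M i) (f i))"
    have A[measurable]: "A i \<in> sets (M i)" if "i \<in> I" for i using A'[OF that] by simp
    have "emeasure (density (PiM I M) (\<lambda>x. \<Prod>i\<in>I. f i (x i))) (Pi\<^sub>E I A)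
      = (\<integral>\<^sup>+x. (\<Prod>i\<in>I. f i (x i)) * indicator (Pi\<^sub>E I A) x \<partial>PiM I M)"
      by (rule emeasure_density) (auto intro!: sets_PiM_I_finite I A)
    also have "\<dots> = (\<integral>\<^sup>+x. (\<Prod>i\<in>I. f i (x i) * indicator (A i) (x i)) \<partial>PiM I M)"
    proof (rule nn_integral_cong)
      fix x assume x: "x \<in> space (PiM I M)"
      have "indicator (Pi\<^sub>E I A) x = (\<Prod>i\<in>I. indicator (A i) (x i) :: ennreal)"
      proof (cases "x \<in> Pi\<^sub>E I A")
        case True then show ?thesis by (auto simp: PiE_iff)
      next
        case False
        then obtain i where "i \<in> I" "x i \<notin> A i" using x by (auto simp: PiE_iff space_PiM)
        then have "(\<Prod>i\<in>I. indicator (A i) (x i) :: ennreal) = 0"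
          by (intro prod_zero[OF I] bexI[of _ i]) auto
        then show ?thesis using False by simp
      qed
      then show "(\<Prod>i\<in>I. f i (x i)) * indicator (Pi\<^sub>E I A) x = (\<Prod>i\<in>I. f i (x i) * indicator (A i) (x i))"
        by (simp add: prod.distrib)
    qed
    also have "\<dots> = (\<Prod>i\<in>I. \<integral>\<^sup>+y. f i y * indicator (A i) y \<partial>M i)"
      by (rule nn_integral_PiM_prod[OF I M]) (auto intro!: borel_measurable_times_ennreal f borel_measurable_indicator A)
    also have "\<dots> = (\<Prod>i\<in>I. emeasure (density (M i) (f i)) (A i))"
      by (intro prod.cong refl emeasure_density[symmetric] f A)
    finally show "emeasure (density (PiM I M) (\<lambda>x. \<Prod>i\<in>I. f i (x i))) (Pi\<^sub>E I A)
      = (\<Prod>i\<in>I. emeasure (density (M i) (f i)) (A i))" .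
  qed
  then show ?thesis ..
qed

text \<open>Point masses pin all coordinates but one, so only coordinate \<open>i\<close> is random.
  This describes the motion of a single particle while the others stand still.\<close>

lemma PiM_update_return:
  assumes I: "finite I" and i: "i \<in> I" and x: "x \<in> space (PiM I M)"
    and K: "prob_space K" "sets K = sets (M i)"
  shows "PiM I (\<lambda>j. if j = i then K else return (M j) (x j)) = distr K (PiM I M) (\<lambda>y. x(i := y))"
proof -
  have xj: "x j \<in> space (M j)" if "j \<in> I" for j using x that by (auto simp: space_PiM)
  have sp: "space K = space (M i)" using K(2) by (rule sets_eq_imp_space_eq)
  have um: "(\<lambda>y. x(i := y)) \<in> K \<rightarrow>\<^sub>M PiM I M"
  proof (rule measurable_PiM_single')
    show "(\<lambda>y. (x(i := y)) j) \<in> K \<rightarrow>\<^sub>M M j" if "j \<in> I" for j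
      using K(2) xj[OF that] by (cases "j = i") (auto simp: measurable_ident_sets)
    show "(\<lambda>y. x(i := y)) \<in> space K \<rightarrow> (\<Pi>\<^sub>E j\<in>I. space (M j))"
      using x i by (auto simp: space_PiM sp PiE_iff extensional_def)
  qed
  have "distr K (PiM I M) (\<lambda>y. x(i := y)) = PiM I (\<lambda>j. if j = i then K else return (M j) (x j))"
  proof (rule PiM_eqI_prob[OF I])
    show "prob_space (if j = i then K else return (M j) (x j))" if "j \<in> I" for j
      using K xj[OF that] by (auto intro: prob_space_return)
    show "sets (distr K (PiM I M) (\<lambda>y. x(i := y))) = sets (PiM I (\<lambda>j. if j = i then K else return (M j) (x j)))"
      by (simp, intro sets_PiM_cong) (auto simp: K)
    fix A assume A': "\<And>j. j \<in> I \<Longrightarrow> A j \<in> sets (if j = i then K else return (M j) (x j))"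
    have A: "A j \<in> sets (M j)" if "j \<in> I" for j using A'[OF that] K by (auto split: if_splits)
    have "emeasure (distr K (PiM I M) (\<lambda>y. x(i := y))) (Pi\<^sub>E I A) = emeasure K ((\<lambda>y. x(i := y)) -` Pi\<^sub>E I A \<inter> space K)"
      by (intro emeasure_distr um sets_PiM_I_finite I A)
    also have "(\<lambda>y. x(i := y)) -` Pi\<^sub>E I A \<inter> space K = (if \<forall>j\<in>I-{i}. x j \<in> A j then A i else {})"
      using x i sets.sets_into_space[OF A[OF i]]
      by (auto simp: space_PiM sp PiE_iff extensional_def split: if_splits)
    also have "emeasure K \<dots> = emeasure K (A i) * (\<Prod>j\<in>I-{i}. indicator (A j) (x j))"
    proof (cases "\<forall>j\<in>I-{i}. x j \<in> A j")
      case True then show ?thesis by (auto simp: indicator_def)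
    next
      case False
      then obtain j where "j \<in> I - {i}" "x j \<notin> A j" by blast
      then have "(\<Prod>j\<in>I-{i}. indicator (A j) (x j) :: ennreal) = 0"
        using I by (intro prod_zero bexI[of _ j]) auto
      then show ?thesis using False by auto
    qed
    also have "\<dots> = emeasure K (A i) * (\<Prod>j\<in>I-{i}. emeasure (if j = i then K else return (M j) (x j)) (A j))"
      using A by (intro arg_cong2[where f="(*)"] refl prod.cong) auto
    also have "\<dots> = (\<Prod>j\<in>I. emeasure (if j = i then K else return (M j) (x j)) (A j))"
      using I i by (subst (2) prod.remove[of _ i]) auto
    finally show "emeasure (distr K (PiM I M) (\<lambda>y. x(i := y))) (Pi\<^sub>E I A)
      = (\<Prod>j\<in>I. emeasure (if j = i then K else return (M j) (x j)) (A j))" .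
  qed
  then show ?thesis ..
qed

lemma measurable_update_pair:
  assumes "i \<in> I"
  shows "(\<lambda>(x, z). x(i := z)) \<in> PiM I M \<Otimes>\<^sub>M M i \<rightarrow>\<^sub>M PiM I M"
  using measurable_add_dim[of i I M] assms by (simp add: insert_absorb)

text \<open>Overwriting one coordinate by an independent copy erases its old value. The coordinate
  of interest can thus be separated from a full sample of the product, with the index set kept
  intact.\<close>

lemma distr_PiM_resample:
  assumes I: "finite I" and i: "i \<in> I" and M: "\<And>j. j \<in> I \<Longrightarrow> prob_space (M j)"
  shows "distr (PiM I M \<Otimes>\<^sub>M M i) (PiM I M) (\<lambda>(x, z). x(i := z)) = PiM I M"
proof (rule PiM_eqI_prob[OF I M])
  interpret i: prob_space "M i" using M[OF i] .
  interpret P: prob_space "PiM I M" using M by (rule prob_space_PiM)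
  show "sets (distr (PiM I M \<Otimes>\<^sub>M M i) (PiM I M) (\<lambda>(x, z). x(i := z))) = sets (PiM I M)" by simp
  fix A assume A: "\<And>j. j \<in> I \<Longrightarrow> A j \<in> sets (M j)"
  \<comment> \<open>The old value of coordinate \<open>i\<close> is forgotten, so its constraint
    becomes the whole space.\<close>
  let ?A' = "\<lambda>j. if j = i then space (M i) else A j"
  have A': "?A' j \<in> sets (M j)" if "j \<in> I" for j using A[OF that] by auto
  have "emeasure (distr (PiM I M \<Otimes>\<^sub>M M i) (PiM I M) (\<lambda>(x, z). x(i := z))) (Pi\<^sub>E I A)
    = emeasure (PiM I M \<Otimes>\<^sub>M M i) ((\<lambda>(x, z). x(i := z)) -` Pi\<^sub>E I A \<inter> space (PiM I M \<Otimes>\<^sub>M M i))"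
    by (intro emeasure_distr measurable_update_pair i sets_PiM_I_finite I A)
  also have "(\<lambda>(x, z). x(i := z)) -` Pi\<^sub>E I A \<inter> space (PiM I M \<Otimes>\<^sub>M M i) = Pi\<^sub>E I ?A' \<times> A i"
  proof -
    have 1: "x j \<in> space (M j)" if "x \<in> Pi\<^sub>E I ?A'" "j \<in> I" for x j
      using that sets.sets_into_space[OF A'[OF that(2)]] by (auto simp: PiE_iff)
    have 2: "x \<in> space (PiM I M)" if "x \<in> Pi\<^sub>E I ?A'" for x
      using 1[OF that] that by (simp add: space_PiM PiE_iff)
    have 3: "x(i := z) \<in> Pi\<^sub>E I A \<longleftrightarrow> x \<in> Pi\<^sub>E I ?A' \<and> z \<in> A i" if "x \<in> space (PiM I M)" for x z
      using that i by (auto simp: space_PiM PiE_iff extensional_def)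
    show ?thesis
      using 2 3 sets.sets_into_space[OF A[OF i]] by (auto simp: space_pair_measure simp del: PiE_iff)
  qed
  also have "emeasure (PiM I M \<Otimes>\<^sub>M M i) \<dots> = (\<Prod>j\<in>I. emeasure (M j) (?A' j)) * emeasure (M i) (A i)"
    by (subst i.emeasure_pair_measure_Times)
       (auto intro!: sets_PiM_I_finite I A' A i simp: emeasure_PiM_prob[OF I M A'])
  also have "(\<Prod>j\<in>I. emeasure (M j) (?A' j)) = (\<Prod>j\<in>I-{i}. emeasure (M j) (A j))"
    using I i i.emeasure_space_1 by (subst prod.remove[of _ i]) auto
  also have "\<dots> * emeasure (M i) (A i) = (\<Prod>j\<in>I. emeasure (M j) (A j))"
    using I i by (subst (2) prod.remove[of _ i]) (auto simp: mult.commute)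
  finally show "emeasure (distr (PiM I M \<Otimes>\<^sub>M M i) (PiM I M) (\<lambda>(x, z). x(i := z))) (Pi\<^sub>E I A)
    = (\<Prod>j\<in>I. emeasure (M j) (A j))" .
qed auto

subsection \<open>The weak topology\<close>

definition bcont :: "('a::topological_space \<Rightarrow> real) \<Rightarrow> bool" where
  "bcont \<phi> \<longleftrightarrow> continuous_on UNIV \<phi> \<and> bounded (range \<phi>)"

lemma bcont_measurable: "bcont \<phi> \<Longrightarrow> \<phi> \<in> borel_measurable borel"
  by (auto simp: bcont_def intro: borel_measurable_continuous_onI)

lemma bcontE:
  assumes "bcont \<phi>" obtains B where "B > 0" "\<And>x. \<bar>\<phi> x\<bar> \<le> B"
proof -
  from assms obtain b where "\<forall>x\<in>range \<phi>. norm x \<le> b" by (auto simp: bcont_def bounded_iff)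
  then show ?thesis by (intro that[of "max 1 b"]) (auto simp: le_max_iff_disj)
qed

lemma prob_measuresD: "\<nu> \<in> prob_measures \<Longrightarrow> prob_space \<nu>" "\<nu> \<in> prob_measures \<Longrightarrow> sets \<nu> = sets borel"
  by (auto simp: prob_measures_def)

lemma space_prob_measures: "\<nu> \<in> prob_measures \<Longrightarrow> space \<nu> = UNIV"
  using sets_eq_imp_space_eq[of \<nu> borel] by (auto simp: prob_measures_def)

lemma topspace_weak_topology: "topspace weak_topology = (prob_measures :: 'a::polish_space measure set)"
proof -
  have "prob_measures = {\<nu> \<in> prob_measures :: 'a measure set. (\<integral>x. 0 \<partial>\<nu>) \<in> (UNIV::real set)}" by simp
  then have "\<exists>(f::'a \<Rightarrow> real) U. prob_measures = {\<nu> \<in> prob_measures :: 'a measure set. (\<integral>x. f x \<partial>\<nu>) \<in> U} \<and>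
      continuous_on UNIV f \<and> bounded (range f) \<and> open U"
    by (intro exI[of _ "\<lambda>_. 0"] exI[of _ UNIV]) auto
  then show ?thesis
    unfolding weak_topology_def topology_generated_by_topspace by blast
qed

lemma openin_weak_halfball:
  fixes \<phi> :: "'a::polish_space \<Rightarrow> real"
  assumes "bcont \<phi>"
  shows "openin weak_topology {\<rho> \<in> prob_measures. \<bar>(\<integral>x. \<phi> x \<partial>\<rho>) - c\<bar> < r}"
proof -
  have "{\<rho> \<in> prob_measures. \<bar>(\<integral>x. \<phi> x \<partial>\<rho>) - c\<bar> < r} = {\<rho> \<in> prob_measures. (\<integral>x. \<phi> x \<partial>\<rho>) \<in> ball c r}"
    by (auto simp: dist_real_def abs_minus_commute)
  then show ?thesis
    unfolding weak_topology_def openin_topology_generated_by_iff using assms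
    by (intro generate_topology_on.Basis) (auto simp: bcont_def simp del: mem_ball intro!: exI[of _ \<phi>] exI[of _ "ball c r"])
qed

lemma openin_weak_ball:
  fixes \<Phi> :: "('a::polish_space \<Rightarrow> real) set"
  assumes "finite \<Phi>" "\<And>\<phi>. \<phi> \<in> \<Phi> \<Longrightarrow> bcont \<phi>"
  shows "openin weak_topology {\<rho> \<in> prob_measures. \<forall>\<phi>\<in>\<Phi>. \<bar>(\<integral>x. \<phi> x \<partial>\<rho>) - c \<phi>\<bar> < r}"
  using assms
proof (induction \<Phi>)
  case empty
  then show ?case using openin_topspace[of weak_topology] by (simp add: topspace_weak_topology)
next
  case (insert \<phi> \<Phi>)
  have "{\<rho> \<in> prob_measures. \<forall>\<psi>\<in>insert \<phi> \<Phi>. \<bar>(\<integral>x. \<psi> x \<partial>\<rho>) - c \<psi>\<bar> < r}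
    = {\<rho> \<in> prob_measures. \<bar>(\<integral>x. \<phi> x \<partial>\<rho>) - c \<phi>\<bar> < r} \<inter> {\<rho> \<in> prob_measures. \<forall>\<phi>\<in>\<Phi>. \<bar>(\<integral>x. \<phi> x \<partial>\<rho>) - c \<phi>\<bar> < r}"
    by auto
  then show ?case using insert by (simp only:) (intro openin_Int openin_weak_halfball; simp)
qed

text \<open>Induction over the generation of the topology: a basic set is controlled by its one test
  function, an intersection by the union of the test sets with the smaller radius.\<close>

lemma weak_open_contains_ball:
  fixes \<nu> :: "'a::polish_space measure"
  assumes "openin weak_topology U" "\<nu> \<in> U"
  shows "\<exists>\<Phi> r. finite \<Phi> \<and> r > 0 \<and> (\<forall>\<phi>\<in>\<Phi>. bcont \<phi>) \<and>
    (\<forall>\<rho>\<in>prob_measures. (\<forall>\<phi>\<in>\<Phi>. \<bar>(\<integral>x. \<phi> x \<partial>\<rho>) - (\<integral>x. \<phi> x \<partial>\<nu>)\<bar> < r) \<longrightarrow> \<rho> \<in> U)"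
  using assms[unfolded weak_topology_def openin_topology_generated_by_iff]
proof (induction)
  case Empty then show ?case by simp
next
  case (Int a b)
  then have "\<nu> \<in> a" "\<nu> \<in> b" by auto
  from Int.IH(1)[OF this(1)] obtain \<Phi> r where
    1: "finite \<Phi>" "r > 0" "\<forall>\<phi>\<in>\<Phi>. bcont \<phi>"
    "\<forall>\<rho>\<in>prob_measures. (\<forall>\<phi>\<in>\<Phi>. \<bar>(\<integral>x. \<phi> x \<partial>\<rho>) - (\<integral>x. \<phi> x \<partial>\<nu>)\<bar> < r) \<longrightarrow> \<rho> \<in> a" by blast
  from Int.IH(2)[OF \<open>\<nu> \<in> b\<close>] obtain \<Psi> s where
    2: "finite \<Psi>" "s > 0" "\<forall>\<phi>\<in>\<Psi>. bcont \<phi>"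
    "\<forall>\<rho>\<in>prob_measures. (\<forall>\<phi>\<in>\<Psi>. \<bar>(\<integral>x. \<phi> x \<partial>\<rho>) - (\<integral>x. \<phi> x \<partial>\<nu>)\<bar> < s) \<longrightarrow> \<rho> \<in> b" by blast
  show ?case using 1 2 by (intro exI[of _ "\<Phi> \<union> \<Psi>"] exI[of _ "min r s"]) auto
next
  case (UN K)
  then obtain k where k: "k \<in> K" "\<nu> \<in> k" by auto
  with UN.IH[OF k] show ?case by (meson UnionI)
next
  case (Basis s)
  then obtain f :: "'a \<Rightarrow> real" and V where s: "s = {\<nu> \<in> prob_measures. (\<integral>x. f x \<partial>\<nu>) \<in> V}"
    "continuous_on UNIV f" "bounded (range f)" "open V" by blast
  with Basis obtain r where r: "r > 0" "ball (\<integral>x. f x \<partial>\<nu>) r \<subseteq> V"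
    by (auto simp: open_contains_ball)
  then show ?case
    using s by (intro exI[of _ "{f}"] exI[of _ r])
      (auto simp: bcont_def subset_eq dist_real_def abs_minus_commute)
qed

text \<open>A Lebesgue number argument: finitely many test balls of half radius cover
  \<open>K\<close>, and the union of their test sets with the least half radius serves every point
  of \<open>K\<close> by the triangle inequality.\<close>

lemma weak_compact_uniform_nbhd:
  fixes K :: "'a::polish_space measure set"
  assumes K: "compactin weak_topology K" and U: "openin weak_topology U" and KU: "K \<subseteq> U"
  shows "\<exists>\<Phi> r. finite \<Phi> \<and> r > 0 \<and> (\<forall>\<phi>\<in>\<Phi>. bcont \<phi>) \<and>
    (\<forall>\<nu>\<in>K. \<forall>\<rho>\<in>prob_measures. (\<forall>\<phi>\<in>\<Phi>. \<bar>(\<integral>x. \<phi> x \<partial>\<rho>) - (\<integral>x. \<phi> x \<partial>\<nu>)\<bar> < r) \<longrightarrow> \<rho> \<in> U)"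
proof -
  have "\<forall>\<nu>\<in>K. \<exists>\<Phi> r. finite \<Phi> \<and> r > 0 \<and> (\<forall>\<phi>\<in>\<Phi>. bcont \<phi>) \<and>
    (\<forall>\<rho>\<in>prob_measures. (\<forall>\<phi>\<in>\<Phi>. \<bar>(\<integral>x. \<phi> x \<partial>\<rho>) - (\<integral>x. \<phi> x \<partial>\<nu>)\<bar> < r) \<longrightarrow> \<rho> \<in> U)"
    using weak_open_contains_ball[OF U] KU by blast
  then obtain \<Phi> r where
    \<Phi>: "\<And>\<nu>. \<nu> \<in> K \<Longrightarrow> finite (\<Phi> \<nu>)" "\<And>\<nu>. \<nu> \<in> K \<Longrightarrow> (r \<nu>::real) > 0" "\<And>\<nu> \<phi>. \<nu> \<in> K \<Longrightarrow> \<phi> \<in> \<Phi> \<nu> \<Longrightarrow> bcont \<phi>"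
      "\<And>\<nu> \<rho>. \<nu> \<in> K \<Longrightarrow> \<rho> \<in> prob_measures \<Longrightarrow> (\<And>\<phi>. \<phi> \<in> \<Phi> \<nu> \<Longrightarrow> \<bar>(\<integral>x. \<phi> x \<partial>\<rho>) - (\<integral>x. \<phi> x \<partial>\<nu>)\<bar> < r \<nu>) \<Longrightarrow> \<rho> \<in> U"
    by metis
  define W where "W \<nu> = {\<rho> \<in> prob_measures. \<forall>\<phi>\<in>\<Phi> \<nu>. \<bar>(\<integral>x. \<phi> x \<partial>\<rho>) - (\<integral>x. \<phi> x \<partial>\<nu>)\<bar> < r \<nu> / 2}" for \<nu>
  have KP: "K \<subseteq> prob_measures"
    using K by (auto simp: compactin_def topspace_weak_topology)
  have "\<forall>V\<in>W ` K. openin weak_topology V"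
    unfolding W_def proof (intro ballI, elim imageE, simp only:)
    fix \<nu> assume "\<nu> \<in> K"
    then show "openin weak_topology {\<rho> \<in> prob_measures. \<forall>\<phi>\<in>\<Phi> \<nu>. \<bar>(\<integral>x. \<phi> x \<partial>\<rho>) - (\<integral>x. \<phi> x \<partial>\<nu>)\<bar> < r \<nu> / 2}"
      using \<Phi>(1,3) by (intro openin_weak_ball) auto
  qed
  moreover have "K \<subseteq> \<Union>(W ` K)" using KP \<Phi>(2) by (auto simp: W_def)
  ultimately obtain \<F> where \<F>: "finite \<F>" "\<F> \<subseteq> W ` K" "K \<subseteq> \<Union>\<F>"
    using K unfolding compactin_def by meson
  then obtain K0 where K0: "K0 \<subseteq> K" "finite K0" "\<F> = W ` K0"
    using finite_subset_image by meson
  \<comment> \<open>The inserted \<open>1\<close> gives the minimum a meaning when \<open>K0\<close>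
    is empty.\<close>
  let ?r = "Min (insert 1 ((\<lambda>\<nu>. r \<nu> / 2) ` K0))"
  have r0: "?r > 0" using K0 \<Phi>(2) by (subst Min_gr_iff) auto
  have rle: "?r \<le> r \<nu> / 2" if "\<nu> \<in> K0" for \<nu> using that K0 by (intro Min_le) auto
  show ?thesis
  proof (intro exI[of _ "\<Union>(\<Phi> ` K0)"] exI[of _ ?r] conjI ballI impI)
    show "finite (\<Union>(\<Phi> ` K0))" using K0 \<Phi>(1) by auto
    show "?r > 0" by fact
    show "bcont \<phi>" if "\<phi> \<in> \<Union>(\<Phi> ` K0)" for \<phi> using that K0 \<Phi>(3) by auto
    fix \<nu> \<rho> assume \<nu>: "\<nu> \<in> K" and \<rho>: "\<rho> \<in> prob_measures"
      and close: "\<forall>\<phi>\<in>\<Union>(\<Phi> ` K0). \<bar>(\<integral>x. \<phi> x \<partial>\<rho>) - (\<integral>x. \<phi> x \<partial>\<nu>)\<bar> < ?r"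
    obtain \<nu>0 where \<nu>0: "\<nu>0 \<in> K0" "\<nu> \<in> W \<nu>0" using \<F> K0 \<nu> by auto
    show "\<rho> \<in> U"
    proof (rule \<Phi>(4)[OF _ \<rho>])
      show "\<nu>0 \<in> K" using \<nu>0 K0 by auto
      fix \<phi> assume \<phi>: "\<phi> \<in> \<Phi> \<nu>0"
      have "\<bar>(\<integral>x. \<phi> x \<partial>\<rho>) - (\<integral>x. \<phi> x \<partial>\<nu>)\<bar> < r \<nu>0 / 2" using close \<phi> \<nu>0 rle[OF \<nu>0(1)] by fastforce
      moreover have "\<bar>(\<integral>x. \<phi> x \<partial>\<nu>) - (\<integral>x. \<phi> x \<partial>\<nu>0)\<bar> < r \<nu>0 / 2" using \<nu>0 \<phi> by (auto simp: W_def)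
      ultimately show "\<bar>(\<integral>x. \<phi> x \<partial>\<rho>) - (\<integral>x. \<phi> x \<partial>\<nu>0)\<bar> < r \<nu>0" by linarith
    qed
  qed
qed

subsection \<open>Empirical measures\<close>

text \<open>\<open>measure_of\<close> yields the intended values only for a countably additive set
  function. Recognizing the image of the uniform measure on the indices supplies this, and makes
  integrals computable.\<close>

lemma emp_measure_eq_distr:
  assumes "n > 0"
  shows "emp_measure n x = distr (uniform_count_measure {..<n}) borel x"
proof -
  let ?M = "distr (uniform_count_measure {..<n}) borel x"
  have x: "x \<in> uniform_count_measure {..<n} \<rightarrow>\<^sub>M borel"
    by (simp add: measurable_def space_uniform_count_measure sets_uniform_count_measure)
  have "?M = measure_of (space ?M) (sets ?M) (emeasure ?M)"
    by (rule measure_of_of_measure[symmetric])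
  also have "\<dots> = measure_of UNIV (sets borel) (emeasure ?M)"
    by (simp only: space_distr sets_distr space_borel)
  also have "\<dots> = measure_of UNIV (sets borel) (\<lambda>A. ennreal (real (card {i \<in> {..<n}. x i \<in> A}) / real n))"
  proof (rule measure_of_eq)
    show "sets borel \<subseteq> Pow (UNIV :: 'a set)" by simp
    fix A assume "A \<in> sigma_sets UNIV (sets borel :: 'a set set)"
    then have A: "A \<in> sets borel" using sets.sigma_sets_eq[of "borel :: 'a measure"] by simp
    have "emeasure ?M A = emeasure (uniform_count_measure {..<n}) {i \<in> {..<n}. x i \<in> A}"
      using emeasure_distr[OF x A]
      by (simp add: space_uniform_count_measure vimage_def Int_def conj_commute)
    also have "\<dots> = ennreal (real (card {i \<in> {..<n}. x i \<in> A}) / real n)"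
      using assms by (subst emeasure_uniform_count_measure) auto
    finally show "emeasure ?M A = ennreal (real (card {i \<in> {..<n}. x i \<in> A}) / real n)" .
  qed
  finally show ?thesis by (simp add: emp_measure_def)
qed

lemma emp_measure_prob:
  assumes "n > 0" shows "emp_measure n x \<in> prob_measures"
proof -
  have "prob_space (uniform_count_measure {..<n})"
    using assms by (intro prob_space_uniform_count_measure) auto
  then have "prob_space (distr (uniform_count_measure {..<n}) borel x)"
    by (rule prob_space.prob_space_distr) (simp add: measurable_def space_uniform_count_measure sets_uniform_count_measure)
  then show ?thesis by (simp add: prob_measures_def emp_measure_eq_distr[OF assms])
qed

lemma integral_emp_measure:
  fixes \<phi> :: "'a::polish_space \<Rightarrow> real"
  assumes "n > 0" "\<phi> \<in> borel_measurable borel"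
  shows "(\<integral>y. \<phi> y \<partial>emp_measure n x) = (\<Sum>i<n. \<phi> (x i)) / real n"
proof -
  have "(\<integral>y. \<phi> y \<partial>emp_measure n x) = (\<integral>i. \<phi> (x i) \<partial>uniform_count_measure {..<n})"
    unfolding emp_measure_eq_distr[OF assms(1)]
    by (rule integral_distr) (use assms in \<open>simp_all add: measurable_def space_uniform_count_measure sets_uniform_count_measure\<close>)
  also have "\<dots> = (\<Sum>i<n. 1 / real n * \<phi> (x i))"
    unfolding uniform_count_measure_def
    by (subst lebesgue_integral_point_measure_finite) auto
  finally show ?thesis by (simp add: sum_divide_distrib)
qed

text \<open>The preimage of a generator is a preimage under a finite average of a continuous
  function of the coordinates, hence open in the product topology on sequences; the induction
  follows the generation of the weak topology.\<close>

lemma open_emp_measure_vimage: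
  fixes U :: "'a::polish_space measure set"
  assumes n: "n > 0" and U: "openin weak_topology U"
  shows "open {x. emp_measure n x \<in> U}"
  using U[unfolded weak_topology_def openin_topology_generated_by_iff]
proof induction
  case Empty then show ?case by simp
next
  case (Int a b)
  then show ?case using open_Int[of "{x. emp_measure n x \<in> a}" "{x. emp_measure n x \<in> b}"]
    by (simp add: Collect_conj_eq)
next
  case (UN K)
  then have "open (\<Union>k\<in>K. {x. emp_measure n x \<in> k})" by blast
  moreover have "(\<Union>k\<in>K. {x. emp_measure n x \<in> k}) = {x. emp_measure n x \<in> \<Union>K}" by auto
  ultimately show ?case by simp
next
  case (Basis s)
  then obtain f :: "'a \<Rightarrow> real" and V where s: "s = {\<nu> \<in> prob_measures. (\<integral>x. f x \<partial>\<nu>) \<in> V}"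
    "continuous_on UNIV f" "bounded (range f)" "open V" by blast
  have f: "f \<in> borel_measurable borel" using s by (intro borel_measurable_continuous_onI)
  have "continuous_on UNIV (\<lambda>x::nat \<Rightarrow> 'a. (\<Sum>i<n. f (x i)) / real n)"
    using n by (intro continuous_intros continuous_on_compose2[OF s(2)] continuous_on_product_coordinates) auto
  then have "open ((\<lambda>x::nat \<Rightarrow> 'a. (\<Sum>i<n. f (x i)) / real n) -` V)"
    using s(4) by (rule open_vimage[rotated])
  also have "(\<lambda>x::nat \<Rightarrow> 'a. (\<Sum>i<n. f (x i)) / real n) -` V = {x. emp_measure n x \<in> s}"
    by (auto simp: s emp_measure_prob[OF n] integral_emp_measure[OF n f])
  finally show ?case .
qed

text \<open>Openness above concerns all sequences, while \<open>PiM {..<n}\<close> carries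
  extensional functions. The inclusion is measurable because the coordinates from \<open>n\<close>
  on are constantly \<open>undefined\<close>.\<close>

lemma measurable_PiM_subset_UNIV:
  "(\<lambda>x. x) \<in> PiM {..<n} (\<lambda>_. borel) \<rightarrow>\<^sub>M PiM UNIV (\<lambda>_::nat. borel :: 'a::topological_space measure)"
proof (rule measurable_PiM_single')
  fix i :: nat
  show "(\<lambda>x. x i) \<in> PiM {..<n} (\<lambda>_. borel) \<rightarrow>\<^sub>M (borel :: 'a measure)"
  proof (cases "i < n")
    case True then show ?thesis by (intro measurable_component_singleton) auto
  next
    case False
    then have "(\<lambda>x. undefined) \<in> PiM {..<n} (\<lambda>_. borel) \<rightarrow>\<^sub>M (borel :: 'a measure)" by simp
    then show ?thesis
      by (rule measurable_cong[THEN iffD1, rotated]) (use False in \<open>auto simp: space_PiM PiE_iff extensional_def\<close>)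
  qed
qed auto

lemma emp_measure_vimage_sets:
  fixes U :: "'a::polish_space measure set"
  assumes "n > 0" "openin weak_topology U"
  shows "{x \<in> space (PiM {..<n} (\<lambda>_. borel)). emp_measure n x \<in> U} \<in> sets (PiM {..<n} (\<lambda>_. borel))"
proof -
  have "{x. emp_measure n x \<in> U} \<in> sets (PiM UNIV (\<lambda>_::nat. borel :: 'a measure))"
    using open_emp_measure_vimage[OF assms] by (simp add: sets_PiM_equal_borel)
  from measurable_sets[OF measurable_PiM_subset_UNIV this, of n] show ?thesis
    by (simp add: vimage_def Int_def conj_commute)
qed

lemma lsc_emp_measurable:
  fixes F :: "'a::polish_space measure \<Rightarrow> real"
  assumes "n > 0" "lsc_on weak_topology F"
  shows "(\<lambda>x. F (emp_measure n x)) \<in> borel_measurable (PiM {..<n} (\<lambda>_. borel))"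
proof (rule borel_measurableI_greater)
  fix c
  have "openin weak_topology {\<nu> \<in> topspace weak_topology. c < F \<nu>}"
    using assms(2) by (simp add: lsc_on_def)
  from emp_measure_vimage_sets[OF assms(1) this]
  show "{x \<in> space (PiM {..<n} (\<lambda>_. borel)). c < F (emp_measure n x)} \<in> sets (PiM {..<n} (\<lambda>_. borel))"
    by (simp add: topspace_weak_topology emp_measure_prob[OF assms(1)])
qed

lemma usc_emp_measurable:
  fixes F :: "'a::polish_space measure \<Rightarrow> real"
  assumes "n > 0" "usc_on weak_topology F"
  shows "(\<lambda>x. F (emp_measure n x)) \<in> borel_measurable (PiM {..<n} (\<lambda>_. borel))"
proof (rule borel_measurableI_less)
  fix c
  have "openin weak_topology {\<nu> \<in> topspace weak_topology. F \<nu> < c}"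
    using assms(2) by (simp add: usc_on_def)
  from emp_measure_vimage_sets[OF assms(1) this]
  show "{x \<in> space (PiM {..<n} (\<lambda>_. borel)). F (emp_measure n x) < c} \<in> sets (PiM {..<n} (\<lambda>_. borel))"
    by (simp add: topspace_weak_topology emp_measure_prob[OF assms(1)])
qed

lemma sets_PiM_prob_measure:
  "\<rho> \<in> prob_measures \<Longrightarrow> sets (PiM {..<n} (\<lambda>_. \<rho>)) = sets (PiM {..<n} (\<lambda>_. borel))"
  by (intro sets_PiM_cong) (auto simp: prob_measures_def)

section \<open>Law of large numbers for empirical measures\<close>

lemma variance_sum_bound:
  fixes \<rho> :: "'a::polish_space measure" and \<psi> :: "'a \<Rightarrow> real"
  assumes \<rho>: "\<rho> \<in> prob_measures" and \<psi>: "\<psi> \<in> borel_measurable borel" "\<And>x. \<bar>\<psi> x\<bar> \<le> B" "(\<integral>x. \<psi> x \<partial>\<rho>) = 0"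
  shows "(\<integral>x. (\<Sum>i<n. \<psi> (x i))\<^sup>2 \<partial>PiM {..<n} (\<lambda>_. \<rho>)) \<le> real n * B\<^sup>2"
proof -
  let ?P = "PiM {..<n} (\<lambda>_. \<rho>)"
  interpret r: prob_space \<rho> using \<rho> by (rule prob_measuresD)
  interpret pp: product_prob_space "\<lambda>_. \<rho>" by (rule product_prob_spaceI) (rule r.prob_space_axioms)
  interpret P: prob_space ?P by (rule prob_space_PiM) (rule r.prob_space_axioms)
  have B0: "0 \<le> B" using \<psi>(2)[of undefined] by linarith
  have sr: "sets \<rho> = sets borel" using \<rho> by (rule prob_measuresD)
  have \<psi>m[measurable]: "\<psi> \<in> borel_measurable \<rho>" using \<psi>(1) sr by (simp cong: measurable_cong_sets)
  have cm: "(\<lambda>x. \<psi> (x i)) \<in> borel_measurable ?P" if "i < n" for i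
    using measurable_PiM_coordinate[of i "{..<n}" \<psi> "\<lambda>_. \<rho>" borel] that \<psi>m by auto
  have bd: "\<bar>\<psi> a * \<psi> b\<bar> \<le> B * B" for a b
    unfolding abs_mult using \<psi>(2) B0 by (intro mult_mono) auto
  have int: "integrable ?P (\<lambda>x. \<psi> (x i) * \<psi> (x j))" if "i < n" "j < n" for i j
    using bd by (intro P.integrable_const_bound[where B="B*B"] AE_I2 borel_measurable_times cm that) auto
  have off: "(\<integral>x. \<psi> (x i) * \<psi> (x j) \<partial>?P) = 0" if ij: "i < n" "j < n" "i \<noteq> j" for i j
  proof -
    \<comment> \<open>The product of two coordinates is written as a full product over
      \<open>{..<n}\<close> with factor 1 elsewhere, so that it integrates factorwise; a centred
      factor then makes it vanish.\<close>
    let ?h = "\<lambda>k. if k = i \<or> k = j then \<psi> else (\<lambda>_. 1)"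
    have "(\<Prod>k<n. ?h k (x k)) = \<psi> (x i) * \<psi> (x j)" for x
    proof -
      have "(\<Prod>k<n. ?h k (x k)) = (\<Prod>k\<in>{i,j}. ?h k (x k))"
        using ij by (intro prod.mono_neutral_right) auto
      also have "\<dots> = \<psi> (x i) * \<psi> (x j)" using ij by simp
      finally show ?thesis .
    qed
    then have "(\<integral>x. \<psi> (x i) * \<psi> (x j) \<partial>?P) = (\<integral>x. (\<Prod>k<n. ?h k (x k)) \<partial>?P)" by simp
    also have "\<dots> = (\<Prod>k<n. \<integral>x. ?h k x \<partial>\<rho>)"
      using \<psi> B0 by (intro pp.product_integral_prod) (auto intro!: r.integrable_const_bound[where B=B])
    also have "\<dots> = 0" using ij \<psi>(3) by (intro prod_zero bexI[of _ i]) auto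
    finally show ?thesis .
  qed
  have "(\<integral>x. (\<Sum>i<n. \<psi> (x i))\<^sup>2 \<partial>?P) = (\<integral>x. (\<Sum>i<n. \<Sum>j<n. \<psi> (x i) * \<psi> (x j)) \<partial>?P)"
    by (simp add: power2_eq_square sum_product)
  also have "\<dots> = (\<Sum>i<n. \<integral>x. (\<Sum>j<n. \<psi> (x i) * \<psi> (x j)) \<partial>?P)"
    by (intro Bochner_Integration.integral_sum Bochner_Integration.integrable_sum int) auto
  also have "\<dots> = (\<Sum>i<n. \<Sum>j<n. \<integral>x. \<psi> (x i) * \<psi> (x j) \<partial>?P)"
    by (intro sum.cong refl Bochner_Integration.integral_sum int) auto
  also have "\<dots> \<le> (\<Sum>i<n. \<Sum>j<n. if j = i then B * B else 0)"
  proof (intro sum_mono)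
    fix i j assume ij: "i \<in> {..<n}" "j \<in> {..<n}"
    have "(\<integral>x. \<psi> (x i) * \<psi> (x i) \<partial>?P) \<le> B * B"
      using ij bd by (intro P.integral_le_const int AE_I2) (auto simp: abs_le_iff)
    then show "(\<integral>x. \<psi> (x i) * \<psi> (x j) \<partial>?P) \<le> (if j = i then B * B else 0)"
      using off ij by auto
  qed
  also have "\<dots> = real n * B\<^sup>2" by (simp add: power2_eq_square)
  finally show ?thesis .
qed

text \<open>Near \<open>\<rho>\<close> in finitely many test functions \<open>F\<close> exceeds
  \<open>d\<close>; elsewhere it is at least \<open>-C\<close>. The indicator of the bad event is
  dominated by squared deviations of the empirical means, whose integral is of order 1/n, as in
  Chebyshev's inequality.\<close>

lemma lsc_emp_measure_lln:
  fixes F :: "'a::polish_space measure \<Rightarrow> real"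
  assumes \<rho>: "\<rho> \<in> prob_measures" and F: "lsc_on weak_topology F"
    and C: "\<And>\<nu>. \<nu> \<in> prob_measures \<Longrightarrow> \<bar>F \<nu>\<bar> \<le> C" and c: "c < F \<rho>"
  shows "\<forall>\<^sub>F n in sequentially. c < (\<integral>x. F (emp_measure n x) \<partial>PiM {..<n} (\<lambda>_. \<rho>))"
proof -
  interpret r: prob_space \<rho> using \<rho> by (rule prob_measuresD)
  have sr: "sets \<rho> = sets borel" using \<rho> by (rule prob_measuresD)
  \<comment> \<open>A level strictly between \<open>c\<close> and \<open>F \<rho>\<close> leaves the
    gap \<open>d - c\<close> to absorb the deviation term.\<close>
  define d where "d = (c + F \<rho>) / 2"
  have d: "c < d" "d < F \<rho>" using c by (auto simp: d_def)
  \<comment> \<open>Chosen so that \<open>d - D \<le> -C\<close>: one unit of squared deviation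
    already lowers the minorant to a lower bound of \<open>F\<close>.\<close>
  define D where "D = max 0 (d + C)"
  have D0: "0 \<le> D" by (simp add: D_def)
  have "openin weak_topology {\<nu> \<in> prob_measures. d < F \<nu>}"
    using F by (simp add: lsc_on_def topspace_weak_topology)
  from weak_open_contains_ball[OF this, of \<rho>] obtain \<Phi> r where
    \<Phi>: "finite \<Phi>" "r > 0" "\<And>\<phi>. \<phi> \<in> \<Phi> \<Longrightarrow> bcont \<phi>"
    "\<And>\<nu>. \<nu> \<in> prob_measures \<Longrightarrow> (\<And>\<phi>. \<phi> \<in> \<Phi> \<Longrightarrow> \<bar>(\<integral>x. \<phi> x \<partial>\<nu>) - (\<integral>x. \<phi> x \<partial>\<rho>)\<bar> < r) \<Longrightarrow> d < F \<nu>"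
    using d \<rho> by auto
  have "\<exists>B. \<forall>\<phi>\<in>\<Phi>. B \<phi> > 0 \<and> (\<forall>x. \<bar>\<phi> x - (\<integral>x. \<phi> x \<partial>\<rho>)\<bar> \<le> B \<phi>)"
  proof (rule bchoice, intro ballI)
    fix \<phi> assume "\<phi> \<in> \<Phi>"
    then obtain B where B: "B > 0" "\<And>x. \<bar>\<phi> x\<bar> \<le> B" using \<Phi>(3) bcontE by blast
    then show "\<exists>B. B > 0 \<and> (\<forall>x. \<bar>\<phi> x - (\<integral>x. \<phi> x \<partial>\<rho>)\<bar> \<le> B)"
      by (intro exI[of _ "B + \<bar>\<integral>x. \<phi> x \<partial>\<rho>\<bar>"])
        (auto intro!: order_trans[OF abs_triangle_ineq4] add_mono add_pos_nonneg)
  qed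
  then obtain B where B: "\<And>\<phi> x. \<phi> \<in> \<Phi> \<Longrightarrow> \<bar>\<phi> x - (\<integral>x. \<phi> x \<partial>\<rho>)\<bar> \<le> B \<phi>" by blast
  define V where "V = (\<Sum>\<phi>\<in>\<Phi>. (B \<phi>)\<^sup>2)"
  have bound: "d - D * V / r\<^sup>2 * (1 / real n) \<le> (\<integral>x. F (emp_measure n x) \<partial>PiM {..<n} (\<lambda>_. \<rho>))" if n: "n > 0" for n
  proof -
    let ?P = "PiM {..<n} (\<lambda>_. \<rho>)"
    interpret P: prob_space ?P by (rule prob_space_PiM) (rule r.prob_space_axioms)
    define S where "S \<phi> x = (\<Sum>i<n. \<phi> (x i) - (\<integral>x. \<phi> x \<partial>\<rho>))" for \<phi> :: "'a \<Rightarrow> real" and x :: "nat \<Rightarrow> 'a"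
    have Sm: "S \<phi> \<in> borel_measurable ?P" if "\<phi> \<in> \<Phi>" for \<phi>
      unfolding S_def
    proof (intro borel_measurable_sum borel_measurable_diff borel_measurable_const)
      fix i assume "i \<in> {..<n}"
      then show "(\<lambda>x. \<phi> (x i)) \<in> borel_measurable ?P"
        using measurable_PiM_coordinate[of i "{..<n}" \<phi> "\<lambda>_. \<rho>" borel] bcont_measurable[OF \<Phi>(3)[OF that]] sr
        by (simp cong: measurable_cong_sets)
    qed
    have Sb: "\<bar>S \<phi> x\<bar> \<le> n * B \<phi>" if "\<phi> \<in> \<Phi>" for \<phi> x
    proof -
      have "\<bar>S \<phi> x\<bar> \<le> (\<Sum>i<n. \<bar>\<phi> (x i) - (\<integral>x. \<phi> x \<partial>\<rho>)\<bar>)" unfolding S_def by (rule sum_abs)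
      also have "\<dots> \<le> (\<Sum>i<n. B \<phi>)" by (intro sum_mono B that)
      finally show ?thesis by simp
    qed
    have S2: "integrable ?P (\<lambda>x. (S \<phi> x)\<^sup>2)" if "\<phi> \<in> \<Phi>" for \<phi>
    proof (rule P.integrable_const_bound[where B="(n * B \<phi>)\<^sup>2"])
      have "(S \<phi> x)\<^sup>2 \<le> (n * B \<phi>)\<^sup>2" for x
        using power_mono[OF Sb[OF that], of x 2] by simp
      then show "AE x in ?P. norm ((S \<phi> x)\<^sup>2) \<le> (real n * B \<phi>)\<^sup>2" by simp
      show "(\<lambda>x. (S \<phi> x)\<^sup>2) \<in> borel_measurable ?P" using Sm[OF that] by simp
    qed
    have S2i: "(\<integral>x. (S \<phi> x)\<^sup>2 \<partial>?P) \<le> real n * (B \<phi>)\<^sup>2" if \<phi>: "\<phi> \<in> \<Phi>" for \<phi>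
    proof -
      obtain b where b: "\<And>x. \<bar>\<phi> x\<bar> \<le> b" using bcontE[OF \<Phi>(3)[OF \<phi>]] by blast
      have m: "\<phi> \<in> borel_measurable borel" using \<Phi>(3)[OF that] by (rule bcont_measurable)
      have "integrable \<rho> \<phi>"
        by (rule r.integrable_const_bound[where B=b]) (use b m sr in \<open>auto cong: measurable_cong_sets\<close>)
      then have z: "(\<integral>y. \<phi> y - (\<integral>x. \<phi> x \<partial>\<rho>) \<partial>\<rho>) = 0"
        by (simp add: r.prob_space)
      show ?thesis unfolding S_def
        by (rule variance_sum_bound[OF \<rho>]) (use m B[OF that] z in auto)
    qed
    have pw: "d - D * (\<Sum>\<phi>\<in>\<Phi>. (S \<phi> x / (n * r))\<^sup>2) \<le> F (emp_measure n x)" for x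
    proof (cases "\<forall>\<phi>\<in>\<Phi>. \<bar>S \<phi> x / n\<bar> < r")
      case True
      have "d < F (emp_measure n x)"
      proof (rule \<Phi>(4)[OF emp_measure_prob[OF n]])
        fix \<phi> assume \<phi>: "\<phi> \<in> \<Phi>"
        have "(\<integral>y. \<phi> y \<partial>emp_measure n x) - (\<integral>x. \<phi> x \<partial>\<rho>) = S \<phi> x / n"
          using n by (subst integral_emp_measure[OF n bcont_measurable[OF \<Phi>(3)[OF \<phi>]]])
             (simp add: S_def sum_subtractf field_simps)
        then show "\<bar>(\<integral>y. \<phi> y \<partial>emp_measure n x) - (\<integral>x. \<phi> x \<partial>\<rho>)\<bar> < r" using True \<phi> by simp
      qed
      moreover have "0 \<le> D * (\<Sum>\<phi>\<in>\<Phi>. (S \<phi> x / (n * r))\<^sup>2)" using D0 by (intro mult_nonneg_nonneg sum_nonneg) auto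
      ultimately show ?thesis by linarith
    next
      case False
      then obtain \<phi> where \<phi>: "\<phi> \<in> \<Phi>" "r \<le> \<bar>S \<phi> x / n\<bar>" by force
      \<comment> \<open>A single deviation of size at least \<open>r\<close> makes the sum of
        squares at least 1.\<close>
      have "1 \<le> \<bar>S \<phi> x / (n * r)\<bar>" using \<phi>(2) \<open>r > 0\<close> n by (simp add: field_simps)
      then have "1 \<le> \<bar>S \<phi> x / (n * r)\<bar>\<^sup>2" by (rule one_le_power)
      then have "1 \<le> (S \<phi> x / (n * r))\<^sup>2" by (simp only: power2_abs)
      also have "\<dots> \<le> (\<Sum>\<phi>\<in>\<Phi>. (S \<phi> x / (n * r))\<^sup>2)" by (rule member_le_sum) (use \<phi> \<Phi> in auto)
      finally have "D \<le> D * (\<Sum>\<phi>\<in>\<Phi>. (S \<phi> x / (n * r))\<^sup>2)" using D0 by (simp add: mult_le_cancel_left1)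
      moreover have "- C \<le> F (emp_measure n x)" using C[OF emp_measure_prob[OF n], of x] by linarith
      ultimately show ?thesis unfolding D_def by linarith
    qed
    have Fm: "(\<lambda>x. F (emp_measure n x)) \<in> borel_measurable ?P"
      using lsc_emp_measurable[OF n F] sets_PiM_prob_measure[OF \<rho>, of n] by (simp cong: measurable_cong_sets)
    have "d - D * V / r\<^sup>2 * (1 / real n) \<le> d - D * (\<Sum>\<phi>\<in>\<Phi>. (\<integral>x. (S \<phi> x)\<^sup>2 \<partial>?P) / (n * r)\<^sup>2)"
    proof -
      have "(\<Sum>\<phi>\<in>\<Phi>. (\<integral>x. (S \<phi> x)\<^sup>2 \<partial>?P) / (n * r)\<^sup>2) \<le> (\<Sum>\<phi>\<in>\<Phi>. (n * (B \<phi>)\<^sup>2) / (n * r)\<^sup>2)"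
        by (intro sum_mono divide_right_mono S2i) auto
      also have "\<dots> = V / r\<^sup>2 * (1 / n)"
        using n by (simp add: V_def sum_divide_distrib[symmetric] sum_distrib_left[symmetric] power2_eq_square)
      finally show ?thesis using D0 mult_left_mono by fastforce
    qed
    also have "\<dots> = (\<integral>x. d - D * (\<Sum>\<phi>\<in>\<Phi>. (S \<phi> x / (n * r))\<^sup>2) \<partial>?P)"
      using S2 by (simp add: power_divide P.prob_space Bochner_Integration.integral_sum)
    also have "\<dots> \<le> (\<integral>x. F (emp_measure n x) \<partial>?P)"
    proof (rule integral_mono)
      show "integrable ?P (\<lambda>x. d - D * (\<Sum>\<phi>\<in>\<Phi>. (S \<phi> x / (n * r))\<^sup>2))"
        using S2 by (simp add: power_divide)
      show "integrable ?P (\<lambda>x. F (emp_measure n x))"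
        using C[OF emp_measure_prob[OF n]] by (intro P.integrable_const_bound[where B=C] Fm) auto
    qed (use pw in auto)
    finally show ?thesis .
  qed
  have "(\<lambda>n. d - D * V / r\<^sup>2 * (1 / real n)) \<longlonglongrightarrow> d - D * V / r\<^sup>2 * 0"
    by (intro tendsto_intros lim_1_over_n)
  then have "\<forall>\<^sub>F n in sequentially. c < d - D * V / r\<^sup>2 * (1 / real n)"
    using d by (intro order_tendstoD(1)[where y="d - D * V / r\<^sup>2 * 0"]) auto
  then show ?thesis
    using eventually_gt_at_top[of 0]
  proof eventually_elim
    case (elim n)
    then show ?case using bound[of n] by linarith
  qed
qed

subsection \<open>The Markov process\<close>

locale markov_setting =
  fixes Px :: "'a::polish_space \<Rightarrow> 'w measure" and X :: "real \<Rightarrow> 'w \<Rightarrow> 'a" and \<mu> :: "'a measure"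
  assumes markov: "markov_process Px X"
    and mu: "\<mu> \<in> prob_measures"
    and reversible: "reversible Px X \<mu>"
    and strongly_continuous: "strongly_continuous_L2 Px X \<mu>"
begin

definition \<Omega> :: "'w measure" where "\<Omega> = Px undefined"

definition K :: "real \<Rightarrow> 'a \<Rightarrow> 'a measure" where "K r x = distr (Px x) borel (X r)"

abbreviation P :: "real \<Rightarrow> ('a \<Rightarrow> ennreal) \<Rightarrow> 'a \<Rightarrow> ennreal" where
  "P r v x \<equiv> (\<integral>\<^sup>+y. v y \<partial>K r x)"

lemma prob_mu: "prob_space \<mu>" using mu by (rule prob_measuresD)
lemma sets_mu[measurable_cong, simp]: "sets \<mu> = sets borel" using mu by (rule prob_measuresD)
lemma space_mu[simp]: "space \<mu> = UNIV" using mu by (rule space_prob_measures)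

lemma prob_Px: "prob_space (Px x)" using markov by (auto simp: markov_process_def)

lemma sets_Px[measurable_cong, simp]: "sets (Px x) = sets \<Omega>"
  using markov unfolding markov_process_def \<Omega>_def by blast

lemma space_Px[simp]: "space (Px x) = space \<Omega>"
  by (rule sets_eq_imp_space_eq) simp

lemma Px_kernel[measurable]: "Px \<in> borel \<rightarrow>\<^sub>M prob_algebra \<Omega>"
proof (rule measurable_prob_algebra_generated[OF sets.sigma_sets_eq[symmetric] sets.Int_stable sets.space_closed])
  show "\<And>A. A \<in> sets \<Omega> \<Longrightarrow> (\<lambda>a. emeasure (Px a) A) \<in> borel_measurable borel"
    using markov unfolding markov_process_def \<Omega>_def by blast
qed (auto intro: prob_Px)

lemma X_measurable_Px: "0 \<le> r \<Longrightarrow> X r \<in> Px x \<rightarrow>\<^sub>M borel"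
  using markov by (auto simp: markov_process_def)

lemma X_measurable: "0 \<le> r \<Longrightarrow> X r \<in> \<Omega> \<rightarrow>\<^sub>M borel"
  unfolding \<Omega>_def by (rule X_measurable_Px)

text \<open>Freezing the process at time 0 for negative times extends joint measurability from the
  half line to the whole line, where the later time integrals live.\<close>

lemma X_joint:
  "(\<lambda>(s, \<omega>). X (max 0 s) \<omega>) \<in> borel \<Otimes>\<^sub>M \<Omega> \<rightarrow>\<^sub>M borel"
proof -
  have 1: "(\<lambda>(s, \<omega>). X s \<omega>) \<in> restrict_space borel {0..} \<Otimes>\<^sub>M \<Omega> \<rightarrow>\<^sub>M borel"
    using markov unfolding markov_process_def \<Omega>_def by blast
  have 2: "(\<lambda>z. (max 0 (fst z), snd z)) \<in> borel \<Otimes>\<^sub>M \<Omega> \<rightarrow>\<^sub>M restrict_space borel {0::real..} \<Otimes>\<^sub>M \<Omega>"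
    by (intro measurable_Pair measurable_restrict_space2) auto
  show ?thesis using measurable_compose[OF 2 1] by (simp add: case_prod_beta')
qed

lemma cond_exp_X:
  assumes "0 \<le> s" "0 \<le> r" "f \<in> borel_measurable borel" "bounded (range f)"
  shows "AE \<omega> in Px x. real_cond_exp (Px x) (nat_filt X (Px x) s) (\<lambda>\<omega>. f (X (s + r) \<omega>)) \<omega> = Pt Px X r f (X s \<omega>)"
  using markov assms unfolding markov_process_def by blast

lemma X_0: "AE \<omega> in Px x. X 0 \<omega> = x"
  using markov by (auto simp: markov_process_def)

lemma K_kernel[measurable]: "0 \<le> r \<Longrightarrow> K r \<in> borel \<rightarrow>\<^sub>M prob_algebra borel"
  unfolding K_def[abs_def]
  by (rule measurable_compose[OF Px_kernel measurable_distr_prob_space[OF X_measurable]])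

lemma sets_K[measurable_cong, simp]: "sets (K r x) = sets borel" by (simp add: K_def)
lemma space_K[simp]: "space (K r x) = UNIV" by (simp add: K_def)
lemma prob_K: "0 \<le> r \<Longrightarrow> prob_space (K r x)"
  unfolding K_def by (rule prob_space.prob_space_distr[OF prob_Px X_measurable_Px])

lemma nn_integral_K: "0 \<le> r \<Longrightarrow> v \<in> borel_measurable borel \<Longrightarrow> P r v x = (\<integral>\<^sup>+\<omega>. v (X r \<omega>) \<partial>Px x)"
  unfolding K_def by (subst nn_integral_distr) (auto intro: X_measurable_Px)

lemma P_measurable[measurable]:
  "0 \<le> r \<Longrightarrow> v \<in> borel_measurable borel \<Longrightarrow> P r v \<in> borel_measurable borel"
  by (rule measurable_compose[OF measurable_prob_algebraD[OF K_kernel] nn_integral_measurable_subprob_algebra])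

text \<open>The process starts at \<open>x\<close> only almost surely, which is enough for its
  law.\<close>

lemma K_0: "K 0 x = return borel x"
proof (rule measure_eqI)
  fix A assume "A \<in> sets (K 0 x)"
  then have A[measurable]: "A \<in> sets borel" by simp
  interpret prob_space "Px x" by (rule prob_Px)
  have [measurable]: "X 0 \<in> Px x \<rightarrow>\<^sub>M borel" by (rule X_measurable_Px) simp
  have "emeasure (K 0 x) A = (\<integral>\<^sup>+\<omega>. indicator A (X 0 \<omega>) \<partial>Px x)"
    using nn_integral_K[of 0 "indicator A" x] by simp
  also have "\<dots> = (\<integral>\<^sup>+\<omega>. indicator A x \<partial>Px x)"
    using X_0[of x] by (intro nn_integral_cong_AE) auto
  also have "\<dots> = emeasure (return borel x) A" by (simp add: emeasure_space_1 del: space_Px)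
  finally show "emeasure (K 0 x) A = emeasure (return borel x) A" .
qed simp

lemma P_0: "v \<in> borel_measurable borel \<Longrightarrow> P 0 v x = v x"
  unfolding K_0 by (subst nn_integral_return) auto

subsection \<open>The Markov property for the pair of past and future\<close>

text \<open>The natural filtration refers to a measure only through its space, which all
  \<open>Px x\<close> share; one sigma-algebra \<open>past s\<close> therefore serves every starting
  point.\<close>

definition past :: "real \<Rightarrow> 'w measure" where "past s = nat_filt X \<Omega> s"

lemma past_Px: "nat_filt X (Px x) s = past s"
  unfolding past_def nat_filt_def by simp

lemma space_past[simp]: "space (past s) = space \<Omega>"
  unfolding past_def nat_filt_def by (simp add: space_measure_of_conv)

lemma sets_past_subset: "sets (past s) \<subseteq> sets \<Omega>"
  unfolding past_def nat_filt_def using measurable_sets[OF X_measurable]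
  by (subst sets_measure_of) (auto intro!: sets.sigma_sets_subset)

lemma subalgebra_past: "subalgebra (Px x) (past s)"
  using sets_past_subset by (auto simp: subalgebra_def)

lemma measurable_id_past: "(\<lambda>\<omega>. \<omega>) \<in> \<Omega> \<rightarrow>\<^sub>M past s"
  using sets_past_subset by (auto simp: measurable_def dest: sets.sets_into_space)

lemma X_measurable_past: "0 \<le> r \<Longrightarrow> r \<le> s \<Longrightarrow> X r \<in> past s \<rightarrow>\<^sub>M borel"
proof (rule measurableI)
  fix A :: "'a set" assume "0 \<le> r" "r \<le> s" "A \<in> sets borel"
  then show "X r -` A \<inter> space (past s) \<in> sets (past s)"
    unfolding space_past by (auto simp: past_def nat_filt_def intro!: sigma_sets.Basic)
qed simp

text \<open>The Markov property, given as an identity for \<open>real_cond_exp\<close>, is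
  integrated over an event of the past. This turns it into an identity of measures on rectangles of
  past events and future positions.\<close>

lemma emeasure_past_future:
  assumes s: "0 \<le> s" and r: "0 \<le> r" and A: "A \<in> sets (past s)" and B[measurable]: "B \<in> sets borel"
  shows "emeasure (Px x) (A \<inter> (X (s + r) -` B \<inter> space \<Omega>)) = (\<integral>\<^sup>+\<omega>. indicator A \<omega> * emeasure (K r (X s \<omega>)) B \<partial>Px x)"
proof -
  interpret prob_space "Px x" by (rule prob_Px)
  interpret finite_measure_subalgebra "Px x" "past s" by standard (rule subalgebra_past)
  have [measurable]: "X (s + r) \<in> Px x \<rightarrow>\<^sub>M borel" "X s \<in> Px x \<rightarrow>\<^sub>M borel" using s r by (auto intro: X_measurable_Px)
  have A': "A \<in> sets (Px x)" using A sets_past_subset by auto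
  note [measurable] = A'
  have Bi: "integrable (Px x) (\<lambda>\<omega>. indicator B (X (s + r) \<omega>) :: real)"
    by (rule integrable_const_bound[where B=1]) auto
  have Pt: "Pt Px X r (indicator B) y = measure (K r y) B" for y
  proof -
    interpret y: prob_space "Px y" by (rule prob_Px)
    have "Pt Px X r (indicator B) y = (\<integral>\<omega>. indicator B \<omega> \<partial>K r y)"
      unfolding Pt_def K_def by (rule integral_distr[symmetric]) (auto intro: X_measurable_Px r)
    then show ?thesis by simp
  qed
  have b: "bounded (range (indicator B :: 'a \<Rightarrow> real))" by (auto simp: bounded_iff indicator_def intro!: exI[of _ 1])
  have ce: "AE \<omega> in Px x. real_cond_exp (Px x) (past s) (\<lambda>\<omega>. indicator B (X (s + r) \<omega>)) \<omega> = measure (K r (X s \<omega>)) B"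
    using cond_exp_X[OF s r _ b, of x] by (simp add: past_Px Pt)
  have mk[measurable]: "(\<lambda>y. measure (K r y) B) \<in> borel_measurable borel"
    using measurable_compose[OF K_kernel[OF r] measurable_measure_prob_algebra] by simp
  have le1: "measure (K r y) B \<le> 1" for y
    using prob_space.prob_le_1[OF prob_K[OF r]] by blast
  have "measure (Px x) (A \<inter> (X (s + r) -` B \<inter> space \<Omega>)) = (\<integral>\<omega>\<in>A. indicator B (X (s + r) \<omega>) \<partial>Px x)"
  proof -
    let ?S = "A \<inter> (X (s + r) -` B \<inter> space \<Omega>)"
    have "(\<integral>\<omega>\<in>A. indicator B (X (s + r) \<omega>) \<partial>Px x) = (\<integral>\<omega>. indicator ?S \<omega> \<partial>Px x)"
      unfolding set_lebesgue_integral_def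
      by (intro Bochner_Integration.integral_cong refl) (simp add: indicator_def)
    also have "\<dots> = measure (Px x) (?S \<inter> space (Px x))" by (rule Bochner_Integration.integral_indicator)
    also have "?S \<inter> space (Px x) = ?S" by auto
    finally show ?thesis by simp
  qed
  also have "\<dots> = (\<integral>\<omega>\<in>A. real_cond_exp (Px x) (past s) (\<lambda>\<omega>. indicator B (X (s + r) \<omega>)) \<omega> \<partial>Px x)"
    by (rule real_cond_exp_intA[OF Bi A])
  also have "\<dots> = (\<integral>\<omega>\<in>A. measure (K r (X s \<omega>)) B \<partial>Px x)"
    unfolding set_lebesgue_integral_def using ce
    by (intro integral_cong_AE) auto
  finally have eq: "measure (Px x) (A \<inter> (X (s + r) -` B \<inter> space \<Omega>)) = (\<integral>\<omega>. indicator A \<omega> * measure (K r (X s \<omega>)) B \<partial>Px x)"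
    by (simp add: set_lebesgue_integral_def)
  have "(\<integral>\<^sup>+\<omega>. indicator A \<omega> * emeasure (K r (X s \<omega>)) B \<partial>Px x) = (\<integral>\<^sup>+\<omega>. ennreal (indicator A \<omega> * measure (K r (X s \<omega>)) B) \<partial>Px x)"
    by (intro nn_integral_cong) (simp add: indicator_def finite_measure.emeasure_eq_measure[OF prob_space.finite_measure[OF prob_K[OF r]]])
  also have "\<dots> = ennreal (\<integral>\<omega>. indicator A \<omega> * measure (K r (X s \<omega>)) B \<partial>Px x)"
    by (intro nn_integral_eq_integral integrable_const_bound[where B=1] AE_I2)
       (auto simp: indicator_def le1)
  finally show ?thesis using eq by (simp add: emeasure_eq_measure)
qed

text \<open>The kernel remembers the past path and appends a position drawn from the transition
  kernel at \<open>X s\<close>.\<close>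

lemma past_kernel: "0 \<le> s \<Longrightarrow> 0 \<le> r \<Longrightarrow>
  (\<lambda>\<omega>. distr (K r (X s \<omega>)) (past s \<Otimes>\<^sub>M borel) (Pair \<omega>)) \<in> past s \<rightarrow>\<^sub>M prob_algebra (past s \<Otimes>\<^sub>M borel)"
  by (rule measurable_distr_prob_space2[where M=borel])
     (auto intro!: measurable_compose[OF X_measurable_past K_kernel])

text \<open>The joint law of the path up to time \<open>s\<close> and the position at
  \<open>s + r\<close> is disintegrated over the past. As an equation between measures, the Markov
  property becomes compatible with \<open>PiM_bind\<close> and so with independent copies.\<close>

lemma past_future_law:
  assumes s: "0 \<le> s" and r: "0 \<le> r"
  shows "distr (Px x) (past s \<Otimes>\<^sub>M borel) (\<lambda>\<omega>. (\<omega>, X (s + r) \<omega>))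
    = distr (Px x) (past s) (\<lambda>\<omega>. \<omega>) \<bind> (\<lambda>\<omega>. distr (K r (X s \<omega>)) (past s \<Otimes>\<^sub>M borel) (Pair \<omega>))"
    (is "?L = ?R")
proof -
  \<comment> \<open>The identity map into the coarser sigma-algebra restricts \<open>Px x\<close> to
    events of the past.\<close>
  have id: "(\<lambda>\<omega>. \<omega>) \<in> Px x \<rightarrow>\<^sub>M past s" using measurable_id_past by (simp cong: measurable_cong_sets)
  have Xm: "X (s + r) \<in> Px x \<rightarrow>\<^sub>M borel" using s r by (auto intro: X_measurable_Px)
  have pm: "(\<lambda>\<omega>. (\<omega>, X (s + r) \<omega>)) \<in> Px x \<rightarrow>\<^sub>M past s \<Otimes>\<^sub>M borel"
    using id Xm by (rule measurable_Pair)
  have D: "distr (Px x) (past s) (\<lambda>\<omega>. \<omega>) \<in> space (prob_algebra (past s))"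
    using prob_space.prob_space_distr[OF prob_Px id] by (simp add: space_prob_algebra)
  note k = past_kernel[OF s r]
  have setsR: "sets ?R = sets (past s \<Otimes>\<^sub>M borel)" using D k by (rule sets_bind')
  have pR: "prob_space ?R" using D k by (rule prob_space_bind')
  show ?thesis
  proof (rule measure_eqI_generator_eq[OF Int_stable_pair_measure_generator[of "past s" borel]])
    show "{a \<times> b |a b. a \<in> sets (past s) \<and> b \<in> sets borel} \<subseteq> Pow (space (past s) \<times> space borel)"
      by (rule pair_measure_closed)
    show "sets ?L = sigma_sets (space (past s) \<times> space borel) {a \<times> b |a b. a \<in> sets (past s) \<and> b \<in> sets borel}"
      by (simp add: sets_pair_measure)
    show "sets ?R = sigma_sets (space (past s) \<times> space borel) {a \<times> b |a b. a \<in> sets (past s) \<and> b \<in> sets borel}"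
      unfolding setsR by (simp add: sets_pair_measure)
    show "range (\<lambda>_::nat. space (past s) \<times> space borel) \<subseteq> {a \<times> b |a b. a \<in> sets (past s) \<and> b \<in> sets borel}"
      using sets.top[of "past s"] sets.top[of borel] by blast
    show "(\<Union>i::nat. space (past s) \<times> space borel) = space (past s) \<times> space borel" by auto
    show "emeasure ?L (space (past s) \<times> space borel) \<noteq> \<infinity>" for i :: nat
      using prob_space.emeasure_le_1[OF prob_space.prob_space_distr[OF prob_Px pm]] by (metis ennreal_one_less_top infinity_ennreal_def leD)
    fix Z assume "Z \<in> {a \<times> b |a b. a \<in> sets (past s) \<and> b \<in> sets (borel :: 'a measure)}"
    then obtain A B where Z: "Z = A \<times> B" and A: "A \<in> sets (past s)" and B[measurable]: "B \<in> sets borel" by blast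
    have AB: "A \<times> B \<in> sets (past s \<Otimes>\<^sub>M borel)" using A B by simp
    have "emeasure ?L Z = emeasure (Px x) (A \<inter> (X (s + r) -` B \<inter> space \<Omega>))"
      unfolding Z by (subst emeasure_distr[OF pm AB]) (auto intro!: arg_cong[where f="emeasure _"])
    also have "\<dots> = (\<integral>\<^sup>+\<omega>. indicator A \<omega> * emeasure (K r (X s \<omega>)) B \<partial>Px x)"
      by (rule emeasure_past_future[OF s r A B])
    also have "\<dots> = (\<integral>\<^sup>+\<omega>. indicator A \<omega> * emeasure (K r (X s \<omega>)) B \<partial>distr (Px x) (past s) (\<lambda>\<omega>. \<omega>))"
    proof (rule nn_integral_distr[symmetric, OF id])
      have "(\<lambda>\<omega>. emeasure (K r (X s \<omega>)) B) \<in> borel_measurable (past s)"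
        using measurable_compose[OF X_measurable_past[OF s order.refl] measurable_compose[OF K_kernel[OF r] measurable_prob_algebraD[OF measurable_ident, THEN measurable_compose, OF measurable_emeasure_subprob_algebra[OF B]]]]
        by simp
      then show "(\<lambda>\<omega>. indicator A \<omega> * emeasure (K r (X s \<omega>)) B) \<in> borel_measurable (distr (Px x) (past s) (\<lambda>\<omega>. \<omega>))"
        using A by auto
    qed
    also have "\<dots> = (\<integral>\<^sup>+\<omega>. emeasure (distr (K r (X s \<omega>)) (past s \<Otimes>\<^sub>M borel) (Pair \<omega>)) (A \<times> B) \<partial>distr (Px x) (past s) (\<lambda>\<omega>. \<omega>))"
    proof (rule nn_integral_cong)
      fix \<omega> assume "\<omega> \<in> space (distr (Px x) (past s) (\<lambda>\<omega>. \<omega>))"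
      then have w: "\<omega> \<in> space (past s)" by simp
      have "Pair \<omega> \<in> K r (X s \<omega>) \<rightarrow>\<^sub>M past s \<Otimes>\<^sub>M borel" using w by (auto intro!: measurable_Pair1')
      then have "emeasure (distr (K r (X s \<omega>)) (past s \<Otimes>\<^sub>M borel) (Pair \<omega>)) (A \<times> B) = emeasure (K r (X s \<omega>)) (Pair \<omega> -` (A \<times> B) \<inter> space (K r (X s \<omega>)))"
        using AB by (rule emeasure_distr)
      also have "Pair \<omega> -` (A \<times> B) \<inter> space (K r (X s \<omega>)) = (if \<omega> \<in> A then B else {})" by auto
      finally show "indicator A \<omega> * emeasure (K r (X s \<omega>)) B = emeasure (distr (K r (X s \<omega>)) (past s \<Otimes>\<^sub>M borel) (Pair \<omega>)) (A \<times> B)"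
        by (simp add: indicator_def)
    qed
    also have "\<dots> = emeasure ?R Z"
      unfolding Z by (rule emeasure_bind_prob_algebra[symmetric, OF D k AB])
    finally show "emeasure ?L Z = emeasure ?R Z" .
  qed
qed

lemma markov_nn:
  assumes s: "0 \<le> s" and r: "0 \<le> r" and Y[measurable]: "Y \<in> borel_measurable (past s)" and v[measurable]: "v \<in> borel_measurable borel"
  shows "(\<integral>\<^sup>+\<omega>. Y \<omega> * v (X (s + r) \<omega>) \<partial>Px x) = (\<integral>\<^sup>+\<omega>. Y \<omega> * P r v (X s \<omega>) \<partial>Px x)"
proof -
  have id: "(\<lambda>\<omega>. \<omega>) \<in> Px x \<rightarrow>\<^sub>M past s" using measurable_id_past by (simp cong: measurable_cong_sets)
  have Xm: "X (s + r) \<in> Px x \<rightarrow>\<^sub>M borel" using s r by (auto intro: X_measurable_Px)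
  have pm: "(\<lambda>\<omega>. (\<omega>, X (s + r) \<omega>)) \<in> Px x \<rightarrow>\<^sub>M past s \<Otimes>\<^sub>M borel"
    using id Xm by (rule measurable_Pair)
  let ?H = "\<lambda>z. Y (fst z) * v (snd z)"
  have H: "?H \<in> borel_measurable (past s \<Otimes>\<^sub>M borel)" by measurable
  have k: "(\<lambda>\<omega>. distr (K r (X s \<omega>)) (past s \<Otimes>\<^sub>M borel) (Pair \<omega>)) \<in> distr (Px x) (past s) (\<lambda>\<omega>. \<omega>) \<rightarrow>\<^sub>M subprob_algebra (past s \<Otimes>\<^sub>M borel)"
    using measurable_prob_algebraD[OF past_kernel[OF s r]] by simp
  have "(\<integral>\<^sup>+\<omega>. Y \<omega> * v (X (s + r) \<omega>) \<partial>Px x) = (\<integral>\<^sup>+z. ?H z \<partial>distr (Px x) (past s \<Otimes>\<^sub>M borel) (\<lambda>\<omega>. (\<omega>, X (s + r) \<omega>)))"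
    by (subst nn_integral_distr[OF pm]) auto
  also have "\<dots> = (\<integral>\<^sup>+\<omega>. \<integral>\<^sup>+z. ?H z \<partial>distr (K r (X s \<omega>)) (past s \<Otimes>\<^sub>M borel) (Pair \<omega>) \<partial>distr (Px x) (past s) (\<lambda>\<omega>. \<omega>))"
    unfolding past_future_law[OF s r] by (rule nn_integral_bind[OF H k])
  also have "\<dots> = (\<integral>\<^sup>+\<omega>. Y \<omega> * P r v (X s \<omega>) \<partial>distr (Px x) (past s) (\<lambda>\<omega>. \<omega>))"
  proof (rule nn_integral_cong)
    fix \<omega> assume "\<omega> \<in> space (distr (Px x) (past s) (\<lambda>\<omega>. \<omega>))"
    then have "Pair \<omega> \<in> K r (X s \<omega>) \<rightarrow>\<^sub>M past s \<Otimes>\<^sub>M borel" by (auto intro!: measurable_Pair1')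
    then show "(\<integral>\<^sup>+z. ?H z \<partial>distr (K r (X s \<omega>)) (past s \<Otimes>\<^sub>M borel) (Pair \<omega>)) = Y \<omega> * P r v (X s \<omega>)"
      by (subst nn_integral_distr) (auto simp: nn_integral_cmult)
  qed
  also have "\<dots> = (\<integral>\<^sup>+\<omega>. Y \<omega> * P r v (X s \<omega>) \<partial>Px x)"
    by (rule nn_integral_distr[OF id])
       (use measurable_compose[OF X_measurable_past[OF s order.refl] P_measurable[OF r v]] in auto)
  finally show ?thesis .
qed

text \<open>Chapman--Kolmogorov, obtained from the Markov property with the constant past weight
  1.\<close>

lemma K_add: assumes s: "0 \<le> s" and r: "0 \<le> r" shows "K (s + r) x = K s x \<bind> K r"
proof (rule measure_eqI)
  have D: "K s x \<in> space (prob_algebra borel)" using prob_K[OF s] by (simp add: space_prob_algebra)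
  show "sets (K (s + r) x) = sets (K s x \<bind> K r)" using sets_bind'[OF D K_kernel[OF r]] by simp
  fix B assume "B \<in> sets (K (s + r) x)"
  then have B[measurable]: "B \<in> sets borel" by simp
  have "emeasure (K (s + r) x) B = (\<integral>\<^sup>+\<omega>. 1 * indicator B (X (s + r) \<omega>) \<partial>Px x)"
    using nn_integral_K[of "s + r" "indicator B" x] s r by simp
  also have "\<dots> = (\<integral>\<^sup>+\<omega>. P r (indicator B) (X s \<omega>) \<partial>Px x)"
    by (subst markov_nn[OF s r]) auto
  also have "\<dots> = (\<integral>\<^sup>+y. P r (indicator B) y \<partial>K s x)"
    by (rule nn_integral_K[symmetric, OF s P_measurable[OF r]]) simp
  also have "\<dots> = emeasure (K s x \<bind> K r) B"
    by (subst emeasure_bind_prob_algebra[OF D K_kernel[OF r] B]) (simp add: B)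
  finally show "emeasure (K (s + r) x) B = emeasure (K s x \<bind> K r) B" .
qed

subsection \<open>Reversibility\<close>

text \<open>Law of the pair (X_0, X_r) under the stationary start \<open>\<mu>\<close>. Bilinear
  expressions in the semigroup become integrals against \<open>J r\<close>, and reversibility
  becomes its symmetry.\<close>

definition J :: "real \<Rightarrow> ('a \<times> 'a) measure" where
  "J r = \<mu> \<bind> (\<lambda>x. distr (K r x) (borel \<Otimes>\<^sub>M borel) (Pair x))"

lemma J_kernel: "0 \<le> r \<Longrightarrow> (\<lambda>x. distr (K r x) (borel \<Otimes>\<^sub>M borel) (Pair x)) \<in> borel \<rightarrow>\<^sub>M prob_algebra (borel \<Otimes>\<^sub>M borel)"
  by (rule measurable_distr_prob_space2[where M=borel]) auto

lemma J_kernel_mu: "0 \<le> r \<Longrightarrow> (\<lambda>x. distr (K r x) (borel \<Otimes>\<^sub>M borel) (Pair x)) \<in> \<mu> \<rightarrow>\<^sub>M prob_algebra (borel \<Otimes>\<^sub>M borel)"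
  using J_kernel by (simp cong: measurable_cong_sets)

lemma mu_in: "\<mu> \<in> space (prob_algebra \<mu>)" using prob_mu by (simp add: space_prob_algebra)

lemma sets_J[measurable_cong]: "0 \<le> r \<Longrightarrow> sets (J r) = sets (borel \<Otimes>\<^sub>M borel)"
  unfolding J_def using mu_in J_kernel_mu by (rule sets_bind')

lemma prob_J: "0 \<le> r \<Longrightarrow> prob_space (J r)"
  unfolding J_def using mu_in J_kernel_mu by (rule prob_space_bind')

lemma nn_integral_J:
  assumes r: "0 \<le> r" and H[measurable]: "H \<in> borel_measurable (borel \<Otimes>\<^sub>M borel)"
  shows "(\<integral>\<^sup>+z. H z \<partial>J r) = (\<integral>\<^sup>+x. \<integral>\<^sup>+y. H (x, y) \<partial>K r x \<partial>\<mu>)"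
  unfolding J_def nn_integral_bind[OF H measurable_prob_algebraD[OF J_kernel_mu[OF r]]]
  by (intro nn_integral_cong nn_integral_distr) auto

text \<open>Reversibility, applied to two indicators, is symmetry on rectangles; these are stable
  under intersection and generate the product sigma-algebra.\<close>

lemma J_symmetric: assumes r: "0 \<le> r" shows "distr (J r) (borel \<Otimes>\<^sub>M borel) (\<lambda>z. (snd z, fst z)) = J r"
proof -
  interpret prob_space "J r" using r by (rule prob_J)
  interpret mu: prob_space \<mu> by (rule prob_mu)
  note [measurable_cong] = sets_J[OF r]
  have sw: "(\<lambda>z. (snd z, fst z)) \<in> J r \<rightarrow>\<^sub>M borel \<Otimes>\<^sub>M borel" by measurable
  have rect: "emeasure (J r) (A \<times> B) = ennreal (\<integral>x. indicator A x * Pt Px X r (indicator B) x \<partial>\<mu>)"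
    if [measurable]: "A \<in> sets borel" "B \<in> sets borel" for A B
  proof -
    have Pt: "Pt Px X r (indicator B) y = measure (K r y) B" for y
    proof -
      interpret y: prob_space "Px y" by (rule prob_Px)
      have "Pt Px X r (indicator B) y = (\<integral>\<omega>. indicator B \<omega> \<partial>K r y)"
        unfolding Pt_def K_def by (rule integral_distr[symmetric]) (auto intro: X_measurable_Px r)
      then show ?thesis by simp
    qed
    have [measurable]: "(\<lambda>y. measure (K r y) B) \<in> borel_measurable borel"
      using measurable_compose[OF K_kernel[OF r] measurable_measure_prob_algebra] by simp
    have le1: "measure (K r y) B \<le> 1" for y
      using prob_space.prob_le_1[OF prob_K[OF r]] by blast
    have "emeasure (J r) (A \<times> B) = (\<integral>\<^sup>+z. indicator (A \<times> B) z \<partial>J r)"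
      by (rule nn_integral_indicator[symmetric]) (simp add: sets_J[OF r])
    also have "\<dots> = (\<integral>\<^sup>+z. indicator A (fst z) * indicator B (snd z) \<partial>J r)"
      by (intro nn_integral_cong) (auto split: split_indicator)
    also have "\<dots> = (\<integral>\<^sup>+x. indicator A x * emeasure (K r x) B \<partial>\<mu>)"
      by (subst nn_integral_J[OF r]) (auto simp: nn_integral_cmult)
    also have "\<dots> = (\<integral>\<^sup>+x. ennreal (indicator A x * Pt Px X r (indicator B) x) \<partial>\<mu>)"
      by (intro nn_integral_cong) (simp add: Pt indicator_def finite_measure.emeasure_eq_measure[OF prob_space.finite_measure[OF prob_K[OF r]]])
    also have "\<dots> = ennreal (\<integral>x. indicator A x * Pt Px X r (indicator B) x \<partial>\<mu>)"
      unfolding Pt by (intro nn_integral_eq_integral mu.integrable_const_bound[where B=1] AE_I2) (auto simp: indicator_def le1)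
    finally show ?thesis .
  qed
  have b: "bounded (range (indicator B :: 'a \<Rightarrow> real))" for B by (auto simp: bounded_iff indicator_def intro!: exI[of _ 1])
  have sym: "emeasure (J r) (A \<times> B) = emeasure (J r) (B \<times> A)" if [measurable]: "A \<in> sets borel" "B \<in> sets borel" for A B
  proof -
    have "(\<integral>x. indicator A x * Pt Px X r (indicator B) x \<partial>\<mu>) = (\<integral>x. Pt Px X r (indicator A) x * indicator B x \<partial>\<mu>)"
      using reversible b[of A] b[of B] r that unfolding reversible_def by auto
    then show ?thesis by (simp add: rect mult.commute)
  qed
  show ?thesis
  proof (rule measure_eqI_generator_eq[OF Int_stable_pair_measure_generator[of borel borel]])
    show "{a \<times> b |a b. a \<in> sets borel \<and> b \<in> sets borel} \<subseteq> Pow (space borel \<times> space (borel::'a measure))"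
      by (rule pair_measure_closed)
    show "sets (distr (J r) (borel \<Otimes>\<^sub>M borel) (\<lambda>z. (snd z, fst z))) = sigma_sets (space borel \<times> space borel) {a \<times> b |a b. a \<in> sets borel \<and> b \<in> sets borel}"
      by (simp add: sets_pair_measure)
    show "sets (J r) = sigma_sets (space borel \<times> space borel) {a \<times> b |a b. a \<in> sets borel \<and> b \<in> sets borel}"
      unfolding sets_J[OF r] by (simp add: sets_pair_measure)
    show "range (\<lambda>_::nat. space borel \<times> space borel) \<subseteq> {a \<times> b |a b. a \<in> sets borel \<and> b \<in> sets (borel::'a measure)}"
      using sets.top[of "borel :: 'a measure"] by blast
    show "(\<Union>i::nat. space borel \<times> space borel) = space borel \<times> space (borel::'a measure)" by auto
    show "emeasure (distr (J r) (borel \<Otimes>\<^sub>M borel) (\<lambda>z. (snd z, fst z))) (space borel \<times> space borel) \<noteq> \<infinity>" for i :: nat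
      using prob_space.emeasure_le_1[OF prob_space_distr[OF sw]] by (metis ennreal_one_less_top infinity_ennreal_def leD)
    fix Z assume "Z \<in> {a \<times> b |a b. a \<in> sets (borel :: 'a measure) \<and> b \<in> sets (borel :: 'a measure)}"
    then obtain A B where Z: "Z = A \<times> B" and [measurable]: "A \<in> sets borel" "B \<in> sets borel" by blast
    have "emeasure (distr (J r) (borel \<Otimes>\<^sub>M borel) (\<lambda>z. (snd z, fst z))) Z = emeasure (J r) (B \<times> A)"
      unfolding Z using sets_eq_imp_space_eq[OF sets_J[OF r]]
      by (subst emeasure_distr[OF sw]) (auto intro!: arg_cong[where f="emeasure _"] simp: space_pair_measure)
    also have "\<dots> = emeasure (J r) Z" unfolding Z by (rule sym) auto
    finally show "emeasure (distr (J r) (borel \<Otimes>\<^sub>M borel) (\<lambda>z. (snd z, fst z))) Z = emeasure (J r) Z" .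
  qed
qed

lemma J_swap:
  assumes r: "0 \<le> r" and H[measurable]: "H \<in> borel_measurable (borel \<Otimes>\<^sub>M borel)"
  shows "(\<integral>\<^sup>+z. H (snd z, fst z) \<partial>J r) = (\<integral>\<^sup>+z. H z \<partial>J r)"
proof -
  note [measurable_cong] = sets_J[OF r]
  have "(\<integral>\<^sup>+z. H z \<partial>J r) = (\<integral>\<^sup>+z. H z \<partial>distr (J r) (borel \<Otimes>\<^sub>M borel) (\<lambda>z. (snd z, fst z)))"
    using J_symmetric[OF r] by simp
  also have "\<dots> = (\<integral>\<^sup>+z. H (snd z, fst z) \<partial>J r)" by (rule nn_integral_distr) measurable
  finally show ?thesis ..
qed

lemma P_symmetric:
  assumes r: "0 \<le> r" and [measurable]: "u \<in> borel_measurable borel" "v \<in> borel_measurable borel"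
  shows "(\<integral>\<^sup>+x. u x * P r v x \<partial>\<mu>) = (\<integral>\<^sup>+x. P r u x * v x \<partial>\<mu>)"
proof -
  have "(\<integral>\<^sup>+x. u x * P r v x \<partial>\<mu>) = (\<integral>\<^sup>+z. u (fst z) * v (snd z) \<partial>J r)"
    by (subst nn_integral_J[OF r]) (auto simp: nn_integral_cmult)
  also have "\<dots> = (\<integral>\<^sup>+z. u (snd z) * v (fst z) \<partial>J r)"
    using J_swap[OF r, of "\<lambda>z. u (snd z) * v (fst z)"] by simp
  also have "\<dots> = (\<integral>\<^sup>+x. P r u x * v x \<partial>\<mu>)"
    by (subst nn_integral_J[OF r]) (auto simp: nn_integral_multc)
  finally show ?thesis .
qed

lemma P_one: "0 \<le> r \<Longrightarrow> P r (\<lambda>_. c) x = c"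
  using prob_space.emeasure_space_1[OF prob_K[of r x]] by simp

lemma P_invariant:
  assumes "0 \<le> r" "u \<in> borel_measurable borel"
  shows "(\<integral>\<^sup>+x. P r u x \<partial>\<mu>) = (\<integral>\<^sup>+x. u x \<partial>\<mu>)"
  using P_symmetric[of r u "\<lambda>_. 1"] assms P_one[OF assms(1)] by simp

end

subsection \<open>Independent particles\<close>

context markov_setting
begin

text \<open>The Borel product, with extensional functions as points. \<open>M n\<close> and all
  particle kernels share its measurable sets, so measurability is stated over \<open>B n\<close>
  throughout.\<close>

definition B :: "nat \<Rightarrow> (nat \<Rightarrow> 'a) measure" where "B n = PiM {..<n} (\<lambda>_. borel)"
definition M :: "nat \<Rightarrow> (nat \<Rightarrow> 'a) measure" where "M n = PiM {..<n} (\<lambda>_. \<mu>)"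

abbreviation "meas n \<equiv> borel_measurable (B n)"

abbreviation sqnorm :: "nat \<Rightarrow> ((nat \<Rightarrow> 'a) \<Rightarrow> real) \<Rightarrow> ennreal" where
  "sqnorm n u \<equiv> \<integral>\<^sup>+x. ennreal ((u x)\<^sup>2) \<partial>M n"

lemma sets_M[measurable_cong, simp]: "sets (M n) = sets (B n)"
  unfolding M_def B_def by (intro sets_PiM_cong) auto

lemma space_B: "space (B n) = extensional {..<n}"
  by (auto simp: B_def space_PiM PiE_def)

lemma space_M[simp]: "space (M n) = space (B n)"
  by (rule sets_eq_imp_space_eq) simp

lemma prob_M: "prob_space (M n)" unfolding M_def by (rule prob_space_PiM) (rule prob_mu)

text \<open>Transition kernel of independent particles in which particle \<open>i\<close> runs for
  its own time \<open>\<tau> i\<close>. The individual clocks make it possible to interpolate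
  between moving all particles and moving one.\<close>

definition N :: "nat \<Rightarrow> (nat \<Rightarrow> real) \<Rightarrow> (nat \<Rightarrow> 'a) \<Rightarrow> (nat \<Rightarrow> 'a) measure" where
  "N n \<tau> x = PiM {..<n} (\<lambda>i. K (\<tau> i) (x i))"

abbreviation Nt :: "nat \<Rightarrow> real \<Rightarrow> (nat \<Rightarrow> 'a) \<Rightarrow> (nat \<Rightarrow> 'a) measure" where
  "Nt n r \<equiv> N n (\<lambda>_. r)"

lemma sets_N[measurable_cong, simp]: "sets (N n \<tau> x) = sets (B n)"
  unfolding N_def B_def by (intro sets_PiM_cong) auto

lemma space_N[simp]: "space (N n \<tau> x) = space (B n)"
  by (rule sets_eq_imp_space_eq) simp

lemma prob_N: "(\<And>i. 0 \<le> \<tau> i) \<Longrightarrow> prob_space (N n \<tau> x)"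
  unfolding N_def by (intro prob_space_PiM prob_K) auto

abbreviation PN :: "nat \<Rightarrow> (nat \<Rightarrow> real) \<Rightarrow> ((nat \<Rightarrow> 'a) \<Rightarrow> ennreal) \<Rightarrow> (nat \<Rightarrow> 'a) \<Rightarrow> ennreal" where
  "PN n \<tau> v x \<equiv> \<integral>\<^sup>+y. v y \<partial>N n \<tau> x"

abbreviation "PP n r \<equiv> PN n (\<lambda>_. r)"

lemma N_cong: "(\<And>i. i < n \<Longrightarrow> \<tau> i = \<sigma> i) \<Longrightarrow> (\<And>i. i < n \<Longrightarrow> x i = y i) \<Longrightarrow> N n \<tau> x = N n \<sigma> y"
  unfolding N_def by (intro PiM_cong) auto

lemma N_kernel:
  assumes "\<And>i. 0 \<le> \<tau> i"
  shows "N n \<tau> \<in> B n \<rightarrow>\<^sub>M prob_algebra (B n)"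
  unfolding N_def[abs_def] B_def
proof (rule measurable_PiM_kernel)
  fix i assume "i \<in> {..<n}"
  then show "(\<lambda>x. K (\<tau> i) (x i)) \<in> PiM {..<n} (\<lambda>_. borel) \<rightarrow>\<^sub>M prob_algebra borel"
    using measurable_PiM_coordinate[of i "{..<n}" "K (\<tau> i)" "\<lambda>_. borel"] K_kernel[OF assms] by auto
qed simp

lemma N_measurable:
  assumes "\<And>i. 0 \<le> \<tau> i" "v \<in> meas n"
  shows "PN n \<tau> v \<in> meas n"
  using N_kernel[OF assms(1), of n]
  by (rule measurable_compose[OF measurable_prob_algebraD nn_integral_measurable_subprob_algebra[OF assms(2)]])

text \<open>Chapman--Kolmogorov for individual clocks: the one-particle equations are multiplied by
  \<open>PiM_bind\<close>.\<close>

lemma N_add: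
  assumes \<tau>: "\<And>i. 0 \<le> \<tau> i" and \<sigma>: "\<And>i. 0 \<le> \<sigma> i"
  shows "N n (\<lambda>i. \<tau> i + \<sigma> i) x = N n \<tau> x \<bind> N n \<sigma>"
proof -
  have "N n (\<lambda>i. \<tau> i + \<sigma> i) x = PiM {..<n} (\<lambda>i. K (\<tau> i) (x i) \<bind> K (\<sigma> i))"
    unfolding N_def by (intro PiM_cong refl K_add \<tau> \<sigma>)
  also have "\<dots> = PiM {..<n} (\<lambda>i. K (\<tau> i) (x i)) \<bind> (\<lambda>y. PiM {..<n} (\<lambda>i. K (\<sigma> i) (y i)))"
    by (rule PiM_bind[where L="\<lambda>_. borel"])
       (use K_kernel[OF \<sigma>] prob_K[OF \<tau>] in \<open>auto cong: measurable_cong_sets\<close>)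
  finally show ?thesis by (simp add: N_def[abs_def])
qed

lemma nn_integral_N_add:
  assumes \<tau>: "\<And>i. 0 \<le> \<tau> i" and \<sigma>: "\<And>i. 0 \<le> \<sigma> i" and v: "v \<in> meas n"
  shows "PN n (\<lambda>i. \<tau> i + \<sigma> i) v x = (\<integral>\<^sup>+y. PN n \<sigma> v y \<partial>N n \<tau> x)"
proof -
  have "N n \<sigma> \<in> N n \<tau> x \<rightarrow>\<^sub>M subprob_algebra (B n)"
    using measurable_prob_algebraD[OF N_kernel[OF \<sigma>]] by (simp cong: measurable_cong_sets)
  then show ?thesis unfolding N_add[OF \<tau> \<sigma>] using v by (intro nn_integral_bind)
qed

text \<open>The product of the stationary pair laws, unzipped into the vector of starts and the
  vector of ends, is the stationary two-time law of the particle system. The reason is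
  \<open>PiM_bind\<close>, applied to kernels that remember their starting point.\<close>

lemma nn_integral_prod_J:
  assumes \<tau>: "\<And>i. 0 \<le> \<tau> i" and H: "H \<in> borel_measurable (B n \<Otimes>\<^sub>M B n)"
  shows "(\<integral>\<^sup>+x. \<integral>\<^sup>+y. H (x, y) \<partial>N n \<tau> x \<partial>M n)
    = (\<integral>\<^sup>+z. H (\<lambda>i\<in>{..<n}. fst (z i), \<lambda>i\<in>{..<n}. snd (z i)) \<partial>PiM {..<n} (\<lambda>i. J (\<tau> i)))"
proof -
  let ?BB = "PiM {..<n} (\<lambda>_. borel \<Otimes>\<^sub>M borel :: ('a \<times> 'a) measure)"
  let ?k = "\<lambda>x. PiM {..<n} (\<lambda>i. distr (K (\<tau> i) (x i)) (borel \<Otimes>\<^sub>M borel) (Pair (x i)))"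
  have un: "(\<lambda>z. (\<lambda>i\<in>{..<n}. fst (z i), \<lambda>i\<in>{..<n}. snd (z i))) \<in> ?BB \<rightarrow>\<^sub>M B n \<Otimes>\<^sub>M B n"
    unfolding B_def by measurable
  have H': "(\<lambda>z. H (\<lambda>i\<in>{..<n}. fst (z i), \<lambda>i\<in>{..<n}. snd (z i))) \<in> borel_measurable ?BB"
    using un H by (rule measurable_compose)
  have eq: "PiM {..<n} (\<lambda>i. J (\<tau> i)) = M n \<bind> ?k"
    unfolding J_def M_def
    by (rule PiM_bind[where L="\<lambda>_. borel \<Otimes>\<^sub>M borel"]) (auto intro: prob_mu J_kernel_mu \<tau>)
  have k: "?k \<in> M n \<rightarrow>\<^sub>M subprob_algebra ?BB"
    unfolding M_def
  proof (rule measurable_prob_algebraD, rule measurable_PiM_kernel)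
    fix i assume "i \<in> {..<n}"
    then show "(\<lambda>x. distr (K (\<tau> i) (x i)) (borel \<Otimes>\<^sub>M borel) (Pair (x i))) \<in> PiM {..<n} (\<lambda>_. \<mu>) \<rightarrow>\<^sub>M prob_algebra (borel \<Otimes>\<^sub>M borel)"
      using measurable_PiM_coordinate[of i "{..<n}" "\<lambda>y. distr (K (\<tau> i) y) (borel \<Otimes>\<^sub>M borel) (Pair y)" "\<lambda>_. \<mu>", OF _ J_kernel_mu[OF \<tau>]] by auto
  qed simp
  have "(\<integral>\<^sup>+z. H (\<lambda>i\<in>{..<n}. fst (z i), \<lambda>i\<in>{..<n}. snd (z i)) \<partial>PiM {..<n} (\<lambda>i. J (\<tau> i)))
    = (\<integral>\<^sup>+x. \<integral>\<^sup>+z. H (\<lambda>i\<in>{..<n}. fst (z i), \<lambda>i\<in>{..<n}. snd (z i)) \<partial>?k x \<partial>M n)"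
    unfolding eq by (rule nn_integral_bind[OF H' k])
  also have "\<dots> = (\<integral>\<^sup>+x. \<integral>\<^sup>+y. H (x, y) \<partial>N n \<tau> x \<partial>M n)"
  proof (rule nn_integral_cong)
    fix x assume x: "x \<in> space (M n)"
    have kd: "?k x = distr (N n \<tau> x) ?BB (\<lambda>y. \<lambda>i\<in>{..<n}. (x i, y i))"
      unfolding N_def
      by (rule distr_PiM_componentwise[symmetric]) (auto intro: prob_K \<tau>)
    have pm: "(\<lambda>y. \<lambda>i\<in>{..<n}. (x i, y i)) \<in> N n \<tau> x \<rightarrow>\<^sub>M ?BB"
    proof -
      have "(\<lambda>y. \<lambda>i\<in>{..<n}. (x i, y i)) \<in> PiM {..<n} (\<lambda>_. borel) \<rightarrow>\<^sub>M ?BB" by measurable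
      then show ?thesis by (simp add: B_def cong: measurable_cong_sets)
    qed
    have "(\<integral>\<^sup>+z. H (\<lambda>i\<in>{..<n}. fst (z i), \<lambda>i\<in>{..<n}. snd (z i)) \<partial>?k x)
      = (\<integral>\<^sup>+y. H (\<lambda>i\<in>{..<n}. x i, \<lambda>i\<in>{..<n}. y i) \<partial>N n \<tau> x)"
      unfolding kd by (subst nn_integral_distr[OF pm]) (auto simp: H' cong: restrict_cong)
    also have "\<dots> = (\<integral>\<^sup>+y. H (x, y) \<partial>N n \<tau> x)"
      using x by (intro nn_integral_cong) (simp add: space_B extensional_restrict)
    finally show "(\<integral>\<^sup>+z. H (\<lambda>i\<in>{..<n}. fst (z i), \<lambda>i\<in>{..<n}. snd (z i)) \<partial>?k x) = (\<integral>\<^sup>+y. H (x, y) \<partial>N n \<tau> x)" .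
  qed
  finally show ?thesis ..
qed

text \<open>Coordinatewise exchange of start and end preserves every factor
  \<open>J (\<tau> i)\<close> and hence their product.\<close>

lemma N_swap:
  assumes \<tau>: "\<And>i. 0 \<le> \<tau> i" and H: "H \<in> borel_measurable (B n \<Otimes>\<^sub>M B n)"
  shows "(\<integral>\<^sup>+x. \<integral>\<^sup>+y. H (y, x) \<partial>N n \<tau> x \<partial>M n) = (\<integral>\<^sup>+x. \<integral>\<^sup>+y. H (x, y) \<partial>N n \<tau> x \<partial>M n)"
proof -
  let ?BB = "PiM {..<n} (\<lambda>_. borel \<Otimes>\<^sub>M borel :: ('a \<times> 'a) measure)"
  let ?JJ = "PiM {..<n} (\<lambda>i. J (\<tau> i))"
  have sJ: "sets ?JJ = sets ?BB" by (intro sets_PiM_cong) (auto simp: sets_J \<tau>)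
  have "(\<lambda>z. (snd z, fst z)) \<in> borel \<Otimes>\<^sub>M borel \<rightarrow>\<^sub>M (borel \<Otimes>\<^sub>M borel :: ('a \<times> 'a) measure)" by measurable
  then have sw1: "(\<lambda>z. (snd z, fst z)) \<in> J (\<tau> i) \<rightarrow>\<^sub>M borel \<Otimes>\<^sub>M borel" for i
    by (simp add: measurable_cong_sets[OF sets_J[OF \<tau>] refl])
  have "(\<lambda>z. \<lambda>i\<in>{..<n}. (snd (z i), fst (z i))) \<in> ?BB \<rightarrow>\<^sub>M ?BB" by measurable
  then have sw: "(\<lambda>z. \<lambda>i\<in>{..<n}. (snd (z i), fst (z i))) \<in> ?JJ \<rightarrow>\<^sub>M ?BB"
    by (simp add: measurable_cong_sets[OF sJ refl])
  have un: "(\<lambda>z. (\<lambda>i\<in>{..<n}. fst (z i), \<lambda>i\<in>{..<n}. snd (z i))) \<in> ?BB \<rightarrow>\<^sub>M B n \<Otimes>\<^sub>M B n"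
    unfolding B_def by measurable
  have H': "(\<lambda>z. H (\<lambda>i\<in>{..<n}. fst (z i), \<lambda>i\<in>{..<n}. snd (z i))) \<in> borel_measurable ?BB"
    using un H by (rule measurable_compose)
  have eq: "?JJ = distr ?JJ ?BB (\<lambda>z. \<lambda>i\<in>{..<n}. (snd (z i), fst (z i)))"
    by (subst distr_PiM_componentwise[where f="\<lambda>_ z. (snd z, fst z)" and L="\<lambda>_. borel \<Otimes>\<^sub>M borel"])
       (auto intro: prob_J \<tau> sw1 simp: J_symmetric[OF \<tau>])
  have H2: "(\<lambda>(x, y). H (y, x)) \<in> borel_measurable (B n \<Otimes>\<^sub>M B n)"
    using H by measurable
  have "(\<integral>\<^sup>+x. \<integral>\<^sup>+y. H (x, y) \<partial>N n \<tau> x \<partial>M n)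
    = (\<integral>\<^sup>+z. H (\<lambda>i\<in>{..<n}. fst (z i), \<lambda>i\<in>{..<n}. snd (z i)) \<partial>?JJ)"
    by (rule nn_integral_prod_J[OF \<tau> H])
  also have "\<dots> = (\<integral>\<^sup>+z. H (\<lambda>i\<in>{..<n}. snd (z i), \<lambda>i\<in>{..<n}. fst (z i)) \<partial>?JJ)"
    by (subst eq, subst nn_integral_distr[OF sw]) (auto simp: H' cong: restrict_cong)
  also have "\<dots> = (\<integral>\<^sup>+x. \<integral>\<^sup>+y. H (y, x) \<partial>N n \<tau> x \<partial>M n)"
    using nn_integral_prod_J[OF \<tau> H2] by simp
  finally show ?thesis ..
qed

lemma N_symmetric:
  assumes \<tau>: "\<And>i. 0 \<le> \<tau> i" and u: "u \<in> meas n" and v: "v \<in> meas n"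
  shows "(\<integral>\<^sup>+x. u x * PN n \<tau> v x \<partial>M n) = (\<integral>\<^sup>+x. PN n \<tau> u x * v x \<partial>M n)"
proof -
  have v': "v \<in> borel_measurable (N n \<tau> x)" and u': "u \<in> borel_measurable (N n \<tau> x)" for x
    using u v by (auto cong: measurable_cong_sets)
  have "(\<integral>\<^sup>+x. u x * PN n \<tau> v x \<partial>M n) = (\<integral>\<^sup>+x. \<integral>\<^sup>+y. (\<lambda>(x, y). u x * v y) (x, y) \<partial>N n \<tau> x \<partial>M n)"
    by (simp add: nn_integral_cmult[OF v'])
  also have "\<dots> = (\<integral>\<^sup>+x. \<integral>\<^sup>+y. (\<lambda>(x, y). u x * v y) (y, x) \<partial>N n \<tau> x \<partial>M n)"
    by (rule N_swap[symmetric, OF \<tau>]) (use u v in measurable)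
  also have "\<dots> = (\<integral>\<^sup>+x. PN n \<tau> u x * v x \<partial>M n)"
    by (simp add: nn_integral_multc[OF u'])
  finally show ?thesis .
qed

lemma N_invariant:
  assumes \<tau>: "\<And>i. 0 \<le> \<tau> i" and u: "u \<in> meas n"
  shows "(\<integral>\<^sup>+x. PN n \<tau> u x \<partial>M n) = (\<integral>\<^sup>+x. u x \<partial>M n)"
  using N_symmetric[OF \<tau> _ u, of "\<lambda>_. 1"] prob_space.emeasure_space_1[OF prob_N[OF \<tau>], of n]
  by simp

section \<open>Quadratic forms of particles with individual running times\<close>

definition phi :: "nat \<Rightarrow> ((nat \<Rightarrow> 'a) \<Rightarrow> ennreal) \<Rightarrow> (nat \<Rightarrow> real) \<Rightarrow> ennreal" where
  "phi n u \<tau> = (\<integral>\<^sup>+x. u x * PN n \<tau> u x \<partial>M n)"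

lemma phi_cong: "(\<And>i. i < n \<Longrightarrow> \<tau> i = \<sigma> i) \<Longrightarrow> phi n u \<tau> = phi n u \<sigma>"
  unfolding phi_def using N_cong[of n \<tau> \<sigma>] by (intro nn_integral_cong) auto

lemma phi_add:
  assumes \<tau>: "\<And>i. 0 \<le> \<tau> i" and \<sigma>: "\<And>i. 0 \<le> \<sigma> i" and u: "u \<in> meas n"
  shows "phi n u (\<lambda>i. \<tau> i + \<sigma> i) = (\<integral>\<^sup>+x. PN n \<tau> u x * PN n \<sigma> u x \<partial>M n)"
  unfolding phi_def nn_integral_N_add[OF \<tau> \<sigma> u]
  by (rule N_symmetric[OF \<tau> u N_measurable[OF \<sigma> u]])

lemma phi_double:
  assumes \<tau>: "\<And>i. 0 \<le> \<tau> i" and u: "u \<in> meas n"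
  shows "phi n u (\<lambda>i. 2 * \<tau> i) = (\<integral>\<^sup>+x. (PN n \<tau> u x)\<^sup>2 \<partial>M n)"
  unfolding mult_2 phi_add[OF \<tau> \<tau> u] power2_eq_square ..

text \<open>\<open>phi\<close> at a sum of time vectors is the inner product of two evolved
  functions, so 2ab \<le> a^2 + b^2 makes it midpoint convex in the time vector.\<close>

lemma phi_midpoint:
  assumes \<tau>: "\<And>i. 0 \<le> \<tau> i" and \<sigma>: "\<And>i. 0 \<le> \<sigma> i" and u: "u \<in> meas n"
  shows "2 * phi n u (\<lambda>i. \<tau> i + \<sigma> i) \<le> phi n u (\<lambda>i. 2 * \<tau> i) + phi n u (\<lambda>i. 2 * \<sigma> i)"
proof -
  have m[measurable]: "PN n \<tau> u \<in> meas n"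
    "PN n \<sigma> u \<in> meas n"
    by (intro N_measurable \<tau> \<sigma> u)+
  have "2 * phi n u (\<lambda>i. \<tau> i + \<sigma> i) = (\<integral>\<^sup>+x. 2 * PN n \<tau> u x * PN n \<sigma> u x \<partial>M n)"
    unfolding phi_add[OF \<tau> \<sigma> u] by (subst nn_integral_cmult[symmetric]) (auto simp: mult.assoc)
  also have "\<dots> \<le> (\<integral>\<^sup>+x. (PN n \<tau> u x)\<^sup>2 + (PN n \<sigma> u x)\<^sup>2 \<partial>M n)"
    by (intro nn_integral_mono sum_of_squares_ge_ennreal)
  also have "\<dots> = phi n u (\<lambda>i. 2 * \<tau> i) + phi n u (\<lambda>i. 2 * \<sigma> i)"
    unfolding phi_double[OF \<tau> u] phi_double[OF \<sigma> u] by (rule nn_integral_add) auto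
  finally show ?thesis .
qed

text \<open>Iterated midpoint convexity: Jensen's inequality for \<open>2 ^ k\<close> equal weights,
  by splitting the family of time vectors into two halves.\<close>

lemma phi_dyadic:
  fixes \<tau> :: "nat \<Rightarrow> nat \<Rightarrow> real"
  assumes \<tau>: "\<And>j i. 0 \<le> \<tau> j i" and u: "u \<in> meas n"
  shows "2 ^ k * phi n u (\<lambda>i. (\<Sum>j<2 ^ k. \<tau> j i) / 2 ^ k) \<le> (\<Sum>j<2 ^ k. phi n u (\<tau> j))"
  using \<tau>
proof (induction k arbitrary: \<tau>)
  case 0
  have "{..<1 :: nat} = {0}" by auto
  then show ?case by (simp del: One_nat_def)
next
  case (Suc k)
  let ?\<sigma> = "\<lambda>j. \<tau> (2 ^ k + j)"
  let ?a = "\<lambda>i. (\<Sum>j<2 ^ k. \<tau> j i) / 2 ^ k" and ?b = "\<lambda>i. (\<Sum>j<2 ^ k. ?\<sigma> j i) / 2 ^ k"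
  have split: "(\<Sum>j<2 ^ Suc k. f j) = (\<Sum>j<2 ^ k. f j) + (\<Sum>j<2 ^ k. f (2 ^ k + j))" for f :: "nat \<Rightarrow> 'z::comm_monoid_add"
  proof -
    have "(\<Sum>j<2 ^ Suc k. f j) = (\<Sum>j\<in>{0..<2 ^ k}. f j) + (\<Sum>j\<in>{2 ^ k..<2 ^ k + 2 ^ k}. f j)"
      by (simp add: atLeast0LessThan[symmetric] mult_2 sum.atLeastLessThan_concat)
    also have "(\<Sum>j\<in>{2 ^ k..<2 ^ k + 2 ^ k}. f j) = (\<Sum>j\<in>{0..<2 ^ k}. f (2 ^ k + j))"
      using sum.shift_bounds_nat_ivl[of f 0 "2 ^ k" "2 ^ k"] by (simp add: add.commute)
    finally show ?thesis by (simp add: atLeast0LessThan)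
  qed
  have eq: "(\<lambda>i. (\<Sum>j<2 ^ Suc k. \<tau> j i) / 2 ^ Suc k) = (\<lambda>i. ?a i / 2 + ?b i / 2)"
    unfolding split by (auto simp: add_divide_distrib)
  have nn: "0 \<le> ?a i / 2" "0 \<le> ?b i / 2" for i
    by (auto intro!: divide_nonneg_nonneg sum_nonneg Suc.prems)
  have "2 ^ Suc k * phi n u (\<lambda>i. (\<Sum>j<2 ^ Suc k. \<tau> j i) / 2 ^ Suc k) = 2 ^ k * (2 * phi n u (\<lambda>i. ?a i / 2 + ?b i / 2))"
    unfolding eq by (simp add: mult.assoc mult.left_commute)
  also have "\<dots> \<le> 2 ^ k * (phi n u ?a + phi n u ?b)"
    using phi_midpoint[of "\<lambda>i. ?a i / 2" "\<lambda>i. ?b i / 2", OF nn u] by (intro mult_left_mono) auto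
  also have "\<dots> = 2 ^ k * phi n u ?a + 2 ^ k * phi n u ?b" by (simp add: distrib_left)
  also have "\<dots> \<le> (\<Sum>j<2 ^ k. phi n u (\<tau> j)) + (\<Sum>j<2 ^ k. phi n u (?\<sigma> j))"
    by (intro add_mono Suc.IH Suc.prems)
  also have "\<dots> = (\<Sum>j<2 ^ Suc k. phi n u (\<tau> j))" by (rule split[symmetric])
  finally show ?case .
qed

definition single :: "nat \<Rightarrow> real \<Rightarrow> nat \<Rightarrow> real" where "single i s = (\<lambda>j. if j = i then s else 0)"

text \<open>Commuting positive contractions satisfy the arithmetic--geometric mean inequality
  \<open>A\<^sub>1 \<cdots> A\<^sub>N \<le> (1/N) \<Sum> A\<^sub>i\<^sup>N\<close>; this compares moving all particles for a short time \<open>h\<close>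
  with moving one particle for the longer time \<open>2\<^sup>k h\<close>.\<close>

lemma phi_all_le_singles:
  assumes h: "0 \<le> h" and n: "n \<le> 2 ^ k" and u: "u \<in> meas n"
  shows "2 ^ k * phi n u (\<lambda>_. h) \<le> (\<Sum>i<n. phi n u (single i (2 ^ k * h))) + of_nat (2 ^ k - n) * phi n u (\<lambda>_. 0)"
proof -
  \<comment> \<open>Vector \<open>j\<close> runs only particle \<open>j\<close>, for the whole time.
    Averaging gives \<open>h\<close> in each coordinate below \<open>n\<close>; the padding indices
    from \<open>n\<close> on move no particle and account for the terms at time 0.\<close>
  let ?\<tau> = "\<lambda>j. single j (2 ^ k * h)"
  have nn: "0 \<le> ?\<tau> j i" for i j using h by (simp add: single_def)
  have "phi n u (\<lambda>_. h) = phi n u (\<lambda>i. (\<Sum>j<2 ^ k. ?\<tau> j i) / 2 ^ k)"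
  proof (rule phi_cong)
    fix i assume "i < n"
    then have "i < 2 ^ k" using n by linarith
    then have "(\<Sum>j<2 ^ k. ?\<tau> j i) = 2 ^ k * h" by (simp add: single_def)
    then show "h = (\<Sum>j<2 ^ k. ?\<tau> j i) / 2 ^ k" by simp
  qed
  then have "2 ^ k * phi n u (\<lambda>_. h) \<le> (\<Sum>j<2 ^ k. phi n u (?\<tau> j))"
    using phi_dyadic[of ?\<tau>, OF nn u] by simp
  also have "\<dots> = (\<Sum>j<n. phi n u (?\<tau> j)) + (\<Sum>j\<in>{n..<2 ^ k}. phi n u (?\<tau> j))"
    using n by (subst sum.union_disjoint[symmetric]) (auto intro!: sum.cong)
  also have "(\<Sum>j\<in>{n..<2 ^ k}. phi n u (?\<tau> j)) = (\<Sum>j\<in>{n..<2 ^ k}. phi n u (\<lambda>_. 0))"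
    by (intro sum.cong refl phi_cong) (auto simp: single_def)
  finally show ?thesis by (simp add: mult.commute)
qed

lemma N_0: "x \<in> space (B n) \<Longrightarrow> Nt n 0 x = return (B n) x"
  unfolding N_def B_def K_0 by (subst PiM_return) (auto simp: space_PiM)

lemma phi_0: "u \<in> meas n \<Longrightarrow> phi n u (\<lambda>_. 0) = (\<integral>\<^sup>+x. (u x)\<^sup>2 \<partial>M n)"
  unfolding phi_def by (intro nn_integral_cong) (simp add: N_0 nn_integral_return power2_eq_square)

lemma N_single:
  assumes x: "x \<in> space (B n)" and i: "i < n" and s: "0 \<le> s"
  shows "N n (single i s) x = distr (K s (x i)) (B n) (\<lambda>y. x(i := y))"
proof -
  have "N n (single i s) x = PiM {..<n} (\<lambda>j. if j = i then K s (x i) else return borel (x j))"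
    unfolding N_def by (intro PiM_cong refl) (auto simp: single_def K_0)
  also have "\<dots> = distr (K s (x i)) (B n) (\<lambda>y. x(i := y))"
    unfolding B_def by (rule PiM_update_return) (use x i in \<open>auto simp: B_def prob_K s\<close>)
  finally show ?thesis .
qed

lemma update_measurable: "i < n \<Longrightarrow> (\<lambda>z. (fst z)(i := snd z)) \<in> B n \<Otimes>\<^sub>M borel \<rightarrow>\<^sub>M B n"
  unfolding B_def using measurable_update_pair[of i "{..<n}" "\<lambda>_. borel"] by (simp add: case_prod_beta')

lemma update_measurable1:
  assumes "i < n" "x \<in> space (B n)"
  shows "(\<lambda>y. x(i := y)) \<in> borel \<rightarrow>\<^sub>M B n"
  using measurable_compose[OF measurable_Pair1'[OF assms(2)] update_measurable[OF assms(1)]] by simp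

lemma nn_integral_N_single:
  assumes x: "x \<in> space (B n)" and i: "i < n" and s: "0 \<le> s" and v: "v \<in> meas n"
  shows "PN n (single i s) v x = (\<integral>\<^sup>+y. v (x(i := y)) \<partial>K s (x i))"
  unfolding N_single[OF x i s]
  by (rule nn_integral_distr) (use update_measurable1[OF i x] v in \<open>auto cong: measurable_cong_sets\<close>)

lemma nn_integral_resample:
  assumes i: "i < n" and H: "H \<in> meas n"
  shows "(\<integral>\<^sup>+x. H x \<partial>M n) = (\<integral>\<^sup>+x. \<integral>\<^sup>+z. H (x(i := z)) \<partial>\<mu> \<partial>M n)"
proof -
  interpret m: prob_space \<mu> by (rule prob_mu)
  have "M n = distr (M n \<Otimes>\<^sub>M \<mu>) (M n) (\<lambda>(x, z). x(i := z))"
    unfolding M_def using i prob_mu by (subst distr_PiM_resample) auto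
  then have "(\<integral>\<^sup>+x. H x \<partial>M n) = (\<integral>\<^sup>+x. H x \<partial>distr (M n \<Otimes>\<^sub>M \<mu>) (M n) (\<lambda>(x, z). x(i := z)))" by simp
  also have "\<dots> = (\<integral>\<^sup>+p. H ((fst p)(i := snd p)) \<partial>(M n \<Otimes>\<^sub>M \<mu>))"
    using update_measurable[OF i] H
    by (subst nn_integral_distr) (auto simp: case_prod_beta' cong: measurable_cong_sets sets_pair_measure_cong)
  also have "\<dots> = (\<integral>\<^sup>+x. \<integral>\<^sup>+z. H (x(i := z)) \<partial>\<mu> \<partial>M n)"
    using measurable_compose[OF update_measurable[OF i] H]
    by (subst m.nn_integral_fst[symmetric]) (auto cong: measurable_cong_sets sets_pair_measure_cong)
  finally show ?thesis .
qed

subsection \<open>The Markov property of independent copies\<close>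

abbreviation paths :: "nat \<Rightarrow> (nat \<Rightarrow> 'w) measure" where "paths n \<equiv> PiM {..<n} (\<lambda>_. \<Omega>)"
abbreviation pasts :: "nat \<Rightarrow> real \<Rightarrow> (nat \<Rightarrow> 'w) measure" where "pasts n s \<equiv> PiM {..<n} (\<lambda>_. past s)"

definition Pn :: "nat \<Rightarrow> (nat \<Rightarrow> 'a) \<Rightarrow> (nat \<Rightarrow> 'w) measure" where
  "Pn n x = PiM {..<n} (\<lambda>i. Px (x i))"

definition Xn :: "nat \<Rightarrow> real \<Rightarrow> (nat \<Rightarrow> 'w) \<Rightarrow> nat \<Rightarrow> 'a" where
  "Xn n s \<omega> = (\<lambda>i\<in>{..<n}. X s (\<omega> i))"

lemma sets_Pn[measurable_cong, simp]: "sets (Pn n x) = sets (paths n)"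
  unfolding Pn_def by (intro sets_PiM_cong) auto

lemma space_Pn[simp]: "space (Pn n x) = space (paths n)"
  by (rule sets_eq_imp_space_eq) simp

lemma prob_Pn: "prob_space (Pn n x)"
  unfolding Pn_def by (intro prob_space_PiM prob_Px)

lemma Xn_measurable_past:
  assumes "0 \<le> r" "r \<le> s" shows "Xn n r \<in> pasts n s \<rightarrow>\<^sub>M B n"
  unfolding Xn_def[abs_def] B_def
proof (rule measurable_restrict)
  fix i assume "i \<in> {..<n}"
  then show "(\<lambda>\<omega>. X r (\<omega> i)) \<in> pasts n s \<rightarrow>\<^sub>M borel"
    using measurable_PiM_coordinate[of i "{..<n}" "X r" "\<lambda>_. past s"] X_measurable_past[OF assms] by auto
qed

lemma Xn_measurable:
  assumes "0 \<le> r" shows "Xn n r \<in> paths n \<rightarrow>\<^sub>M B n"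
  unfolding Xn_def[abs_def] B_def
proof (rule measurable_restrict)
  fix i assume "i \<in> {..<n}"
  then show "(\<lambda>\<omega>. X r (\<omega> i)) \<in> paths n \<rightarrow>\<^sub>M borel"
    using measurable_PiM_coordinate[of i "{..<n}" "X r" "\<lambda>_. \<Omega>"] X_measurable[OF assms] by auto
qed

lemma nn_integral_Pn:
  assumes r: "0 \<le> r" and v: "v \<in> meas n"
  shows "(\<integral>\<^sup>+\<omega>. v (Xn n r \<omega>) \<partial>Pn n x) = PP n r v x"
proof -
  have "Nt n r x = distr (Pn n x) (B n) (Xn n r)"
    unfolding N_def K_def Pn_def B_def Xn_def[abs_def]
    by (rule distr_PiM_componentwise[symmetric]) (auto intro: prob_Px X_measurable_Px r)
  then show ?thesis using Xn_measurable[OF r] v by (simp, subst nn_integral_distr) (auto cong: measurable_cong_sets)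
qed

text \<open>\<open>past_future_law\<close> disintegrates each particle over its own past, and
  \<open>PiM_bind\<close> multiplies these disintegrations. The weight \<open>Y\<close> ranges over
  functionals of the joint past, that is, of the product of the individual pasts.\<close>

lemma markov_Pn:
  assumes s: "0 \<le> s" and r: "0 \<le> r" and Y: "Y \<in> borel_measurable (pasts n s)"
    and v: "v \<in> meas n"
  shows "(\<integral>\<^sup>+\<omega>. Y \<omega> * v (Xn n (s + r) \<omega>) \<partial>Pn n x) = (\<integral>\<^sup>+\<omega>. Y \<omega> * PP n r v (Xn n s \<omega>) \<partial>Pn n x)"
proof -
  let ?G = "pasts n s"
  let ?GB = "PiM {..<n} (\<lambda>_. past s \<Otimes>\<^sub>M borel)"
  let ?k = "\<lambda>\<omega>. distr (K r (X s \<omega>)) (past s \<Otimes>\<^sub>M borel) (Pair \<omega>)"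
  let ?D = "\<lambda>i. distr (Px (x i)) (past s) (\<lambda>\<omega>. \<omega>)"
  have id: "(\<lambda>\<omega>. \<omega>) \<in> Px x \<rightarrow>\<^sub>M past s" for x using measurable_id_past by (simp cong: measurable_cong_sets)
  have Xm: "X (s + r) \<in> Px x \<rightarrow>\<^sub>M borel" for x using s r by (auto intro: X_measurable_Px)
  have pm: "(\<lambda>\<omega>. (\<omega>, X (s + r) \<omega>)) \<in> Px x \<rightarrow>\<^sub>M past s \<Otimes>\<^sub>M borel" for x
    using id Xm by (rule measurable_Pair)
  \<comment> \<open>A point of \<open>?GB\<close> pairs, for each particle, its past path with its
    future position; \<open>?H\<close> reads the two components separately.\<close>
  let ?H = "\<lambda>z. Y (\<lambda>i\<in>{..<n}. fst (z i)) * v (\<lambda>i\<in>{..<n}. snd (z i))"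
  have 1: "(\<lambda>z. \<lambda>i\<in>{..<n}. fst (z i)) \<in> ?GB \<rightarrow>\<^sub>M ?G" by measurable
  have 2: "(\<lambda>z. \<lambda>i\<in>{..<n}. snd (z i)) \<in> ?GB \<rightarrow>\<^sub>M B n" unfolding B_def by measurable
  have H: "?H \<in> borel_measurable ?GB"
    by (intro borel_measurable_times_ennreal measurable_compose[OF 1 Y] measurable_compose[OF 2 v])
  have Gd: "PiM {..<n} ?D = distr (Pn n x) ?G (\<lambda>\<omega>. \<lambda>i\<in>{..<n}. \<omega> i)"
    unfolding Pn_def by (rule distr_PiM_componentwise[symmetric]) (auto intro: prob_Px id)
  have rid: "(\<lambda>\<omega>. \<lambda>i\<in>{..<n}. \<omega> i) \<in> Pn n x \<rightarrow>\<^sub>M ?G"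
  proof -
    have "(\<lambda>\<omega>. \<lambda>i\<in>{..<n}. \<omega> i) \<in> paths n \<rightarrow>\<^sub>M ?G"
    proof (rule measurable_restrict)
      fix i assume "i \<in> {..<n}"
      then show "(\<lambda>\<omega>. \<omega> i) \<in> paths n \<rightarrow>\<^sub>M past s"
        using measurable_PiM_coordinate[of i "{..<n}" "\<lambda>\<omega>. \<omega>" "\<lambda>_. \<Omega>"] measurable_id_past by auto
    qed
    then show ?thesis by (simp cong: measurable_cong_sets)
  qed
  have ext: "(\<lambda>i\<in>{..<n}. \<omega> i) = \<omega>" if "\<omega> \<in> space (Pn n x)" for \<omega>
    using that by (auto simp: space_PiM PiE_iff extensional_restrict)
  have L: "distr (Pn n x) ?GB (\<lambda>\<omega>. \<lambda>i\<in>{..<n}. (\<omega> i, X (s + r) (\<omega> i)))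
    = PiM {..<n} ?D \<bind> (\<lambda>\<omega>. PiM {..<n} (\<lambda>i. ?k (\<omega> i)))"
  proof -
    have "distr (Pn n x) ?GB (\<lambda>\<omega>. \<lambda>i\<in>{..<n}. (\<omega> i, X (s + r) (\<omega> i)))
      = PiM {..<n} (\<lambda>i. distr (Px (x i)) (past s \<Otimes>\<^sub>M borel) (\<lambda>\<omega>. (\<omega>, X (s + r) \<omega>)))"
      unfolding Pn_def by (rule distr_PiM_componentwise) (auto intro: prob_Px pm)
    also have "\<dots> = PiM {..<n} (\<lambda>i. ?D i \<bind> ?k)"
      unfolding past_future_law[OF s r] ..
    also have "\<dots> = PiM {..<n} ?D \<bind> (\<lambda>\<omega>. PiM {..<n} (\<lambda>i. ?k (\<omega> i)))"
      by (rule PiM_bind[where L="\<lambda>_. past s \<Otimes>\<^sub>M borel"])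
         (use past_kernel[OF s r] in \<open>auto intro: prob_space.prob_space_distr[OF prob_Px id]\<close>)
    finally show ?thesis .
  qed
  have k: "(\<lambda>\<omega>. PiM {..<n} (\<lambda>i. ?k (\<omega> i))) \<in> PiM {..<n} ?D \<rightarrow>\<^sub>M subprob_algebra ?GB"
  proof (rule measurable_prob_algebraD, rule measurable_PiM_kernel)
    fix i assume "i \<in> {..<n}"
    then show "(\<lambda>\<omega>. ?k (\<omega> i)) \<in> PiM {..<n} ?D \<rightarrow>\<^sub>M prob_algebra (past s \<Otimes>\<^sub>M borel)"
      using measurable_PiM_coordinate[of i "{..<n}" ?k ?D] past_kernel[OF s r] by auto
  qed simp
  have pm': "(\<lambda>\<omega>. \<lambda>i\<in>{..<n}. (\<omega> i, X (s + r) (\<omega> i))) \<in> Pn n x \<rightarrow>\<^sub>M ?GB"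
    unfolding Pn_def
  proof (rule measurable_restrict)
    fix i assume "i \<in> {..<n}"
    then show "(\<lambda>\<omega>. (\<omega> i, X (s + r) (\<omega> i))) \<in> PiM {..<n} (\<lambda>i. Px (x i)) \<rightarrow>\<^sub>M past s \<Otimes>\<^sub>M borel"
      using measurable_PiM_coordinate[of i "{..<n}" "\<lambda>\<omega>. (\<omega>, X (s + r) \<omega>)" "\<lambda>i. Px (x i)"] pm by auto
  qed
  have "(\<integral>\<^sup>+\<omega>. Y \<omega> * v (Xn n (s + r) \<omega>) \<partial>Pn n x) = (\<integral>\<^sup>+\<omega>. ?H (\<lambda>i\<in>{..<n}. (\<omega> i, X (s + r) (\<omega> i))) \<partial>Pn n x)"
    by (intro nn_integral_cong) (simp add: Xn_def ext[simplified] cong: restrict_cong)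
  also have "\<dots> = (\<integral>\<^sup>+z. ?H z \<partial>distr (Pn n x) ?GB (\<lambda>\<omega>. \<lambda>i\<in>{..<n}. (\<omega> i, X (s + r) (\<omega> i))))"
    by (rule nn_integral_distr[symmetric, OF pm']) (simp add: H)
  also have "\<dots> = (\<integral>\<^sup>+\<omega>. \<integral>\<^sup>+z. ?H z \<partial>PiM {..<n} (\<lambda>i. ?k (\<omega> i)) \<partial>PiM {..<n} ?D)"
    unfolding L by (rule nn_integral_bind[OF H k])
  also have "\<dots> = (\<integral>\<^sup>+\<omega>. Y \<omega> * PP n r v (Xn n s \<omega>) \<partial>PiM {..<n} ?D)"
  proof (rule nn_integral_cong)
    fix \<omega> assume "\<omega> \<in> space (PiM {..<n} ?D)"
    then have w0: "\<omega> \<in> (\<Pi>\<^sub>E i\<in>{..<n}. space \<Omega>)" by (simp add: space_PiM)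
    then have w: "\<omega> i \<in> space (past s)" if "i < n" for i
      using that by (auto simp: PiE_iff)
    have we: "(\<lambda>i\<in>{..<n}. \<omega> i) = \<omega>"
      using w0 by (auto simp: PiE_iff extensional_restrict)
    have pw: "Pair (\<omega> i) \<in> K r (X s (\<omega> i)) \<rightarrow>\<^sub>M past s \<Otimes>\<^sub>M borel" if "i < n" for i
      using w[OF that] by (auto intro!: measurable_Pair1' cong: measurable_cong_sets)
    have kd: "PiM {..<n} (\<lambda>i. ?k (\<omega> i)) = distr (Nt n r (Xn n s \<omega>)) ?GB (\<lambda>y. \<lambda>i\<in>{..<n}. (\<omega> i, y i))"
    proof -
      have "Nt n r (Xn n s \<omega>) = PiM {..<n} (\<lambda>i. K r (X s (\<omega> i)))"
        unfolding N_def by (intro PiM_cong) (auto simp: Xn_def)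
      then show ?thesis
        by (simp, intro distr_PiM_componentwise[symmetric]) (auto intro: prob_K r pw)
    qed
    have pwm: "(\<lambda>y. \<lambda>i\<in>{..<n}. (\<omega> i, y i)) \<in> Nt n r (Xn n s \<omega>) \<rightarrow>\<^sub>M ?GB"
    proof -
      have "(\<lambda>y. \<lambda>i\<in>{..<n}. (\<omega> i, y i)) \<in> PiM {..<n} (\<lambda>_. borel) \<rightarrow>\<^sub>M ?GB"
        using w by (intro measurable_restrict measurable_Pair) auto
      then show ?thesis by (simp add: B_def cong: measurable_cong_sets)
    qed
    have v': "v \<in> borel_measurable (Nt n r (Xn n s \<omega>))" using v by (simp cong: measurable_cong_sets)
    have "(\<integral>\<^sup>+z. ?H z \<partial>PiM {..<n} (\<lambda>i. ?k (\<omega> i)))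
      = (\<integral>\<^sup>+y. ?H (\<lambda>i\<in>{..<n}. (\<omega> i, y i)) \<partial>Nt n r (Xn n s \<omega>))"
      unfolding kd by (rule nn_integral_distr[OF pwm]) (simp add: H)
    also have "\<dots> = (\<integral>\<^sup>+y. Y \<omega> * v y \<partial>Nt n r (Xn n s \<omega>))"
      by (intro nn_integral_cong) (simp add: we space_B extensional_restrict cong: restrict_cong)
    also have "\<dots> = Y \<omega> * PP n r v (Xn n s \<omega>)"
      by (rule nn_integral_cmult[OF v'])
    finally show "(\<integral>\<^sup>+z. ?H z \<partial>PiM {..<n} (\<lambda>i. ?k (\<omega> i))) = Y \<omega> * PP n r v (Xn n s \<omega>)" .
  qed
  also have "\<dots> = (\<integral>\<^sup>+\<omega>. Y \<omega> * PP n r v (Xn n s \<omega>) \<partial>Pn n x)"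
  proof -
    have "(\<lambda>\<omega>. PP n r v (Xn n s \<omega>)) \<in> borel_measurable ?G"
      by (rule measurable_compose[OF Xn_measurable_past[OF s order.refl] N_measurable[OF r v]])
    then have m: "(\<lambda>\<omega>. Y \<omega> * PP n r v (Xn n s \<omega>)) \<in> borel_measurable ?G"
      using Y by (intro borel_measurable_times_ennreal)
    have "(\<integral>\<^sup>+\<omega>. Y \<omega> * PP n r v (Xn n s \<omega>) \<partial>PiM {..<n} ?D)
      = (\<integral>\<^sup>+\<omega>. Y (\<lambda>i\<in>{..<n}. \<omega> i) * PP n r v (Xn n s (\<lambda>i\<in>{..<n}. \<omega> i)) \<partial>Pn n x)"
      unfolding Gd by (rule nn_integral_distr[OF rid]) (simp add: m)
    also have "\<dots> = (\<integral>\<^sup>+\<omega>. Y \<omega> * PP n r v (Xn n s \<omega>) \<partial>Pn n x)"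
      by (intro nn_integral_cong) (simp only: ext)
    finally show ?thesis .
  qed
  finally show ?thesis .
qed

end

subsection \<open>Discretization of the Feynman--Kac functional\<close>

abbreviation unif :: "real \<Rightarrow> real measure" where "unif h \<equiv> uniform_measure lborel {0..<h}"

lemma prob_space_uniform_Ico: "0 < (h::real) \<Longrightarrow> prob_space (unif h)"
  by (rule prob_space_uniform_measure) auto

lemma AE_uniform_Ico: "AE r in unif h. 0 \<le> r \<and> r < h"
  by (rule AE_uniform_measureI) auto

lemma integral_indicator_shift:
  fixes \<psi> :: "real \<Rightarrow> real"
  assumes \<psi>[measurable]: "\<psi> \<in> borel_measurable borel" and b: "\<And>r. \<bar>\<psi> r\<bar> \<le> b" and a: "0 \<le> a" and s: "0 \<le> s"
  shows "(\<integral>r. indicator {0..<a + s} r * \<psi> r \<partial>lborel)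
    = (\<integral>r. indicator {0..<a} r * \<psi> r \<partial>lborel) + (\<integral>r. indicator {0..<s} r * \<psi> (a + r) \<partial>lborel)"
proof -
  have int: "integrable lborel (\<lambda>s. indicator {c..<d} s * \<psi> s)" for c d
  proof (rule Bochner_Integration.integrable_bound)
    show "integrable lborel (\<lambda>s. b * indicator {c..<d} s)" by (cases "c \<le> d") auto
    have "0 \<le> b" using b[of 0] by linarith
    then show "AE s in lborel. norm (indicator {c..<d} s * \<psi> s) \<le> norm (b * indicator {c..<d} s)"
      using b by (auto split: split_indicator)
  qed simp
  have "(\<integral>r. indicator {0..<a + s} r * \<psi> r \<partial>lborel)
    = (\<integral>r. indicator {0..<a} r * \<psi> r + indicator {a..<a + s} r * \<psi> r \<partial>lborel)"
    using a s by (intro Bochner_Integration.integral_cong refl) (auto split: split_indicator)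
  also have "\<dots> = (\<integral>r. indicator {0..<a} r * \<psi> r \<partial>lborel) + (\<integral>r. indicator {a..<a + s} r * \<psi> r \<partial>lborel)"
    by (rule Bochner_Integration.integral_add[OF int int])
  also have "(\<integral>r. indicator {a..<a + s} r * \<psi> r \<partial>lborel)
    = (\<integral>r. indicator {a..<a + s} (a + 1 * r) * \<psi> (a + 1 * r) \<partial>lborel)"
    by (subst lborel_integral_real_affine[where c=1 and t=a]) auto
  also have "\<dots> = (\<integral>r. indicator {0..<s} r * \<psi> (a + r) \<partial>lborel)"
    by (intro Bochner_Integration.integral_cong refl) (auto split: split_indicator simp: algebra_simps)
  finally show ?thesis .
qed

text \<open>All blocks are referred to one common offset \<open>r\<close> in \<open>[0, h)\<close>.
  This is what turns a time integral into an average over shifted grids.\<close>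

lemma integral_time_split:
  fixes \<psi> :: "real \<Rightarrow> real"
  assumes \<psi>[measurable]: "\<psi> \<in> borel_measurable borel" and b: "\<And>s. \<bar>\<psi> s\<bar> \<le> b" and h: "0 < h"
  shows "(\<integral>s. indicator {0..<real m * h} s * \<psi> s \<partial>lborel) = (\<Sum>k<m. \<integral>r. indicator {0..<h} r * \<psi> (real k * h + r) \<partial>lborel)"
proof (induction m)
  case (Suc m)
  have t: "real (Suc m) * h = real m * h + h" by (simp add: algebra_simps)
  show ?case unfolding t using integral_indicator_shift[OF \<psi> b, of "real m * h" h] h Suc by simp
qed simp

lemma integral_uniform_Ico:
  fixes Y :: "real \<Rightarrow> real"
  assumes [measurable]: "Y \<in> borel_measurable borel" and h: "0 < h"
  shows "(\<integral>r. Y r \<partial>unif h) = (\<integral>r. indicator {0..<h} r * Y r \<partial>lborel) / h"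
proof -
  have "unif h = density lborel (\<lambda>r. ennreal (indicator {0..<h} r / h))"
    using h unfolding uniform_measure_def
    by (intro density_cong) (auto simp: divide_ennreal ennreal_indicator[symmetric] simp del: ennreal_indicator)
  then have "(\<integral>r. Y r \<partial>unif h) = (\<integral>r. (indicator {0..<h} r / h) * Y r \<partial>lborel)"
    using h by (simp add: integral_density)
  then show ?thesis by simp
qed

lemma (in prob_space) abs_integral_le_const:
  fixes f :: "'a \<Rightarrow> real"
  assumes f: "integrable M f" and b: "\<And>x. \<bar>f x\<bar> \<le> c"
  shows "\<bar>\<integral>x. f x \<partial>M\<bar> \<le> c"
proof -
  have "f x \<le> c" "- c \<le> f x" for x using b[of x] by (auto simp: abs_le_iff)
  then have "(\<integral>x. f x \<partial>M) \<le> c" "- c \<le> (\<integral>x. f x \<partial>M)"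
    by (intro integral_le_const integral_ge_const f AE_I2; simp)+
  then show ?thesis by linarith
qed

lemma (in prob_space) exp_integral_le:
  fixes Y :: "'a \<Rightarrow> real"
  assumes [measurable]: "Y \<in> borel_measurable M" and b: "\<And>x. \<bar>Y x\<bar> \<le> b"
  shows "ennreal (exp (\<integral>x. Y x \<partial>M)) \<le> (\<integral>\<^sup>+x. ennreal (exp (Y x)) \<partial>M)"
proof -
  have "exp (Y x) \<le> exp b" for x using b[of x] by simp
  then have e: "integrable M (\<lambda>x. exp (Y x))" by (intro integrable_const_bound[where B="exp b"]) auto
  have i: "integrable M Y" by (rule integrable_const_bound[where B=b]) (use b in auto)
  have "exp (\<integral>x. Y x \<partial>M) \<le> (\<integral>x. exp (Y x) \<partial>M)"
    by (rule jensens_inequality[OF i _ _ e exp_convex]) auto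
  then show ?thesis by (subst nn_integral_eq_integral[OF e]) (auto intro: ennreal_leI)
qed

lemma (in prob_space) nn_integral_square_le:
  assumes "u \<in> borel_measurable M"
  shows "(\<integral>\<^sup>+x. u x \<partial>M)\<^sup>2 \<le> (\<integral>\<^sup>+x. (u x)\<^sup>2 \<partial>M)"
  using Cauchy_Schwarz_nn_integral[OF assms, of "\<lambda>_. 1"] by (simp add: emeasure_space_1)

text \<open>A factor can be cancelled in \<open>ennreal\<close> only if it is finite; accordingly,
  norms are first bounded crudely before the sharp estimate is extracted.\<close>

lemma ennreal_square_le_imp_le:
  fixes x c :: ennreal
  assumes "x\<^sup>2 \<le> c * x" "x < \<infinity>"
  shows "x \<le> c"
proof (cases "x = 0")
  case False
  then show ?thesis
    using assms ennreal_mult_le_mult_iff[of x x c] by (simp add: power2_eq_square mult.commute less_top)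
qed simp

context markov_setting
begin

lemma Xn_joint: "(\<lambda>(s, \<omega>). Xn n (max 0 s) \<omega>) \<in> borel \<Otimes>\<^sub>M paths n \<rightarrow>\<^sub>M B n"
  unfolding Xn_def B_def case_prod_beta'
proof (rule measurable_restrict)
  fix i assume i: "i \<in> {..<n}"
  have "(\<lambda>z. (fst z, snd z i)) \<in> borel \<Otimes>\<^sub>M paths n \<rightarrow>\<^sub>M (borel \<Otimes>\<^sub>M \<Omega> :: (real \<times> 'w) measure)"
    using i by measurable
  from measurable_compose[OF this X_joint]
  show "(\<lambda>x. X (max 0 (fst x)) (snd x i)) \<in> borel \<Otimes>\<^sub>M paths n \<rightarrow>\<^sub>M borel" by simp
qed

lemma measurable_Xn_shift:
  assumes f: "f \<in> meas n" and g: "g \<in> L \<rightarrow>\<^sub>M borel" and w: "w \<in> L \<rightarrow>\<^sub>M paths n"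
  shows "(\<lambda>z. f (Xn n (max 0 (g z)) (w z))) \<in> borel_measurable L"
proof -
  have "(\<lambda>z. (g z, w z)) \<in> L \<rightarrow>\<^sub>M borel \<Otimes>\<^sub>M paths n" using g w by measurable
  from measurable_compose[OF this Xn_joint] have "(\<lambda>z. Xn n (max 0 (g z)) (w z)) \<in> L \<rightarrow>\<^sub>M B n" by simp
  then show ?thesis using f by (rule measurable_compose)
qed

lemma Pn_kernel: "Pn n \<in> B n \<rightarrow>\<^sub>M prob_algebra (paths n)"
  unfolding Pn_def[abs_def] B_def
proof (rule measurable_PiM_kernel)
  fix i assume "i \<in> {..<n}"
  then show "(\<lambda>x. Px (x i)) \<in> PiM {..<n} (\<lambda>_. borel) \<rightarrow>\<^sub>M prob_algebra \<Omega>"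
    using measurable_PiM_coordinate[of i "{..<n}" Px "\<lambda>_. borel"] Px_kernel by auto
qed simp

section \<open>Norms of the time-discretized functional\<close>

lemma N_contraction:
  assumes \<tau>: "\<And>i. 0 \<le> \<tau> i" and v: "v \<in> meas n"
  shows "(\<integral>\<^sup>+x. (PN n \<tau> v x)\<^sup>2 \<partial>M n) \<le> (\<integral>\<^sup>+x. (v x)\<^sup>2 \<partial>M n)"
proof -
  have "(\<integral>\<^sup>+x. (PN n \<tau> v x)\<^sup>2 \<partial>M n) \<le> (\<integral>\<^sup>+x. (\<integral>\<^sup>+y. (v y)\<^sup>2 \<partial>N n \<tau> x) \<partial>M n)"
    using v by (intro nn_integral_mono prob_space.nn_integral_square_le[OF prob_N[OF \<tau>]])
      (auto cong: measurable_cong_sets)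
  also have "\<dots> = (\<integral>\<^sup>+x. (v x)\<^sup>2 \<partial>M n)"
    using v by (intro N_invariant \<tau>) simp
  finally show ?thesis .
qed

text \<open>Cauchy--Schwarz after distributing the time as two halves, one on each side.\<close>

lemma N_polarized:
  assumes h: "0 \<le> h" and u: "u \<in> meas n" and v: "v \<in> meas n"
  shows "(\<integral>\<^sup>+x. u x * PP n h v x \<partial>M n)\<^sup>2 \<le> phi n u (\<lambda>_. h) * phi n v (\<lambda>_. h)"
proof -
  have h2: "\<And>i::nat. 0 \<le> h / 2" using h by simp
  have eq: "(\<lambda>_::nat. h) = (\<lambda>i. h / 2 + h / 2)" "(\<lambda>_::nat. h) = (\<lambda>i. 2 * (h / 2))" by auto
  have "(\<integral>\<^sup>+x. u x * PP n h v x \<partial>M n)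
    = (\<integral>\<^sup>+x. PP n (h / 2) u x * PP n (h / 2) v x \<partial>M n)"
    unfolding eq(1) nn_integral_N_add[OF h2 h2 v]
    by (rule N_symmetric[OF h2 u N_measurable[OF h2 v]])
  also have "\<dots>\<^sup>2 \<le> (\<integral>\<^sup>+x. (PP n (h / 2) u x)\<^sup>2 \<partial>M n) * (\<integral>\<^sup>+x. (PP n (h / 2) v x)\<^sup>2 \<partial>M n)"
    using N_measurable[OF h2 u] N_measurable[OF h2 v] by (intro Cauchy_Schwarz_nn_integral) auto
  also have "\<dots> = phi n u (\<lambda>_. h) * phi n v (\<lambda>_. h)"
    unfolding eq(2) phi_double[OF h2 u] phi_double[OF h2 v] by simp
  finally show ?thesis .
qed

text \<open>In terms of v = u / w the form hypothesis bounds the quadratic form of the symmetric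
  operator w P_h w by \<open>\<kappa>\<close>, where \<open>w\<close> is exp(h f / 2). This form is
  nonnegative, and the polarized inequality with \<open>Q\<close> itself as one argument turns the
  bound of the form into a bound of the operator norm.\<close>

lemma norm_from_form:
  assumes h: "0 \<le> h" and f[measurable]: "f \<in> meas n" and b: "\<And>x. \<bar>f x\<bar> \<le> b"
    and form: "\<And>u. u \<in> meas n \<Longrightarrow>
      phi n u (\<lambda>_. h) \<le> \<kappa> * (\<integral>\<^sup>+x. ennreal (exp (- h * f x)) * (u x)\<^sup>2 \<partial>M n)"
    and W[measurable]: "W \<in> meas n" and W_fin: "(\<integral>\<^sup>+x. (W x)\<^sup>2 \<partial>M n) < \<infinity>"
  defines "w \<equiv> \<lambda>x. ennreal (exp (h * f x / 2))"
  defines "Q \<equiv> \<lambda>x. w x * (\<integral>\<^sup>+y. w y * W y \<partial>Nt n h x)"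
  shows "(\<integral>\<^sup>+x. (Q x)\<^sup>2 \<partial>M n) \<le> \<kappa>\<^sup>2 * (\<integral>\<^sup>+x. (W x)\<^sup>2 \<partial>M n)"
    and "Q \<in> meas n"
proof -
  have h': "\<And>i::nat. 0 \<le> h" using h by simp
  have w[measurable]: "w \<in> meas n" unfolding w_def by measurable
  have wW: "(\<lambda>y. w y * W y) \<in> meas n" by measurable
  have NQ[measurable]: "(\<lambda>x. \<integral>\<^sup>+y. w y * W y \<partial>Nt n h x) \<in> meas n"
    by (rule N_measurable[OF h' wW])
  show Q[measurable]: "Q \<in> meas n" unfolding Q_def by measurable
  have wle: "(w x)\<^sup>2 \<le> ennreal (exp (h * b))" for x
  proof -
    have "(w x)\<^sup>2 = ennreal (exp (h * f x))"
      unfolding w_def by (simp add: power2_eq_square ennreal_mult[symmetric] exp_add[symmetric])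
    also have "h * f x \<le> h * b" using b[of x] h by (intro mult_left_mono) auto
    finally show ?thesis by (simp add: ennreal_leI)
  qed
  have wform: "phi n (\<lambda>x. w x * v x) (\<lambda>_. h) \<le> \<kappa> * (\<integral>\<^sup>+x. (v x)\<^sup>2 \<partial>M n)" if [measurable]: "v \<in> meas n" for v
  proof -
    have "phi n (\<lambda>x. w x * v x) (\<lambda>_. h) \<le> \<kappa> * (\<integral>\<^sup>+x. ennreal (exp (- h * f x)) * (w x * v x)\<^sup>2 \<partial>M n)"
      by (rule form) measurable
    also have "\<dots> = \<kappa> * (\<integral>\<^sup>+x. (v x)\<^sup>2 \<partial>M n)"
    proof (intro arg_cong[where f="\<lambda>c. \<kappa> * c"] nn_integral_cong)
      fix x
      have "ennreal (exp (- h * f x)) * (w x)\<^sup>2 = 1"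
        unfolding w_def by (simp add: power2_eq_square ennreal_mult[symmetric] exp_add[symmetric])
      then show "ennreal (exp (- h * f x)) * (w x * v x)\<^sup>2 = (v x)\<^sup>2"
        by (simp add: power_mult_distrib mult.assoc[symmetric])
    qed
    finally show ?thesis .
  qed
  let ?q = "\<integral>\<^sup>+x. (Q x)\<^sup>2 \<partial>M n" and ?W = "\<integral>\<^sup>+x. (W x)\<^sup>2 \<partial>M n"
  \<comment> \<open>Crude estimate of \<open>?q\<close>, wanted only for its finiteness, which
    permits cancelling \<open>?q\<close> at the end.\<close>
  have "?q \<le> (\<integral>\<^sup>+x. ennreal (exp (h * b)) * (\<integral>\<^sup>+y. w y * W y \<partial>Nt n h x)\<^sup>2 \<partial>M n)"
    unfolding Q_def power_mult_distrib by (intro nn_integral_mono mult_right_mono wle) auto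
  also have "\<dots> = ennreal (exp (h * b)) * (\<integral>\<^sup>+x. (\<integral>\<^sup>+y. w y * W y \<partial>Nt n h x)\<^sup>2 \<partial>M n)"
    by (rule nn_integral_cmult) measurable
  also have "\<dots> \<le> ennreal (exp (h * b)) * (\<integral>\<^sup>+x. (w x * W x)\<^sup>2 \<partial>M n)"
    by (intro mult_left_mono N_contraction h' wW) auto
  also have "\<dots> \<le> ennreal (exp (h * b)) * (\<integral>\<^sup>+x. ennreal (exp (h * b)) * (W x)\<^sup>2 \<partial>M n)"
    unfolding power_mult_distrib by (intro mult_left_mono nn_integral_mono mult_right_mono wle) auto
  also have "\<dots> = ennreal (exp (h * b)) * (ennreal (exp (h * b)) * ?W)"
    by (subst nn_integral_cmult) auto
  also have "\<dots> < \<infinity>" using W_fin by (simp add: ennreal_mult_less_top)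
  finally have fin: "?q < \<infinity>" .
  have "?q = (\<integral>\<^sup>+x. (w x * Q x) * (\<integral>\<^sup>+y. w y * W y \<partial>Nt n h x) \<partial>M n)"
    by (intro nn_integral_cong) (simp add: power2_eq_square Q_def ac_simps)
  then have "?q\<^sup>2 \<le> phi n (\<lambda>x. w x * Q x) (\<lambda>_. h) * phi n (\<lambda>x. w x * W x) (\<lambda>_. h)"
    using N_polarized[OF h _ wW, of "\<lambda>x. w x * Q x"] by simp
  also have "\<dots> \<le> (\<kappa> * ?q) * (\<kappa> * ?W)"
    by (intro mult_mono wform) auto
  also have "\<dots> = (\<kappa>\<^sup>2 * ?W) * ?q" by (simp add: power2_eq_square ac_simps)
  finally show "?q \<le> \<kappa>\<^sup>2 * ?W" using fin by (rule ennreal_square_le_imp_le)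
qed

text \<open>The final function is absorbed by the Markov property at time \<open>m h + r\<close>,
  which applies the one-step operator to \<open>V\<close>. Iteration leaves a power of that
  operator, preceded by the initial time \<open>r\<close>.\<close>

lemma fdd_markov:
  assumes h: "0 \<le> h" and r: "0 \<le> r" and \<psi>[measurable]: "\<psi> \<in> meas n" and V: "V \<in> meas n"
  shows "(\<integral>\<^sup>+\<omega>. (\<Prod>k<m. \<psi> (Xn n (real k * h + r) \<omega>)) * V (Xn n (real m * h + r) \<omega>) \<partial>Pn n x)
    = (\<integral>\<^sup>+y. ((\<lambda>v y. \<psi> y * PP n h v y) ^^ m) V y \<partial>Nt n r x)"
  using V
proof (induction m arbitrary: V)
  case 0
  then show ?case using nn_integral_Pn[OF r, of V n x] by simp
next
  case (Suc m)
  let ?T = "\<lambda>v y. \<psi> y * PP n h v y"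
  let ?Y = "\<lambda>\<omega>. \<Prod>k<Suc m. \<psi> (Xn n (real k * h + r) \<omega>)"
  have h': "\<And>i::nat. 0 \<le> h" using h by simp
  have mr: "0 \<le> real m * h + r" using h r by simp
  have TV: "?T V \<in> meas n" using N_measurable[OF h' Suc.prems] by measurable
  have Y: "?Y \<in> borel_measurable (pasts n (real m * h + r))"
  proof (rule borel_measurable_prod_ennreal)
    fix k assume "k \<in> {..<Suc m}"
    then have "real k * h + r \<le> real m * h + r" "0 \<le> real k * h + r"
      using h r by (auto intro!: mult_right_mono)
    then show "(\<lambda>\<omega>. \<psi> (Xn n (real k * h + r) \<omega>)) \<in> borel_measurable (pasts n (real m * h + r))"
      by (intro measurable_compose[OF Xn_measurable_past \<psi>])
  qed
  have t: "real (Suc m) * h + r = (real m * h + r) + h" by (simp add: algebra_simps)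
  have "(\<integral>\<^sup>+\<omega>. ?Y \<omega> * V (Xn n (real (Suc m) * h + r) \<omega>) \<partial>Pn n x)
    = (\<integral>\<^sup>+\<omega>. ?Y \<omega> * PP n h V (Xn n (real m * h + r) \<omega>) \<partial>Pn n x)"
    unfolding t by (rule markov_Pn[OF mr h Y Suc.prems])
  also have "\<dots> = (\<integral>\<^sup>+\<omega>. (\<Prod>k<m. \<psi> (Xn n (real k * h + r) \<omega>)) * ?T V (Xn n (real m * h + r) \<omega>) \<partial>Pn n x)"
    by (intro nn_integral_cong) (simp add: mult.assoc)
  also have "\<dots> = (\<integral>\<^sup>+y. (?T ^^ m) (?T V) y \<partial>Nt n r x)"
    by (rule Suc.IH[OF TV])
  finally show ?case unfolding funpow_Suc_right comp_def .
qed

text \<open>A Riemann product carries full factors exp(h f), while the controlled operator is the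
  symmetric one with exp(h f / 2) on both sides. Rebalancing leaves a half factor at each end, at
  most exp(h b / 2) in norm; the incomplete time steps \<open>r\<close> and \<open>h - r\<close> are
  contractions. In total there are \<open>m\<close> norms \<open>\<kappa>\<close> and one factor
  exp(h b).\<close>

lemma fdd_norm:
  assumes h: "0 \<le> h" and r: "0 \<le> r" "r \<le> h" and f[measurable]: "f \<in> meas n" and b: "\<And>x. \<bar>f x\<bar> \<le> b"
    and form: "\<And>u. u \<in> meas n \<Longrightarrow>
      phi n u (\<lambda>_. h) \<le> \<kappa> * (\<integral>\<^sup>+x. ennreal (exp (- h * f x)) * (u x)\<^sup>2 \<partial>M n)"
    and g[measurable]: "g \<in> meas n" and g1: "(\<integral>\<^sup>+x. (g x)\<^sup>2 \<partial>M n) \<le> 1" and \<kappa>: "\<kappa> < \<infinity>"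
  shows "(\<integral>\<^sup>+x. (\<integral>\<^sup>+\<omega>. (\<Prod>k<Suc m. ennreal (exp (h * f (Xn n (real k * h + r) \<omega>)))) * g (Xn n (real (Suc m) * h) \<omega>) \<partial>Pn n x)\<^sup>2 \<partial>M n)
    \<le> (ennreal (exp (h * b)) * \<kappa> ^ m)\<^sup>2"
proof -
  let ?\<psi> = "\<lambda>x. ennreal (exp (h * f x))"
  let ?w = "\<lambda>x. ennreal (exp (h * f x / 2))"
  let ?T = "\<lambda>v y. ?\<psi> y * PP n h v y"
  let ?Q = "\<lambda>v y. ?w y * (\<integral>\<^sup>+z. ?w z * v z \<partial>Nt n h y)"
  have r': "\<And>i::nat. 0 \<le> r" using r by simp
  have hr': "\<And>i::nat. 0 \<le> h - r" using r by simp
  let ?G = "\<lambda>y. PP n (h - r) g y"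
  have G[measurable]: "?G \<in> meas n" by (rule N_measurable[OF hr' g])
  let ?V0 = "\<lambda>y. ?\<psi> y * ?G y" and ?W0 = "\<lambda>y. ?w y * ?G y"
  have ww: "?w y * (?w y * c) = ?\<psi> y * c" for y c
    by (simp add: mult.assoc[symmetric] ennreal_mult[symmetric] exp_add[symmetric])
  have w2: "(?w x)\<^sup>2 \<le> ennreal (exp (h * b))" for x
  proof -
    have "(?w x)\<^sup>2 = ennreal (exp (h * f x))"
      by (simp add: power2_eq_square ennreal_mult[symmetric] exp_add[symmetric])
    also have "h * f x \<le> h * b" using b[of x] h by (intro mult_left_mono) auto
    finally show ?thesis by (simp add: ennreal_leI)
  qed
  have V0: "?V0 \<in> meas n" and W0: "?W0 \<in> meas n" by measurable
  \<comment> \<open>Multiplication by the half weight intertwines the one-sided operator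
    \<open>?T\<close> with the symmetric \<open>?Q\<close>.\<close>
  have TQ: "(?T ^^ k) ?V0 = (\<lambda>y. ?w y * (?Q ^^ k) ?W0 y)" for k
  proof (induction k)
    case 0 then show ?case by (simp add: ww)
  next
    case (Suc k)
    show ?case unfolding funpow.simps comp_def Suc by (simp add: ww)
  qed
  have W: "(\<integral>\<^sup>+x. ((?Q ^^ k) ?W0 x)\<^sup>2 \<partial>M n) \<le> (\<kappa>\<^sup>2) ^ k * ennreal (exp (h * b)) \<and> (?Q ^^ k) ?W0 \<in> meas n" for k
  proof (induction k)
    case 0
    have "(\<integral>\<^sup>+x. (?W0 x)\<^sup>2 \<partial>M n) \<le> (\<integral>\<^sup>+x. ennreal (exp (h * b)) * (?G x)\<^sup>2 \<partial>M n)"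
      unfolding power_mult_distrib by (intro nn_integral_mono mult_right_mono w2) auto
    also have "\<dots> = ennreal (exp (h * b)) * (\<integral>\<^sup>+x. (?G x)\<^sup>2 \<partial>M n)"
      by (rule nn_integral_cmult) measurable
    also have "\<dots> \<le> ennreal (exp (h * b)) * 1"
      by (intro mult_left_mono order_trans[OF N_contraction[OF hr' g] g1]) auto
    finally show ?case using W0 by simp
  next
    case (Suc k)
    let ?Wk = "(?Q ^^ k) ?W0"
    have m: "?Wk \<in> meas n" and le: "(\<integral>\<^sup>+x. (?Wk x)\<^sup>2 \<partial>M n) \<le> (\<kappa>\<^sup>2) ^ k * ennreal (exp (h * b))"
      using Suc by auto
    have "(\<kappa>\<^sup>2) ^ k * ennreal (exp (h * b)) < \<infinity>" using \<kappa> by (simp add: ennreal_mult_less_top power_less_top_ennreal)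
    with le have fin: "(\<integral>\<^sup>+x. (?Wk x)\<^sup>2 \<partial>M n) < \<infinity>" by (rule le_less_trans)
    note nf = norm_from_form[OF h f b form m fin]
    have "(\<integral>\<^sup>+x. (?Q ?Wk x)\<^sup>2 \<partial>M n) \<le> \<kappa>\<^sup>2 * (\<integral>\<^sup>+x. (?Wk x)\<^sup>2 \<partial>M n)" by (rule nf(1))
    also have "\<dots> \<le> \<kappa>\<^sup>2 * ((\<kappa>\<^sup>2) ^ k * ennreal (exp (h * b)))" using le by (intro mult_left_mono) auto
    finally show ?case using nf(2) by (simp add: mult.assoc)
  qed
  have Wm[measurable]: "(?Q ^^ m) ?W0 \<in> meas n" using W by blast
  have key: "(\<integral>\<^sup>+\<omega>. (\<Prod>k<Suc m. ?\<psi> (Xn n (real k * h + r) \<omega>)) * g (Xn n (real (Suc m) * h) \<omega>) \<partial>Pn n x)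
    = (\<integral>\<^sup>+y. (?T ^^ m) ?V0 y \<partial>Nt n r x)" for x
  proof -
    let ?Y = "\<lambda>\<omega>. \<Prod>k<Suc m. ?\<psi> (Xn n (real k * h + r) \<omega>)"
    have mr: "0 \<le> real m * h + r" using h r by simp
    have Y: "?Y \<in> borel_measurable (pasts n (real m * h + r))"
    proof (rule borel_measurable_prod_ennreal)
      fix k assume "k \<in> {..<Suc m}"
      then have "real k * h + r \<le> real m * h + r" "0 \<le> real k * h + r"
        using h r by (auto intro!: mult_right_mono)
      then show "(\<lambda>\<omega>. ?\<psi> (Xn n (real k * h + r) \<omega>)) \<in> borel_measurable (pasts n (real m * h + r))"
        by (intro measurable_compose[OF Xn_measurable_past, where g="?\<psi>"]) measurable
    qed
    \<comment> \<open>The last grid point is followed by an incomplete step of length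
      \<open>h - r\<close> up to the final time.\<close>
    have t: "real (Suc m) * h = (real m * h + r) + (h - r)" by (simp add: algebra_simps)
    have hr: "0 \<le> h - r" using r by simp
    have "(\<integral>\<^sup>+\<omega>. ?Y \<omega> * g (Xn n (real (Suc m) * h) \<omega>) \<partial>Pn n x) = (\<integral>\<^sup>+\<omega>. ?Y \<omega> * ?G (Xn n (real m * h + r) \<omega>) \<partial>Pn n x)"
      unfolding t by (rule markov_Pn[OF mr hr Y g])
    also have "\<dots> = (\<integral>\<^sup>+\<omega>. (\<Prod>k<m. ?\<psi> (Xn n (real k * h + r) \<omega>)) * ?V0 (Xn n (real m * h + r) \<omega>) \<partial>Pn n x)"
      by (intro nn_integral_cong) (simp add: mult.assoc)
    also have "\<dots> = (\<integral>\<^sup>+y. (?T ^^ m) ?V0 y \<partial>Nt n r x)"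
      by (rule fdd_markov[OF h r(1) _ V0]) measurable
    finally show ?thesis .
  qed
  have "(\<integral>\<^sup>+x. (\<integral>\<^sup>+y. (?T ^^ m) ?V0 y \<partial>Nt n r x)\<^sup>2 \<partial>M n) \<le> (\<integral>\<^sup>+x. ((?T ^^ m) ?V0 x)\<^sup>2 \<partial>M n)"
    by (rule N_contraction[OF r']) (unfold TQ, measurable)
  also have "\<dots> \<le> (\<integral>\<^sup>+x. ennreal (exp (h * b)) * ((?Q ^^ m) ?W0 x)\<^sup>2 \<partial>M n)"
    unfolding TQ power_mult_distrib by (intro nn_integral_mono mult_right_mono w2) auto
  also have "\<dots> = ennreal (exp (h * b)) * (\<integral>\<^sup>+x. ((?Q ^^ m) ?W0 x)\<^sup>2 \<partial>M n)"
    by (rule nn_integral_cmult) measurable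
  also have "\<dots> \<le> ennreal (exp (h * b)) * ((\<kappa>\<^sup>2) ^ m * ennreal (exp (h * b)))"
    using W by (intro mult_left_mono) auto
  also have "\<dots> = (ennreal (exp (h * b)) * \<kappa> ^ m)\<^sup>2"
    by (simp add: power2_eq_square power_mult_distrib ac_simps)
  finally show ?thesis unfolding key .
qed

section \<open>The Feynman--Kac operator and its norm\<close>

abbreviation "fk \<equiv> fk_op Px X"
abbreviation "fkn \<equiv> fk_norm Px X \<mu>"

lemma fk_op_eq:
  "fk n t f g x = (\<integral>\<^sup>+\<omega>. ennreal (g (Xn n t \<omega>) * exp (\<integral>s\<in>{0..t}. f (Xn n s \<omega>) \<partial>lborel)) \<partial>Pn n x)"
  unfolding fk_op_def Pn_def Xn_def ..

lemma path_measurable: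
  assumes f: "f \<in> meas n" and w: "\<omega> \<in> space (paths n)"
  shows "(\<lambda>s. f (Xn n (max 0 s) \<omega>)) \<in> borel_measurable borel"
  by (rule measurable_Xn_shift[OF f]) (use w in auto)

lemma set_integral_path:
  fixes f :: "(nat \<Rightarrow> 'a) \<Rightarrow> real"
  assumes t: "0 \<le> t"
  shows "(\<integral>s\<in>{0..t}. f (Xn n s \<omega>) \<partial>lborel) = (\<integral>s. indicator {0..t} s * f (Xn n (max 0 s) \<omega>) \<partial>lborel)"
  unfolding set_lebesgue_integral_def
  by (intro Bochner_Integration.integral_cong refl) (auto split: split_indicator simp: max_def)

lemma path_integral_blocks:
  fixes f :: "(nat \<Rightarrow> 'a) \<Rightarrow> real"
  assumes f: "f \<in> meas n" and b: "\<And>x. \<bar>f x\<bar> \<le> b" and h: "0 < h"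
    and w: "\<omega> \<in> space (paths n)"
  shows "(\<integral>s\<in>{0..real m * h}. f (Xn n s \<omega>) \<partial>lborel)
    = (\<Sum>k<m. h * (\<integral>r. f (Xn n (max 0 (real k * h + r)) \<omega>) \<partial>unif h))"
proof -
  note \<Psi>[measurable] = path_measurable[OF f w]
  let ?\<Psi> = "\<lambda>s. f (Xn n (max 0 s) \<omega>)"
  have "(\<integral>s\<in>{0..real m * h}. f (Xn n s \<omega>) \<partial>lborel) = (\<integral>s. indicator {0..real m * h} s * ?\<Psi> s \<partial>lborel)"
    by (rule set_integral_path) (use h in simp)
  also have "\<dots> = (\<integral>s. indicator {0..<real m * h} s * ?\<Psi> s \<partial>lborel)"
  proof (rule integral_cong_AE)
    show "AE s in lborel. indicator {0..real m * h} s * ?\<Psi> s = indicator {0..<real m * h} s * ?\<Psi> s"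
      using AE_lborel_singleton[of "real m * h"] by eventually_elim (auto split: split_indicator)
  qed measurable
  also have "\<dots> = (\<Sum>k<m. \<integral>r. indicator {0..<h} r * ?\<Psi> (real k * h + r) \<partial>lborel)"
    by (rule integral_time_split[OF \<Psi> b h])
  also have "\<dots> = (\<Sum>k<m. h * (\<integral>r. ?\<Psi> (real k * h + r) \<partial>unif h))"
    using h by (intro sum.cong refl) (simp add: integral_uniform_Ico)
  finally show ?thesis .
qed

lemma path_integral_bound:
  fixes f :: "(nat \<Rightarrow> 'a) \<Rightarrow> real"
  assumes f: "f \<in> meas n" and b: "\<And>x. \<bar>f x\<bar> \<le> b" and t: "0 < t"
    and w: "\<omega> \<in> space (paths n)"
  shows "\<bar>\<integral>s\<in>{0..t}. f (Xn n s \<omega>) \<partial>lborel\<bar> \<le> t * b"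
proof -
  let ?U = "unif t"
  interpret U: prob_space ?U by (rule prob_space_uniform_Ico[OF t])
  note [measurable] = path_measurable[OF f w]
  have "\<bar>\<integral>r. f (Xn n (max 0 (0 + r)) \<omega>) \<partial>?U\<bar> \<le> b"
    using b by (intro U.abs_integral_le_const U.integrable_const_bound[where B=b]) auto
  then show ?thesis using path_integral_blocks[OF f b t w, of 1] t by (simp add: abs_mult)
qed

text \<open>The integral of \<open>f\<close> along the path is the average, over a uniform offset
  \<open>r\<close>, of Riemann sums on the grid \<open>k h + r\<close>; Jensen's inequality for exp
  moves the average outside. Shifting the grid makes this exact for paths that are merely measurable
  in time.\<close>

lemma fk_op_le:
  fixes f g :: "(nat \<Rightarrow> 'a) \<Rightarrow> real"
  assumes f[measurable]: "f \<in> meas n" and b: "\<And>x. \<bar>f x\<bar> \<le> b" and h: "0 < h"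
    and g[measurable]: "g \<in> meas n" and g0: "\<And>x. 0 \<le> g x"
  shows "fk n (real (Suc m) * h) f g x \<le>
    (\<integral>\<^sup>+r. (\<integral>\<^sup>+\<omega>. (\<Prod>k<Suc m. ennreal (exp (h * f (Xn n (max 0 (real k * h + r)) \<omega>)))) * ennreal (g (Xn n (real (Suc m) * h) \<omega>)) \<partial>Pn n x)
      \<partial>unif h)"
proof -
  let ?U = "unif h"
  let ?t = "real (Suc m) * h"
  let ?G = "\<lambda>r \<omega>. (\<Prod>k<Suc m. ennreal (exp (h * f (Xn n (max 0 (real k * h + r)) \<omega>)))) * ennreal (g (Xn n ?t \<omega>))"
  interpret U: prob_space ?U by (rule prob_space_uniform_Ico[OF h])
  interpret Q: prob_space "Pn n x" by (rule prob_Pn)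
  interpret UQ: pair_sigma_finite ?U "Pn n x" ..
  have t: "0 \<le> ?t" using h by simp
  have Xt: "Xn n ?t \<in> paths n \<rightarrow>\<^sub>M B n" by (rule Xn_measurable[OF t])
  have Gm: "(\<lambda>(r, \<omega>). ?G r \<omega>) \<in> borel_measurable (?U \<Otimes>\<^sub>M Pn n x)"
  proof -
    have fk: "(\<lambda>z. f (Xn n (max 0 (real k * h + fst z)) (snd z))) \<in> borel_measurable (borel \<Otimes>\<^sub>M paths n)" for k
      by (rule measurable_Xn_shift[OF f]) measurable
    have gk: "(\<lambda>z. g (Xn n ?t (snd z))) \<in> borel_measurable (borel \<Otimes>\<^sub>M paths n)"
      by (rule measurable_compose[OF measurable_snd measurable_compose[OF Xt g]])
    have "(\<lambda>z. ?G (fst z) (snd z)) \<in> borel_measurable (borel \<Otimes>\<^sub>M paths n)"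
      using fk[measurable] gk[measurable] by measurable
    then show ?thesis
      by (simp add: case_prod_beta' cong: measurable_cong_sets sets_pair_measure_cong)
  qed
  have "fk n ?t f g x \<le> (\<integral>\<^sup>+\<omega>. \<integral>\<^sup>+r. ?G r \<omega> \<partial>?U \<partial>Pn n x)"
    unfolding fk_op_eq
  proof (rule nn_integral_mono)
    fix \<omega> assume "\<omega> \<in> space (Pn n x)"
    then have w: "\<omega> \<in> space (paths n)" by simp
    define \<Psi> where "\<Psi> s = f (Xn n (max 0 s) \<omega>)" for s
    have \<Psi>[measurable]: "\<Psi> \<in> borel_measurable borel" unfolding \<Psi>_def by (rule path_measurable[OF f w])
    have b\<Psi>: "\<bar>\<Psi> s\<bar> \<le> b" for s unfolding \<Psi>_def by (rule b)
    define Y where "Y r = h * (\<Sum>k<Suc m. \<Psi> (real k * h + r))" for r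
    have Ym[measurable]: "Y \<in> borel_measurable borel" unfolding Y_def by measurable
    have Yb: "\<bar>Y r\<bar> \<le> h * (real (Suc m) * b)" for r
    proof -
      have "\<bar>\<Sum>k<Suc m. \<Psi> (real k * h + r)\<bar> \<le> (\<Sum>k<Suc m. \<bar>\<Psi> (real k * h + r)\<bar>)" by (rule sum_abs)
      also have "\<dots> \<le> (\<Sum>k<Suc m. b)" by (intro sum_mono b\<Psi>)
      finally show ?thesis unfolding Y_def abs_mult using h by simp
    qed
    have "integrable ?U (\<lambda>r. \<Psi> (real k * h + r))" for k
      by (rule U.integrable_const_bound[where B=b]) (use b\<Psi> in auto)
    then have eq: "(\<integral>s\<in>{0..?t}. f (Xn n s \<omega>) \<partial>lborel) = (\<integral>r. Y r \<partial>?U)"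
      unfolding path_integral_blocks[OF f b h w] Y_def \<Psi>_def[symmetric] sum_distrib_left by simp
    have "ennreal (g (Xn n ?t \<omega>) * exp (\<integral>s\<in>{0..?t}. f (Xn n s \<omega>) \<partial>lborel))
      = ennreal (exp (\<integral>r. Y r \<partial>?U)) * ennreal (g (Xn n ?t \<omega>))"
      unfolding eq using g0 by (simp add: ennreal_mult mult.commute)
    also have "\<dots> \<le> (\<integral>\<^sup>+r. ennreal (exp (Y r)) \<partial>?U) * ennreal (g (Xn n ?t \<omega>))"
      by (intro mult_right_mono U.exp_integral_le[OF _ Yb]) auto
    also have "\<dots> = (\<integral>\<^sup>+r. ennreal (exp (Y r)) * ennreal (g (Xn n ?t \<omega>)) \<partial>?U)"
      by (rule nn_integral_multc[symmetric]) simp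
    also have "\<dots> = (\<integral>\<^sup>+r. ?G r \<omega> \<partial>?U)"
    proof (rule nn_integral_cong)
      fix r
      have "ennreal (exp (Y r)) = (\<Prod>k<Suc m. ennreal (exp (h * f (Xn n (max 0 (real k * h + r)) \<omega>))))"
        unfolding Y_def \<Psi>_def sum_distrib_left exp_sum[OF finite_lessThan] by (rule prod_ennreal[symmetric]) simp
      then show "ennreal (exp (Y r)) * ennreal (g (Xn n ?t \<omega>)) = ?G r \<omega>" by (simp only:)
    qed
    finally show "ennreal (g (Xn n ?t \<omega>) * exp (\<integral>s\<in>{0..?t}. f (Xn n s \<omega>) \<partial>lborel)) \<le> (\<integral>\<^sup>+r. ?G r \<omega> \<partial>?U)" .
  qed
  also have "\<dots> = (\<integral>\<^sup>+r. \<integral>\<^sup>+\<omega>. ?G r \<omega> \<partial>Pn n x \<partial>?U)"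
    using UQ.Fubini'[OF Gm] by simp
  finally show ?thesis .
qed

text \<open>Jensen for the square and Fubini reduce the estimate to a fixed offset, where
  \<open>fdd_norm\<close> gives a bound independent of that offset.\<close>

lemma fk_op_norm_le:
  fixes f g :: "(nat \<Rightarrow> 'a) \<Rightarrow> real"
  assumes f[measurable]: "f \<in> meas n" and b: "\<And>x. \<bar>f x\<bar> \<le> b" and h: "0 < h"
    and g[measurable]: "g \<in> meas n" and g0: "\<And>x. 0 \<le> g x"
    and g1: "sqnorm n g \<le> 1"
    and form: "\<And>u. u \<in> meas n \<Longrightarrow>
      phi n u (\<lambda>_. h) \<le> \<kappa> * (\<integral>\<^sup>+x. ennreal (exp (- h * f x)) * (u x)\<^sup>2 \<partial>M n)" and \<kappa>: "\<kappa> < \<infinity>"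
  shows "(\<integral>\<^sup>+x. (fk n (real (Suc m) * h) f g x)\<^sup>2 \<partial>M n) \<le> (ennreal (exp (h * b)) * \<kappa> ^ m)\<^sup>2"
proof -
  let ?U = "unif h"
  let ?t = "real (Suc m) * h"
  let ?G = "\<lambda>r \<omega>. (\<Prod>k<Suc m. ennreal (exp (h * f (Xn n (max 0 (real k * h + r)) \<omega>)))) * ennreal (g (Xn n ?t \<omega>))"
  let ?A = "\<lambda>r x. \<integral>\<^sup>+\<omega>. ?G r \<omega> \<partial>Pn n x"
  interpret U: prob_space ?U by (rule prob_space_uniform_Ico[OF h])
  interpret Mn: prob_space "M n" by (rule prob_M)
  interpret UM: pair_sigma_finite ?U "M n" ..
  have t: "0 \<le> ?t" using h by simp
  have Xt: "Xn n ?t \<in> paths n \<rightarrow>\<^sub>M B n" by (rule Xn_measurable[OF t])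
  \<comment> \<open>Fubini in the offset and the starting point asks for measurability in both
    jointly; it comes from the joint measurability of the path map and of the kernel
    \<open>Pn\<close>.\<close>
  have Am: "(\<lambda>(r, x). ?A r x) \<in> borel_measurable (borel \<Otimes>\<^sub>M B n)"
  proof -
    have fk: "(\<lambda>z. f (Xn n (max 0 (real k * h + fst (fst z))) (snd z))) \<in> borel_measurable ((borel \<Otimes>\<^sub>M B n) \<Otimes>\<^sub>M paths n)" for k
      by (rule measurable_Xn_shift[OF f]) measurable
    have gk: "(\<lambda>z. g (Xn n ?t (snd z))) \<in> borel_measurable ((borel \<Otimes>\<^sub>M B n) \<Otimes>\<^sub>M paths n)"
      by (rule measurable_compose[OF measurable_snd measurable_compose[OF Xt g]])
    have "(\<lambda>z. ?G (fst (fst z)) (snd z)) \<in> borel_measurable ((borel \<Otimes>\<^sub>M B n) \<Otimes>\<^sub>M paths n)"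
      using fk[measurable] gk[measurable] by measurable
    then have "(\<lambda>z. \<integral>\<^sup>+\<omega>. ?G (fst z) \<omega> \<partial>Pn n (snd z)) \<in> borel_measurable (borel \<Otimes>\<^sub>M B n)"
      by (intro nn_integral_measurable_subprob_algebra2[where N="paths n"]
        measurable_compose[OF measurable_snd measurable_prob_algebraD[OF Pn_kernel]]) (simp add: case_prod_beta')
    then show ?thesis by (simp add: case_prod_beta')
  qed
  have Am': "(\<lambda>(r, x). (?A r x)\<^sup>2) \<in> borel_measurable (?U \<Otimes>\<^sub>M M n)"
  proof -
    have "(\<lambda>(r, x). (?A r x)\<^sup>2) \<in> borel_measurable (borel \<Otimes>\<^sub>M B n)"
      using borel_measurable_power_ennreal[OF Am, of 2] by (simp add: case_prod_beta')
    then show ?thesis by (simp cong: measurable_cong_sets sets_pair_measure_cong)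
  qed
  have Ar: "(\<lambda>r. ?A r x) \<in> borel_measurable ?U" if "x \<in> space (B n)" for x
  proof -
    have "(\<lambda>r. (r, x)) \<in> borel \<rightarrow>\<^sub>M borel \<Otimes>\<^sub>M B n" using that by simp
    from measurable_compose[OF this Am] show ?thesis by simp
  qed
  have "(\<integral>\<^sup>+x. (fk n ?t f g x)\<^sup>2 \<partial>M n) \<le> (\<integral>\<^sup>+x. (\<integral>\<^sup>+r. ?A r x \<partial>?U)\<^sup>2 \<partial>M n)"
    by (intro nn_integral_mono power_mono fk_op_le[OF f b h g g0]) auto
  also have "\<dots> \<le> (\<integral>\<^sup>+x. (\<integral>\<^sup>+r. (?A r x)\<^sup>2 \<partial>?U) \<partial>M n)"
    using Ar by (intro nn_integral_mono U.nn_integral_square_le) auto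
  also have "\<dots> = (\<integral>\<^sup>+r. (\<integral>\<^sup>+x. (?A r x)\<^sup>2 \<partial>M n) \<partial>?U)"
    using UM.Fubini'[OF Am'] by simp
  also have "\<dots> \<le> (\<integral>\<^sup>+r. (ennreal (exp (h * b)) * \<kappa> ^ m)\<^sup>2 \<partial>?U)"
  proof (rule nn_integral_mono_AE)
    have "AE r in ?U. r \<in> {0..<h}" by (rule AE_uniform_measureI) auto
    then show "AE r in ?U. (\<integral>\<^sup>+x. (?A r x)\<^sup>2 \<partial>M n) \<le> (ennreal (exp (h * b)) * \<kappa> ^ m)\<^sup>2"
    proof eventually_elim
      case (elim r)
      then have r: "0 \<le> r" "r \<le> h" by auto
      have max: "max 0 (real k * h + r) = real k * h + r" for k using r h by (simp add: max_def)
      have g1': "(\<integral>\<^sup>+x. (ennreal (g x))\<^sup>2 \<partial>M n) \<le> 1" using g1 g0 by (simp add: ennreal_power)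
      have h0: "0 \<le> h" using h by simp
      have gm: "(\<lambda>x. ennreal (g x)) \<in> meas n" by measurable
      show ?case
        unfolding max by (rule fdd_norm[OF h0 r f b form gm g1' \<kappa>])
    qed
  qed
  also have "\<dots> = (ennreal (exp (h * b)) * \<kappa> ^ m)\<^sup>2"
    using U.emeasure_space_1 by simp
  finally show ?thesis .
qed

definition unit_fun :: "nat \<Rightarrow> ((nat \<Rightarrow> 'a) \<Rightarrow> real) set" where
  "unit_fun n = {g. g \<in> meas n \<and> (\<forall>y. 0 \<le> g y) \<and> (sqnorm n g) \<le> 1}"

lemma fk_norm_eq:
  "fkn n t f = sqrt (enn2real (SUP g\<in>unit_fun n. \<integral>\<^sup>+y. (fk n t f g y)\<^sup>2 \<partial>M n))"
proof -
  have "borel_measurable (M n) = (meas n :: ((nat \<Rightarrow> 'a) \<Rightarrow> real) set)"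
    by (rule measurable_cong_sets) auto
  then show ?thesis unfolding fk_norm_def unit_fun_def M_def[symmetric] by simp
qed

lemma fk_op_one_ge:
  fixes f :: "(nat \<Rightarrow> 'a) \<Rightarrow> real"
  assumes f: "f \<in> meas n" and b: "\<And>x. \<bar>f x\<bar> \<le> b" and t: "0 < t"
  shows "ennreal (exp (- (t * b))) \<le> fk n t f (\<lambda>_. 1) x"
proof -
  interpret Q: prob_space "Pn n x" by (rule prob_Pn)
  have "ennreal (exp (- (t * b))) = (\<integral>\<^sup>+\<omega>. ennreal (exp (- (t * b))) \<partial>Pn n x)"
    using Q.emeasure_space_1 by simp
  also have "\<dots> \<le> (\<integral>\<^sup>+\<omega>. ennreal (1 * exp (\<integral>s\<in>{0..t}. f (Xn n s \<omega>) \<partial>lborel)) \<partial>Pn n x)"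
  proof (rule nn_integral_mono)
    fix \<omega> assume "\<omega> \<in> space (Pn n x)"
    then have "\<bar>\<integral>s\<in>{0..t}. f (Xn n s \<omega>) \<partial>lborel\<bar> \<le> t * b" by (intro path_integral_bound[OF f b t]) simp
    then show "ennreal (exp (- (t * b))) \<le> ennreal (1 * exp (\<integral>s\<in>{0..t}. f (Xn n s \<omega>) \<partial>lborel))"
      by (intro ennreal_leI) auto
  qed
  finally show ?thesis unfolding fk_op_eq by simp
qed

text \<open>The constant function 1 witnesses that the argument of the logarithm will be
  positive.\<close>

lemma fk_sup_pos:
  fixes f :: "(nat \<Rightarrow> 'a) \<Rightarrow> real"
  assumes f: "f \<in> meas n" and b: "\<And>x. \<bar>f x\<bar> \<le> b" and t: "0 < t"
  shows "0 < (SUP g\<in>unit_fun n. \<integral>\<^sup>+y. (fk n t f g y)\<^sup>2 \<partial>M n)"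
proof -
  interpret Mn: prob_space "M n" by (rule prob_M)
  have one: "(\<lambda>_. 1) \<in> unit_fun n" using Mn.emeasure_space_1 by (simp add: unit_fun_def)
  have "0 < (ennreal (exp (- (t * b))))\<^sup>2" by (simp add: power2_eq_square ennreal_zero_less_mult_iff)
  also have "\<dots> = (\<integral>\<^sup>+y. (ennreal (exp (- (t * b))))\<^sup>2 \<partial>M n)" using Mn.emeasure_space_1 by simp
  also have "\<dots> \<le> (\<integral>\<^sup>+y. (fk n t f (\<lambda>_. 1) y)\<^sup>2 \<partial>M n)"
    by (intro nn_integral_mono power_mono fk_op_one_ge[OF f b t]) auto
  also have "\<dots> \<le> (SUP g\<in>unit_fun n. \<integral>\<^sup>+y. (fk n t f g y)\<^sup>2 \<partial>M n)"
    by (rule SUP_upper[OF one])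
  finally show ?thesis .
qed

text \<open>Each of the m = t / h - 1 full steps costs exp(h \<Lambda>), and the two ends together
  cost exp(h b). The excess over \<open>t * \<Lambda>\<close> is of order \<open>h\<close> and
  disappears on fine grids.\<close>

lemma fk_norm_upper:
  fixes f :: "(nat \<Rightarrow> 'a) \<Rightarrow> real"
  assumes f: "f \<in> meas n" and b: "\<And>x. \<bar>f x\<bar> \<le> b" and h: "0 < h" and t: "t = real (Suc m) * h"
    and form: "\<And>u. u \<in> meas n \<Longrightarrow>
      phi n u (\<lambda>_. h) \<le> ennreal (exp (h * \<Lambda>)) * (\<integral>\<^sup>+x. ennreal (exp (- h * f x)) * (u x)\<^sup>2 \<partial>M n)"
  shows "ln (fkn n t f) \<le> t * \<Lambda> + h * (b - \<Lambda>)"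
proof -
  let ?S = "SUP g\<in>unit_fun n. \<integral>\<^sup>+y. (fk n t f g y)\<^sup>2 \<partial>M n"
  let ?c = "exp (h * b) * exp (h * \<Lambda>) ^ m"
  have "?S \<le> (ennreal (exp (h * b)) * ennreal (exp (h * \<Lambda>)) ^ m)\<^sup>2"
  proof (rule SUP_least)
    fix g assume "g \<in> unit_fun n"
    then show "(\<integral>\<^sup>+y. (fk n t f g y)\<^sup>2 \<partial>M n) \<le> (ennreal (exp (h * b)) * ennreal (exp (h * \<Lambda>)) ^ m)\<^sup>2"
      unfolding t by (intro fk_op_norm_le[OF f b h _ _ _ form]) (auto simp: unit_fun_def)
  qed
  also have "\<dots> = ennreal (?c\<^sup>2)"
    by (simp add: ennreal_power ennreal_mult[symmetric])
  finally have S: "?S \<le> ennreal (?c\<^sup>2)" .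
  have "0 < t" using h t by simp
  from fk_sup_pos[OF f b this] have pos: "0 < ?S" .
  have "?S < top" using S ennreal_less_top by (rule le_less_trans)
  then have "0 < enn2real ?S" using pos by (simp add: enn2real_positive_iff)
  then have fpos: "0 < fkn n t f" unfolding fk_norm_eq by simp
  have "enn2real ?S \<le> ?c\<^sup>2" using enn2real_mono[OF S] by simp
  then have "fkn n t f \<le> ?c" unfolding fk_norm_eq
    by (intro real_le_lsqrt) auto
  then have "ln (fkn n t f) \<le> ln ?c" using fpos by simp
  also have "ln ?c = h * b + real m * (h * \<Lambda>)"
    by (simp add: ln_mult ln_realpow)
  also have "\<dots> = t * \<Lambda> + h * (b - \<Lambda>)" by (simp add: t algebra_simps)
  finally show ?thesis .
qed

end

subsection \<open>The Dirichlet form\<close>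

text \<open>Fubini for a kernel and a signed integrand. Positive and negative parts are integrated
  as \<open>ennreal\<close> functions; their inner integrals are finite almost everywhere only, so
  the return to reals happens under \<open>AE\<close>.\<close>

lemma integral_bind_integrable:
  fixes f :: "'b \<Rightarrow> real"
  assumes K: "K \<in> M \<rightarrow>\<^sub>M prob_algebra N" and M: "prob_space M" and f: "integrable (M \<bind> K) f"
  shows "AE x in M. integrable (K x) f" and "(\<integral>y. f y \<partial>(M \<bind> K)) = (\<integral>x. (\<integral>y. f y \<partial>K x) \<partial>M)"
    and "integrable M (\<lambda>x. \<integral>y. f y \<partial>K x)"
proof -
  have Msp: "M \<in> space (prob_algebra M)" using M by (simp add: space_prob_algebra)
  have sb: "sets (M \<bind> K) = sets N" using Msp K by (rule sets_bind')
  have K': "K \<in> M \<rightarrow>\<^sub>M subprob_algebra N" using K by (rule measurable_prob_algebraD)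
  have fN[measurable]: "f \<in> borel_measurable N"
    using borel_measurable_integrable[OF f] by (simp add: measurable_cong_sets[OF sb refl])
  have fK: "f \<in> borel_measurable (K x)" if "x \<in> space M" for x
  proof -
    have "sets (K x) = sets N" using measurable_space[OF K that] by (simp add: space_prob_algebra)
    then show ?thesis using fN measurable_cong_sets by blast
  qed
  have km[measurable]: "(\<lambda>x. \<integral>\<^sup>+y. v y \<partial>K x) \<in> borel_measurable M" if "v \<in> borel_measurable N" for v
    by (rule measurable_compose[OF K' nn_integral_measurable_subprob_algebra[OF that]])
  have bind: "(\<integral>\<^sup>+y. v y \<partial>(M \<bind> K)) = (\<integral>\<^sup>+x. \<integral>\<^sup>+y. v y \<partial>K x \<partial>M)" if "v \<in> borel_measurable N" for v
    by (rule nn_integral_bind[OF that K'])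
  let ?a = "\<lambda>x. \<integral>\<^sup>+y. ennreal (f y) \<partial>K x" and ?b = "\<lambda>x. \<integral>\<^sup>+y. ennreal (- f y) \<partial>K x"
  have n: "(\<integral>\<^sup>+x. \<integral>\<^sup>+y. ennreal (norm (f y)) \<partial>K x \<partial>M) < \<infinity>"
    using f by (subst bind[symmetric]) (auto simp: integrable_iff_bounded)
  have "AE x in M. (\<integral>\<^sup>+y. ennreal (norm (f y)) \<partial>K x) \<noteq> \<infinity>"
    using n by (intro nn_integral_PInf_AE km) auto
  with AE_space show int: "AE x in M. integrable (K x) f"
    by eventually_elim (auto simp: integrable_iff_bounded fK less_top)
  obtain p q where pq: "(\<integral>\<^sup>+y. ennreal (f y) \<partial>(M \<bind> K)) = ennreal p" "(\<integral>\<^sup>+y. ennreal (- f y) \<partial>(M \<bind> K)) = ennreal q"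
    "(\<integral>y. f y \<partial>(M \<bind> K)) = p - q" "0 \<le> p" "0 \<le> q"
    using f by (elim integrableE)
  \<comment> \<open>A nonnegative function of finite integral may pass through
    \<open>enn2real\<close> at the price of a null set; this is used for both signs.\<close>
  have part: "integrable M (\<lambda>x. enn2real (c x)) \<and> (\<integral>x. enn2real (c x) \<partial>M) = p"
    if c: "c \<in> borel_measurable M" "(\<integral>\<^sup>+x. c x \<partial>M) = ennreal p" "0 \<le> p" for c p
  proof -
    have "AE x in M. c x \<noteq> \<infinity>" using c by (intro nn_integral_PInf_AE) auto
    then have eq: "(\<integral>\<^sup>+x. ennreal (enn2real (c x)) \<partial>M) = ennreal p"
      unfolding c(2)[symmetric] by (intro nn_integral_cong_AE) (auto simp: less_top)
    have "integrable M (\<lambda>x. enn2real (c x))"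
      using c(1) eq by (intro integrableI_nonneg) auto
    moreover have "(\<integral>x. enn2real (c x) \<partial>M) = p"
      using c(1,3) eq by (subst integral_eq_nn_integral) auto
    ultimately show ?thesis ..
  qed
  have a: "integrable M (\<lambda>x. enn2real (?a x)) \<and> (\<integral>x. enn2real (?a x) \<partial>M) = p"
    using pq by (intro part km) (auto simp: bind[symmetric])
  have b: "integrable M (\<lambda>x. enn2real (?b x)) \<and> (\<integral>x. enn2real (?b x) \<partial>M) = q"
    using pq by (intro part km) (auto simp: bind[symmetric])
  have ab: "AE x in M. (\<integral>y. f y \<partial>K x) = enn2real (?a x) - enn2real (?b x)"
    using int by eventually_elim (rule real_lebesgue_integral_def)
  have im: "(\<lambda>x. \<integral>y. f y \<partial>K x) \<in> borel_measurable M"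
    by (rule measurable_compose[OF K' integral_measurable_subprob_algebra[OF fN]])
  have "(\<integral>x. (\<integral>y. f y \<partial>K x) \<partial>M) = (\<integral>x. enn2real (?a x) - enn2real (?b x) \<partial>M)"
    using ab by (intro integral_cong_AE im) auto
  also have "\<dots> = p - q" using a b by simp
  finally show "(\<integral>y. f y \<partial>(M \<bind> K)) = (\<integral>x. (\<integral>y. f y \<partial>K x) \<partial>M)" using pq by simp
  show "integrable M (\<lambda>x. \<integral>y. f y \<partial>K x)"
    using a b ab by (subst integrable_cong_AE[OF im _ ab]) auto
qed

text \<open>Young's inequality for the cross term. For quadratic energies it serves as a triangle
  inequality whose leading constant is arbitrarily close to 1.\<close>

lemma square_diff_le: "0 < d \<Longrightarrow> (a + b)\<^sup>2 \<le> (1 + d) * a\<^sup>2 + (1 + 1 / d) * (b::real)\<^sup>2"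
proof -
  assume d: "0 < d"
  have "0 \<le> (d * a - b)\<^sup>2 / d" using d by simp
  also have "\<dots> = d * a\<^sup>2 - 2 * a * b + b\<^sup>2 / d"
    using d by (simp add: power2_eq_square field_simps)
  finally show ?thesis by (simp add: power2_sum algebra_simps)
qed

section \<open>Square-integrable functions\<close>

lemma L2_measurable: "L2 M f \<Longrightarrow> f \<in> borel_measurable M" by (simp add: L2_def)

lemma integrable_bounded_mult:
  fixes f z :: "'b \<Rightarrow> real"
  assumes f: "integrable M f" and z: "z \<in> borel_measurable M" "\<And>x. \<bar>z x\<bar> \<le> b"
  shows "integrable M (\<lambda>x. z x * f x)"
proof (rule Bochner_Integration.integrable_bound)
  show "integrable M (\<lambda>x. b * f x)" using f by simp
  show "(\<lambda>x. z x * f x) \<in> borel_measurable M" using z(1) f by measurable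
  show "AE x in M. norm (z x * f x) \<le> norm (b * f x)"
    unfolding real_norm_def abs_mult using order_trans[OF z(2) abs_ge_self] by (intro AE_I2 mult_right_mono) auto
qed

lemma L2_mult_integrable:
  assumes "L2 M f" "L2 M g" shows "integrable M (\<lambda>x. f x * g x)"
proof (rule Bochner_Integration.integrable_bound)
  show "integrable M (\<lambda>x. (f x)\<^sup>2 + (g x)\<^sup>2)" using assms by (auto simp: L2_def)
  show "(\<lambda>x. f x * g x) \<in> borel_measurable M" using assms by (auto simp: L2_def)
  have "\<bar>f x * g x\<bar> \<le> (f x)\<^sup>2 + (g x)\<^sup>2" for x
  proof -
    have "2 * (\<bar>f x\<bar> * \<bar>g x\<bar>) \<le> (f x)\<^sup>2 + (g x)\<^sup>2"
      using sum_squares_bound[of "\<bar>f x\<bar>" "\<bar>g x\<bar>"] by (simp add: mult.assoc)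
    moreover have "0 \<le> \<bar>f x\<bar> * \<bar>g x\<bar>" by simp
    ultimately show ?thesis unfolding abs_mult by linarith
  qed
  then show "AE x in M. norm (f x * g x) \<le> norm ((f x)\<^sup>2 + (g x)\<^sup>2)" by simp
qed

lemma L2_lincomb: assumes "L2 M f" "L2 M g" shows "L2 M (\<lambda>x. a * f x + b * g x)"
proof -
  have "(\<lambda>x. (a * f x + b * g x)\<^sup>2) = (\<lambda>x. a\<^sup>2 * (f x)\<^sup>2 + 2 * a * b * (f x * g x) + b\<^sup>2 * (g x)\<^sup>2)"
    by (auto simp: power2_sum power_mult_distrib algebra_simps)
  then show ?thesis using assms L2_mult_integrable[OF assms] by (auto simp: L2_def)
qed

lemma L2_add: "L2 M f \<Longrightarrow> L2 M g \<Longrightarrow> L2 M (\<lambda>x. f x + g x)" using L2_lincomb[of M f g 1 1] by simp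
lemma L2_diff: "L2 M f \<Longrightarrow> L2 M g \<Longrightarrow> L2 M (\<lambda>x. f x - g x)" using L2_lincomb[of M f g 1 "-1"] by simp
lemma L2_cmult: "L2 M f \<Longrightarrow> L2 M (\<lambda>x. a * f x)" using L2_lincomb[of M f f a 0] by simp
lemma L2_square: "L2 M f \<Longrightarrow> integrable M (\<lambda>x. (f x)\<^sup>2)" by (simp add: L2_def)

lemma L2_cauchy_schwarz:
  assumes "L2 M f" "L2 M g"
  shows "\<bar>\<integral>x. f x * g x \<partial>M\<bar> \<le> sqrt (\<integral>x. (f x)\<^sup>2 \<partial>M) * sqrt (\<integral>x. (g x)\<^sup>2 \<partial>M)"
proof -
  let ?a = "\<integral>x. (f x)\<^sup>2 \<partial>M" and ?b = "\<integral>x. (g x)\<^sup>2 \<partial>M" and ?c = "\<integral>x. f x * g x \<partial>M"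
  have a0: "0 \<le> ?a" "0 \<le> ?b" by auto
  have q: "0 \<le> s\<^sup>2 * ?a + 2 * s * t * ?c + t\<^sup>2 * ?b" for s t
  proof -
    have "0 \<le> (\<integral>x. (s * f x + t * g x)\<^sup>2 \<partial>M)" by simp
    also have "\<dots> = (\<integral>x. s\<^sup>2 * (f x)\<^sup>2 + 2 * s * t * (f x * g x) + t\<^sup>2 * (g x)\<^sup>2 \<partial>M)"
      by (intro Bochner_Integration.integral_cong refl) (simp add: power2_sum power_mult_distrib algebra_simps)
    also have "\<dots> = s\<^sup>2 * ?a + 2 * s * t * ?c + t\<^sup>2 * ?b"
      using L2_square[OF assms(1)] L2_square[OF assms(2)] L2_mult_integrable[OF assms] by simp
    finally show ?thesis .
  qed
  have "?c\<^sup>2 \<le> ?a * ?b"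
  proof (cases "?b = 0")
    case True
    show ?thesis
    proof (rule ccontr)
      assume "\<not> ?thesis"
      then have c: "?c \<noteq> 0" using True by auto
      \<comment> \<open>When \<open>?b\<close> vanishes the quadratic polynomial is affine in its
        second variable; this argument gives it the value -1.\<close>
      from q[of 1 "- (?a + 1) / (2 * ?c)"] show False using True c by (simp add: field_simps)
    qed
  next
    case False
    then have "0 < ?b" using a0 by linarith
    \<comment> \<open>The minimizing direction of the quadratic form.\<close>
    from q[of "?b" "- ?c"] have "0 \<le> ?b * (?a * ?b - ?c\<^sup>2)"
      by (simp add: algebra_simps power2_eq_square)
    then show ?thesis using \<open>0 < ?b\<close> by (simp add: zero_le_mult_iff)
  qed
  from real_sqrt_le_mono[OF this] show ?thesis by (simp only: real_sqrt_abs real_sqrt_mult)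
qed

context markov_setting
begin

section \<open>The semigroup on square-integrable functions\<close>

abbreviation "FI \<equiv> fisher Px X \<mu>"
abbreviation "ddom \<equiv> dform_dom Px X \<mu>"
abbreviation "dfm \<equiv> dform Px X \<mu>"
abbreviation "grel \<equiv> gen_rel Px X \<mu>"
abbreviation T :: "real \<Rightarrow> ('a \<Rightarrow> real) \<Rightarrow> 'a \<Rightarrow> real" where "T \<equiv> Pt Px X"

abbreviation L2m :: "('a \<Rightarrow> real) \<Rightarrow> bool" where "L2m \<equiv> L2 \<mu>"

lemma L2m_measurable: "L2m f \<Longrightarrow> f \<in> borel_measurable borel"
  by (simp add: L2_def cong: measurable_cong_sets)

lemma T_eq: "0 \<le> r \<Longrightarrow> f \<in> borel_measurable borel \<Longrightarrow> T r f x = (\<integral>y. f y \<partial>K r x)"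
  unfolding Pt_def K_def by (rule integral_distr[symmetric]) (auto intro: X_measurable_Px)

lemma T_measurable:
  assumes r: "0 \<le> r" and f: "f \<in> borel_measurable borel" shows "T r f \<in> borel_measurable borel"
proof -
  have "(\<lambda>x. \<integral>y. f y \<partial>K r x) \<in> borel_measurable borel"
    by (rule measurable_compose[OF measurable_prob_algebraD[OF K_kernel[OF r]] integral_measurable_subprob_algebra[OF f]])
  then show ?thesis using T_eq[OF r f] by (simp add: fun_eq_iff[symmetric] cong: measurable_cong)
qed

text \<open>Both marginals of \<open>J r\<close> are \<open>\<mu>\<close>: the first by
  construction, the second by invariance.\<close>

lemma J_integral_fst:
  fixes f :: "'a \<Rightarrow> real"
  assumes r: "0 \<le> r" and f: "integrable \<mu> f"
  shows "integrable (J r) (\<lambda>z. f (fst z))" "(\<integral>z. f (fst z) \<partial>J r) = (\<integral>x. f x \<partial>\<mu>)"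
    "integrable (J r) (\<lambda>z. f (snd z))" "(\<integral>z. f (snd z) \<partial>J r) = (\<integral>x. f x \<partial>\<mu>)"
proof -
  note [measurable_cong] = sets_J[OF r]
  have f1: "fst \<in> J r \<rightarrow>\<^sub>M \<mu>" and f2: "snd \<in> J r \<rightarrow>\<^sub>M \<mu>" by measurable
  have d1: "distr (J r) \<mu> fst = \<mu>"
  proof (rule measure_eqI)
    fix A assume "A \<in> sets (distr (J r) \<mu> fst)"
    then have A[measurable]: "A \<in> sets borel" by simp
    have "emeasure (distr (J r) \<mu> fst) A = (\<integral>\<^sup>+x. indicator A x \<partial>distr (J r) \<mu> fst)" by simp
    also have "\<dots> = (\<integral>\<^sup>+z. indicator A (fst z) \<partial>J r)" by (rule nn_integral_distr[OF f1]) simp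
    also have "\<dots> = (\<integral>\<^sup>+x. \<integral>\<^sup>+y. indicator A x \<partial>K r x \<partial>\<mu>)" by (subst nn_integral_J[OF r]) auto
    also have "\<dots> = emeasure \<mu> A" using prob_space.emeasure_space_1[OF prob_K[OF r]] by simp
    finally show "emeasure (distr (J r) \<mu> fst) A = emeasure \<mu> A" .
  qed simp
  have d2: "distr (J r) \<mu> snd = \<mu>"
  proof (rule measure_eqI)
    fix A assume "A \<in> sets (distr (J r) \<mu> snd)"
    then have A[measurable]: "A \<in> sets borel" by simp
    have "emeasure (distr (J r) \<mu> snd) A = (\<integral>\<^sup>+x. indicator A x \<partial>distr (J r) \<mu> snd)" by simp
    also have "\<dots> = (\<integral>\<^sup>+z. indicator A (snd z) \<partial>J r)" by (rule nn_integral_distr[OF f2]) simp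
    also have "\<dots> = (\<integral>\<^sup>+x. P r (indicator A) x \<partial>\<mu>)" by (subst nn_integral_J[OF r]) auto
    also have "\<dots> = emeasure \<mu> A" by (subst P_invariant[OF r]) auto
    finally show "emeasure (distr (J r) \<mu> snd) A = emeasure \<mu> A" .
  qed simp
  show "integrable (J r) (\<lambda>z. f (fst z))" using integrable_distr[OF f1, of f] f d1 by simp
  show "integrable (J r) (\<lambda>z. f (snd z))" using integrable_distr[OF f2, of f] f d2 by simp
  show "(\<integral>z. f (fst z) \<partial>J r) = (\<integral>x. f x \<partial>\<mu>)"
    using integral_distr[OF f1 borel_measurable_integrable[OF f]] d1 by simp
  show "(\<integral>z. f (snd z) \<partial>J r) = (\<integral>x. f x \<partial>\<mu>)"
    using integral_distr[OF f2 borel_measurable_integrable[OF f]] d2 by simp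
qed

lemma L2_J:
  assumes r: "0 \<le> r" and f: "L2m f"
  shows "L2 (J r) (\<lambda>z. f (fst z))" "L2 (J r) (\<lambda>z. f (snd z))"
proof -
  note [measurable_cong] = sets_J[OF r]
  note [measurable] = L2m_measurable[OF f]
  show "L2 (J r) (\<lambda>z. f (fst z))" "L2 (J r) (\<lambda>z. f (snd z))"
    using J_integral_fst[OF r L2_square[OF f]] by (auto simp: L2_def)
qed

lemma integral_J:
  fixes H :: "'a \<times> 'a \<Rightarrow> real"
  assumes r: "0 \<le> r" and H: "integrable (J r) H"
  shows "(\<integral>z. H z \<partial>J r) = (\<integral>x. (\<integral>y. H (x, y) \<partial>K r x) \<partial>\<mu>)" "AE x in \<mu>. integrable (K r x) (\<lambda>y. H (x, y))"
proof -
  have Hm: "H \<in> borel_measurable (borel \<Otimes>\<^sub>M borel)"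
    using borel_measurable_integrable[OF H] by (simp add: measurable_cong_sets[OF sets_J[OF r] refl])
  have pm: "Pair x \<in> K r x \<rightarrow>\<^sub>M borel \<Otimes>\<^sub>M borel" for x by (auto intro!: measurable_Pair1' cong: measurable_cong_sets)
  note b = integral_bind_integrable[OF J_kernel_mu[OF r] prob_mu H[unfolded J_def]]
  show "(\<integral>z. H z \<partial>J r) = (\<integral>x. (\<integral>y. H (x, y) \<partial>K r x) \<partial>\<mu>)"
    unfolding J_def b(2) by (subst integral_distr[OF pm]) (auto simp: Hm)
  show "AE x in \<mu>. integrable (K r x) (\<lambda>y. H (x, y))"
    using b(1) by eventually_elim (subst (asm) integrable_distr_eq[OF pm], auto simp: Hm)
qed

lemma T_inner:
  assumes r: "0 \<le> r" and f: "L2m f" and g: "L2m g"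
  shows "(\<integral>x. f x * T r g x \<partial>\<mu>) = (\<integral>z. f (fst z) * g (snd z) \<partial>J r)"
proof -
  have "(\<integral>z. f (fst z) * g (snd z) \<partial>J r) = (\<integral>x. (\<integral>y. f x * g y \<partial>K r x) \<partial>\<mu>)"
    by (subst integral_J[OF r L2_mult_integrable[OF L2_J(1)[OF r f] L2_J(2)[OF r g]]]) auto
  then show ?thesis by (simp add: T_eq[OF r L2m_measurable[OF g]])
qed

lemma T_symmetric:
  assumes r: "0 \<le> r" and f: "L2m f" and g: "L2m g"
  shows "(\<integral>x. f x * T r g x \<partial>\<mu>) = (\<integral>x. g x * T r f x \<partial>\<mu>)"
proof -
  note [measurable_cong] = sets_J[OF r]
  note [measurable] = L2m_measurable[OF f] L2m_measurable[OF g]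
  have "(\<integral>z. f (fst z) * g (snd z) \<partial>J r) = (\<integral>z. f (fst z) * g (snd z) \<partial>distr (J r) (borel \<Otimes>\<^sub>M borel) (\<lambda>z. (snd z, fst z)))"
    using J_symmetric[OF r] by simp
  also have "\<dots> = (\<integral>z. g (fst z) * f (snd z) \<partial>J r)"
    by (subst integral_distr) (auto simp: mult.commute)
  finally show ?thesis using T_inner[OF r f g] T_inner[OF r g f] by simp
qed

text \<open>\<open>T r f\<close> is a Bochner integral, hence 0 by default wherever \<open>f\<close>
  is not integrable. For square-integrable \<open>f\<close> this affects a null set only; linearity
  and the semigroup law accordingly hold almost everywhere.\<close>

lemma T_integrable_AE:
  assumes r: "0 \<le> r" and f: "L2m f"
  shows "AE x in \<mu>. integrable (K r x) f \<and> integrable (K r x) (\<lambda>y. (f y)\<^sup>2)"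
proof -
  have fm: "f \<in> borel_measurable (K r x)" for x using L2m_measurable[OF f] by (simp cong: measurable_cong_sets)
  have "AE x in \<mu>. integrable (K r x) (\<lambda>y. (f y)\<^sup>2)"
    using integral_J(2)[OF r J_integral_fst(3)[OF r L2_square[OF f]]] by simp
  then show ?thesis
  proof eventually_elim
    case (elim x)
    interpret prob_space "K r x" using r by (rule prob_K)
    have "integrable (K r x) (\<lambda>y. f y * 1)"
      by (rule L2_mult_integrable) (use elim fm in \<open>auto simp: L2_def\<close>)
    then show ?case using elim by simp
  qed
qed

text \<open>Cauchy--Schwarz under almost every \<open>K r x\<close> gives a pointwise inequality of
  squares, which invariance of \<open>\<mu>\<close> integrates.\<close>

lemma T_L2:
  assumes r: "0 \<le> r" and f: "L2m f"
  shows "L2m (T r f)" "(\<integral>x. (T r f x)\<^sup>2 \<partial>\<mu>) \<le> (\<integral>x. (f x)\<^sup>2 \<partial>\<mu>)"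
proof -
  note Tm[measurable] = T_measurable[OF r L2m_measurable[OF f]]
  have fm: "f \<in> borel_measurable (K r x)" for x using L2m_measurable[OF f] by (simp cong: measurable_cong_sets)
  note J2 = J_integral_fst[OF r L2_square[OF f]]
  have le: "AE x in \<mu>. (T r f x)\<^sup>2 \<le> (\<integral>y. (f y)\<^sup>2 \<partial>K r x)"
    using T_integrable_AE[OF r f]
  proof eventually_elim
    case (elim x)
    interpret prob_space "K r x" using r by (rule prob_K)
    have "\<bar>\<integral>y. f y * 1 \<partial>K r x\<bar> \<le> sqrt (\<integral>y. (f y)\<^sup>2 \<partial>K r x) * sqrt (\<integral>y. 1\<^sup>2 \<partial>K r x)"
      by (rule L2_cauchy_schwarz) (use elim fm in \<open>auto simp: L2_def\<close>)
    then have "\<bar>T r f x\<bar> \<le> sqrt (\<integral>y. (f y)\<^sup>2 \<partial>K r x)"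
      using prob_space by (simp add: T_eq[OF r L2m_measurable[OF f]])
    then have "\<bar>T r f x\<bar>\<^sup>2 \<le> (sqrt (\<integral>y. (f y)\<^sup>2 \<partial>K r x))\<^sup>2" by (intro power_mono) auto
    then show ?case by simp
  qed
  have H: "integrable (J r) (\<lambda>z. (f (snd z))\<^sup>2)" by (rule J2(3))
  have im: "integrable \<mu> (\<lambda>x. \<integral>y. (f y)\<^sup>2 \<partial>K r x)"
  proof -
    have f2: "(\<lambda>y. (f y)\<^sup>2) \<in> borel_measurable borel" using L2m_measurable[OF f] by simp
    have pm: "Pair x \<in> K r x \<rightarrow>\<^sub>M borel \<Otimes>\<^sub>M borel" for x by (auto intro!: measurable_Pair1' cong: measurable_cong_sets)
    show ?thesis
      using integral_bind_integrable(3)[OF J_kernel_mu[OF r] prob_mu H[unfolded J_def]] f2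
      by (subst (asm) integral_distr[OF pm]) auto
  qed
  have int: "integrable \<mu> (\<lambda>x. (T r f x)\<^sup>2)"
    by (rule Bochner_Integration.integrable_bound[OF im]) (use le in auto)
  then show "L2m (T r f)" using Tm by (simp add: L2_def cong: measurable_cong_sets)
  have "(\<integral>x. (T r f x)\<^sup>2 \<partial>\<mu>) \<le> (\<integral>x. (\<integral>y. (f y)\<^sup>2 \<partial>K r x) \<partial>\<mu>)"
    by (rule integral_mono_AE[OF int im le])
  also have "\<dots> = (\<integral>x. (f x)\<^sup>2 \<partial>\<mu>)"
    using integral_J(1)[OF r H] J2(4) by simp
  finally show "(\<integral>x. (T r f x)\<^sup>2 \<partial>\<mu>) \<le> (\<integral>x. (f x)\<^sup>2 \<partial>\<mu>)" .
qed

lemma T_add_AE: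
  assumes r: "0 \<le> r" and s: "0 \<le> s" and f: "L2m f"
  shows "AE x in \<mu>. T (r + s) f x = T r (T s f) x"
proof -
  have fm: "f \<in> borel_measurable borel" using f by (rule L2m_measurable)
  have rs: "0 \<le> r + s" using r s by simp
  show ?thesis using T_integrable_AE[OF rs f]
  proof eventually_elim
    case (elim x)
    have Ks: "K s \<in> K r x \<rightarrow>\<^sub>M prob_algebra borel" using K_kernel[OF s] by (simp cong: measurable_cong_sets)
    have i: "integrable (K r x \<bind> K s) f" using elim by (simp add: K_add[OF r s])
    have "T (r + s) f x = (\<integral>y. f y \<partial>(K r x \<bind> K s))"
      by (simp add: T_eq[OF rs fm] K_add[OF r s])
    also have "\<dots> = (\<integral>y. (\<integral>z. f z \<partial>K s y) \<partial>K r x)"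
      by (rule integral_bind_integrable(2)[OF Ks prob_K[OF r] i])
    also have "\<dots> = T r (T s f) x"
    proof -
      have "T s f = (\<lambda>y. \<integral>z. f z \<partial>K s y)" by (rule ext) (rule T_eq[OF s fm])
      then show ?thesis unfolding T_eq[OF r T_measurable[OF s fm]] by simp
    qed
    finally show ?case .
  qed
qed

lemma T_lincomb_AE:
  assumes r: "0 \<le> r" and f: "L2m f" and g: "L2m g"
  shows "AE x in \<mu>. T r (\<lambda>x. a * f x + b * g x) x = a * T r f x + b * T r g x"
  using T_integrable_AE[OF r f] T_integrable_AE[OF r g]
proof eventually_elim
  case (elim x)
  have m: "(\<lambda>x. a * f x + b * g x) \<in> borel_measurable borel"
    using L2m_measurable[OF f] L2m_measurable[OF g] by simp
  show ?case using elim by (simp add: T_eq[OF r m] T_eq[OF r L2m_measurable[OF f]] T_eq[OF r L2m_measurable[OF g]])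
qed

text \<open>The Dirichlet form of the bounded generator \<open>(T s - 1) / s\<close>, in its jump form.\<close>

definition En :: "real \<Rightarrow> ('a \<Rightarrow> real) \<Rightarrow> real" where
  "En s f = (\<integral>z. (f (fst z) - f (snd z))\<^sup>2 \<partial>J s) / (2 * s)"

lemma En_nonneg: "0 < s \<Longrightarrow> 0 \<le> En s f" by (simp add: En_def)

lemma En_eq:
  assumes s: "0 < s" and f: "L2m f"
  shows "En s f = ((\<integral>x. (f x)\<^sup>2 \<partial>\<mu>) - (\<integral>x. f x * T s f x \<partial>\<mu>)) / s"
proof -
  have s0: "0 \<le> s" using s by simp
  note J2 = J_integral_fst[OF s0 L2_square[OF f]]
  note i = L2_mult_integrable[OF L2_J(1)[OF s0 f] L2_J(2)[OF s0 f]]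
  have "(\<integral>z. (f (fst z) - f (snd z))\<^sup>2 \<partial>J s) = (\<integral>z. (f (fst z))\<^sup>2 + (f (snd z))\<^sup>2 - 2 * (f (fst z) * f (snd z)) \<partial>J s)"
    by (intro Bochner_Integration.integral_cong refl) (simp add: power2_diff)
  also have "\<dots> = 2 * ((\<integral>x. (f x)\<^sup>2 \<partial>\<mu>) - (\<integral>x. f x * T s f x \<partial>\<mu>))"
    using J2 i by (simp add: T_inner[OF s0 f f])
  finally have e: "(\<integral>z. (f (fst z) - f (snd z))\<^sup>2 \<partial>J s) = 2 * ((\<integral>x. (f x)\<^sup>2 \<partial>\<mu>) - (\<integral>x. f x * T s f x \<partial>\<mu>))" .
  show ?thesis unfolding En_def e by (rule mult_divide_mult_cancel_left) simp
qed

lemma En_integrable: "0 \<le> s \<Longrightarrow> L2m f \<Longrightarrow> integrable (J s) (\<lambda>z. (f (fst z) - f (snd z))\<^sup>2)"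
  using L2_square[OF L2_diff[OF L2_J]] by blast

lemma En_triangle:
  assumes s: "0 < s" and d: "0 < d" and f: "L2m f" and g: "L2m g"
  shows "En s f \<le> (1 + d) * En s g + (1 + 1 / d) * En s (\<lambda>x. f x - g x)"
proof -
  have s0: "0 \<le> s" using s by simp
  have fg: "L2m (\<lambda>x. f x - g x)" using f g by (rule L2_diff)
  have "(\<integral>z. (f (fst z) - f (snd z))\<^sup>2 \<partial>J s)
    \<le> (\<integral>z. (1 + d) * (g (fst z) - g (snd z))\<^sup>2 + (1 + 1 / d) * ((f (fst z) - g (fst z)) - (f (snd z) - g (snd z)))\<^sup>2 \<partial>J s)"
  proof (rule integral_mono)
    show "integrable (J s) (\<lambda>z. (f (fst z) - f (snd z))\<^sup>2)" by (rule En_integrable[OF s0 f])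
    show "integrable (J s) (\<lambda>z. (1 + d) * (g (fst z) - g (snd z))\<^sup>2 + (1 + 1 / d) * ((f (fst z) - g (fst z)) - (f (snd z) - g (snd z)))\<^sup>2)"
      using En_integrable[OF s0 g] En_integrable[OF s0 fg] by simp
    show "(f (fst z) - f (snd z))\<^sup>2 \<le> (1 + d) * (g (fst z) - g (snd z))\<^sup>2 + (1 + 1 / d) * ((f (fst z) - g (fst z)) - (f (snd z) - g (snd z)))\<^sup>2" for z
      using square_diff_le[OF d, of "g (fst z) - g (snd z)" "(f (fst z) - g (fst z)) - (f (snd z) - g (snd z))"] by (simp add: algebra_simps)
  qed
  also have "\<dots> = (1 + d) * (\<integral>z. (g (fst z) - g (snd z))\<^sup>2 \<partial>J s) + (1 + 1 / d) * (\<integral>z. ((f (fst z) - g (fst z)) - (f (snd z) - g (snd z)))\<^sup>2 \<partial>J s)"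
    using En_integrable[OF s0 g] En_integrable[OF s0 fg] by simp
  finally have "En s f \<le> ((1 + d) * (\<integral>z. (g (fst z) - g (snd z))\<^sup>2 \<partial>J s) + (1 + 1 / d) * (\<integral>z. ((f (fst z) - g (fst z)) - (f (snd z) - g (snd z)))\<^sup>2 \<partial>J s)) / (2 * s)"
    unfolding En_def using s by (intro divide_right_mono) auto
  then show ?thesis unfolding En_def by (simp only: add_divide_distrib times_divide_eq_right)
qed

text \<open>At fixed \<open>s\<close> the approximate energy is controlled by the L2 norm; this
  allows limits along approximating sequences.\<close>

lemma En_le_norm:
  assumes s: "0 < s" and f: "L2m f" shows "En s f \<le> 2 * (\<integral>x. (f x)\<^sup>2 \<partial>\<mu>) / s"
proof -
  have s0: "0 \<le> s" using s by simp
  note J2 = J_integral_fst[OF s0 L2_square[OF f]]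
  have "(\<integral>z. (f (fst z) - f (snd z))\<^sup>2 \<partial>J s) \<le> (\<integral>z. 2 * (f (fst z))\<^sup>2 + 2 * (f (snd z))\<^sup>2 \<partial>J s)"
  proof (rule integral_mono[OF En_integrable[OF s0 f]])
    show "integrable (J s) (\<lambda>z. 2 * (f (fst z))\<^sup>2 + 2 * (f (snd z))\<^sup>2)" using J2 by simp
    show "(f (fst z) - f (snd z))\<^sup>2 \<le> 2 * (f (fst z))\<^sup>2 + 2 * (f (snd z))\<^sup>2" for z
      using square_diff_le[of 1 "f (fst z)" "- f (snd z)"] by simp
  qed
  also have "\<dots> = 4 * (\<integral>x. (f x)\<^sup>2 \<partial>\<mu>)" using J2 by simp
  finally show ?thesis unfolding En_def using s by (simp add: field_simps)
qed

lemma En_cmult: "En s (\<lambda>x. a * f x) = a\<^sup>2 * En s f"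
proof -
  have "(a * u - a * v)\<^sup>2 = a\<^sup>2 * (u - v)\<^sup>2" for u v :: real
    by (simp add: power_mult_distrib[symmetric] right_diff_distrib)
  then show ?thesis by (simp add: En_def)
qed

text \<open>Write R for \<open>T (s / 2)\<close>. Then <f, T s f> = |R f|^2, and |f - R f|^2 \<ge> 0
  rearranges to |f|^2 - |R f|^2 \<le> 2 (|f|^2 - <f, R f>).\<close>

lemma En_halve:
  assumes s: "0 < s" and f: "L2m f"
  shows "En s f \<le> En (s / 2) f"
proof -
  have s2: "0 \<le> s / 2" "0 < s / 2" using s by auto
  note Tf = T_L2[OF s2(1) f]
  have "(\<integral>x. f x * T s f x \<partial>\<mu>) = (\<integral>x. f x * T (s / 2) (T (s / 2) f) x \<partial>\<mu>)"
  proof (rule integral_cong_AE)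
    show "AE x in \<mu>. f x * T s f x = f x * T (s / 2) (T (s / 2) f) x"
      using T_add_AE[OF s2(1) s2(1) f] by eventually_elim simp
    show "(\<lambda>x. f x * T s f x) \<in> borel_measurable \<mu>" "(\<lambda>x. f x * T (s / 2) (T (s / 2) f) x) \<in> borel_measurable \<mu>"
      using L2m_measurable[OF f] T_measurable[of s f] T_measurable[OF s2(1) L2m_measurable[OF Tf(1)]] s by (auto cong: measurable_cong_sets)
  qed
  also have "\<dots> = (\<integral>x. T (s / 2) f x * T (s / 2) f x \<partial>\<mu>)"
    by (rule T_symmetric[OF s2(1) f Tf(1)])
  finally have 1: "(\<integral>x. f x * T s f x \<partial>\<mu>) = (\<integral>x. (T (s / 2) f x)\<^sup>2 \<partial>\<mu>)" by (simp add: power2_eq_square)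
  have "0 \<le> (\<integral>x. (f x - T (s / 2) f x)\<^sup>2 \<partial>\<mu>)" by simp
  also have "\<dots> = (\<integral>x. (f x)\<^sup>2 + (T (s / 2) f x)\<^sup>2 - 2 * (f x * T (s / 2) f x) \<partial>\<mu>)"
    by (intro Bochner_Integration.integral_cong refl) (simp add: power2_diff)
  also have "\<dots> = (\<integral>x. (f x)\<^sup>2 \<partial>\<mu>) + (\<integral>x. (T (s / 2) f x)\<^sup>2 \<partial>\<mu>) - 2 * (\<integral>x. f x * T (s / 2) f x \<partial>\<mu>)"
    using L2_square[OF f] L2_square[OF Tf(1)] L2_mult_integrable[OF f Tf(1)] by simp
  finally have "(\<integral>x. (f x)\<^sup>2 \<partial>\<mu>) - (\<integral>x. (T (s / 2) f x)\<^sup>2 \<partial>\<mu>) \<le> 2 * ((\<integral>x. (f x)\<^sup>2 \<partial>\<mu>) - (\<integral>x. f x * T (s / 2) f x \<partial>\<mu>))"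
    by (simp add: algebra_simps)
  then have "((\<integral>x. (f x)\<^sup>2 \<partial>\<mu>) - (\<integral>x. (T (s / 2) f x)\<^sup>2 \<partial>\<mu>)) / s \<le> 2 * ((\<integral>x. (f x)\<^sup>2 \<partial>\<mu>) - (\<integral>x. f x * T (s / 2) f x \<partial>\<mu>)) / s"
    using s by (intro divide_right_mono) auto
  then show ?thesis
    unfolding En_eq[OF s f] En_eq[OF s2(2) f] 1 by (simp add: mult.commute)
qed

lemma En_dyadic_incseq:
  assumes s: "0 < s" and f: "L2m f" shows "incseq (\<lambda>k. En (s / 2 ^ k) f)"
proof (rule incseq_SucI)
  fix k
  have "0 < s / 2 ^ k" using s by simp
  from En_halve[OF this f] show "En (s / 2 ^ k) f \<le> En (s / 2 ^ Suc k) f" by (simp add: mult.commute)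
qed

text \<open>The approximate energy is minus the pairing of \<open>f\<close> with its difference
  quotient, so L2 convergence of the quotients suffices by Cauchy--Schwarz.\<close>

lemma En_generator_limit:
  assumes s: "0 < s" and g: "grel f h"
  shows "(\<lambda>k. En (s / 2 ^ k) f) \<longlonglongrightarrow> - (\<integral>x. f x * h x \<partial>\<mu>)"
proof -
  have f: "L2m f" and h: "L2m h" and lim: "((\<lambda>s. \<integral>x. ((T s f x - f x) / s - h x)\<^sup>2 \<partial>\<mu>) \<longlongrightarrow> 0) (at_right 0)"
    using g by (auto simp: gen_rel_def)
  let ?q = "\<lambda>a. \<integral>x. ((T a f x - f x) / a - h x)\<^sup>2 \<partial>\<mu>"
  have bound: "\<bar>En a f + (\<integral>x. f x * h x \<partial>\<mu>)\<bar> \<le> sqrt (\<integral>x. (f x)\<^sup>2 \<partial>\<mu>) * sqrt (?q a)" if a: "0 < a" for a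
  proof -
    have a0: "0 \<le> a" using a by simp
    note Tf = T_L2(1)[OF a0 f]
    have d: "L2m (\<lambda>x. (T a f x - f x) / a - h x)"
      using L2_diff[OF L2_cmult[OF L2_diff[OF Tf f], of "1 / a"] h] by simp
    have "(\<integral>x. f x * ((T a f x - f x) / a - h x) \<partial>\<mu>) = (\<integral>x. (f x * T a f x - (f x)\<^sup>2) / a - f x * h x \<partial>\<mu>)"
      by (intro Bochner_Integration.integral_cong refl) (simp add: power2_eq_square algebra_simps diff_divide_distrib)
    also have "\<dots> = ((\<integral>x. f x * T a f x \<partial>\<mu>) - (\<integral>x. (f x)\<^sup>2 \<partial>\<mu>)) / a - (\<integral>x. f x * h x \<partial>\<mu>)"
      using L2_square[OF f] L2_mult_integrable[OF f Tf] L2_mult_integrable[OF f h] by simp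
    also have "\<dots> = - (En a f + (\<integral>x. f x * h x \<partial>\<mu>))"
      unfolding En_eq[OF a f] using a by (simp add: field_simps)
    finally have "En a f + (\<integral>x. f x * h x \<partial>\<mu>) = - (\<integral>x. f x * ((T a f x - f x) / a - h x) \<partial>\<mu>)" by simp
    then show ?thesis using L2_cauchy_schwarz[OF f d] by simp
  qed
  have s0: "filterlim (\<lambda>k. s / 2 ^ k) (at_right 0) sequentially"
  proof (rule tendsto_imp_filterlim_at_right)
    have "(\<lambda>k. s * (1 / 2) ^ k) \<longlonglongrightarrow> s * 0" by (intro tendsto_intros LIMSEQ_power_zero) simp
    then show "(\<lambda>k. s / 2 ^ k) \<longlonglongrightarrow> 0" by (simp add: power_divide)
    show "\<forall>\<^sub>F k in sequentially. 0 < s / 2 ^ k" using s by simp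
  qed
  have "(\<lambda>k. ?q (s / 2 ^ k)) \<longlonglongrightarrow> 0" using lim s0 by (rule filterlim_compose)
  then have "(\<lambda>k. sqrt (\<integral>x. (f x)\<^sup>2 \<partial>\<mu>) * sqrt (?q (s / 2 ^ k))) \<longlonglongrightarrow> sqrt (\<integral>x. (f x)\<^sup>2 \<partial>\<mu>) * sqrt 0"
    by (intro tendsto_intros)
  then have l0: "(\<lambda>k. sqrt (\<integral>x. (f x)\<^sup>2 \<partial>\<mu>) * sqrt (?q (s / 2 ^ k))) \<longlonglongrightarrow> 0" by simp
  have "(\<lambda>k. En (s / 2 ^ k) f + (\<integral>x. f x * h x \<partial>\<mu>)) \<longlonglongrightarrow> 0"
  proof (rule Lim_null_comparison[OF _ l0], rule always_eventually, rule allI)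
    fix k
    show "norm (En (s / 2 ^ k) f + (\<integral>x. f x * h x \<partial>\<mu>)) \<le> sqrt (\<integral>x. (f x)\<^sup>2 \<partial>\<mu>) * sqrt (?q (s / 2 ^ k))"
      unfolding real_norm_def using s by (intro bound) simp
  qed
  from tendsto_add[OF this tendsto_const[of "- (\<integral>x. f x * h x \<partial>\<mu>)"]] show ?thesis by simp
qed

section \<open>The domain of the generator\<close>

abbreviation "gdom \<equiv> gen_dom Px X \<mu>"
abbreviation "D0 \<equiv> dform0 Px X \<mu>"

lemma gdom_L2: "gdom f \<Longrightarrow> L2m f" by (auto simp: gen_dom_def gen_rel_def)

lemma En_D0_limit:
  assumes "0 < s" "gdom f" shows "(\<lambda>k. En (s / 2 ^ k) f) \<longlonglongrightarrow> D0 f"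
proof -
  have "grel f (generator Px X \<mu> f)"
    using assms(2) unfolding gen_dom_def generator_def by (rule someI_ex)
  from En_generator_limit[OF assms(1) this] show ?thesis by (simp add: dform0_def)
qed

lemma En_le_D0:
  assumes s: "0 < s" and f: "gdom f" shows "En s f \<le> D0 f"
  using incseq_le[OF En_dyadic_incseq[OF s gdom_L2[OF f]] En_D0_limit[OF s f], of 0] by simp

text \<open>\<open>generator\<close> picks some \<open>h\<close> related to \<open>f\<close>; the
  limit of the approximate energies shows that every choice gives the same value of the
  form.\<close>

lemma D0_eq: assumes "grel f h" shows "D0 f = - (\<integral>x. f x * h x \<partial>\<mu>)"
proof -
  have "gdom f" using assms by (auto simp: gen_dom_def)
  from LIMSEQ_unique[OF En_D0_limit[of 1, OF _ this] En_generator_limit[of 1, OF _ assms]] show ?thesis by simp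
qed

lemma D0_nonneg: "gdom f \<Longrightarrow> 0 \<le> D0 f"
  using En_nonneg[of 1 f] En_le_D0[of 1 f] by simp

lemma gdom_lincomb:
  assumes f: "gdom f" and g: "gdom g" shows "gdom (\<lambda>x. a * f x + b * g x)"
proof -
  obtain h k where h: "grel f h" and k: "grel g k" using f g by (auto simp: gen_dom_def)
  have L: "L2m f" "L2m h" "L2m g" "L2m k" using h k by (auto simp: gen_rel_def)
  let ?qf = "\<lambda>s. \<integral>x. ((T s f x - f x) / s - h x)\<^sup>2 \<partial>\<mu>" and ?qg = "\<lambda>s. \<integral>x. ((T s g x - g x) / s - k x)\<^sup>2 \<partial>\<mu>"
  let ?q = "\<lambda>s. \<integral>x. ((T s (\<lambda>x. a * f x + b * g x) x - (a * f x + b * g x)) / s - (a * h x + b * k x))\<^sup>2 \<partial>\<mu>"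
  have le: "?q s \<le> 2 * a\<^sup>2 * ?qf s + 2 * b\<^sup>2 * ?qg s" if s: "0 < s" for s
  proof -
    have s0: "0 \<le> s" using s by simp
    have df: "L2m (\<lambda>x. (T s f x - f x) / s - h x)"
      using L2_diff[OF L2_cmult[OF L2_diff[OF T_L2(1)[OF s0 L(1)] L(1)], of "1 / s"] L(2)] by simp
    have dg: "L2m (\<lambda>x. (T s g x - g x) / s - k x)"
      using L2_diff[OF L2_cmult[OF L2_diff[OF T_L2(1)[OF s0 L(3)] L(3)], of "1 / s"] L(4)] by simp
    have fg: "L2m (\<lambda>x. a * f x + b * g x)" using L by (intro L2_lincomb)
    have d: "L2m (\<lambda>x. (T s (\<lambda>x. a * f x + b * g x) x - (a * f x + b * g x)) / s - (a * h x + b * k x))"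
      using L2_diff[OF L2_cmult[OF L2_diff[OF T_L2(1)[OF s0 fg] fg], of "1 / s"] L2_lincomb[OF L(2) L(4)]] by simp
    have "?q s \<le> (\<integral>x. 2 * a\<^sup>2 * ((T s f x - f x) / s - h x)\<^sup>2 + 2 * b\<^sup>2 * ((T s g x - g x) / s - k x)\<^sup>2 \<partial>\<mu>)"
    proof (rule integral_mono_AE)
      show "AE x in \<mu>. ((T s (\<lambda>x. a * f x + b * g x) x - (a * f x + b * g x)) / s - (a * h x + b * k x))\<^sup>2
        \<le> 2 * a\<^sup>2 * ((T s f x - f x) / s - h x)\<^sup>2 + 2 * b\<^sup>2 * ((T s g x - g x) / s - k x)\<^sup>2"
        using T_lincomb_AE[OF s0 L(1) L(3), of a b]
      proof eventually_elim
        case (elim x)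
        have "(T s (\<lambda>x. a * f x + b * g x) x - (a * f x + b * g x)) / s - (a * h x + b * k x)
          = a * ((T s f x - f x) / s - h x) + b * ((T s g x - g x) / s - k x)"
          using s unfolding elim by (simp add: field_simps)
        also have "(\<dots>)\<^sup>2 \<le> 2 * (a * ((T s f x - f x) / s - h x))\<^sup>2 + 2 * (b * ((T s g x - g x) / s - k x))\<^sup>2"
          using square_diff_le[of 1] by fastforce
        finally show ?case by (simp add: power_mult_distrib)
      qed
    qed (use L2_square[OF d] L2_square[OF df] L2_square[OF dg] in auto)
    then show ?thesis using L2_square[OF df] L2_square[OF dg] by simp
  qed
  have "((\<lambda>s. 2 * a\<^sup>2 * ?qf s + 2 * b\<^sup>2 * ?qg s) \<longlongrightarrow> 2 * a\<^sup>2 * 0 + 2 * b\<^sup>2 * 0) (at_right 0)"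
    using h k unfolding gen_rel_def by (intro tendsto_intros) auto
  then have lim: "((\<lambda>s. 2 * a\<^sup>2 * ?qf s + 2 * b\<^sup>2 * ?qg s) \<longlongrightarrow> 0) (at_right 0)" by simp
  have ev: "\<forall>\<^sub>F s in at_right 0. ?q s \<le> 2 * a\<^sup>2 * ?qf s + 2 * b\<^sup>2 * ?qg s"
    unfolding eventually_at_right_field by (intro exI[of _ 1] conjI allI impI le) auto
  have "(?q \<longlongrightarrow> 0) (at_right 0)"
    by (rule tendsto_sandwich[OF _ ev tendsto_const lim]) simp
  then have "grel (\<lambda>x. a * f x + b * g x) (\<lambda>x. a * h x + b * k x)"
    unfolding gen_rel_def using L by (auto intro: L2_lincomb)
  then show ?thesis by (auto simp: gen_dom_def)
qed

lemma gdom_diff: "gdom f \<Longrightarrow> gdom g \<Longrightarrow> gdom (\<lambda>x. f x - g x)"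
  using gdom_lincomb[of f g 1 "-1"] by simp

lemma gdom_cmult: "gdom f \<Longrightarrow> gdom (\<lambda>x. a * f x)"
  using gdom_lincomb[of f f a 0] by simp

lemma D0_cmult: assumes "gdom f" shows "D0 (\<lambda>x. a * f x) = a\<^sup>2 * D0 f"
proof -
  have "(\<lambda>k. En (1 / 2 ^ k) (\<lambda>x. a * f x)) \<longlonglongrightarrow> D0 (\<lambda>x. a * f x)"
    by (rule En_D0_limit) (use gdom_cmult[OF assms] in auto)
  moreover have "(\<lambda>k. En (1 / 2 ^ k) (\<lambda>x. a * f x)) \<longlonglongrightarrow> a\<^sup>2 * D0 f"
    unfolding En_cmult using assms by (intro tendsto_intros En_D0_limit) auto
  ultimately show ?thesis by (rule LIMSEQ_unique)
qed

lemma D0_triangle: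
  assumes d: "0 < d" and f: "gdom f" and g: "gdom g"
  shows "D0 f \<le> (1 + d) * D0 g + (1 + 1 / d) * D0 (\<lambda>x. f x - g x)"
proof (rule LIMSEQ_le)
  show "(\<lambda>k. En (1 / 2 ^ k) f) \<longlonglongrightarrow> D0 f" using f by (intro En_D0_limit) auto
  show "(\<lambda>k. (1 + d) * En (1 / 2 ^ k) g + (1 + 1 / d) * En (1 / 2 ^ k) (\<lambda>x. f x - g x))
    \<longlonglongrightarrow> (1 + d) * D0 g + (1 + 1 / d) * D0 (\<lambda>x. f x - g x)"
    using g gdom_diff[OF f g] by (intro tendsto_intros En_D0_limit) auto
  show "\<exists>N. \<forall>k\<ge>N. En (1 / 2 ^ k) f \<le> (1 + d) * En (1 / 2 ^ k) g + (1 + 1 / d) * En (1 / 2 ^ k) (\<lambda>x. f x - g x)"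
    using En_triangle[OF _ d gdom_L2[OF f] gdom_L2[OF g]] by auto
qed

section \<open>The closure of the form\<close>

abbreviation "approx \<equiv> dform_approx Px X \<mu>"

text \<open>\<open>dform\<close> is a \<open>lim\<close> along a chosen sequence, so its value can
  be used only after convergence is known. The Cauchy condition on energies of differences first
  bounds the energies and then, by Young's inequality, makes them a Cauchy sequence.\<close>

lemma approx_convergent:
  assumes a: "approx gk g" shows "convergent (\<lambda>k. D0 (gk k))"
proof -
  have gd: "\<And>k. gdom (gk k)" and cau: "\<And>e. e > 0 \<Longrightarrow> \<exists>N. \<forall>k\<ge>N. \<forall>l\<ge>N. D0 (\<lambda>x. gk k x - gk l x) < e"
    using a by (auto simp: dform_approx_def)
  obtain N1 where N1: "\<And>k l. k \<ge> N1 \<Longrightarrow> l \<ge> N1 \<Longrightarrow> D0 (\<lambda>x. gk k x - gk l x) < 1" using cau[of 1] by auto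
  \<comment> \<open>Young's inequality with weight 1 against the fixed element
    \<open>gk N1\<close>.\<close>
  define C where "C = 2 * D0 (gk N1) + 2"
  have C: "D0 (gk k) \<le> C" if "k \<ge> N1" for k
    using D0_triangle[OF _ gd gd, of 1 k N1] N1[OF that order.refl] by (simp add: C_def)
  have C0: "0 < C" using D0_nonneg[OF gd, of N1] by (simp add: C_def)
  have "Cauchy (\<lambda>k. D0 (gk k))"
  proof (rule CauchyI')
    fix e :: real assume e: "0 < e"
    \<comment> \<open>The errors \<open>d * C\<close> and \<open>(1 + 1 / d) * e'\<close> are
      arranged to be a quarter of \<open>e\<close> each.\<close>
    define d where "d = e / (4 * C)"
    have d: "0 < d" using e C0 by (simp add: d_def)
    define e' where "e' = e / (4 * (1 + 1 / d))"
    have e': "0 < e'" using e d by (simp add: e'_def add_pos_pos)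
    obtain N2 where N2: "\<And>k l. k \<ge> N2 \<Longrightarrow> l \<ge> N2 \<Longrightarrow> D0 (\<lambda>x. gk k x - gk l x) < e'" using cau[OF e'] by auto
    have half: "D0 (gk k) \<le> D0 (gk l) + e / 2" if "k \<ge> max N1 N2" "l \<ge> max N1 N2" for k l
    proof -
      have "D0 (gk k) \<le> (1 + d) * D0 (gk l) + (1 + 1 / d) * D0 (\<lambda>x. gk k x - gk l x)"
        by (rule D0_triangle[OF d gd gd])
      also have "\<dots> \<le> D0 (gk l) + d * C + (1 + 1 / d) * e'"
      proof (rule add_mono)
        show "(1 + d) * D0 (gk l) \<le> D0 (gk l) + d * C"
          using C[of l] that d by (simp add: distrib_right)
        show "(1 + 1 / d) * D0 (\<lambda>x. gk k x - gk l x) \<le> (1 + 1 / d) * e'"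
          using N2[of k l] that d by (intro mult_left_mono) auto
      qed
      also have "d * C = e / 4" using C0 by (simp add: d_def)
      also have "(1 + 1 / d) * e' = e / 4"
      proof -
        have "0 < 1 + 1 / d" using d by (simp add: add_pos_pos)
        moreover have "q \<noteq> 0 \<Longrightarrow> q * (e / (4 * q)) = e / 4" for q :: real by simp
        ultimately show ?thesis unfolding e'_def by (metis less_irrefl)
      qed
      finally show ?thesis by simp
    qed
    show "\<exists>M. \<forall>m\<ge>M. \<forall>n>m. dist (D0 (gk m)) (D0 (gk n)) < e"
    proof (intro exI[of _ "max N1 N2"] allI impI)
      fix m n assume "max N1 N2 \<le> m" "m < n"
      then show "dist (D0 (gk m)) (D0 (gk n)) < e" using half[of m n] half[of n m] e unfolding dist_real_def by linarith
    qed
  qed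
  then show ?thesis by (simp add: Cauchy_convergent_iff)
qed

text \<open>\<open>En s\<close> is dominated by \<open>D0\<close> on the sequence and continuous in
  L2, so the limit inherits the bound up to a factor \<open>1 + d\<close> with \<open>d\<close>
  arbitrarily small.\<close>

lemma En_le_approx_limit:
  assumes a: "approx gk g" and s: "0 < s" and lim: "(\<lambda>k. D0 (gk k)) \<longlonglongrightarrow> D"
  shows "En s g \<le> D"
proof (rule field_le_epsilon)
  have gd: "\<And>k. gdom (gk k)" and g: "L2m g" and l2: "(\<lambda>k. \<integral>x. (gk k x - g x)\<^sup>2 \<partial>\<mu>) \<longlonglongrightarrow> 0"
    using a by (auto simp: dform_approx_def)
  have key: "En s g \<le> (1 + d) * D" if d: "0 < d" for d
  proof (rule LIMSEQ_le_const)
    show "(\<lambda>k. (1 + d) * D0 (gk k) + (1 + 1 / d) * (2 * (\<integral>x. (gk k x - g x)\<^sup>2 \<partial>\<mu>) / s)) \<longlonglongrightarrow> (1 + d) * D"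
      using tendsto_add[OF tendsto_mult[OF tendsto_const[of "1 + d"] lim] tendsto_mult[OF tendsto_const[of "1 + 1 / d"] tendsto_divide[OF tendsto_mult[OF tendsto_const[of 2] l2] tendsto_const[of s]]]] s
      by simp
    show "\<exists>N. \<forall>k\<ge>N. En s g \<le> (1 + d) * D0 (gk k) + (1 + 1 / d) * (2 * (\<integral>x. (gk k x - g x)\<^sup>2 \<partial>\<mu>) / s)"
    proof (intro exI allI impI)
      fix k :: nat
      have "En s g \<le> (1 + d) * En s (gk k) + (1 + 1 / d) * En s (\<lambda>x. g x - gk k x)"
        by (rule En_triangle[OF s d g gdom_L2[OF gd]])
      also have "\<dots> \<le> (1 + d) * D0 (gk k) + (1 + 1 / d) * (2 * (\<integral>x. (g x - gk k x)\<^sup>2 \<partial>\<mu>) / s)"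
        using d by (intro add_mono mult_left_mono En_le_D0[OF s gd] En_le_norm[OF s] L2_diff g gdom_L2[OF gd]) auto
      finally show "En s g \<le> (1 + d) * D0 (gk k) + (1 + 1 / d) * (2 * (\<integral>x. (gk k x - g x)\<^sup>2 \<partial>\<mu>) / s)"
        by (simp add: power2_commute)
    qed
  qed
  fix e :: real assume e: "0 < e"
  have D0': "0 \<le> D" using lim D0_nonneg[OF gd] by (intro LIMSEQ_le_const) auto
  \<comment> \<open>\<open>D + 1\<close> guards against a vanishing energy.\<close>
  define d where "d = e / (D + 1)"
  have "0 < d" using e D0' by (simp add: d_def)
  from key[OF this] have "En s g \<le> D + d * D" by (simp add: distrib_right)
  also have "d * D \<le> e" using e D0' by (simp add: d_def field_simps)
  finally show "En s g \<le> D + e" by simp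
qed

lemma dform_SOME:
  assumes "ddom g"
  obtains gk where "approx gk g" "(\<lambda>k. D0 (gk k)) \<longlonglongrightarrow> dfm g"
proof
  let ?g = "SOME gk. approx gk g"
  show a: "approx ?g g" using assms unfolding dform_dom_def by (rule someI_ex)
  show "(\<lambda>k. D0 (?g k)) \<longlonglongrightarrow> dfm g"
    unfolding dform_def using approx_convergent[OF a] by (simp add: convergent_LIMSEQ_iff)
qed

lemma En_le_dform: "ddom g \<Longrightarrow> 0 < s \<Longrightarrow> En s g \<le> dfm g"
  by (erule dform_SOME) (rule En_le_approx_limit)

text \<open>\<open>dform\<close> at \<open>w\<close> is a limit along an unknown approximating
  sequence \<open>hk\<close>, which must be compared with \<open>g\<close>. Since
  \<open>hk k - hk l\<close> tends to \<open>hk k - g\<close> in L2, the bound through approximate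
  energies makes the energy of \<open>hk k - g\<close> small; this is the closability of the form.
  Equality is asked almost everywhere only, because \<open>w\<close> will come from a Radon--Nikodym
  derivative.\<close>

lemma dform_le_D0:
  assumes g: "gdom g" and w: "w \<in> borel_measurable borel" and eq: "AE x in \<mu>. w x = g x"
  shows "ddom w" "dfm w \<le> D0 g"
proof -
  have gL: "L2m g" using g by (rule gdom_L2)
  have gm: "g \<in> borel_measurable borel" using gL by (rule L2m_measurable)
  have wL: "L2m w"
  proof -
    have "integrable \<mu> (\<lambda>x. (w x)\<^sup>2)"
      using L2_square[OF gL] eq w gm by (subst integrable_cong_AE[where g="\<lambda>x. (g x)\<^sup>2"]) (auto cong: measurable_cong_sets)
    then show ?thesis using w by (simp add: L2_def cong: measurable_cong_sets)
  qed
  have z: "(\<integral>x. (g x - w x)\<^sup>2 \<partial>\<mu>) = 0"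
    using eq w gm by (subst integral_cong_AE[where g="\<lambda>_. 0"]) (auto cong: measurable_cong_sets)
  have "D0 (\<lambda>x. g x - g x) = 0" using D0_cmult[OF g, of 0] by simp
  then have "approx (\<lambda>_. g) w"
    unfolding dform_approx_def using wL g z by auto
  then show dom: "ddom w" by (auto simp: dform_dom_def)
  obtain hk where a: "approx hk w" and lim: "(\<lambda>k. D0 (hk k)) \<longlonglongrightarrow> dfm w"
    using dform_SOME[OF dom] by blast
  have hd: "\<And>k. gdom (hk k)" and cau: "\<And>e. e > 0 \<Longrightarrow> \<exists>N. \<forall>k\<ge>N. \<forall>l\<ge>N. D0 (\<lambda>x. hk k x - hk l x) < e"
    and l2: "(\<lambda>k. \<integral>x. (hk k x - w x)\<^sup>2 \<partial>\<mu>) \<longlonglongrightarrow> 0"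
    using a by (auto simp: dform_approx_def)
  have small: "D0 (\<lambda>x. hk k x - g x) \<le> e" if N: "\<forall>k\<ge>N. \<forall>l\<ge>N. D0 (\<lambda>x. hk k x - hk l x) < e" and k: "k \<ge> N" for N k e
  proof (rule LIMSEQ_le_const2[OF En_D0_limit[of 1, OF _ gdom_diff[OF hd g]]])
    \<comment> \<open>Starting the sequence at \<open>N\<close> keeps the energies of all its terms
      below \<open>e\<close>.\<close>
    have "approx (\<lambda>l x. hk k x - hk (l + N) x) (\<lambda>x. hk k x - g x)"
      unfolding dform_approx_def
    proof (intro conjI allI impI)
      show "L2m (\<lambda>x. hk k x - g x)" by (intro L2_diff gL gdom_L2 hd)
      show "gdom (\<lambda>x. hk k x - hk (l + N) x)" for l by (intro gdom_diff hd)
      have "(\<lambda>l. \<integral>x. (hk (l + N) x - w x)\<^sup>2 \<partial>\<mu>) \<longlonglongrightarrow> 0" using l2 by (rule LIMSEQ_ignore_initial_segment)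
      moreover have "(\<integral>x. (hk (l + N) x - w x)\<^sup>2 \<partial>\<mu>) = (\<integral>x. (hk k x - hk (l + N) x - (hk k x - g x))\<^sup>2 \<partial>\<mu>)" for l
      proof (rule integral_cong_AE)
        note [measurable] = w gm L2m_measurable[OF gdom_L2[OF hd]]
        show "(\<lambda>x. (hk (l + N) x - w x)\<^sup>2) \<in> borel_measurable \<mu>" by measurable
        show "(\<lambda>x. (hk k x - hk (l + N) x - (hk k x - g x))\<^sup>2) \<in> borel_measurable \<mu>" by measurable
        show "AE x in \<mu>. (hk (l + N) x - w x)\<^sup>2 = (hk k x - hk (l + N) x - (hk k x - g x))\<^sup>2"
          using eq by eventually_elim (simp add: power2_commute)
      qed
      ultimately show "(\<lambda>l. \<integral>x. (hk k x - hk (l + N) x - (hk k x - g x))\<^sup>2 \<partial>\<mu>) \<longlonglongrightarrow> 0" by simp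
      fix e' :: real assume "0 < e'"
      then obtain M where M: "\<forall>k\<ge>M. \<forall>l\<ge>M. D0 (\<lambda>x. hk k x - hk l x) < e'" using cau by blast
      have "D0 (\<lambda>x. hk k x - hk (l + N) x - (hk k x - hk (l' + N) x)) < e'" if "l \<ge> M" "l' \<ge> M" for l l'
      proof -
        have "(\<lambda>x. hk k x - hk (l + N) x - (hk k x - hk (l' + N) x)) = (\<lambda>x. hk (l' + N) x - hk (l + N) x)" by auto
        then show ?thesis using M that by auto
      qed
      then show "\<exists>M. \<forall>l\<ge>M. \<forall>l'\<ge>M. D0 (\<lambda>x. hk k x - hk (l + N) x - (hk k x - hk (l' + N) x)) < e'" by blast
    qed
    then have ap: "approx (\<lambda>l x. hk k x - hk (l + N) x) (\<lambda>x. hk k x - g x)" .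
    obtain D where D: "(\<lambda>l. D0 (\<lambda>x. hk k x - hk (l + N) x)) \<longlonglongrightarrow> D"
      using approx_convergent[OF ap] by (auto simp: convergent_def)
    have "D \<le> e" using N k by (intro LIMSEQ_le_const2[OF D]) (auto intro!: exI[of _ 0] less_imp_le)
    then show "\<exists>M. \<forall>j\<ge>M. En (1 / 2 ^ j) (\<lambda>x. hk k x - g x) \<le> e"
      using order_trans[OF En_le_approx_limit[OF ap _ D]] by simp
  qed simp
  have key: "dfm w \<le> (1 + d) * D0 g + (1 + 1 / d) * e" if d: "0 < d" and e: "0 < e" for d e
  proof -
    obtain N where N: "\<forall>k\<ge>N. \<forall>l\<ge>N. D0 (\<lambda>x. hk k x - hk l x) < e" using cau[OF e] by blast
    show ?thesis
    proof (rule LIMSEQ_le_const2[OF lim], intro exI allI impI)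
      fix k assume k: "k \<ge> N"
      have "D0 (hk k) \<le> (1 + d) * D0 g + (1 + 1 / d) * D0 (\<lambda>x. hk k x - g x)" by (rule D0_triangle[OF d hd g])
      also have "\<dots> \<le> (1 + d) * D0 g + (1 + 1 / d) * e" using d small[OF N k] by (intro add_left_mono mult_left_mono) auto
      finally show "D0 (hk k) \<le> (1 + d) * D0 g + (1 + 1 / d) * e" .
    qed
  qed
  show "dfm w \<le> D0 g"
  proof (rule field_le_epsilon)
    fix e :: real assume e: "0 < e"
    \<comment> \<open>\<open>D0 g + 1\<close> guards against a vanishing energy; the two error terms
      are at most \<open>e / 2\<close> each.\<close>
    define d where "d = e / (2 * (D0 g + 1))"
    have D: "0 \<le> D0 g" by (rule D0_nonneg[OF g])
    have d: "0 < d" using e D by (simp add: d_def)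
    have p: "0 < 1 + 1 / d" using d by (simp add: add_pos_pos)
    have "dfm w \<le> (1 + d) * D0 g + (1 + 1 / d) * (e / (2 * (1 + 1 / d)))"
      using d e p by (intro key) auto
    also have "(1 + 1 / d) * (e / (2 * (1 + 1 / d))) = e / 2"
    proof -
      have "q \<noteq> 0 \<Longrightarrow> q * (e / (2 * q)) = e / 2" for q :: real by simp
      then show ?thesis using p by (metis less_irrefl)
    qed
    also have "(1 + d) * D0 g \<le> D0 g + e / 2" using e D by (simp add: d_def field_simps)
    finally show "dfm w \<le> D0 g + e" by simp
  qed
qed

end

subsection \<open>Mollification in time\<close>

text \<open>Both sides are the integral over \<open>[0, a + s)\<close> minus those over
  \<open>[0, a)\<close> and \<open>[0, s)\<close>, an expression symmetric in \<open>a\<close> and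
  \<open>s\<close>. It trades the increment of a time average for the average of an
  increment.\<close>

lemma average_shift:
  fixes \<psi> :: "real \<Rightarrow> real"
  assumes \<psi>[measurable]: "\<psi> \<in> borel_measurable borel" and b: "\<And>r. \<bar>\<psi> r\<bar> \<le> b" and a: "0 < a" and s: "0 < s"
  shows "s * ((\<integral>r. \<psi> (a + r) \<partial>unif s) - (\<integral>r. \<psi> r \<partial>unif s))
    = a * ((\<integral>r. \<psi> (s + r) \<partial>unif a) - (\<integral>r. \<psi> r \<partial>unif a))"
  using integral_indicator_shift[OF \<psi> b, of a s] integral_indicator_shift[OF \<psi> b, of s a] a s
  by (simp add: integral_uniform_Ico algebra_simps)

lemma (in prob_space) integral_square_le:
  fixes f :: "'a \<Rightarrow> real"
  assumes [measurable]: "f \<in> borel_measurable M" and b: "\<And>x. \<bar>f x\<bar> \<le> b"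
  shows "(\<integral>x. f x \<partial>M)\<^sup>2 \<le> (\<integral>x. (f x)\<^sup>2 \<partial>M)"
proof -
  have f2: "integrable M (\<lambda>x. (f x)\<^sup>2)"
  proof (rule integrable_const_bound[where B="b\<^sup>2"])
    show "AE x in M. norm ((f x)\<^sup>2) \<le> b\<^sup>2" using power_mono[OF b, of _ 2] by simp
  qed simp
  have "\<bar>\<integral>x. f x * 1 \<partial>M\<bar> \<le> sqrt (\<integral>x. (f x)\<^sup>2 \<partial>M) * sqrt (\<integral>x. 1\<^sup>2 \<partial>M)"
    using f2 by (intro L2_cauchy_schwarz) (auto simp: L2_def)
  then have "\<bar>\<integral>x. f x \<partial>M\<bar> \<le> sqrt (\<integral>x. (f x)\<^sup>2 \<partial>M)" by (simp add: prob_space)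
  then have "\<bar>\<integral>x. f x \<partial>M\<bar>\<^sup>2 \<le> (sqrt (\<integral>x. (f x)\<^sup>2 \<partial>M))\<^sup>2" by (intro power_mono) auto
  then show ?thesis by simp
qed

lemma integral_fubini_bounded:
  fixes H :: "'b \<Rightarrow> 'c \<Rightarrow> real"
  assumes A: "prob_space A" and B: "prob_space B" and H[measurable]: "(\<lambda>(x, y). H x y) \<in> borel_measurable (A \<Otimes>\<^sub>M B)"
    and b: "\<And>x y. \<bar>H x y\<bar> \<le> c"
  shows "(\<integral>x. (\<integral>y. H x y \<partial>B) \<partial>A) = (\<integral>y. (\<integral>x. H x y \<partial>A) \<partial>B)"
proof -
  interpret A: prob_space A by fact
  interpret B: prob_space B by fact
  interpret AB: pair_prob_space A B ..
  have "integrable (A \<Otimes>\<^sub>M B) (\<lambda>(x, y). H x y)"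
    by (rule AB.P.integrable_const_bound[where B=c]) (use b in auto)
  from AB.Fubini_integral[OF this] show ?thesis by simp
qed

text \<open>Convexity preserves a positive first increment, and the resulting linear growth
  contradicts the bound.\<close>

lemma convex_bounded_le:
  fixes x :: "nat \<Rightarrow> real"
  assumes conv: "\<And>k. 2 * x (Suc k) \<le> x k + x (Suc (Suc k))" and b: "\<And>k. x k \<le> C"
  shows "x 1 \<le> x 0"
proof (rule ccontr)
  assume "\<not> x 1 \<le> x 0"
  define d where "d = x 1 - x 0"
  have d: "0 < d" using \<open>\<not> x 1 \<le> x 0\<close> by (simp add: d_def)
  have inc: "d \<le> x (Suc k) - x k" for k
  proof (induction k)
    case 0 show ?case by (simp add: d_def)
  next
    case (Suc k) then show ?case using conv[of k] by linarith
  qed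
  have lin: "x 0 + real k * d \<le> x k" for k
  proof (induction k)
    case 0 show ?case by simp
  next
    case (Suc k) then show ?case using inc[of k] by (simp add: algebra_simps)
  qed
  obtain k :: nat where "C - x 0 < real k * d" using reals_Archimedean3[OF d] by blast
  then show False using lin[of k] b[of k] by linarith
qed

context markov_setting
begin

lemma L2m_bounded:
  assumes "f \<in> borel_measurable borel" "\<And>x. \<bar>f x\<bar> \<le> c" shows "L2m f"
proof -
  interpret m: prob_space \<mu> by (rule prob_mu)
  have "integrable \<mu> (\<lambda>x. (f x)\<^sup>2)"
  proof (rule m.integrable_const_bound[where B="c\<^sup>2"])
    show "AE x in \<mu>. norm ((f x)\<^sup>2) \<le> c\<^sup>2" using power_mono[OF assms(2), of _ 2] by simp
    show "(\<lambda>x. (f x)\<^sup>2) \<in> borel_measurable \<mu>" using assms(1) by (auto cong: measurable_cong_sets)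
  qed
  then show ?thesis using assms(1) by (auto simp: L2_def cong: measurable_cong_sets)
qed

end

text \<open>For bounded \<open>g\<close> the functions \<open>T r g\<close> are genuine integrals
  everywhere, so the semigroup law and Fubini hold pointwise. Square roots of one-particle marginals
  will be instances.\<close>

locale bounded_function = markov_setting Px X \<mu>
  for Px :: "'a::polish_space \<Rightarrow> 'w measure" and X :: "real \<Rightarrow> 'w \<Rightarrow> 'a" and \<mu> :: "'a measure" +
  fixes g :: "'a \<Rightarrow> real" and U :: real
  assumes g_measurable[measurable]: "g \<in> borel_measurable borel" and g_nonneg: "\<And>x. 0 \<le> g x" and g_le: "\<And>x. g x \<le> U"
begin

lemma g_L2: "L2m g" using g_nonneg g_le by (intro L2m_bounded[where c=U]) auto

lemma T_bounds: assumes r: "0 \<le> r" shows "0 \<le> T r g x" "T r g x \<le> U"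
proof -
  interpret prob_space "K r x" using r by (rule prob_K)
  have "integrable (K r x) g"
    using g_nonneg g_le by (intro integrable_const_bound[where B=U]) (auto cong: measurable_cong_sets)
  then show "0 \<le> T r g x" "T r g x \<le> U"
    unfolding T_eq[OF r g_measurable] using g_nonneg g_le by (auto intro!: integral_le_const)
qed

lemma T_integrable: "0 \<le> r \<Longrightarrow> 0 \<le> s \<Longrightarrow> integrable (K r x) (T s g)"
  using T_bounds T_measurable[OF _ g_measurable]
  by (intro finite_measure.integrable_const_bound[OF prob_space.finite_measure[OF prob_K], where B=U])
     (auto cong: measurable_cong_sets)

lemma T_add: assumes r: "0 \<le> r" and s: "0 \<le> s" shows "T r (T s g) x = T (r + s) g x"
proof -
  have rs: "0 \<le> r + s" using r s by simp
  have Ks: "K s \<in> K r x \<rightarrow>\<^sub>M prob_algebra borel" using K_kernel[OF s] by (simp cong: measurable_cong_sets)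
  interpret prob_space "K (r + s) x" using rs by (rule prob_K)
  have i: "integrable (K r x \<bind> K s) g" unfolding K_add[OF r s, symmetric]
    using g_nonneg g_le by (intro integrable_const_bound[where B=U]) (auto cong: measurable_cong_sets)
  have "T r (T s g) x = (\<integral>y. (\<integral>z. g z \<partial>K s y) \<partial>K r x)"
    unfolding T_eq[OF r T_measurable[OF s g_measurable]]
    by (intro Bochner_Integration.integral_cong refl T_eq s g_measurable)
  then show ?thesis
    unfolding T_eq[OF rs g_measurable] K_add[OF r s]
    using integral_bind_integrable(2)[OF Ks prob_K[OF r] i] by (simp only:)
qed

lemma T_zero: "T 0 g x = g x"
  unfolding T_eq[OF order.refl g_measurable] K_0 by (rule integral_return) auto

lemma T_L2m: "0 \<le> r \<Longrightarrow> L2m (T r g)"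
  using T_bounds T_measurable[OF _ g_measurable] by (intro L2m_bounded[where c=U]) auto

text \<open>The orbit of \<open>g\<close>, frozen at negative times so as to be jointly measurable
  on the whole line.\<close>

definition G :: "real \<Rightarrow> 'a \<Rightarrow> real" where "G r x = T (max 0 r) g x"

lemma G_bound: "\<bar>G r x\<bar> \<le> U" using T_bounds[of "max 0 r" x] by (simp add: G_def)
lemma G_nonneg: "0 \<le> G r x" using T_bounds[of "max 0 r" x] by (simp add: G_def)

text \<open>For nonnegative \<open>g\<close> the Bochner integral agrees with an
  \<open>nn_integral\<close> against the kernel \<open>Px\<close>, which is jointly measurable in
  time and starting point.\<close>

lemma G_joint[measurable]: "(\<lambda>(r, x). G r x) \<in> borel_measurable (borel \<Otimes>\<^sub>M borel)"
proof -
  have "(\<lambda>z. (fst (fst z), snd z)) \<in> (borel \<Otimes>\<^sub>M borel) \<Otimes>\<^sub>M \<Omega> \<rightarrow>\<^sub>M (borel \<Otimes>\<^sub>M \<Omega> :: (real \<times> 'w) measure)" by measurable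
  from measurable_compose[OF this X_joint]
  have 1: "(\<lambda>z. X (max 0 (fst (fst z))) (snd z)) \<in> (borel \<Otimes>\<^sub>M (borel :: 'a measure)) \<Otimes>\<^sub>M \<Omega> \<rightarrow>\<^sub>M borel" by simp
  have "(\<lambda>z. \<integral>\<^sup>+\<omega>. ennreal (g (X (max 0 (fst z)) \<omega>)) \<partial>Px (snd z)) \<in> borel_measurable (borel \<Otimes>\<^sub>M borel)"
    using 1 by (intro nn_integral_measurable_subprob_algebra2[where N=\<Omega>]
        measurable_compose[OF measurable_snd measurable_prob_algebraD[OF Px_kernel]]) (simp add: case_prod_beta')
  then have 2: "(\<lambda>z. enn2real (\<integral>\<^sup>+\<omega>. ennreal (g (X (max 0 (fst z)) \<omega>)) \<partial>Px (snd z))) \<in> borel_measurable (borel \<Otimes>\<^sub>M borel)"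
    by measurable
  have "G r x = enn2real (\<integral>\<^sup>+\<omega>. ennreal (g (X (max 0 r) \<omega>)) \<partial>Px x)" for r x
  proof -
    have [measurable]: "X (max 0 r) \<in> Px x \<rightarrow>\<^sub>M borel" by (rule X_measurable_Px) simp
    show ?thesis unfolding G_def Pt_def using g_nonneg by (intro integral_eq_nn_integral) auto
  qed
  then show ?thesis using 2 by (simp add: case_prod_beta')
qed

lemma G_joint_swap: "(\<lambda>(x, r). G r x) \<in> borel_measurable (borel \<Otimes>\<^sub>M borel)"
  using measurable_compose[OF measurable_pair_swap' G_joint] by (simp add: case_prod_beta')

lemma G_measurable1[measurable]: "(\<lambda>r. G r x) \<in> borel_measurable borel"
proof -
  have "(\<lambda>r. (r, x)) \<in> borel \<rightarrow>\<^sub>M (borel \<Otimes>\<^sub>M borel)" by simp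
  from measurable_compose[OF this G_joint] show ?thesis by simp
qed

lemma G_measurable2[measurable]: "G r \<in> borel_measurable borel"
  unfolding G_def[abs_def] using T_measurable[of "max 0 r" g] by simp

text \<open>Autocorrelation of the orbit. By symmetry the inner product of two orbit points depends
  on the sum of their times only, so all distances and energies along the orbit are combinations of
  values of \<open>\<kappa>\<close>.\<close>

definition \<kappa> :: "real \<Rightarrow> real" where "\<kappa> r = (\<integral>x. g x * T r g x \<partial>\<mu>)"

lemma \<kappa>_eq: assumes a: "0 \<le> a" and b: "0 \<le> b" shows "(\<integral>x. T a g x * T b g x \<partial>\<mu>) = \<kappa> (a + b)"
proof -
  have "(\<integral>x. T a g x * T b g x \<partial>\<mu>) = (\<integral>x. T b g x * T a g x \<partial>\<mu>)" by (simp add: mult.commute)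
  also have "\<dots> = (\<integral>x. g x * T a (T b g) x \<partial>\<mu>)" by (rule T_symmetric[OF a T_L2m[OF b] g_L2])
  finally show ?thesis by (simp add: T_add[OF a b] \<kappa>_def)
qed

lemma \<kappa>_square: "0 \<le> a \<Longrightarrow> \<kappa> (2 * a) = (\<integral>x. (T a g x)\<^sup>2 \<partial>\<mu>)"
  unfolding mult_2 power2_eq_square by (rule \<kappa>_eq[symmetric])

text \<open>Both values are squared norms at half time, and the additional half time
  \<open>(b - a) / 2\<close> acts as a contraction.\<close>

lemma \<kappa>_decreasing: assumes a: "0 \<le> a" and b: "a \<le> b" shows "\<kappa> b \<le> \<kappa> a"
proof -
  have "\<kappa> b = (\<integral>x. (T (b / 2) g x)\<^sup>2 \<partial>\<mu>)" using \<kappa>_square[of "b / 2"] a b by simp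
  also have "\<dots> = (\<integral>x. (T ((b - a) / 2) (T (a / 2) g) x)\<^sup>2 \<partial>\<mu>)"
    using T_add[of "(b - a) / 2" "a / 2"] a b by (simp add: add_divide_distrib[symmetric])
  also have "\<dots> \<le> (\<integral>x. (T (a / 2) g x)\<^sup>2 \<partial>\<mu>)" using a b by (intro T_L2(2) T_L2m) auto
  also have "\<dots> = \<kappa> a" using \<kappa>_square[of "a / 2"] a by simp
  finally show ?thesis .
qed

lemma \<kappa>_zero: "\<kappa> 0 = (\<integral>x. (g x)\<^sup>2 \<partial>\<mu>)" using \<kappa>_square[of 0] by (simp add: T_zero)

lemma \<kappa>_nonneg: "0 \<le> a \<Longrightarrow> 0 \<le> \<kappa> a" using \<kappa>_square[of "a / 2"] by simp

lemma En_\<kappa>: assumes s: "0 < s" shows "s * En s g = \<kappa> 0 - \<kappa> s"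
  unfolding \<kappa>_zero \<kappa>_def[of s] En_eq[OF s g_L2] using s by simp

lemma diff_square:
  assumes a: "0 \<le> a" and b: "0 \<le> b"
  shows "(\<integral>x. (T a g x - T b g x)\<^sup>2 \<partial>\<mu>) = \<kappa> (2 * a) + \<kappa> (2 * b) - 2 * \<kappa> (a + b)"
proof -
  have "(\<integral>x. (T a g x - T b g x)\<^sup>2 \<partial>\<mu>) = (\<integral>x. (T a g x)\<^sup>2 + (T b g x)\<^sup>2 - 2 * (T a g x * T b g x) \<partial>\<mu>)"
    by (intro Bochner_Integration.integral_cong refl) (simp add: power2_diff)
  also have "\<dots> = (\<integral>x. (T a g x)\<^sup>2 \<partial>\<mu>) + (\<integral>x. (T b g x)\<^sup>2 \<partial>\<mu>) - 2 * (\<integral>x. T a g x * T b g x \<partial>\<mu>)"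
    using L2_square[OF T_L2m[OF a]] L2_square[OF T_L2m[OF b]] L2_mult_integrable[OF T_L2m[OF a] T_L2m[OF b]] by simp
  finally show ?thesis by (simp add: \<kappa>_square[OF a] \<kappa>_square[OF b] \<kappa>_eq[OF a b])
qed

text \<open>Along \<open>0, r, 2r, \<dots>\<close> the function \<open>a \<mapsto> \<kappa> a - \<kappa> (a + s)\<close> is convex and bounded, hence nonincreasing.\<close>

lemma \<kappa>_increments:
  assumes r: "0 \<le> r" and s: "0 < s" shows "\<kappa> r - \<kappa> (r + s) \<le> \<kappa> 0 - \<kappa> s"
proof -
  let ?x = "\<lambda>k::nat. \<kappa> (real k * r) - \<kappa> (real k * r + s)"
  have "?x 1 \<le> ?x 0"
  proof (rule convex_bounded_le[where x="?x" and C="\<kappa> 0"])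
    fix k
    \<comment> \<open>The times are halved so that pairings of \<open>T ?a g\<close> and
      \<open>T ?b g\<close> produce \<open>\<kappa>\<close> at \<open>k r\<close>,
      \<open>(k + 1) r\<close> and \<open>(k + 2) r\<close>. Nonnegativity of the approximate energy
      of their difference is then the convexity of \<open>?x\<close> at
      \<open>k + 1\<close>.\<close>
    let ?a = "real k * r / 2" and ?b = "(real k + 2) * r / 2"
    have a: "0 \<le> ?a" and b: "0 \<le> ?b" and s0: "0 \<le> s" using r s by auto
    let ?d = "\<lambda>x. T ?a g x - T ?b g x"
    have dL: "L2m ?d" by (intro L2_diff T_L2m a b)
    have Td: "T s ?d x = T (?a + s) g x - T (?b + s) g x" for x
    proof -
      have m: "?d \<in> borel_measurable borel" using dL by (rule L2m_measurable)
      have "T s ?d x = T s (T ?a g) x - T s (T ?b g) x"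
        unfolding T_eq[OF s0 m] T_eq[OF s0 T_measurable[OF a g_measurable]] T_eq[OF s0 T_measurable[OF b g_measurable]]
        by (rule Bochner_Integration.integral_diff) (intro T_integrable s0 a b)+
      then show ?thesis by (simp only: T_add[OF s0 a] T_add[OF s0 b] add.commute[of s])
    qed
    have as: "0 \<le> ?a + s" "0 \<le> ?b + s" using a b s by auto
    note ints = L2_mult_integrable[OF T_L2m[OF a] T_L2m[OF as(1)]] L2_mult_integrable[OF T_L2m[OF b] T_L2m[OF as(1)]]
      L2_mult_integrable[OF T_L2m[OF a] T_L2m[OF as(2)]] L2_mult_integrable[OF T_L2m[OF b] T_L2m[OF as(2)]]
    have "(\<integral>x. ?d x * T s ?d x \<partial>\<mu>) = (\<integral>x. T ?a g x * T (?a + s) g x - T ?b g x * T (?a + s) g x - T ?a g x * T (?b + s) g x + T ?b g x * T (?b + s) g x \<partial>\<mu>)"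
      unfolding Td by (intro Bochner_Integration.integral_cong refl) (simp add: algebra_simps)
    also have "\<dots> = \<kappa> (?a + (?a + s)) - \<kappa> (?b + (?a + s)) - \<kappa> (?a + (?b + s)) + \<kappa> (?b + (?b + s))"
      unfolding \<kappa>_eq[OF a as(1), symmetric] \<kappa>_eq[OF b as(1), symmetric] \<kappa>_eq[OF a as(2), symmetric] \<kappa>_eq[OF b as(2), symmetric]
      using ints by simp
    finally have 1: "(\<integral>x. ?d x * T s ?d x \<partial>\<mu>) = \<kappa> (?a + (?a + s)) - \<kappa> (?b + (?a + s)) - \<kappa> (?a + (?b + s)) + \<kappa> (?b + (?b + s))" .
    have "0 \<le> s * En s ?d" using s En_nonneg[of s] by simp
    then have le: "(\<integral>x. ?d x * T s ?d x \<partial>\<mu>) \<le> \<kappa> (2 * ?a) + \<kappa> (2 * ?b) - 2 * \<kappa> (?a + ?b)"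
      unfolding En_eq[OF s dL] diff_square[OF a b] using s by simp
    have e: "2 * ?a = real k * r" "2 * ?b = real (Suc (Suc k)) * r" "?a + ?b = real (Suc k) * r"
      "?a + (?a + s) = real k * r + s" "?b + (?b + s) = real (Suc (Suc k)) * r + s"
      "?b + (?a + s) = real (Suc k) * r + s" "?a + (?b + s) = real (Suc k) * r + s"
      by (auto simp: field_simps)
    from le[unfolded 1 e] show "2 * ?x (Suc k) \<le> ?x k + ?x (Suc (Suc k))"
      unfolding right_diff_distrib by linarith
  next
    fix k
    show "?x k \<le> \<kappa> 0"
      using \<kappa>_decreasing[of 0 "real k * r"] \<kappa>_nonneg[of "real k * r + s"] r s by auto
  qed
  then show ?thesis by simp
qed

section \<open>The time average of an orbit\<close>

definition avg :: "real \<Rightarrow> 'a \<Rightarrow> real" where "avg s x = (\<integral>r. G r x \<partial>unif s)"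

lemma avg_measurable[measurable]: "0 < s \<Longrightarrow> avg s \<in> borel_measurable borel"
proof -
  assume s: "0 < s"
  interpret prob_space "unif s" using s by (rule prob_space_uniform_Ico)
  have "(\<lambda>(x, r). G r x) \<in> borel_measurable (borel \<Otimes>\<^sub>M unif s)"
    using G_joint_swap by (simp cong: measurable_cong_sets sets_pair_measure_cong)
  then show ?thesis unfolding avg_def[abs_def] by (rule borel_measurable_lebesgue_integral)
qed

lemma avg_bounds: assumes s: "0 < s" shows "0 \<le> avg s x" "avg s x \<le> U"
proof -
  interpret prob_space "unif s" using s by (rule prob_space_uniform_Ico)
  have "integrable (unif s) (\<lambda>r. G r x)"
    using G_bound by (intro integrable_const_bound[where B=U]) auto
  then show "0 \<le> avg s x" "avg s x \<le> U"
    unfolding avg_def using G_nonneg G_bound by (auto intro!: integral_le_const simp: abs_le_iff)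
qed

lemma avg_L2: "0 < s \<Longrightarrow> L2m (avg s)"
  using avg_bounds by (intro L2m_bounded[where c=U]) auto

lemma T_avg:
  assumes a: "0 \<le> a" and s: "0 < s"
  shows "T a (avg s) x = (\<integral>r. G (a + r) x \<partial>unif s)"
proof -
  have "T a (avg s) x = (\<integral>y. (\<integral>r. G r y \<partial>unif s) \<partial>K a x)"
    unfolding T_eq[OF a avg_measurable[OF s]] avg_def ..
  also have "\<dots> = (\<integral>r. (\<integral>y. G r y \<partial>K a x) \<partial>unif s)"
  proof (rule integral_fubini_bounded[OF prob_K[OF a] prob_space_uniform_Ico[OF s] _ G_bound])
    show "(\<lambda>(y, r). G r y) \<in> borel_measurable (K a x \<Otimes>\<^sub>M unif s)"
      using G_joint_swap by (simp cong: measurable_cong_sets sets_pair_measure_cong)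
  qed
  also have "\<dots> = (\<integral>r. G (a + r) x \<partial>unif s)"
  proof (rule integral_cong_AE)
    show "AE r in unif s. (\<integral>y. G r y \<partial>K a x) = G (a + r) x"
      using AE_uniform_Ico[of s]
    proof eventually_elim
      case (elim r)
      then have "G r = T r g" "G (a + r) x = T (a + r) g x" using a by (auto simp: G_def max_def)
      then show ?case using T_add[OF a, of r x] elim by (simp add: T_eq[OF a T_measurable[OF _ g_measurable]])
    qed
    have "(\<lambda>(r, y). G r y) \<in> borel_measurable (borel \<Otimes>\<^sub>M K a x)"
      using G_joint by (simp cong: measurable_cong_sets sets_pair_measure_cong)
    from sigma_finite_measure.borel_measurable_lebesgue_integral[OF prob_space_imp_sigma_finite[OF prob_K[OF a]] this]
    show "(\<lambda>r. \<integral>y. G r y \<partial>K a x) \<in> borel_measurable (unif s)" by simp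
  qed simp
  finally show ?thesis .
qed

lemma fubini_mu:
  fixes s :: real
  assumes s: "0 < s" and H: "(\<lambda>(r, x). H r x) \<in> borel_measurable (borel \<Otimes>\<^sub>M borel)" and b: "\<And>r x. \<bar>H r x\<bar> \<le> (c::real)"
  shows "(\<integral>x. (\<integral>r. H r x \<partial>unif s) \<partial>\<mu>) = (\<integral>r. (\<integral>x. H r x \<partial>\<mu>) \<partial>unif s)"
  by (rule integral_fubini_bounded[symmetric, OF prob_space_uniform_Ico[OF s] prob_mu _ b])
     (use H in \<open>simp cong: measurable_cong_sets sets_pair_measure_cong\<close>)

text \<open>Jensen in the offset, then Fubini: an average over offsets is no worse in mean square
  than the worst offset.\<close>

lemma average_square_bound:
  fixes s :: real
  assumes s: "0 < s" and H[measurable]: "(\<lambda>(r, x). H r x) \<in> borel_measurable (borel \<Otimes>\<^sub>M borel)" and b: "\<And>r x. \<bar>H r x\<bar> \<le> (c::real)"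
    and le: "\<And>r. 0 \<le> r \<Longrightarrow> r < s \<Longrightarrow> (\<integral>x. (H r x)\<^sup>2 \<partial>\<mu>) \<le> q"
  shows "(\<integral>x. (\<integral>r. H r x \<partial>unif s)\<^sup>2 \<partial>\<mu>) \<le> q"
proof -
  interpret m: prob_space \<mu> by (rule prob_mu)
  interpret V: prob_space "unif s" using s by (rule prob_space_uniform_Ico)
  have c2: "\<bar>(H r x)\<^sup>2\<bar> \<le> c\<^sup>2" for r x using power_mono[OF b[of r x], of 2] by simp
  have H1: "(\<lambda>r. H r x) \<in> borel_measurable borel" for x
  proof -
    have "(\<lambda>r. (r, x)) \<in> borel \<rightarrow>\<^sub>M (borel \<Otimes>\<^sub>M borel)" by simp
    from measurable_compose[OF this H] show ?thesis by simp
  qed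
  have H2: "(\<lambda>(r, x). (H r x)\<^sup>2) \<in> borel_measurable (borel \<Otimes>\<^sub>M borel)"
    using H by (simp add: case_prod_beta')
  have sw: "(\<lambda>(x, r). J r x) \<in> borel_measurable (\<mu> \<Otimes>\<^sub>M unif s)"
    if "(\<lambda>(r, x). J r x) \<in> borel_measurable (borel \<Otimes>\<^sub>M borel)" for J :: "real \<Rightarrow> 'a \<Rightarrow> real"
  proof -
    have "(\<lambda>(x, r). J r x) \<in> borel_measurable (borel \<Otimes>\<^sub>M borel)"
      using measurable_compose[OF measurable_pair_swap' that] by (simp add: case_prod_beta')
    then show ?thesis by (simp cong: measurable_cong_sets sets_pair_measure_cong)
  qed
  note im[measurable] = V.borel_measurable_lebesgue_integral[OF sw[OF H]] V.borel_measurable_lebesgue_integral[OF sw[OF H2]]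
  have "(\<integral>x. (\<integral>r. H r x \<partial>unif s)\<^sup>2 \<partial>\<mu>) \<le> (\<integral>x. (\<integral>r. (H r x)\<^sup>2 \<partial>unif s) \<partial>\<mu>)"
  proof (rule integral_mono)
    have le: "(\<integral>r. H r x \<partial>unif s)\<^sup>2 \<le> (\<integral>r. (H r x)\<^sup>2 \<partial>unif s)" for x
      using H1 b by (intro V.integral_square_le) auto
    have le2: "(\<integral>r. (H r x)\<^sup>2 \<partial>unif s) \<le> c\<^sup>2" for x
      using H1[of x] c2 by (intro V.integral_le_const V.integrable_const_bound[where B="c\<^sup>2"] AE_I2) auto
    show "integrable \<mu> (\<lambda>x. (\<integral>r. H r x \<partial>unif s)\<^sup>2)"
      using order_trans[OF le le2] by (intro m.integrable_const_bound[where B="c\<^sup>2"] AE_I2) auto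
    show "integrable \<mu> (\<lambda>x. \<integral>r. (H r x)\<^sup>2 \<partial>unif s)"
      using le2 by (intro m.integrable_const_bound[where B="c\<^sup>2"] AE_I2) auto
    show "(\<integral>r. H r x \<partial>unif s)\<^sup>2 \<le> (\<integral>r. (H r x)\<^sup>2 \<partial>unif s)" for x by (rule le)
  qed
  also have "\<dots> = (\<integral>r. (\<integral>x. (H r x)\<^sup>2 \<partial>\<mu>) \<partial>unif s)"
    by (rule fubini_mu[OF s H2 c2])
  also have "\<dots> \<le> q"
  proof (rule V.integral_le_const)
    show "AE r in unif s. (\<integral>x. (H r x)\<^sup>2 \<partial>\<mu>) \<le> q"
      using AE_uniform_Ico[of s] by eventually_elim (use le in auto)
    have m2: "(\<lambda>r. \<integral>x. (H r x)\<^sup>2 \<partial>\<mu>) \<in> borel_measurable borel"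
      using H2 by (intro m.borel_measurable_lebesgue_integral) (simp cong: measurable_cong_sets sets_pair_measure_cong)
    have b2: "\<bar>\<integral>x. (H r x)\<^sup>2 \<partial>\<mu>\<bar> \<le> c\<^sup>2" for r
    proof -
      have H2r: "(\<lambda>x. (H r x)\<^sup>2) \<in> borel_measurable \<mu>"
      proof -
        have "(\<lambda>x. (r, x)) \<in> borel \<rightarrow>\<^sub>M (borel \<Otimes>\<^sub>M borel)" by simp
        from measurable_compose[OF this H] show ?thesis by (simp cong: measurable_cong_sets)
      qed
      have "(\<integral>x. (H r x)\<^sup>2 \<partial>\<mu>) \<le> c\<^sup>2"
        using c2 H2r by (intro m.integral_le_const m.integrable_const_bound[where B="c\<^sup>2"] AE_I2) auto
      then show ?thesis by simp
    qed
    show "integrable (unif s) (\<lambda>r. \<integral>x. (H r x)\<^sup>2 \<partial>\<mu>)"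
      using m2 b2 by (intro V.integrable_const_bound[where B="c\<^sup>2"]) auto
  qed
  finally show ?thesis .
qed

text \<open>The squared distance of \<open>T r g\<close> from \<open>g\<close> is \<kappa>(2r) +
  \<kappa>(0) - 2\<kappa>(r). For r < s monotonicity bounds it by \<kappa>(0) - \<kappa>(s), which
  is \<open>s * En s g\<close>.\<close>

lemma avg_close:
  assumes s: "0 < s" shows "(\<integral>x. (avg s x - g x)\<^sup>2 \<partial>\<mu>) \<le> s * En s g"
proof -
  let ?V = "unif s"
  interpret V: prob_space ?V using s by (rule prob_space_uniform_Ico)
  have VU: "measure ?V UNIV = 1" using V.prob_space by simp
  have "integrable ?V (\<lambda>r. G r x)" for x
    using G_bound by (intro V.integrable_const_bound[where B=U]) auto
  then have "avg s x - g x = (\<integral>r. G r x - g x \<partial>?V)" for x unfolding avg_def using VU by simp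
  then have "(\<integral>x. (avg s x - g x)\<^sup>2 \<partial>\<mu>) = (\<integral>x. (\<integral>r. G r x - g x \<partial>?V)\<^sup>2 \<partial>\<mu>)" by simp
  also have "\<dots> \<le> s * En s g"
  proof (rule average_square_bound[OF s, where c=U])
    show "(\<lambda>(r, x). G r x - g x) \<in> borel_measurable (borel \<Otimes>\<^sub>M borel)"
      using G_joint unfolding case_prod_beta'
      by (intro borel_measurable_diff measurable_compose[OF measurable_snd g_measurable]) auto
    show "\<bar>G r x - g x\<bar> \<le> U" for r x
      using G_nonneg[of r x] G_bound[of r x] g_nonneg[of x] g_le[of x] by (auto simp: abs_le_iff)
    fix r assume r: "0 \<le> r" "r < s"
    have "(\<integral>x. (G r x - g x)\<^sup>2 \<partial>\<mu>) = (\<integral>x. (T r g x - T 0 g x)\<^sup>2 \<partial>\<mu>)" using r by (simp add: G_def T_zero max_def)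
    also have "\<dots> = \<kappa> (2 * r) + \<kappa> 0 - 2 * \<kappa> r" using diff_square[of r 0] r by simp
    also have "\<dots> \<le> \<kappa> 0 - \<kappa> s" using \<kappa>_decreasing[of r "2 * r"] \<kappa>_decreasing[of r s] r by simp
    finally show "(\<integral>x. (G r x - g x)\<^sup>2 \<partial>\<mu>) \<le> s * En s g" by (simp add: En_\<kappa>[OF s])
  qed
  finally show ?thesis .
qed

text \<open>By \<open>average_shift\<close> the difference quotient of \<open>avg s\<close> over
  time \<open>a\<close> equals 1/s times the increment T_s - 1 applied to \<open>avg a\<close>. As
  \<open>a\<close> tends to 0, \<open>avg a\<close> tends to \<open>g\<close>, and the contraction
  \<open>T s\<close> respects this limit.\<close>

lemma avg_generator:
  assumes s: "0 < s"
  shows "grel (avg s) (\<lambda>x. (T s g x - g x) / s)"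
proof -
  have s0: "0 \<le> s" using s by simp
  have hL: "L2m (\<lambda>x. (T s g x - g x) / s)"
    using L2_cmult[OF L2_diff[OF T_L2m[OF s0] g_L2], of "1 / s"] by simp
  let ?q = "\<lambda>a. \<integral>x. (T a g x - g x)\<^sup>2 \<partial>\<mu>"
  let ?Q = "\<lambda>a. \<integral>x. ((T a (avg s) x - avg s x) / a - (T s g x - g x) / s)\<^sup>2 \<partial>\<mu>"
  \<comment> \<open>The 4 combines (A - B)^2 \<le> 2 (A^2 + B^2) with the bound of both squared
    norms by that of \<open>?B\<close>.\<close>
  let ?R = "\<lambda>a. 4 / s\<^sup>2 * (sqrt (\<integral>x. (g x)\<^sup>2 \<partial>\<mu>) * sqrt (?q a))"
  have est: "?Q a \<le> ?R a" if a: "0 < a" for a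
  proof -
    have a0: "0 \<le> a" using a by simp
    let ?A = "\<lambda>x. T s (avg a) x - T s g x" and ?B = "\<lambda>x. avg a x - g x"
    have BL: "L2m ?B" and AL: "L2m ?A" by (intro L2_diff avg_L2 a g_L2 T_L2(1)[OF s0])+
    have id: "(T a (avg s) x - avg s x) / a - (T s g x - g x) / s = (1 / s) * (?A x - ?B x)" for x
    proof -
      have "s * (T a (avg s) x - avg s x) = a * (T s (avg a) x - avg a x)"
        unfolding T_avg[OF a0 s] T_avg[OF s0 a] avg_def by (rule average_shift[OF G_measurable1 G_bound a s])
      then have "(T a (avg s) x - avg s x) / a = (T s (avg a) x - avg a x) / s"
        using a s by (simp add: field_simps)
      then show ?thesis by (simp add: diff_divide_distrib)
    qed
    have A: "(\<integral>x. (?A x)\<^sup>2 \<partial>\<mu>) \<le> (\<integral>x. (?B x)\<^sup>2 \<partial>\<mu>)"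
    proof -
      have ae: "AE x in \<mu>. T s ?B x = ?A x" using T_lincomb_AE[OF s0 avg_L2[OF a] g_L2, of 1 "-1"] by simp
      have "(\<integral>x. (T s ?B x)\<^sup>2 \<partial>\<mu>) = (\<integral>x. (?A x)\<^sup>2 \<partial>\<mu>)"
      proof (rule integral_cong_AE)
        show "AE x in \<mu>. (T s ?B x)\<^sup>2 = (?A x)\<^sup>2" using ae by eventually_elim simp
      qed (use L2_measurable[OF AL] L2_measurable[OF T_L2(1)[OF s0 BL]] in auto)
      then show ?thesis using T_L2(2)[OF s0 BL] by simp
    qed
    \<comment> \<open>The distance of \<open>avg a\<close> from \<open>g\<close> is bounded by the
      pairing of \<open>g\<close> with \<open>g - T a g\<close>, which strong continuity sends to
      0.\<close>
    have "(\<integral>x. (?B x)\<^sup>2 \<partial>\<mu>) \<le> \<kappa> 0 - \<kappa> a" using avg_close[OF a] by (simp add: En_\<kappa>[OF a])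
    also have "\<dots> = (\<integral>x. g x * (g x - T a g x) \<partial>\<mu>)"
      unfolding \<kappa>_zero \<kappa>_def[of a] using L2_square[OF g_L2] L2_mult_integrable[OF g_L2 T_L2m[OF a0]]
      by (simp add: right_diff_distrib power2_eq_square)
    also have "\<dots> \<le> sqrt (\<integral>x. (g x)\<^sup>2 \<partial>\<mu>) * sqrt (?q a)"
      using L2_cauchy_schwarz[OF g_L2 L2_diff[OF g_L2 T_L2m[OF a0]]] by (simp add: power2_commute[of "g _"])
    finally have B: "(\<integral>x. (?B x)\<^sup>2 \<partial>\<mu>) \<le> sqrt (\<integral>x. (g x)\<^sup>2 \<partial>\<mu>) * sqrt (?q a)" .
    have ABL: "L2m (\<lambda>x. (1 / s) * (?A x - ?B x))" by (intro L2_cmult L2_diff[OF AL BL])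
    have "?Q a = (\<integral>x. ((1 / s) * (?A x - ?B x))\<^sup>2 \<partial>\<mu>)" unfolding id ..
    also have "\<dots> \<le> (\<integral>x. (2 / s\<^sup>2) * ((?A x)\<^sup>2 + (?B x)\<^sup>2) \<partial>\<mu>)"
    proof (rule integral_mono[OF L2_square[OF ABL]])
      show "integrable \<mu> (\<lambda>x. (2 / s\<^sup>2) * ((?A x)\<^sup>2 + (?B x)\<^sup>2))" using L2_square[OF AL] L2_square[OF BL] by simp
      fix x
      have "(p - q)\<^sup>2 \<le> 2 * p\<^sup>2 + 2 * q\<^sup>2" for p q :: real using square_diff_le[of 1 p "- q"] by simp
      then have "(1 / s)\<^sup>2 * (?A x - ?B x)\<^sup>2 \<le> (1 / s)\<^sup>2 * (2 * (?A x)\<^sup>2 + 2 * (?B x)\<^sup>2)"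
        by (intro mult_left_mono) auto
      then show "((1 / s) * (?A x - ?B x))\<^sup>2 \<le> (2 / s\<^sup>2) * ((?A x)\<^sup>2 + (?B x)\<^sup>2)"
        by (simp add: power_mult_distrib power_divide add_divide_distrib)
    qed
    also have "\<dots> = (2 / s\<^sup>2) * ((\<integral>x. (?A x)\<^sup>2 \<partial>\<mu>) + (\<integral>x. (?B x)\<^sup>2 \<partial>\<mu>))"
      using L2_square[OF AL] L2_square[OF BL] by simp
    also have "\<dots> \<le> (2 / s\<^sup>2) * (2 * (sqrt (\<integral>x. (g x)\<^sup>2 \<partial>\<mu>) * sqrt (?q a)))"
      using A B by (intro mult_left_mono) auto
    finally show ?thesis by simp
  qed
  have q: "(?q \<longlongrightarrow> 0) (at_right 0)"
    using strongly_continuous g_L2 by (auto simp: strongly_continuous_L2_def)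
  have "(?R \<longlongrightarrow> 4 / s\<^sup>2 * (sqrt (\<integral>x. (g x)\<^sup>2 \<partial>\<mu>) * sqrt 0)) (at_right 0)"
    by (intro tendsto_mult tendsto_const tendsto_real_sqrt q)
  then have lim: "(?R \<longlongrightarrow> 0) (at_right 0)" by simp
  have "(?Q \<longlongrightarrow> 0) (at_right 0)"
  proof (rule tendsto_sandwich[OF _ _ tendsto_const lim])
    show "\<forall>\<^sub>F a in at_right 0. ?Q a \<le> ?R a" using eventually_at_right_less[of "0::real"] by eventually_elim (rule est)
  qed simp
  then show ?thesis unfolding gen_rel_def using avg_L2[OF s] hL by simp
qed

text \<open>The energy is the mean over r < s of (\<kappa>(r) - \<kappa>(r + s)) / s, and
  \<open>\<kappa>_increments\<close> bounds each term by its value at r = 0, which is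
  \<open>En s g\<close>. Averaging thus produces an element of the generator domain whose full
  energy is bounded by an approximate one.\<close>

lemma avg_energy:
  assumes s: "0 < s" shows "gdom (avg s)" "D0 (avg s) \<le> En s g"
proof -
  let ?V = "unif s"
  interpret V: prob_space ?V using s by (rule prob_space_uniform_Ico)
  interpret m: prob_space \<mu> by (rule prob_mu)
  have s0: "0 \<le> s" using s by simp
  show "gdom (avg s)" using avg_generator[OF s] by (auto simp: gen_dom_def)
  let ?d = "\<lambda>x. g x - T s g x"
  have dm[measurable]: "?d \<in> borel_measurable borel" using T_measurable[OF s0 g_measurable] by simp
  have db: "\<bar>?d x\<bar> \<le> U" for x using g_nonneg[of x] g_le[of x] T_bounds[OF s0, of x] by (auto simp: abs_le_iff)
  have "D0 (avg s) = - (\<integral>x. avg s x * ((T s g x - g x) / s) \<partial>\<mu>)" by (rule D0_eq[OF avg_generator[OF s]])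
  also have "\<dots> = (\<integral>x. avg s x * ?d x / s \<partial>\<mu>)"
    unfolding Bochner_Integration.integral_minus[symmetric]
    by (intro Bochner_Integration.integral_cong refl) (simp add: algebra_simps diff_divide_distrib)
  also have "\<dots> = (\<integral>x. avg s x * ?d x \<partial>\<mu>) / s" by simp
  also have "(\<integral>x. avg s x * ?d x \<partial>\<mu>) = (\<integral>x. (\<integral>r. G r x * ?d x \<partial>?V) \<partial>\<mu>)"
    unfolding avg_def by simp
  also have "\<dots> = (\<integral>r. (\<integral>x. G r x * ?d x \<partial>\<mu>) \<partial>?V)"
  proof (rule fubini_mu[OF s, where c="U * U"])
    show "(\<lambda>(r, x). G r x * ?d x) \<in> borel_measurable (borel \<Otimes>\<^sub>M borel)"
      using G_joint unfolding case_prod_beta'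
      by (intro borel_measurable_times measurable_compose[OF measurable_snd dm]) auto
    show "\<bar>G r x * ?d x\<bar> \<le> U * U" for r x
      unfolding abs_mult using G_bound[of r x] db[of x] by (intro mult_mono) auto
  qed
  also have "\<dots> \<le> s * En s g"
  proof (rule V.integral_le_const)
    show "AE r in ?V. (\<integral>x. G r x * ?d x \<partial>\<mu>) \<le> s * En s g"
      using AE_uniform_Ico[of s]
    proof eventually_elim
      case (elim r)
      then have r: "0 \<le> r" by simp
      have "(\<integral>x. G r x * ?d x \<partial>\<mu>) = (\<integral>x. T r g x * g x - T r g x * T s g x \<partial>\<mu>)"
        using r by (intro Bochner_Integration.integral_cong refl) (simp add: G_def max_def algebra_simps)
      also have "\<dots> = \<kappa> r - \<kappa> (r + s)"
        using L2_mult_integrable[OF T_L2m[OF r] g_L2] L2_mult_integrable[OF T_L2m[OF r] T_L2m[OF s0]] \<kappa>_eq[OF r s0]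
        by (simp add: \<kappa>_def mult.commute)
      also have "\<dots> \<le> \<kappa> 0 - \<kappa> s" by (rule \<kappa>_increments[OF r s])
      finally show ?case by (simp add: En_\<kappa>[OF s])
    qed
    have Gd: "(\<lambda>(r, x). G r x * ?d x) \<in> borel_measurable (borel \<Otimes>\<^sub>M \<mu>)"
    proof -
      have "(\<lambda>(r, x). G r x * ?d x) \<in> borel_measurable (borel \<Otimes>\<^sub>M borel)"
        using G_joint unfolding case_prod_beta'
        by (intro borel_measurable_times measurable_compose[OF measurable_snd dm]) auto
      then show ?thesis by (simp cong: measurable_cong_sets sets_pair_measure_cong)
    qed
    have "\<bar>\<integral>x. G r x * ?d x \<partial>\<mu>\<bar> \<le> U * U" for r
    proof -
      have b: "\<bar>G r x * ?d x\<bar> \<le> U * U" for x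
        unfolding abs_mult using G_bound[of r x] db[of x] by (intro mult_mono) auto
      have i: "integrable \<mu> (\<lambda>x. G r x * ?d x)"
        using b by (intro m.integrable_const_bound[where B="U * U"]) (auto cong: measurable_cong_sets)
      show ?thesis by (rule m.abs_integral_le_const[OF i b])
    qed
    then show "integrable ?V (\<lambda>r. \<integral>x. G r x * ?d x \<partial>\<mu>)"
      using m.borel_measurable_lebesgue_integral[OF Gd] by (intro V.integrable_const_bound[where B="U * U"]) auto
  qed
  finally show "D0 (avg s) \<le> En s g" using s by (simp add: divide_right_mono pos_divide_le_eq mult.commute)
qed

lemma avg_norm:
  assumes s: "0 < s" shows "(\<integral>x. (avg s x)\<^sup>2 \<partial>\<mu>) \<le> (\<integral>x. (g x)\<^sup>2 \<partial>\<mu>)"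
  unfolding avg_def
proof (rule average_square_bound[OF s G_joint G_bound])
  fix r assume r: "0 \<le> r" "r < s"
  then have "(\<integral>x. (G r x)\<^sup>2 \<partial>\<mu>) = \<kappa> (2 * r)" by (simp add: G_def max_def \<kappa>_square)
  also have "\<dots> \<le> \<kappa> 0" using r by (intro \<kappa>_decreasing) auto
  finally show "(\<integral>x. (G r x)\<^sup>2 \<partial>\<mu>) \<le> (\<integral>x. (g x)\<^sup>2 \<partial>\<mu>)" by (simp add: \<kappa>_zero)
qed

text \<open>The witness is \<open>\<mu>\<close> weighted by the normalized square of the time
  average. Being \<open>\<eta>\<close>-close to \<open>g\<close> in L2, the average keeps squared
  norm at least \<open>1 - 3 * \<eta>\<close>; normalization inflates the energy by the reciprocal,
  and bounded test integrals change only by a multiple of \<open>\<eta>\<close>.\<close>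

lemma mollified_measure:
  assumes s: "0 < s" and g1: "(\<integral>x. (g x)\<^sup>2 \<partial>\<mu>) = 1" and \<eta>: "0 < \<eta>" "\<eta> \<le> 1 / 4" and sE: "s * En s g \<le> \<eta>\<^sup>2"
  shows "\<exists>\<nu>\<in>prob_measures. FI \<nu> \<le> ereal (En s g / (1 - 3 * \<eta>)) \<and>
    (\<forall>\<phi> b. \<phi> \<in> borel_measurable borel \<longrightarrow> (\<forall>x. \<bar>\<phi> x\<bar> \<le> b) \<longrightarrow>
      \<bar>(\<integral>x. \<phi> x \<partial>\<nu>) - (\<integral>x. \<phi> x * (g x)\<^sup>2 \<partial>\<mu>)\<bar> \<le> 6 * b * \<eta>)"
proof -
  interpret m: prob_space \<mu> by (rule prob_mu)
  let ?m = "avg s"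
  define N2 where "N2 = (\<integral>x. (?m x)\<^sup>2 \<partial>\<mu>)"
  have mL: "L2m ?m" by (rule avg_L2[OF s])
  have mm[measurable]: "?m \<in> borel_measurable borel" by (rule avg_measurable[OF s])
  have m0: "0 \<le> ?m x" for x by (rule avg_bounds[OF s])
  have dL: "L2m (\<lambda>x. g x - ?m x)" by (rule L2_diff[OF g_L2 mL])
  have aL: "L2m (\<lambda>x. g x + ?m x)" by (rule L2_add[OF g_L2 mL])
  have close: "(\<integral>x. (g x - ?m x)\<^sup>2 \<partial>\<mu>) \<le> \<eta>\<^sup>2"
    using order_trans[OF avg_close[OF s] sE] by (simp add: power2_commute)
  have N1: "N2 \<le> 1" using avg_norm[OF s] g1 by (simp add: N2_def)
  have "1 = (\<integral>x. (?m x + (g x - ?m x))\<^sup>2 \<partial>\<mu>)" using g1 by simp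
  also have "\<dots> \<le> (\<integral>x. (1 + \<eta>) * (?m x)\<^sup>2 + (1 + 1 / \<eta>) * (g x - ?m x)\<^sup>2 \<partial>\<mu>)"
    using L2_square[OF g_L2] L2_square[OF mL] L2_square[OF dL]
    by (intro integral_mono square_diff_le[OF \<eta>(1)]) auto
  also have "\<dots> = (1 + \<eta>) * N2 + (1 + 1 / \<eta>) * (\<integral>x. (g x - ?m x)\<^sup>2 \<partial>\<mu>)"
    using L2_square[OF mL] L2_square[OF dL] by (simp add: N2_def)
  also have "\<dots> \<le> (1 + \<eta>) * N2 + (1 + 1 / \<eta>) * \<eta>\<^sup>2"
    using \<eta> close by (intro add_left_mono mult_left_mono) auto
  also have "(1 + 1 / \<eta>) * \<eta>\<^sup>2 = \<eta>\<^sup>2 + \<eta>" using \<eta> by (simp add: field_simps power2_eq_square)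
  finally have "1 - \<eta> - \<eta>\<^sup>2 \<le> (1 + \<eta>) * N2" by simp
  \<comment> \<open>The slack \<eta> + 2\<eta>^2 is given away for a simple constant.\<close>
  moreover have "(1 + \<eta>) * (1 - 3 * \<eta>) \<le> 1 - \<eta> - \<eta>\<^sup>2"
    using \<eta> by (simp add: algebra_simps power2_eq_square)
  ultimately have "(1 + \<eta>) * (1 - 3 * \<eta>) \<le> (1 + \<eta>) * N2" by simp
  then have Nlow: "1 - 3 * \<eta> \<le> N2" using \<eta> by simp
  have Npos: "0 < N2" "0 < 1 - 3 * \<eta>" using Nlow \<eta> by auto
  define D where "D = (\<lambda>x. ennreal ((?m x)\<^sup>2 / N2))"
  have Dm[measurable]: "D \<in> borel_measurable borel" unfolding D_def by measurable
  have Dm'[measurable]: "D \<in> borel_measurable \<mu>" using Dm by (simp cong: measurable_cong_sets)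
  define \<nu> where "\<nu> = density \<mu> D"
  have D1: "(\<integral>\<^sup>+x. D x \<partial>\<mu>) = 1"
    unfolding D_def using L2_square[OF mL] Npos
    by (subst nn_integral_eq_integral) (auto simp: N2_def)
  have \<nu>: "\<nu> \<in> prob_measures"
    unfolding prob_measures_def \<nu>_def using D1
    by (auto intro!: prob_spaceI simp: emeasure_density cong: nn_integral_cong)
  \<comment> \<open>\<open>fisher\<close> is defined through \<open>RN_deriv\<close>, which agrees
    with the chosen density almost everywhere only; \<open>dform_le_D0\<close> bridges this
    gap.\<close>
  have RN: "AE x in \<mu>. D x = RN_deriv \<mu> \<nu> x"
    by (rule m.RN_deriv_unique) (auto simp: \<nu>_def)
  let ?w = "\<lambda>x. sqrt (enn2real (RN_deriv \<mu> \<nu> x))"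
  have wm: "?w \<in> borel_measurable borel"
    using borel_measurable_RN_deriv[of \<mu> \<nu>] by (simp cong: measurable_cong_sets)
  have weq: "AE x in \<mu>. ?w x = (1 / sqrt N2) * ?m x"
    using RN
  proof eventually_elim
    case (elim x)
    have "enn2real (RN_deriv \<mu> \<nu> x) = (?m x)\<^sup>2 / N2" unfolding elim[symmetric] D_def using Npos by simp
    then show ?case using m0[of x] by (simp add: real_sqrt_divide)
  qed
  have gd: "gdom (\<lambda>x. (1 / sqrt N2) * ?m x)" by (intro gdom_cmult avg_energy(1)[OF s])
  note dl = dform_le_D0[OF gd wm weq]
  have "dfm ?w \<le> D0 (\<lambda>x. (1 / sqrt N2) * ?m x)" by (rule dl(2))
  also have "\<dots> = D0 ?m / N2"
    unfolding D0_cmult[OF avg_energy(1)[OF s]] using Npos by (simp add: power_divide)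
  also have "\<dots> \<le> En s g / N2" using avg_energy(2)[OF s] Npos by (intro divide_right_mono) auto
  also have "\<dots> \<le> En s g / (1 - 3 * \<eta>)" using Nlow Npos En_nonneg[OF s, of g] by (intro divide_left_mono) auto
  finally have dle: "dfm ?w \<le> En s g / (1 - 3 * \<eta>)" .
  have ac: "absolutely_continuous \<mu> \<nu>" unfolding \<nu>_def by (rule absolutely_continuousI_density) simp
  have fi: "FI \<nu> \<le> ereal (En s g / (1 - 3 * \<eta>))"
    unfolding fisher_def Let_def using ac dl(1) dle by simp
  have diff: "\<bar>(\<integral>x. \<phi> x \<partial>\<nu>) - (\<integral>x. \<phi> x * (g x)\<^sup>2 \<partial>\<mu>)\<bar> \<le> 6 * b * \<eta>"
    if \<phi>: "\<phi> \<in> borel_measurable borel" and b: "\<And>x. \<bar>\<phi> x\<bar> \<le> b" for \<phi> b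
  proof -
    have b0: "0 \<le> b" using b[of undefined] by linarith
    note [measurable] = \<phi>
    have bi: "integrable \<mu> (\<lambda>x. \<phi> x * (f x)\<^sup>2)" if f: "L2m f" for f
      by (rule integrable_bounded_mult[OF L2_square[OF f] _ b]) (simp cong: measurable_cong_sets)
    have "(\<integral>x. \<phi> x \<partial>\<nu>) = (\<integral>x. (?m x)\<^sup>2 / N2 * \<phi> x \<partial>\<mu>)"
      unfolding \<nu>_def D_def using Npos by (subst integral_density) (auto cong: measurable_cong_sets)
    also have "\<dots> = (\<integral>x. (\<phi> x * (?m x)\<^sup>2) / N2 \<partial>\<mu>)" by (simp add: mult.commute)
    finally have e1: "(\<integral>x. \<phi> x \<partial>\<nu>) = (\<integral>x. (\<phi> x * (?m x)\<^sup>2) / N2 \<partial>\<mu>)" .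
    let ?R = "\<lambda>x. b * ((1 / (2 * \<eta>)) * (g x - ?m x)\<^sup>2 + (\<eta> / 2) * (g x + ?m x)\<^sup>2 + (1 / N2 - 1) * (?m x)\<^sup>2)"
    have Ri: "integrable \<mu> ?R" using L2_square[OF dL] L2_square[OF aL] L2_square[OF mL] by simp
    have "\<bar>(\<integral>x. \<phi> x \<partial>\<nu>) - (\<integral>x. \<phi> x * (g x)\<^sup>2 \<partial>\<mu>)\<bar> = \<bar>\<integral>x. (\<phi> x * (?m x)\<^sup>2) / N2 - \<phi> x * (g x)\<^sup>2 \<partial>\<mu>\<bar>"
      unfolding e1 using bi[OF mL] bi[OF g_L2] by simp
    also have "\<dots> \<le> (\<integral>x. ?R x \<partial>\<mu>)"
    proof (rule order_trans[OF integral_abs_bound integral_mono])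
      show "integrable \<mu> (\<lambda>x. \<bar>(\<phi> x * (?m x)\<^sup>2) / N2 - \<phi> x * (g x)\<^sup>2\<bar>)" using bi[OF mL] bi[OF g_L2] by simp
      show "integrable \<mu> ?R" by (rule Ri)
      fix x
      have "\<bar>(?m x)\<^sup>2 - (g x)\<^sup>2\<bar> = \<bar>g x - ?m x\<bar> * (g x + ?m x)"
      proof -
        have "(?m x)\<^sup>2 - (g x)\<^sup>2 = - ((g x - ?m x) * (g x + ?m x))" by (simp add: power2_eq_square algebra_simps)
        then show ?thesis using g_nonneg[of x] m0[of x] by (simp add: abs_mult)
      qed
      also have "\<dots> \<le> (1 / (2 * \<eta>)) * (g x - ?m x)\<^sup>2 + (\<eta> / 2) * (g x + ?m x)\<^sup>2"
      proof -
        have "0 \<le> (\<bar>g x - ?m x\<bar> - \<eta> * (g x + ?m x))\<^sup>2 / (2 * \<eta>)" using \<eta> by simp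
        also have "\<dots> = (1 / (2 * \<eta>)) * \<bar>g x - ?m x\<bar>\<^sup>2 + (\<eta> / 2) * (g x + ?m x)\<^sup>2 - \<bar>g x - ?m x\<bar> * (g x + ?m x)"
          using \<eta> by (simp add: power2_diff power_mult_distrib power2_eq_square field_simps)
        finally show ?thesis by simp
      qed
      finally have 1: "\<bar>(?m x)\<^sup>2 - (g x)\<^sup>2\<bar> \<le> (1 / (2 * \<eta>)) * (g x - ?m x)\<^sup>2 + (\<eta> / 2) * (g x + ?m x)\<^sup>2" .
      have "(1 / N2 - 1) \<ge> 0" using Npos N1 by simp
      then have nn: "0 \<le> (1 / N2 - 1) * (?m x)\<^sup>2" by (intro mult_nonneg_nonneg) auto
      have "(?m x)\<^sup>2 / N2 - (?m x)\<^sup>2 = (1 / N2 - 1) * (?m x)\<^sup>2" by (simp add: algebra_simps)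
      with nn have 2: "\<bar>(?m x)\<^sup>2 / N2 - (?m x)\<^sup>2\<bar> = (1 / N2 - 1) * (?m x)\<^sup>2" by (simp only: abs_of_nonneg)
      have "\<bar>(\<phi> x * (?m x)\<^sup>2) / N2 - \<phi> x * (g x)\<^sup>2\<bar> = \<bar>\<phi> x\<bar> * \<bar>((?m x)\<^sup>2 / N2 - (?m x)\<^sup>2) + ((?m x)\<^sup>2 - (g x)\<^sup>2)\<bar>"
        by (simp add: abs_mult[symmetric] algebra_simps)
      also have "\<dots> \<le> b * (\<bar>(?m x)\<^sup>2 / N2 - (?m x)\<^sup>2\<bar> + \<bar>(?m x)\<^sup>2 - (g x)\<^sup>2\<bar>)"
        using b b0 by (intro mult_mono abs_triangle_ineq) auto
      also have "\<dots> \<le> ?R x" unfolding 2 using 1 b0 by (intro mult_left_mono) auto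
      finally show "\<bar>(\<phi> x * (?m x)\<^sup>2) / N2 - \<phi> x * (g x)\<^sup>2\<bar> \<le> ?R x" .
    qed
    also have "(\<integral>x. ?R x \<partial>\<mu>) = b * ((1 / (2 * \<eta>)) * (\<integral>x. (g x - ?m x)\<^sup>2 \<partial>\<mu>) + (\<eta> / 2) * (\<integral>x. (g x + ?m x)\<^sup>2 \<partial>\<mu>) + (1 / N2 - 1) * N2)"
      using L2_square[OF dL] L2_square[OF aL] L2_square[OF mL] by (simp add: N2_def)
    \<comment> \<open>The three contributions are \<eta>/2, 2\<eta> and 3\<eta>, together at most
      6\<eta>.\<close>
    also have "\<dots> \<le> b * ((1 / (2 * \<eta>)) * \<eta>\<^sup>2 + (\<eta> / 2) * 4 + 3 * \<eta>)"
    proof (intro mult_left_mono add_mono close b0)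
      have "(\<integral>x. (g x + ?m x)\<^sup>2 \<partial>\<mu>) \<le> (\<integral>x. 2 * (g x)\<^sup>2 + 2 * (?m x)\<^sup>2 \<partial>\<mu>)"
        using square_diff_le[of 1] L2_square[OF g_L2] L2_square[OF mL] L2_square[OF aL]
        by (intro integral_mono) auto
      also have "\<dots> \<le> 4" using L2_square[OF g_L2] L2_square[OF mL] g1 N1 by (simp add: N2_def)
      finally show "(\<integral>x. (g x + ?m x)\<^sup>2 \<partial>\<mu>) \<le> 4" .
      have "(1 / N2 - 1) * N2 = 1 - N2" using Npos by (simp add: field_simps)
      then show "(1 / N2 - 1) * N2 \<le> 3 * \<eta>" using Nlow by linarith
    qed (use \<eta> in auto)
    also have "\<dots> \<le> 6 * b * \<eta>" using \<eta> b0 by (simp add: power2_eq_square field_simps)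
    finally show ?thesis .
  qed
  show ?thesis using \<nu> fi diff by blast
qed

end

subsection \<open>Localization\<close>

lemma abs_cos_diff_le: "\<bar>cos a - cos b\<bar> \<le> \<bar>a - (b::real)\<bar>"
proof -
  have "\<bar>cos a - cos b\<bar> = 2 * (\<bar>sin ((a + b) / 2)\<bar> * \<bar>sin ((b - a) / 2)\<bar>)"
    by (simp add: cos_diff_cos abs_mult)
  also have "\<dots> \<le> 2 * (1 * \<bar>(b - a) / 2\<bar>)"
    by (intro mult_left_mono mult_mono abs_sin_x_le_abs_x abs_sin_le_one) auto
  finally show ?thesis by simp
qed

text \<open>A cosine bump, since cos^2 + sin^2 = 1 makes the squares of its integer translates sum
  to 1 while it stays Lipschitz.\<close>

definition bump :: "real \<Rightarrow> real" where "bump z = cos (pi / 2 * min 1 \<bar>z\<bar>)"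

lemma bump_nonneg: "0 \<le> bump z"
proof -
  have "0 \<le> pi / 2 * min 1 \<bar>z\<bar>" "pi / 2 * min 1 \<bar>z\<bar> \<le> pi / 2 * 1"
    by (intro mult_nonneg_nonneg mult_left_mono; simp)+
  then show ?thesis unfolding bump_def using pi_gt_zero by (intro cos_ge_zero) linarith+
qed

lemma bump_le_1: "bump z \<le> 1" by (simp add: bump_def)

lemma bump_zero: "1 \<le> \<bar>z\<bar> \<Longrightarrow> bump z = 0" by (simp add: bump_def min_def)

lemma bump_lipschitz: "\<bar>bump z - bump w\<bar> \<le> pi / 2 * \<bar>z - w\<bar>"
proof -
  have "\<bar>bump z - bump w\<bar> \<le> \<bar>pi / 2 * min 1 \<bar>z\<bar> - pi / 2 * min 1 \<bar>w\<bar>\<bar>"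
    unfolding bump_def by (rule abs_cos_diff_le)
  also have "\<dots> = pi / 2 * \<bar>min 1 \<bar>z\<bar> - min 1 \<bar>w\<bar>\<bar>"
    unfolding right_diff_distrib[symmetric] abs_mult by simp
  also have "\<dots> \<le> pi / 2 * \<bar>z - w\<bar>" by (intro mult_left_mono) (auto simp: min_def)
  finally show ?thesis .
qed

text \<open>Only the translates at the floor of \<open>z\<close> and at its successor can be
  nonzero, and they are the cosine and the sine of one angle. The index range reaches
  \<open>Z + 1\<close> so as to contain the successor.\<close>

lemma bump_partition:
  assumes "\<bar>z\<bar> \<le> real_of_int Z"
  shows "(\<Sum>k\<in>{-Z-1..Z+1}. (bump (z - real_of_int k))\<^sup>2) = 1"
proof -
  define k where "k = \<lfloor>z\<rfloor>"
  define w where "w = z - real_of_int k"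
  have w: "0 \<le> w" "w < 1" unfolding w_def k_def by linarith+
  have k: "- Z - 1 \<le> k" "k + 1 \<le> Z + 1" using assms unfolding k_def by linarith+
  have "(\<Sum>k\<in>{-Z-1..Z+1}. (bump (z - real_of_int k))\<^sup>2) = (\<Sum>k\<in>{k, k + 1}. (bump (z - real_of_int k))\<^sup>2)"
  proof (rule sum.mono_neutral_right)
    show "\<forall>j\<in>{- Z - 1..Z + 1} - {k, k + 1}. (bump (z - real_of_int j))\<^sup>2 = 0"
    proof
      fix j assume "j \<in> {- Z - 1..Z + 1} - {k, k + 1}"
      then have "j \<le> k - 1 \<or> k + 2 \<le> j" by auto
      then have "real_of_int j \<le> real_of_int k - 1 \<or> real_of_int k + 2 \<le> real_of_int j" by linarith
      then have "1 \<le> \<bar>z - real_of_int j\<bar>" using w unfolding w_def by linarith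
      then show "(bump (z - real_of_int j))\<^sup>2 = 0" by (simp add: bump_zero)
    qed
  qed (use k in auto)
  also have "\<dots> = (bump w)\<^sup>2 + (bump (w - 1))\<^sup>2" by (simp add: w_def algebra_simps)
  also have "bump w = cos (pi / 2 * w)" using w by (simp add: bump_def min_def)
  also have "bump (w - 1) = cos (pi / 2 - pi / 2 * w)"
  proof -
    have "\<bar>w - 1\<bar> = 1 - w" "min 1 (1 - w) = 1 - w" using w by auto
    then show ?thesis unfolding bump_def by (simp only: right_diff_distrib mult_1_right)
  qed
  also have "\<dots> = sin (pi / 2 * w)" by (simp add: cos_diff)
  finally show ?thesis by simp
qed

context markov_setting
begin

section \<open>Moving a single particle\<close>

lemma phi_le:
  assumes \<tau>: "\<And>i. 0 \<le> \<tau> i" and u: "u \<in> meas n"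
  shows "phi n u \<tau> \<le> (\<integral>\<^sup>+x. (u x)\<^sup>2 \<partial>M n)"
proof -
  have \<tau>2: "\<And>i. 0 \<le> \<tau> i / 2" using \<tau> by simp
  have "phi n u \<tau> = (\<integral>\<^sup>+x. (PN n (\<lambda>i. \<tau> i / 2) u x)\<^sup>2 \<partial>M n)"
    using phi_double[of "\<lambda>i. \<tau> i / 2", OF \<tau>2 u] by simp
  also have "\<dots> \<le> (\<integral>\<^sup>+x. (u x)\<^sup>2 \<partial>M n)" by (rule N_contraction[OF \<tau>2 u])
  finally show ?thesis .
qed

lemma single_nonneg: "0 \<le> s \<Longrightarrow> 0 \<le> single i s j" by (simp add: single_def)

lemma phi_single:
  assumes i: "i < n" and s: "0 \<le> s" and u: "u \<in> meas n"
  shows "phi n u (single i s) = (\<integral>\<^sup>+x. u x * (\<integral>\<^sup>+y. u (x(i := y)) \<partial>K s (x i)) \<partial>M n)"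
  unfolding phi_def by (intro nn_integral_cong) (simp add: nn_integral_N_single[OF _ i s u])

text \<open>Resampling particle \<open>i\<close> from \<open>\<mu>\<close> gives its start and end
  the joint law \<open>J s\<close>, while the other particles stay frozen under \<open>M n\<close>;
  coordinate \<open>i\<close> of that sample is overwritten in both factors.\<close>

lemma phi_single_J:
  assumes i: "i < n" and s: "0 \<le> s" and u: "u \<in> meas n"
  shows "phi n u (single i s) = (\<integral>\<^sup>+z. (\<integral>\<^sup>+x. u (x(i := fst z)) * u (x(i := snd z)) \<partial>M n) \<partial>J s)"
proof -
  interpret Mn: prob_space "M n" by (rule prob_M)
  interpret Jp: prob_space "J s" using s by (rule prob_J)
  interpret MJ: pair_sigma_finite "M n" "J s" ..
  let ?h = "\<lambda>x. u x * PN n (single i s) u x"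
  have hm: "?h \<in> meas n"
    using N_measurable[OF single_nonneg[OF s] u] u by (intro borel_measurable_times_ennreal) auto
  have upd: "x(i := z) \<in> space (B n)" if "x \<in> space (B n)" for x z
    using that i by (auto simp: space_B extensional_def)
  have um: "(\<lambda>y. u (x(i := y))) \<in> borel_measurable borel" if "x \<in> space (B n)" for x
    using measurable_compose[OF update_measurable1[OF i that] u] by simp
  have "phi n u (single i s) = (\<integral>\<^sup>+x. \<integral>\<^sup>+z. ?h (x(i := z)) \<partial>\<mu> \<partial>M n)"
    unfolding phi_def by (rule nn_integral_resample[OF i hm])
  also have "\<dots> = (\<integral>\<^sup>+x. \<integral>\<^sup>+z. u (x(i := fst z)) * u (x(i := snd z)) \<partial>J s \<partial>M n)"
  proof (rule nn_integral_cong)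
    fix x assume "x \<in> space (M n)"
    then have x: "x \<in> space (B n)" by simp
    note [measurable] = um[OF x]
    have "(\<integral>\<^sup>+z. ?h (x(i := z)) \<partial>\<mu>) = (\<integral>\<^sup>+z. u (x(i := z)) * (\<integral>\<^sup>+y. u (x(i := y)) \<partial>K s z) \<partial>\<mu>)"
      by (intro nn_integral_cong) (simp add: nn_integral_N_single[OF upd[OF x] i s u])
    also have "\<dots> = (\<integral>\<^sup>+z. u (x(i := fst z)) * u (x(i := snd z)) \<partial>J s)"
      by (subst nn_integral_J[OF s]) (auto simp: nn_integral_cmult)
    finally show "(\<integral>\<^sup>+z. ?h (x(i := z)) \<partial>\<mu>) = (\<integral>\<^sup>+z. u (x(i := fst z)) * u (x(i := snd z)) \<partial>J s)" .
  qed
  also have "\<dots> = (\<integral>\<^sup>+z. (\<integral>\<^sup>+x. u (x(i := fst z)) * u (x(i := snd z)) \<partial>M n) \<partial>J s)"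
  proof (rule MJ.Fubini'[symmetric])
    have 1: "(\<lambda>p. (fst p)(i := fst (snd p))) \<in> B n \<Otimes>\<^sub>M (borel \<Otimes>\<^sub>M borel) \<rightarrow>\<^sub>M B n"
      using measurable_compose[OF _ update_measurable[OF i], of "\<lambda>p. (fst p, fst (snd p))" "B n \<Otimes>\<^sub>M (borel \<Otimes>\<^sub>M borel)"] by simp
    have 2: "(\<lambda>p. (fst p)(i := snd (snd p))) \<in> B n \<Otimes>\<^sub>M (borel \<Otimes>\<^sub>M borel) \<rightarrow>\<^sub>M B n"
      using measurable_compose[OF _ update_measurable[OF i], of "\<lambda>p. (fst p, snd (snd p))" "B n \<Otimes>\<^sub>M (borel \<Otimes>\<^sub>M borel)"] by simp
    have "(\<lambda>p. u ((fst p)(i := fst (snd p))) * u ((fst p)(i := snd (snd p)))) \<in> borel_measurable (B n \<Otimes>\<^sub>M (borel \<Otimes>\<^sub>M borel))"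
      by (intro borel_measurable_times_ennreal measurable_compose[OF 1 u] measurable_compose[OF 2 u])
    then show "(\<lambda>(x, z). u (x(i := fst z)) * u (x(i := snd z))) \<in> borel_measurable (M n \<Otimes>\<^sub>M J s)"
      by (simp add: case_prod_beta' measurable_cong_sets[OF sets_pair_measure_cong[OF sets_M sets_J[OF s]] refl])
  qed
  finally show ?thesis .
qed

section \<open>Averaged one-particle marginals\<close>

lemma integral_resample:
  fixes H :: "(nat \<Rightarrow> 'a) \<Rightarrow> real"
  assumes i: "i < n" and H: "H \<in> meas n" and b: "\<And>x. \<bar>H x\<bar> \<le> c"
  shows "(\<integral>x. H x \<partial>M n) = (\<integral>z. (\<integral>x. H (x(i := z)) \<partial>M n) \<partial>\<mu>)"
proof -
  interpret m: prob_space \<mu> by (rule prob_mu)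
  interpret Mn: prob_space "M n" by (rule prob_M)
  interpret MM: pair_prob_space "M n" \<mu> ..
  have eq: "M n = distr (M n \<Otimes>\<^sub>M \<mu>) (M n) (\<lambda>(x, z). x(i := z))"
    unfolding M_def using i prob_mu by (subst distr_PiM_resample) auto
  have um: "(\<lambda>(x, z). x(i := z)) \<in> M n \<Otimes>\<^sub>M \<mu> \<rightarrow>\<^sub>M M n"
    using update_measurable[OF i] by (simp add: case_prod_beta' cong: measurable_cong_sets sets_pair_measure_cong)
  have Hm: "H \<in> borel_measurable (M n)" using H by (simp cong: measurable_cong_sets)
  have Hu: "(\<lambda>(x, z). H (x(i := z))) \<in> borel_measurable (M n \<Otimes>\<^sub>M \<mu>)"
    using measurable_compose[OF um Hm] by (simp add: case_prod_beta')
  have int: "integrable (M n \<Otimes>\<^sub>M \<mu>) (\<lambda>(x, z). H (x(i := z)))"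
    by (rule MM.P.integrable_const_bound[where B=c]) (use Hu b in auto)
  have "(\<integral>x. H x \<partial>M n) = (\<integral>x. H x \<partial>distr (M n \<Otimes>\<^sub>M \<mu>) (M n) (\<lambda>(x, z). x(i := z)))" using eq by simp
  also have "\<dots> = (\<integral>p. H ((fst p)(i := snd p)) \<partial>(M n \<Otimes>\<^sub>M \<mu>))"
    by (subst integral_distr[OF um Hm]) (simp add: case_prod_beta')
  also have "\<dots> = (\<integral>z. (\<integral>x. H (x(i := z)) \<partial>M n) \<partial>\<mu>)"
    using MM.integral_snd[OF int] by (simp add: case_prod_beta')
  finally show ?thesis .
qed

text \<open>Density with respect to \<open>\<mu>\<close> of the one-particle marginal of u^2
  \<mu>^n, averaged over the particles because \<open>u\<close> may be asymmetric in its arguments.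
  The integral runs over all of \<open>M n\<close>, whose coordinate \<open>i\<close> is overwritten
  by \<open>z\<close>.\<close>

definition marginal :: "nat \<Rightarrow> ((nat \<Rightarrow> 'a) \<Rightarrow> real) \<Rightarrow> 'a \<Rightarrow> real" where
  "marginal n u z = (\<Sum>i<n. \<integral>x. (u (x(i := z)))\<^sup>2 \<partial>M n) / real n"

context
  fixes n :: nat and u :: "(nat \<Rightarrow> 'a) \<Rightarrow> real" and U :: real
  assumes n: "0 < n" and u_measurable[measurable]: "u \<in> meas n" and u0: "\<And>x. 0 \<le> u x" and uU: "\<And>x. u x \<le> U"
begin

lemma u_square_bound: "\<bar>(u x)\<^sup>2\<bar> \<le> U\<^sup>2"
  using power_mono[OF uU u0, of x 2] by simp

lemma update_square_measurable:
  assumes i: "i < n" shows "(\<lambda>(z, x). (u (x(i := z)))\<^sup>2) \<in> borel_measurable (borel \<Otimes>\<^sub>M B n)"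
proof -
  have "(\<lambda>p. (snd p, fst p)) \<in> borel \<Otimes>\<^sub>M B n \<rightarrow>\<^sub>M B n \<Otimes>\<^sub>M (borel :: 'a measure)" by measurable
  from measurable_compose[OF measurable_compose[OF this update_measurable[OF i]] u_measurable]
  have "(\<lambda>p. u ((snd p)(i := fst p))) \<in> borel_measurable (borel \<Otimes>\<^sub>M B n)" by simp
  then show ?thesis by (simp add: case_prod_beta')
qed

lemma slice_measurable:
  assumes i: "i < n" shows "(\<lambda>x. u (x(i := z))) \<in> borel_measurable (M n)"
proof -
  have "(\<lambda>x. (x, z)) \<in> B n \<rightarrow>\<^sub>M B n \<Otimes>\<^sub>M borel" by simp
  from measurable_compose[OF measurable_compose[OF this update_measurable[OF i]] u_measurable]
  show ?thesis by (simp cong: measurable_cong_sets)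
qed

lemma slice_L2: "i < n \<Longrightarrow> L2 (M n) (\<lambda>x. u (x(i := z)))"
  unfolding L2_def using slice_measurable[of i z] u_square_bound
  by (auto intro!: finite_measure.integrable_const_bound[OF prob_space.finite_measure[OF prob_M], where B="U\<^sup>2"])

lemma slice_bound: "i < n \<Longrightarrow> \<bar>\<integral>x. (u (x(i := z)))\<^sup>2 \<partial>M n\<bar> \<le> U\<^sup>2"
  using L2_square[OF slice_L2] u_square_bound by (intro prob_space.abs_integral_le_const[OF prob_M]) auto

lemma slice_integral_measurable: "i < n \<Longrightarrow> (\<lambda>z. \<integral>x. (u (x(i := z)))\<^sup>2 \<partial>M n) \<in> borel_measurable borel"
proof -
  assume i: "i < n"
  have "(\<lambda>(z, x). (u (x(i := z)))\<^sup>2) \<in> borel_measurable (borel \<Otimes>\<^sub>M M n)"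
    using update_square_measurable[OF i] by (simp cong: measurable_cong_sets sets_pair_measure_cong)
  from sigma_finite_measure.borel_measurable_lebesgue_integral[OF prob_space_imp_sigma_finite[OF prob_M] this] show ?thesis by simp
qed

lemma marginal_measurable: "marginal n u \<in> borel_measurable borel"
  unfolding marginal_def[abs_def] using slice_integral_measurable by (intro borel_measurable_divide borel_measurable_sum) auto

lemma marginal_nonneg: "0 \<le> marginal n u z"
  unfolding marginal_def by (intro divide_nonneg_nonneg sum_nonneg) auto

lemma marginal_le: "marginal n u z \<le> U\<^sup>2"
proof -
  have "(\<Sum>i<n. \<integral>x. (u (x(i := z)))\<^sup>2 \<partial>M n) \<le> (\<Sum>i<n. U\<^sup>2)"
    using slice_bound by (intro sum_mono) (auto simp: abs_le_iff)
  then show ?thesis unfolding marginal_def using n by (simp add: divide_le_eq mult.commute)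
qed

text \<open>Testing the marginal amounts to averaging the empirical mean of \<open>\<phi>\<close>
  under the density u^2; this links the marginal to empirical measures.\<close>

lemma integral_marginal:
  fixes \<phi> :: "'a \<Rightarrow> real"
  assumes \<phi>[measurable]: "\<phi> \<in> borel_measurable borel" and b: "\<And>x. \<bar>\<phi> x\<bar> \<le> b"
  shows "(\<integral>z. \<phi> z * marginal n u z \<partial>\<mu>) = (\<integral>x. (\<Sum>i<n. \<phi> (x i)) / real n * (u x)\<^sup>2 \<partial>M n)"
proof -
  interpret m: prob_space \<mu> by (rule prob_mu)
  interpret Mn: prob_space "M n" by (rule prob_M)
  have b0: "0 \<le> b" using b[of undefined] by linarith
  have cm: "(\<lambda>x. \<phi> (x i)) \<in> meas n" if "i < n" for i
    unfolding B_def using that by (intro measurable_PiM_coordinate) auto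
  have one: "(\<integral>z. \<phi> z * (\<integral>x. (u (x(i := z)))\<^sup>2 \<partial>M n) \<partial>\<mu>) = (\<integral>x. \<phi> (x i) * (u x)\<^sup>2 \<partial>M n)" if i: "i < n" for i
  proof -
    have "(\<integral>x. \<phi> (x i) * (u x)\<^sup>2 \<partial>M n) = (\<integral>z. (\<integral>x. \<phi> z * (u (x(i := z)))\<^sup>2 \<partial>M n) \<partial>\<mu>)"
    proof (subst integral_resample[OF i, of _ "b * U\<^sup>2"])
      show "(\<lambda>x. \<phi> (x i) * (u x)\<^sup>2) \<in> meas n" using cm[OF i] by measurable
      show "\<bar>\<phi> (x i) * (u x)\<^sup>2\<bar> \<le> b * U\<^sup>2" for x
        unfolding abs_mult using b u_square_bound[of x] b0 by (intro mult_mono) auto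
    qed simp
    then show ?thesis by simp
  qed
  have i1: "integrable \<mu> (\<lambda>z. \<phi> z * (\<integral>x. (u (x(i := z)))\<^sup>2 \<partial>M n))" if i: "i < n" for i
  proof (rule m.integrable_const_bound[where B="b * U\<^sup>2"])
    show "AE z in \<mu>. norm (\<phi> z * (\<integral>x. (u (x(i := z)))\<^sup>2 \<partial>M n)) \<le> b * U\<^sup>2"
      unfolding real_norm_def abs_mult using b slice_bound[OF i] b0 by (intro AE_I2 mult_mono) auto
    show "(\<lambda>z. \<phi> z * (\<integral>x. (u (x(i := z)))\<^sup>2 \<partial>M n)) \<in> borel_measurable \<mu>"
      using slice_integral_measurable[OF i] by (auto cong: measurable_cong_sets)
  qed
  have i2: "integrable (M n) (\<lambda>x. \<phi> (x i) * (u x)\<^sup>2)" if i: "i < n" for i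
  proof (rule Mn.integrable_const_bound[where B="b * U\<^sup>2"])
    show "AE x in M n. norm (\<phi> (x i) * (u x)\<^sup>2) \<le> b * U\<^sup>2"
      unfolding real_norm_def abs_mult using b u_square_bound b0 by (intro AE_I2 mult_mono) auto
    show "(\<lambda>x. \<phi> (x i) * (u x)\<^sup>2) \<in> borel_measurable (M n)" using cm[OF i] by measurable
  qed
  have "(\<integral>z. \<phi> z * marginal n u z \<partial>\<mu>) = (\<integral>z. (\<Sum>i<n. \<phi> z * (\<integral>x. (u (x(i := z)))\<^sup>2 \<partial>M n)) / real n \<partial>\<mu>)"
    unfolding marginal_def by (simp add: sum_distrib_left)
  also have "\<dots> = (\<Sum>i<n. \<integral>z. \<phi> z * (\<integral>x. (u (x(i := z)))\<^sup>2 \<partial>M n) \<partial>\<mu>) / real n"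
    using i1 by (simp add: Bochner_Integration.integral_sum)
  also have "\<dots> = (\<Sum>i<n. \<integral>x. \<phi> (x i) * (u x)\<^sup>2 \<partial>M n) / real n"
    by (simp add: one)
  also have "\<dots> = (\<integral>x. (\<Sum>i<n. \<phi> (x i) * (u x)\<^sup>2) / real n \<partial>M n)"
    using i2 by (simp add: Bochner_Integration.integral_sum)
  finally show ?thesis by (simp add: sum_distrib_right)
qed

text \<open>Two Cauchy--Schwarz inequalities, over the remaining particles and then over the index
  \<open>i\<close>. In terms of energies, the square root of the averaged marginal has at most the
  mean energy per particle of \<open>u\<close>: a positive-time form of the superadditivity of
  Fisher information.\<close>

lemma sum_phi_single_le:
  assumes s: "0 < s"
  shows "(\<Sum>i<n. phi n (\<lambda>x. ennreal (u x)) (single i s))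
    \<le> ennreal (real n * (\<integral>z. sqrt (marginal n u z) * T s (\<lambda>z. sqrt (marginal n u z)) z \<partial>\<mu>))"
proof -
  let ?g = "\<lambda>z. sqrt (marginal n u z)"
  have s0: "0 \<le> s" using s by simp
  have U0: "0 \<le> U" using u0 uU order_trans by blast
  have gm[measurable]: "?g \<in> borel_measurable borel" using marginal_measurable by simp
  have g_le: "?g z \<le> U" for z using real_sqrt_le_mono[OF marginal_le[of z]] U0 by simp
  have gL: "L2m ?g" using g_le marginal_nonneg by (intro L2m_bounded[where c=U]) auto
  note [measurable_cong] = sets_J[OF s0]
  have um: "(\<lambda>x. ennreal (u x)) \<in> meas n" by measurable
  let ?a = "\<lambda>i z. \<integral>x. (u (x(i := z)))\<^sup>2 \<partial>M n"
  \<comment> \<open>The inequality is pointwise in the start \<open>z\<close> and the end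
    \<open>y\<close> of the moving particle, so that integration against \<open>J s\<close> comes
    last.\<close>
  have pw: "(\<Sum>i<n. \<integral>\<^sup>+x. ennreal (u (x(i := z))) * ennreal (u (x(i := y))) \<partial>M n) \<le> ennreal (real n * (?g z * ?g y))" for z y
  proof -
    have 1: "(\<integral>\<^sup>+x. ennreal (u (x(i := z))) * ennreal (u (x(i := y))) \<partial>M n) \<le> ennreal (sqrt (?a i z) * sqrt (?a i y))" if i: "i < n" for i
    proof -
      have int: "integrable (M n) (\<lambda>x. u (x(i := z)) * u (x(i := y)))" by (intro L2_mult_integrable slice_L2 i)
      have "(\<integral>\<^sup>+x. ennreal (u (x(i := z))) * ennreal (u (x(i := y))) \<partial>M n) = ennreal (\<integral>x. u (x(i := z)) * u (x(i := y)) \<partial>M n)"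
        using u0 nn_integral_eq_integral[OF int] by (simp add: ennreal_mult)
      also have "\<dots> \<le> ennreal (sqrt (?a i z) * sqrt (?a i y))"
        using L2_cauchy_schwarz[OF slice_L2[OF i] slice_L2[OF i], of z y] by (intro ennreal_leI) (auto simp: abs_le_iff)
      finally show ?thesis .
    qed
    have "(\<Sum>i<n. sqrt (?a i z) * sqrt (?a i y))\<^sup>2 \<le> (\<Sum>i<n. (sqrt (?a i z))\<^sup>2) * (\<Sum>i<n. (sqrt (?a i y))\<^sup>2)"
      by (rule Cauchy_Schwarz_ineq_sum)
    also have "\<dots> = (real n * marginal n u z) * (real n * marginal n u y)"
      using n by (simp add: marginal_def)
    also have "\<dots> = (real n * (?g z * ?g y))\<^sup>2"
      using marginal_nonneg by (simp add: power_mult_distrib power2_eq_square[of "real n"])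
    finally have "(\<Sum>i<n. sqrt (?a i z) * sqrt (?a i y))\<^sup>2 \<le> (real n * (?g z * ?g y))\<^sup>2" .
    then have f1: "(\<Sum>i<n. sqrt (?a i z) * sqrt (?a i y)) \<le> real n * (?g z * ?g y)"
      by (rule power2_le_imp_le) (simp add: marginal_nonneg)
    have f2: "(\<Sum>i<n. \<integral>\<^sup>+x. ennreal (u (x(i := z))) * ennreal (u (x(i := y))) \<partial>M n) \<le> (\<Sum>i<n. ennreal (sqrt (?a i z) * sqrt (?a i y)))"
      using 1 by (intro sum_mono) auto
    have f3: "(\<Sum>i<n. ennreal (sqrt (?a i z) * sqrt (?a i y))) = ennreal (\<Sum>i<n. sqrt (?a i z) * sqrt (?a i y))"
      by (rule sum_ennreal) simp
    show ?thesis by (rule order_trans[OF f2[unfolded f3] ennreal_leI[OF f1]])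
  qed
  have m1: "(\<lambda>z. \<integral>\<^sup>+x. ennreal (u (x(i := fst z))) * ennreal (u (x(i := snd z))) \<partial>M n) \<in> borel_measurable (J s)" if i: "i < n" for i
  proof -
    interpret Mn: prob_space "M n" by (rule prob_M)
    have 1: "(\<lambda>p. (snd p)(i := fst (fst p))) \<in> (borel \<Otimes>\<^sub>M borel) \<Otimes>\<^sub>M B n \<rightarrow>\<^sub>M B n"
      using measurable_compose[OF _ update_measurable[OF i], of "\<lambda>p. (snd p, fst (fst p))" "(borel \<Otimes>\<^sub>M borel) \<Otimes>\<^sub>M B n"] by simp
    have 2: "(\<lambda>p. (snd p)(i := snd (fst p))) \<in> (borel \<Otimes>\<^sub>M borel) \<Otimes>\<^sub>M B n \<rightarrow>\<^sub>M B n"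
      using measurable_compose[OF _ update_measurable[OF i], of "\<lambda>p. (snd p, snd (fst p))" "(borel \<Otimes>\<^sub>M borel) \<Otimes>\<^sub>M B n"] by simp
    have "(\<lambda>p. ennreal (u ((snd p)(i := fst (fst p)))) * ennreal (u ((snd p)(i := snd (fst p))))) \<in> borel_measurable ((borel \<Otimes>\<^sub>M borel) \<Otimes>\<^sub>M B n)"
      by (intro borel_measurable_times_ennreal measurable_compose[OF 1 um] measurable_compose[OF 2 um])
    then have "(\<lambda>(z, x). ennreal (u (x(i := fst z))) * ennreal (u (x(i := snd z)))) \<in> borel_measurable (J s \<Otimes>\<^sub>M M n)"
      by (simp add: case_prod_beta' measurable_cong_sets[OF sets_pair_measure_cong[OF sets_J[OF s0] sets_M] refl])
    then show ?thesis by (rule Mn.borel_measurable_nn_integral)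
  qed
  have "(\<Sum>i<n. phi n (\<lambda>x. ennreal (u x)) (single i s))
    = (\<Sum>i<n. \<integral>\<^sup>+z. (\<integral>\<^sup>+x. ennreal (u (x(i := fst z))) * ennreal (u (x(i := snd z))) \<partial>M n) \<partial>J s)"
    by (intro sum.cong refl phi_single_J s0 um) simp
  also have "\<dots> = (\<integral>\<^sup>+z. (\<Sum>i<n. \<integral>\<^sup>+x. ennreal (u (x(i := fst z))) * ennreal (u (x(i := snd z))) \<partial>M n) \<partial>J s)"
    by (rule nn_integral_sum[symmetric]) (use m1 in simp)
  also have "\<dots> \<le> (\<integral>\<^sup>+z. ennreal (real n * (?g (fst z) * ?g (snd z))) \<partial>J s)"
    by (intro nn_integral_mono pw)
  also have "\<dots> = ennreal (\<integral>z. real n * (?g (fst z) * ?g (snd z)) \<partial>J s)"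
    using L2_mult_integrable[OF L2_J(1)[OF s0 gL] L2_J(2)[OF s0 gL]] marginal_nonneg
    by (intro nn_integral_eq_integral) auto
  also have "(\<integral>z. real n * (?g (fst z) * ?g (snd z)) \<partial>J s) = real n * (\<integral>z. ?g z * T s ?g z \<partial>\<mu>)"
    using T_inner[OF s0 gL gL] by simp
  finally show ?thesis .
qed

end

text \<open>The reduced form of the upper bound: all one-particle moves over time \<open>s\<close>,
  plus a potential. In the application \<open>w\<close> is \<open>s\<close> times the potential
  shifted to be nonnegative, so that everything stays in \<open>ennreal\<close>.\<close>

definition Psi :: "nat \<Rightarrow> real \<Rightarrow> ((nat \<Rightarrow> 'a) \<Rightarrow> ennreal) \<Rightarrow> ((nat \<Rightarrow> 'a) \<Rightarrow> real) \<Rightarrow> ennreal" where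
  "Psi n s w u = (\<Sum>i<n. phi n (\<lambda>x. ennreal (u x)) (single i s)) + (\<integral>\<^sup>+x. w x * ennreal ((u x)\<^sup>2) \<partial>M n)"

text \<open>Boundedness of \<open>u\<close> keeps its marginals bounded, hence within
  \<open>bounded_function\<close>; general functions are reached by truncation in
  \<open>phi_form_bound\<close>.\<close>

definition good :: "nat \<Rightarrow> ((nat \<Rightarrow> 'a) \<Rightarrow> real) \<Rightarrow> bool" where
  "good n u \<longleftrightarrow> u \<in> meas n \<and> (\<forall>x. 0 \<le> u x) \<and> (\<exists>c. \<forall>x. u x \<le> c)"

section \<open>Cutting by empirical means\<close>

definition emp_mean :: "nat \<Rightarrow> ('a \<Rightarrow> real) \<Rightarrow> (nat \<Rightarrow> 'a) \<Rightarrow> real" where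
  "emp_mean n \<phi> x = (\<Sum>i<n. \<phi> (x i)) / real n"

lemma emp_mean_measurable: "\<phi> \<in> borel_measurable borel \<Longrightarrow> emp_mean n \<phi> \<in> meas n"
proof -
  assume \<phi>: "\<phi> \<in> borel_measurable borel"
  have "(\<lambda>x. \<phi> (x i)) \<in> meas n" if "i < n" for i
    unfolding B_def using that \<phi> by (intro measurable_PiM_coordinate) auto
  then show ?thesis unfolding emp_mean_def[abs_def] by (intro borel_measurable_divide borel_measurable_sum) auto
qed

lemma emp_mean_bound:
  assumes b: "\<And>x. \<bar>\<phi> x\<bar> \<le> b" and n: "0 < n" shows "\<bar>emp_mean n \<phi> x\<bar> \<le> b"
proof -
  have "\<bar>\<Sum>i<n. \<phi> (x i)\<bar> \<le> (\<Sum>i<n. \<bar>\<phi> (x i)\<bar>)" by (rule sum_abs)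
  also have "\<dots> \<le> (\<Sum>i<n. b)" by (intro sum_mono b)
  finally show ?thesis using n by (simp add: emp_mean_def divide_le_eq mult.commute)
qed

lemma emp_mean_update:
  assumes b: "\<And>x. \<bar>\<phi> x\<bar> \<le> b" and i: "i < n"
  shows "\<bar>emp_mean n \<phi> x - emp_mean n \<phi> (x(i := y))\<bar> \<le> 2 * b / real n"
proof -
  have "(\<Sum>j<n. \<phi> (x j)) - (\<Sum>j<n. \<phi> ((x(i := y)) j)) = (\<Sum>j<n. if j = i then \<phi> (x i) - \<phi> y else 0)"
    unfolding sum_subtractf[symmetric] by (rule sum.cong) auto
  also have "\<dots> = \<phi> (x i) - \<phi> y" using i by simp
  finally have "emp_mean n \<phi> x - emp_mean n \<phi> (x(i := y)) = (\<phi> (x i) - \<phi> y) / real n"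
    by (simp add: emp_mean_def diff_divide_distrib[symmetric])
  moreover have "\<bar>\<phi> (x i) - \<phi> y\<bar> \<le> 2 * b" using b[of "x i"] b[of y] by linarith
  ultimately show ?thesis by (simp add: divide_right_mono)
qed

text \<open>Cutting \<open>u\<close> with a quadratic partition of unity in the variable
  \<open>emp_mean n \<phi>\<close> costs only \<open>O(1/n)\<close>, since moving one particle changes this variable by \<open>O(1/n)\<close>.\<close>

lemma localization:
  assumes n: "0 < n" and s: "0 < s" and u: "good n u" and w[measurable]: "w \<in> meas n"
    and \<phi>[measurable]: "\<phi> \<in> borel_measurable borel" and b: "\<And>x. \<bar>\<phi> x\<bar> \<le> b" and \<delta>: "0 < \<delta>" and N: "b / \<delta> \<le> real_of_int Z"
  defines "\<xi> \<equiv> \<lambda>k x. bump (emp_mean n \<phi> x / \<delta> - real_of_int k)"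
  defines "\<Delta> \<equiv> {-Z-1..Z+1}"
  shows "Psi n s w u \<le> (\<Sum>k\<in>\<Delta>. Psi n s w (\<lambda>x. \<xi> k x * u x)) + ennreal (real (card \<Delta>) * (pi * b / \<delta>)\<^sup>2 / 2 / real n) * sqnorm n u"
    and "sqnorm n u = (\<Sum>k\<in>\<Delta>. sqnorm n (\<lambda>x. \<xi> k x * u x))"
    and "\<And>k. good n (\<lambda>x. \<xi> k x * u x)"
proof -
  have um[measurable]: "u \<in> meas n" and u0: "\<And>x. 0 \<le> u x" using u by (auto simp: good_def)
  obtain c where c: "\<And>x. u x \<le> c" using u by (auto simp: good_def)
  have s0: "0 \<le> s" using s by simp
  have \<xi>m[measurable]: "\<xi> k \<in> meas n" for k
    unfolding \<xi>_def bump_def[abs_def] using emp_mean_measurable[OF \<phi>] by measurable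
  have \<xi>0: "0 \<le> \<xi> k x" "\<xi> k x \<le> 1" for k x by (auto simp: \<xi>_def bump_nonneg bump_le_1)
  have part: "(\<Sum>k\<in>\<Delta>. (\<xi> k x)\<^sup>2) = 1" for x
    unfolding \<xi>_def \<Delta>_def
  proof (rule bump_partition)
    have "\<bar>emp_mean n \<phi> x / \<delta>\<bar> \<le> b / \<delta>" using emp_mean_bound[OF b n, where x=x] \<delta> by (simp add: divide_right_mono)
    then show "\<bar>emp_mean n \<phi> x / \<delta>\<bar> \<le> real_of_int Z" using N by linarith
  qed
  show good: "good n (\<lambda>x. \<xi> k x * u x)" for k
    unfolding good_def
  proof (intro conjI allI exI)
    show "(\<lambda>x. \<xi> k x * u x) \<in> meas n" by measurable
    show "0 \<le> \<xi> k x * u x" for x using \<xi>0 u0 by simp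
    show "\<xi> k x * u x \<le> c" for x
      using mult_mono[OF \<xi>0(2)[of k x] c[of x]] u0[of x] by simp
  qed
  have sq: "ennreal ((u x)\<^sup>2) = (\<Sum>k\<in>\<Delta>. ennreal ((\<xi> k x * u x)\<^sup>2))" for x
    by (subst sum_ennreal) (auto simp: power_mult_distrib sum_distrib_right[symmetric] part)
  show norm: "sqnorm n u = (\<Sum>k\<in>\<Delta>. sqnorm n (\<lambda>x. \<xi> k x * u x))"
    unfolding sq by (rule nn_integral_sum) measurable
  have weight: "(\<integral>\<^sup>+x. w x * ennreal ((u x)\<^sup>2) \<partial>M n) = (\<Sum>k\<in>\<Delta>. \<integral>\<^sup>+x. w x * ennreal ((\<xi> k x * u x)\<^sup>2) \<partial>M n)"
    unfolding sq sum_distrib_left by (rule nn_integral_sum) measurable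
  \<comment> \<open>Moving one particle changes the argument of the bump by at most 2b /
    (\<delta>n), and the Lipschitz constant is pi/2. Summing the squared changes over
    \<open>\<Delta>\<close> and halving gives \<open>\<kappa>\<close>.\<close>
  define \<kappa> where "\<kappa> = real (card \<Delta>) * (pi * b / (\<delta> * real n))\<^sup>2 / 2"
  have \<kappa>0: "0 \<le> \<kappa>" by (simp add: \<kappa>_def)
  have pw: "u x * u (x(i := y)) \<le> (\<Sum>k\<in>\<Delta>. (\<xi> k x * u x) * (\<xi> k (x(i := y)) * u (x(i := y)))) + \<kappa> * (u x * u (x(i := y)))" if i: "i < n" for i x y
  proof -
    let ?x' = "x(i := y)"
    have lip: "(\<xi> k x - \<xi> k ?x')\<^sup>2 \<le> (pi * b / (\<delta> * real n))\<^sup>2" for k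
    proof -
      have "\<bar>\<xi> k x - \<xi> k ?x'\<bar> \<le> pi / 2 * \<bar>(emp_mean n \<phi> x / \<delta> - real_of_int k) - (emp_mean n \<phi> ?x' / \<delta> - real_of_int k)\<bar>"
        unfolding \<xi>_def by (rule bump_lipschitz)
      also have "\<dots> = pi / 2 * (\<bar>emp_mean n \<phi> x - emp_mean n \<phi> ?x'\<bar> / \<delta>)"
        using \<delta> by (simp add: diff_divide_distrib[symmetric])
      also have "\<dots> \<le> pi / 2 * ((2 * b / real n) / \<delta>)"
        using \<delta> by (intro mult_left_mono divide_right_mono emp_mean_update[OF b i]) auto
      also have "\<dots> = pi * b / (\<delta> * real n)" by (simp add: mult.commute)
      finally have "\<bar>\<xi> k x - \<xi> k ?x'\<bar>\<^sup>2 \<le> (pi * b / (\<delta> * real n))\<^sup>2" by (intro power_mono) auto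
      then show ?thesis by simp
    qed
    \<comment> \<open>The squares sum to 1 at both points, so the defect of the mixed sum is half
      the sum of squared differences. This is the mechanism of the IMS localization formula.\<close>
    have "2 * (1 - (\<Sum>k\<in>\<Delta>. \<xi> k x * \<xi> k ?x')) = (\<Sum>k\<in>\<Delta>. (\<xi> k x)\<^sup>2) + (\<Sum>k\<in>\<Delta>. (\<xi> k ?x')\<^sup>2) - 2 * (\<Sum>k\<in>\<Delta>. \<xi> k x * \<xi> k ?x')"
      by (simp add: part)
    also have "\<dots> = (\<Sum>k\<in>\<Delta>. (\<xi> k x - \<xi> k ?x')\<^sup>2)"
      by (simp add: power2_diff sum.distrib sum_subtractf sum_distrib_left mult.assoc)
    also have "\<dots> \<le> (\<Sum>k\<in>\<Delta>. (pi * b / (\<delta> * real n))\<^sup>2)" by (intro sum_mono lip)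
    also have "\<dots> = 2 * \<kappa>" by (simp add: \<kappa>_def)
    finally have "1 - (\<Sum>k\<in>\<Delta>. \<xi> k x * \<xi> k ?x') \<le> \<kappa>" by (simp only: mult_le_cancel_left_pos zero_less_numeral)
    then have "1 \<le> (\<Sum>k\<in>\<Delta>. \<xi> k x * \<xi> k ?x') + \<kappa>" by linarith
    then have "1 * (u x * u ?x') \<le> ((\<Sum>k\<in>\<Delta>. \<xi> k x * \<xi> k ?x') + \<kappa>) * (u x * u ?x')"
      using u0 by (intro mult_right_mono) auto
    also have "\<dots> = (\<Sum>k\<in>\<Delta>. (\<xi> k x * u x) * (\<xi> k ?x' * u ?x')) + \<kappa> * (u x * u ?x')"
      unfolding distrib_right sum_distrib_right by (simp add: ac_simps)
    finally show ?thesis by simp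
  qed
  have phi_le: "phi n (\<lambda>x. ennreal (u x)) (single i s)
    \<le> (\<Sum>k\<in>\<Delta>. phi n (\<lambda>x. ennreal (\<xi> k x * u x)) (single i s)) + ennreal \<kappa> * sqnorm n u" if i: "i < n" for i
  proof -
    let ?K = "\<lambda>x. K s (x i)"
    have cu: "(\<lambda>y. v (x(i := y))) \<in> borel_measurable (K s (x i))" if "v \<in> meas n" "x \<in> space (B n)" for v :: "(nat \<Rightarrow> 'a) \<Rightarrow> ennreal" and x
      using measurable_compose[OF update_measurable1[OF i that(2)] that(1)] by (simp cong: measurable_cong_sets)
    have km: "(\<lambda>x. v x * (\<integral>\<^sup>+y. v (x(i := y)) \<partial>K s (x i))) \<in> borel_measurable (M n)" if v: "v \<in> meas n" for v
    proof -
      have "(\<lambda>x. v x * PN n (single i s) v x) \<in> borel_measurable (M n)"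
        using v N_measurable[OF single_nonneg[OF s0] v] by simp
      then show ?thesis by (rule measurable_cong[THEN iffD1, rotated]) (simp add: nn_integral_N_single[OF _ i s0 v])
    qed
    have eu: "(\<lambda>x. ennreal (u x)) \<in> meas n" and ek: "(\<lambda>x. ennreal (\<xi> k x * u x)) \<in> meas n" for k by measurable
    have "phi n (\<lambda>x. ennreal (u x)) (single i s)
      \<le> (\<integral>\<^sup>+x. (\<Sum>k\<in>\<Delta>. ennreal (\<xi> k x * u x) * (\<integral>\<^sup>+y. ennreal (\<xi> k (x(i := y)) * u (x(i := y))) \<partial>K s (x i)))
         + ennreal \<kappa> * (ennreal (u x) * (\<integral>\<^sup>+y. ennreal (u (x(i := y))) \<partial>K s (x i))) \<partial>M n)"
      unfolding phi_single[OF i s0 eu]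
    proof (rule nn_integral_mono)
      fix x assume "x \<in> space (M n)"
      then have x: "x \<in> space (B n)" by simp
      note cu1 = cu[OF eu x] and cuk = cu[OF ek x]
      have "ennreal (u x) * (\<integral>\<^sup>+y. ennreal (u (x(i := y))) \<partial>K s (x i)) = (\<integral>\<^sup>+y. ennreal (u x * u (x(i := y))) \<partial>K s (x i))"
        using cu1 u0 by (subst nn_integral_cmult[symmetric]) (auto simp: ennreal_mult)
      also have "\<dots> \<le> (\<integral>\<^sup>+y. (\<Sum>k\<in>\<Delta>. ennreal (\<xi> k x * u x) * ennreal (\<xi> k (x(i := y)) * u (x(i := y)))) + ennreal \<kappa> * (ennreal (u x) * ennreal (u (x(i := y)))) \<partial>K s (x i))"
      proof (rule nn_integral_mono)
        fix y
        have "ennreal (u x * u (x(i := y))) \<le> ennreal ((\<Sum>k\<in>\<Delta>. (\<xi> k x * u x) * (\<xi> k (x(i := y)) * u (x(i := y)))) + \<kappa> * (u x * u (x(i := y))))"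
          by (rule ennreal_leI[OF pw[OF i]])
        also have "\<dots> = (\<Sum>k\<in>\<Delta>. ennreal (\<xi> k x * u x) * ennreal (\<xi> k (x(i := y)) * u (x(i := y)))) + ennreal \<kappa> * (ennreal (u x) * ennreal (u (x(i := y))))"
        proof -
          have "ennreal (\<Sum>k\<in>\<Delta>. (\<xi> k x * u x) * (\<xi> k (x(i := y)) * u (x(i := y)))) = (\<Sum>k\<in>\<Delta>. ennreal ((\<xi> k x * u x) * (\<xi> k (x(i := y)) * u (x(i := y)))))"
            using \<xi>0 u0 by (intro sum_ennreal[symmetric]) simp
          also have "\<dots> = (\<Sum>k\<in>\<Delta>. ennreal (\<xi> k x * u x) * ennreal (\<xi> k (x(i := y)) * u (x(i := y))))"
            using \<xi>0 u0 by (intro sum.cong refl ennreal_mult) auto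
          finally show ?thesis
            using \<xi>0 u0 \<kappa>0 by (subst ennreal_plus) (auto simp: ennreal_mult intro!: sum_nonneg)
        qed
        finally show "ennreal (u x * u (x(i := y))) \<le> (\<Sum>k\<in>\<Delta>. ennreal (\<xi> k x * u x) * ennreal (\<xi> k (x(i := y)) * u (x(i := y)))) + ennreal \<kappa> * (ennreal (u x) * ennreal (u (x(i := y))))" .
      qed
      also have "\<dots> = (\<Sum>k\<in>\<Delta>. ennreal (\<xi> k x * u x) * (\<integral>\<^sup>+y. ennreal (\<xi> k (x(i := y)) * u (x(i := y))) \<partial>K s (x i)))
         + ennreal \<kappa> * (ennreal (u x) * (\<integral>\<^sup>+y. ennreal (u (x(i := y))) \<partial>K s (x i)))"
        using cu1 cuk by (simp add: nn_integral_add nn_integral_sum nn_integral_cmult)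
      finally show "ennreal (u x) * (\<integral>\<^sup>+y. ennreal (u (x(i := y))) \<partial>K s (x i)) \<le> (\<Sum>k\<in>\<Delta>. ennreal (\<xi> k x * u x) * (\<integral>\<^sup>+y. ennreal (\<xi> k (x(i := y)) * u (x(i := y))) \<partial>K s (x i)))
         + ennreal \<kappa> * (ennreal (u x) * (\<integral>\<^sup>+y. ennreal (u (x(i := y))) \<partial>K s (x i)))" .
    qed
    also have "\<dots> = (\<Sum>k\<in>\<Delta>. phi n (\<lambda>x. ennreal (\<xi> k x * u x)) (single i s)) + ennreal \<kappa> * phi n (\<lambda>x. ennreal (u x)) (single i s)"
      using km[OF eu] km[OF ek] by (simp add: nn_integral_add nn_integral_sum nn_integral_cmult phi_single[OF i s0 eu] phi_single[OF i s0 ek])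
    also have "\<dots> \<le> (\<Sum>k\<in>\<Delta>. phi n (\<lambda>x. ennreal (\<xi> k x * u x)) (single i s)) + ennreal \<kappa> * sqnorm n u"
      using phi_le[of "single i s", OF single_nonneg[OF s0] eu] u0 by (intro add_left_mono mult_left_mono) (auto simp: ennreal_power)
    finally show ?thesis .
  qed
  have "Psi n s w u \<le> (\<Sum>i<n. (\<Sum>k\<in>\<Delta>. phi n (\<lambda>x. ennreal (\<xi> k x * u x)) (single i s)) + ennreal \<kappa> * sqnorm n u)
    + (\<Sum>k\<in>\<Delta>. \<integral>\<^sup>+x. w x * ennreal ((\<xi> k x * u x)\<^sup>2) \<partial>M n)"
    unfolding Psi_def weight by (intro add_right_mono sum_mono phi_le) auto
  also have "\<dots> = (\<Sum>k\<in>\<Delta>. Psi n s w (\<lambda>x. \<xi> k x * u x)) + (of_nat n * ennreal \<kappa>) * sqnorm n u"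
    unfolding Psi_def sum.distrib sum.swap[of _ "{..<n}"] by (simp add: ac_simps)
  \<comment> \<open>Each of the \<open>n\<close> particles contributes \<open>\<kappa>\<close>,
    which is of order 1/n^2.\<close>
  also have "of_nat n * ennreal \<kappa> = ennreal (real (card \<Delta>) * (pi * b / \<delta>)\<^sup>2 / 2 / real n)"
  proof -
    have "real n * \<kappa> = real (card \<Delta>) * (pi * b / \<delta>)\<^sup>2 / 2 / real n"
      using n \<delta> by (simp add: \<kappa>_def power2_eq_square field_simps)
    then show ?thesis using \<kappa>0 by (simp add: ennreal_of_nat_eq_real_of_nat ennreal_mult[symmetric])
  qed
  finally show "Psi n s w u \<le> (\<Sum>k\<in>\<Delta>. Psi n s w (\<lambda>x. \<xi> k x * u x)) + ennreal (real (card \<Delta>) * (pi * b / \<delta>)\<^sup>2 / 2 / real n) * sqnorm n u" .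
qed

definition localized :: "nat \<Rightarrow> real \<Rightarrow> ('a \<Rightarrow> real) set \<Rightarrow> ((nat \<Rightarrow> 'a) \<Rightarrow> real) \<Rightarrow> bool" where
  "localized n \<delta> \<Phi> u \<longleftrightarrow> (\<forall>\<phi>\<in>\<Phi>. \<forall>x y. u x \<noteq> 0 \<longrightarrow> u y \<noteq> 0 \<longrightarrow> \<bar>emp_mean n \<phi> x - emp_mean n \<phi> y\<bar> \<le> 2 * \<delta>)"

text \<open>The test functions are treated one at a time: a cut localizes one more empirical mean,
  keeps the earlier localizations because supports shrink, and adds the same error of order 1/n. The
  induction set \<open>\<Phi>1\<close> collects the test functions still to be cut.\<close>

lemma Psi_from_localized:
  assumes n: "0 < n" and s: "0 < s" and w: "w \<in> meas n" and \<delta>: "0 < \<delta>" and N: "b / \<delta> \<le> real_of_int Z"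
    and \<Phi>: "finite \<Phi>" "\<And>\<phi>. \<phi> \<in> \<Phi> \<Longrightarrow> \<phi> \<in> borel_measurable borel" "\<And>\<phi> x. \<phi> \<in> \<Phi> \<Longrightarrow> \<bar>\<phi> x\<bar> \<le> b" and A: "0 \<le> A"
    and loc: "\<And>u. good n u \<Longrightarrow> localized n \<delta> \<Phi> u \<Longrightarrow> Psi n s w u \<le> ennreal A * sqnorm n u"
    and u: "good n u"
  shows "Psi n s w u \<le> ennreal (A + real (card \<Phi>) * (real (card {-Z-1..Z+1}) * (pi * b / \<delta>)\<^sup>2 / 2) / real n) * sqnorm n u"
proof -
  let ?c = "real (card {-Z-1..Z+1}) * (pi * b / \<delta>)\<^sup>2 / 2"
  have c0: "0 \<le> ?c" by simp
  have "\<forall>u. good n u \<longrightarrow> localized n \<delta> (\<Phi> - \<Phi>1) u \<longrightarrow>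
    Psi n s w u \<le> ennreal (A + real (card \<Phi>1) * ?c / real n) * sqnorm n u" if "\<Phi>1 \<subseteq> \<Phi>" for \<Phi>1
    using finite_subset[OF that \<Phi>(1)] that
  proof (induction \<Phi>1)
    case empty
    then show ?case using loc by simp
  next
    case (insert \<phi> \<Phi>1)
    show ?case
    proof (intro allI impI)
      fix u assume u: "good n u" and lu: "localized n \<delta> (\<Phi> - insert \<phi> \<Phi>1) u"
      have \<phi>: "\<phi> \<in> \<Phi>" using insert.prems by simp
      let ?\<xi> = "\<lambda>k x. bump (emp_mean n \<phi> x / \<delta> - real_of_int k)"
      note L = localization[OF n s u w \<Phi>(2)[OF \<phi>] \<Phi>(3)[OF \<phi>] \<delta> N]
      let ?A = "A + real (card \<Phi>1) * ?c / real n"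
      have A0: "0 \<le> ?A" using A c0 by (intro add_nonneg_nonneg divide_nonneg_nonneg mult_nonneg_nonneg) auto
      have IH: "Psi n s w (\<lambda>x. ?\<xi> k x * u x) \<le> ennreal ?A * sqnorm n (\<lambda>x. ?\<xi> k x * u x)" for k
      proof -
        have "localized n \<delta> (\<Phi> - \<Phi>1) (\<lambda>x. ?\<xi> k x * u x)"
          unfolding localized_def
        proof (intro ballI allI impI)
          fix \<psi> x y assume \<psi>: "\<psi> \<in> \<Phi> - \<Phi>1" and nz: "?\<xi> k x * u x \<noteq> 0" "?\<xi> k y * u y \<noteq> 0"
          show "\<bar>emp_mean n \<psi> x - emp_mean n \<psi> y\<bar> \<le> 2 * \<delta>"
          proof (cases "\<psi> = \<phi>")
            case True
            \<comment> \<open>A bump lives on an interval of length 2, that is, of length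
              \<open>2 * \<delta>\<close> before rescaling.\<close>
            have "\<bar>emp_mean n \<phi> x / \<delta> - real_of_int k\<bar> < 1" "\<bar>emp_mean n \<phi> y / \<delta> - real_of_int k\<bar> < 1"
              using nz bump_zero[of "emp_mean n \<phi> x / \<delta> - real_of_int k"] bump_zero[of "emp_mean n \<phi> y / \<delta> - real_of_int k"] by (auto simp: not_le[symmetric])
            then have "\<bar>emp_mean n \<phi> x / \<delta> - emp_mean n \<phi> y / \<delta>\<bar> \<le> 2" by linarith
            then have "\<bar>emp_mean n \<phi> x - emp_mean n \<phi> y\<bar> / \<delta> \<le> 2" using \<delta> by (simp add: diff_divide_distrib[symmetric])
            then show ?thesis using True \<delta> by (simp add: divide_le_eq)
          next
            case False
            then show ?thesis using lu \<psi> nz unfolding localized_def by auto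
          qed
        qed
        then show ?thesis using insert.IH insert.prems L(3)[of k] by auto
      qed
      have "Psi n s w u \<le> (\<Sum>k\<in>{-Z-1..Z+1}. ennreal ?A * sqnorm n (\<lambda>x. ?\<xi> k x * u x)) + ennreal (?c / real n) * sqnorm n u"
        by (rule order_trans[OF L(1) add_right_mono[OF sum_mono[OF IH]]])
      also have "\<dots> = ennreal ?A * sqnorm n u + ennreal (?c / real n) * sqnorm n u"
        unfolding L(2) sum_distrib_left ..
      also have "\<dots> = ennreal (?A + ?c / real n) * sqnorm n u"
        using A0 c0 by (subst ennreal_plus) (auto simp: distrib_right)
      also have "?A + ?c / real n = A + real (card (insert \<phi> \<Phi>1)) * ?c / real n"
        using insert.hyps by (simp add: add_divide_distrib distrib_right)
      finally show "Psi n s w u \<le> ennreal (A + real (card (insert \<phi> \<Phi>1)) * ?c / real n) * sqnorm n u" .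
    qed
  qed
  from this[OF order.refl] u show ?thesis by (simp add: localized_def)
qed

end

subsection \<open>The upper bound\<close>

lemma SUP_min_of_nat_ennreal: "(SUP j. min x (of_nat j)) = (x::ennreal)"
proof (rule antisym)
  show "(SUP j. min x (of_nat j)) \<le> x" by (intro SUP_least) auto
  show "x \<le> (SUP j. min x (of_nat j))"
  proof (cases "x = top")
    case True
    then have "min x (of_nat j) = of_nat j" for j by (simp add: min_def top_unique)
    then have "(SUP j. min x (of_nat j)) = top" by (simp only: ennreal_SUP_of_nat_eq_top)
    then show ?thesis by (metis top_greatest)
  next
    case False
    then obtain j :: nat where "x \<le> of_nat j"
      using ennreal_Ex_less_of_nat[of x] less_imp_le by (auto simp: less_top)
    then have "x = min x (of_nat j)" by (simp add: min_absorb1)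
    then show ?thesis by (metis SUP_upper UNIV_I)
  qed
qed

context markov_setting
begin

lemma fisher_nonneg: "0 \<le> FI \<nu>"
proof -
  have "0 \<le> dfm w" if "ddom w" for w
    using En_le_dform[OF that, of 1] En_nonneg[of 1 w] by simp
  then show ?thesis unfolding fisher_def Let_def by auto
qed

text \<open>The constant 1 has zero approximate energy, so the bound for its mollification is 0.
  This keeps the supremum of the variational formula at least \<open>-C\<close>.\<close>

lemma exists_fisher_zero: "\<exists>\<nu>\<in>prob_measures. FI \<nu> \<le> 0"
proof -
  interpret bounded_function Px X \<mu> "\<lambda>_. 1" 1 by unfold_locales auto
  interpret m: prob_space \<mu> by (rule prob_mu)
  have e: "En 1 (\<lambda>_. 1) = 0" by (simp add: En_def)
  have "measure \<mu> UNIV = 1" using m.prob_space by simp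
  then have "\<exists>\<nu>\<in>prob_measures. FI \<nu> \<le> ereal (En 1 (\<lambda>_. 1) / (1 - 3 * (1/4)))"
    using mollified_measure[of 1 "1/4"] by (auto simp: e)
  then show ?thesis by (simp add: e zero_ereal_def)
qed

text \<open>Discretizing the level \<open>e\<close> avoids any appeal to the lower semicontinuity of the Fisher information.\<close>

lemma usc_near_sublevels:
  fixes F :: "'a measure \<Rightarrow> real"
  assumes K: "\<And>c::real. compactin weak_topology {\<nu> \<in> prob_measures. FI \<nu> \<le> ereal c}"
    and F: "usc_on weak_topology F"
    and S: "\<And>\<nu> e. \<nu> \<in> prob_measures \<Longrightarrow> FI \<nu> \<le> ereal e \<Longrightarrow> F \<nu> \<le> S + e"
    and \<epsilon>: "0 < \<epsilon>"
  shows "\<exists>\<Phi> r. finite \<Phi> \<and> 0 < r \<and> (\<forall>\<phi>\<in>\<Phi>. bcont \<phi>) \<and>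
    (\<forall>e \<nu> \<rho>. 0 \<le> e \<longrightarrow> e \<le> E \<longrightarrow> \<nu> \<in> prob_measures \<longrightarrow> \<rho> \<in> prob_measures \<longrightarrow> FI \<nu> \<le> ereal e \<longrightarrow>
      (\<forall>\<phi>\<in>\<Phi>. \<bar>(\<integral>x. \<phi> x \<partial>\<rho>) - (\<integral>x. \<phi> x \<partial>\<nu>)\<bar> < r) \<longrightarrow> F \<rho> \<le> S + e + 2 * \<epsilon>)"
proof -
  have "\<exists>\<Phi> r. finite \<Phi> \<and> 0 < r \<and> (\<forall>\<phi>\<in>\<Phi>. bcont \<phi>) \<and>
    (\<forall>\<nu>\<in>{\<nu> \<in> prob_measures. FI \<nu> \<le> ereal (real l * \<epsilon>)}. \<forall>\<rho>\<in>prob_measures.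
      (\<forall>\<phi>\<in>\<Phi>. \<bar>(\<integral>x. \<phi> x \<partial>\<rho>) - (\<integral>x. \<phi> x \<partial>\<nu>)\<bar> < r) \<longrightarrow> \<rho> \<in> {\<rho> \<in> prob_measures. F \<rho> < S + real l * \<epsilon> + \<epsilon>})" for l :: nat
  proof (rule weak_compact_uniform_nbhd[OF K])
    show "openin weak_topology {\<rho> \<in> prob_measures. F \<rho> < S + real l * \<epsilon> + \<epsilon>}"
      using F by (simp add: usc_on_def topspace_weak_topology)
    show "{\<nu> \<in> prob_measures. FI \<nu> \<le> ereal (real l * \<epsilon>)} \<subseteq> {\<rho> \<in> prob_measures. F \<rho> < S + real l * \<epsilon> + \<epsilon>}"
      using S[of _ "real l * \<epsilon>"] \<epsilon> by fastforce
  qed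
  then have "\<forall>l. \<exists>p. finite (fst p) \<and> 0 < snd p \<and> (\<forall>\<phi>\<in>fst p. bcont \<phi>) \<and>
    (\<forall>\<nu>\<in>{\<nu> \<in> prob_measures. FI \<nu> \<le> ereal (real l * \<epsilon>)}. \<forall>\<rho>\<in>prob_measures.
      (\<forall>\<phi>\<in>fst p. \<bar>(\<integral>x. \<phi> x \<partial>\<rho>) - (\<integral>x. \<phi> x \<partial>\<nu>)\<bar> < snd p) \<longrightarrow> \<rho> \<in> {\<rho> \<in> prob_measures. F \<rho> < S + real l * \<epsilon> + \<epsilon>})"
    by simp
  from choice[OF this] obtain p where P: "\<forall>l. finite (fst (p l)) \<and> 0 < snd (p l) \<and> (\<forall>\<phi>\<in>fst (p l). bcont \<phi>) \<and>
    (\<forall>\<nu>\<in>{\<nu> \<in> prob_measures. FI \<nu> \<le> ereal (real l * \<epsilon>)}. \<forall>\<rho>\<in>prob_measures.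
      (\<forall>\<phi>\<in>fst (p l). \<bar>(\<integral>x. \<phi> x \<partial>\<rho>) - (\<integral>x. \<phi> x \<partial>\<nu>)\<bar> < snd (p l)) \<longrightarrow> \<rho> \<in> {\<rho> \<in> prob_measures. F \<rho> < S + real l * \<epsilon> + \<epsilon>})" ..
  have p: "finite (fst (p l))" "0 < snd (p l)" "\<phi> \<in> fst (p l) \<Longrightarrow> bcont \<phi>"
    "\<nu> \<in> prob_measures \<Longrightarrow> FI \<nu> \<le> ereal (real l * \<epsilon>) \<Longrightarrow> \<rho> \<in> prob_measures \<Longrightarrow>
      (\<forall>\<phi>\<in>fst (p l). \<bar>(\<integral>x. \<phi> x \<partial>\<rho>) - (\<integral>x. \<phi> x \<partial>\<nu>)\<bar> < snd (p l)) \<Longrightarrow> F \<rho> < S + real l * \<epsilon> + \<epsilon>" for l \<phi> \<nu> \<rho>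
    using P[rule_format, of l] by auto
  \<comment> \<open>Finitely many levels \<open>l * \<epsilon>\<close> suffice for the energies in
    \<open>[0, E]\<close>.\<close>
  define L where "L = nat \<lceil>E / \<epsilon>\<rceil>"
  define r where "r = Min ((snd \<circ> p) ` {..L})"
  have r: "0 < r" unfolding r_def using p(2) by (subst Min_gr_iff) auto
  have rle: "r \<le> snd (p l)" if "l \<le> L" for l unfolding r_def using that by (intro Min_le) auto
  show ?thesis
  proof (intro exI[of _ "\<Union>l\<le>L. fst (p l)"] exI[of _ r] conjI allI impI ballI)
    show "finite (\<Union>l\<le>L. fst (p l))" using p(1) by auto
    show "0 < r" by fact
    show "bcont \<phi>" if "\<phi> \<in> (\<Union>l\<le>L. fst (p l))" for \<phi> using that p(3) by auto
    fix e \<nu> \<rho> assume e: "0 \<le> e" "e \<le> E" and \<nu>: "\<nu> \<in> prob_measures" and \<rho>: "\<rho> \<in> prob_measures" and fi: "FI \<nu> \<le> ereal e"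
      and close: "\<forall>\<phi>\<in>\<Union>l\<le>L. fst (p l). \<bar>(\<integral>x. \<phi> x \<partial>\<rho>) - (\<integral>x. \<phi> x \<partial>\<nu>)\<bar> < r"
    \<comment> \<open>Rounding \<open>e\<close> up to a multiple of \<open>\<epsilon>\<close> costs
      less than \<open>\<epsilon>\<close>; the neighbourhood of the sublevel set costs another
      \<open>\<epsilon>\<close>, whence \<open>2 * \<epsilon>\<close>.\<close>
    define l where "l = nat \<lceil>e / \<epsilon>\<rceil>"
    have c0: "0 \<le> \<lceil>e / \<epsilon>\<rceil>"
    proof -
      have "0 \<le> e / \<epsilon>" using e \<epsilon> by simp
      then show ?thesis by linarith
    qed
    have lL: "l \<le> L" unfolding l_def L_def using e \<epsilon> by (intro nat_mono ceiling_mono divide_right_mono) auto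
    have rl: "real l = of_int \<lceil>e / \<epsilon>\<rceil>" unfolding l_def using c0 by simp
    have "e / \<epsilon> \<le> real l" "real l < e / \<epsilon> + 1" unfolding rl by linarith+
    then have l1: "e \<le> real l * \<epsilon>" and l2: "real l * \<epsilon> < e + \<epsilon>" using \<epsilon> by (auto simp: field_simps)
    have "FI \<nu> \<le> ereal (real l * \<epsilon>)" using fi l1 order_trans by fastforce
    then have "F \<rho> < S + real l * \<epsilon> + \<epsilon>"
    proof (rule p(4)[OF \<nu> _ \<rho>], intro ballI)
      fix \<phi> assume "\<phi> \<in> fst (p l)"
      then have "\<bar>(\<integral>x. \<phi> x \<partial>\<rho>) - (\<integral>x. \<phi> x \<partial>\<nu>)\<bar> < r" using close lL by auto
      then show "\<bar>(\<integral>x. \<phi> x \<partial>\<rho>) - (\<integral>x. \<phi> x \<partial>\<nu>)\<bar> < snd (p l)" using rle[OF lL] by linarith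
    qed
    then show "F \<rho> \<le> S + e + 2 * \<epsilon>" using l2 by linarith
  qed
qed

text \<open>Let \<open>e\<close> be the approximate energy of the square root of the marginal. If
  \<open>e\<close> is at least \<open>2 * C\<close>, it outweighs the whole oscillation of
  \<open>F\<close>. Otherwise the marginal is mollified to some \<open>\<nu>\<close> of Fisher
  information at most \<open>e + \<epsilon>\<close>, and every empirical measure on the support of
  \<open>u\<close> is near \<open>\<nu>\<close>; then \<open>near\<close> bounds \<open>F\<close>
  there by \<open>S + e + 3 * \<epsilon>\<close>, and the energy \<open>e\<close> cancels against
  the loss in the moves.\<close>

lemma localized_bound:
  fixes F :: "'a measure \<Rightarrow> real"
  assumes n: "0 < n" and F: "usc_on weak_topology F" and C: "0 < C" "\<And>\<nu>. \<nu> \<in> prob_measures \<Longrightarrow> \<bar>F \<nu>\<bar> \<le> C"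
    and S: "- C \<le> S" and \<epsilon>: "0 < \<epsilon>"
    and \<Phi>: "finite \<Phi>" "\<And>\<phi>. \<phi> \<in> \<Phi> \<Longrightarrow> bcont \<phi>" "\<And>\<phi> x. \<phi> \<in> \<Phi> \<Longrightarrow> \<bar>\<phi> x\<bar> \<le> b" and b: "0 < b" and r: "0 < r"
    and near: "\<And>e \<nu> \<rho>. 0 \<le> e \<Longrightarrow> e \<le> 2 * C + \<epsilon> \<Longrightarrow> \<nu> \<in> prob_measures \<Longrightarrow> \<rho> \<in> prob_measures \<Longrightarrow> FI \<nu> \<le> ereal e \<Longrightarrow>
      (\<forall>\<phi>\<in>\<Phi>. \<bar>(\<integral>x. \<phi> x \<partial>\<rho>) - (\<integral>x. \<phi> x \<partial>\<nu>)\<bar> < r) \<Longrightarrow> F \<rho> \<le> S + e + 2 * \<epsilon>"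
    and \<eta>: "0 < \<eta>" "\<eta> \<le> 1 / 4" "6 * b * \<eta> \<le> r / 4" "24 * C * \<eta> \<le> \<epsilon>" and s: "0 < s" "s * (2 * C) \<le> \<eta>\<^sup>2"
    and u: "good n u" and loc: "localized n (r / 8) \<Phi> u" and u1: "sqnorm n u = 1"
  shows "Psi n s (\<lambda>x. ennreal (s * real n * (F (emp_measure n x) + C))) u \<le> ennreal (real n + s * real n * (S + C + 3 * \<epsilon>))"
proof -
  interpret Mn: prob_space "M n" by (rule prob_M)
  obtain U where um[measurable]: "u \<in> meas n" and u0: "\<And>x. 0 \<le> u x" and uU: "\<And>x. u x \<le> U"
    using u by (auto simp: good_def)
  note uu = n um u0 uU
  have U0: "0 \<le> U" using u0 uU order_trans by blast
  let ?g = "\<lambda>z. sqrt (marginal n u z)"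
  interpret bounded_function Px X \<mu> ?g U
  proof unfold_locales
    show "?g \<in> borel_measurable borel" using marginal_measurable[OF uu] by simp
    show "0 \<le> ?g z" for z using marginal_nonneg[OF uu] by simp
    show "?g z \<le> U" for z using real_sqrt_le_mono[OF marginal_le[OF uu, of z]] U0 by simp
  qed
  have g2: "(?g z)\<^sup>2 = marginal n u z" for z using marginal_nonneg[OF uu] by simp
  have u2i: "integrable (M n) (\<lambda>x. (u x)\<^sup>2)"
    using u1 by (intro integrableI_nonneg) auto
  have u2: "(\<integral>x. (u x)\<^sup>2 \<partial>M n) = 1"
    using u1 by (subst integral_eq_nn_integral) auto
  have gphi: "(\<integral>z. \<phi> z * (?g z)\<^sup>2 \<partial>\<mu>) = (\<integral>x. emp_mean n \<phi> x * (u x)\<^sup>2 \<partial>M n)"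
    if "\<phi> \<in> borel_measurable borel" "\<And>x. \<bar>\<phi> x\<bar> \<le> c" for \<phi> c
    unfolding g2 emp_mean_def by (rule integral_marginal[OF uu that])
  have g1: "(\<integral>z. (?g z)\<^sup>2 \<partial>\<mu>) = 1"
    using gphi[of "\<lambda>_. 1" 1] u2 n by (simp add: emp_mean_def)
  define e where "e = En s ?g"
  have e0: "0 \<le> e" unfolding e_def by (rule En_nonneg[OF s(1)])
  have s0: "0 \<le> s" using s by simp
  have ip: "(\<integral>z. ?g z * T s ?g z \<partial>\<mu>) = 1 - s * e"
    unfolding e_def En_eq[OF s(1) g_L2] g1 using s by simp
  have ip0: "0 \<le> 1 - s * e"
    unfolding ip[symmetric] using T_bounds(1)[OF s0] marginal_nonneg[OF uu] by (intro integral_nonneg_AE AE_I2 mult_nonneg_nonneg) auto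
  have phis: "(\<Sum>i<n. phi n (\<lambda>x. ennreal (u x)) (single i s)) \<le> ennreal (real n * (1 - s * e))"
    using sum_phi_single_le[OF uu s(1)] unfolding ip .
  have weight: "(\<integral>\<^sup>+x. ennreal (s * real n * (F (emp_measure n x) + C)) * ennreal ((u x)\<^sup>2) \<partial>M n) \<le> ennreal (s * real n * c)"
    if c: "0 \<le> c" "\<And>x. u x \<noteq> 0 \<Longrightarrow> F (emp_measure n x) + C \<le> c" for c
  proof -
    have "(\<integral>\<^sup>+x. ennreal (s * real n * (F (emp_measure n x) + C)) * ennreal ((u x)\<^sup>2) \<partial>M n)
      \<le> (\<integral>\<^sup>+x. ennreal (s * real n * c) * ennreal ((u x)\<^sup>2) \<partial>M n)"
    proof (rule nn_integral_mono)
      fix x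
      show "ennreal (s * real n * (F (emp_measure n x) + C)) * ennreal ((u x)\<^sup>2) \<le> ennreal (s * real n * c) * ennreal ((u x)\<^sup>2)"
        using c(2)[of x] s0 by (cases "u x = 0") (auto intro!: mult_right_mono ennreal_leI mult_left_mono)
    qed
    also have "\<dots> = ennreal (s * real n * c)" using u1 by (simp add: nn_integral_cmult)
    finally show ?thesis .
  qed
  have SC: "0 \<le> S + C" using S by linarith
  \<comment> \<open>The two cases below differ only in the bound \<open>c\<close> for the shifted
    potential on the support of \<open>u\<close>; the moves contribute \<open>- s * e\<close> per
    particle.\<close>
  have total: "Psi n s (\<lambda>x. ennreal (s * real n * (F (emp_measure n x) + C))) u \<le> ennreal (real n + s * real n * (S + C + 3 * \<epsilon>))"
    if c: "0 \<le> c" "\<And>x. u x \<noteq> 0 \<Longrightarrow> F (emp_measure n x) + C \<le> c" and le: "c \<le> S + C + 3 * \<epsilon> + e" for c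
  proof -
    have "Psi n s (\<lambda>x. ennreal (s * real n * (F (emp_measure n x) + C))) u \<le> ennreal (real n * (1 - s * e)) + ennreal (s * real n * c)"
      unfolding Psi_def by (intro add_mono phis weight[OF c])
    also have "\<dots> = ennreal (real n * (1 - s * e) + s * real n * c)"
      using ip0 s0 c(1) by (subst ennreal_plus) auto
    also have "\<dots> \<le> ennreal (real n + s * real n * (S + C + 3 * \<epsilon>))"
    proof (rule ennreal_leI)
      have "s * real n * c \<le> s * real n * (S + C + 3 * \<epsilon> + e)" using le s0 by (intro mult_left_mono) auto
      then show "real n * (1 - s * e) + s * real n * c \<le> real n + s * real n * (S + C + 3 * \<epsilon>)" by (simp add: algebra_simps)
    qed
    finally show ?thesis .
  qed
  show ?thesis
  proof (cases "2 * C \<le> e")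
    case True
    show ?thesis
    proof (rule total[of "2 * C"])
      show "F (emp_measure n x) + C \<le> 2 * C" for x using C(2)[OF emp_measure_prob[OF n], of x] by linarith
      show "2 * C \<le> S + C + 3 * \<epsilon> + e" using True SC \<epsilon> by linarith
    qed (use C in simp)
  next
    case False
    have "s * e \<le> \<eta>\<^sup>2" using mult_left_mono[of e "2 * C" s] False s by linarith
    then have "s * En s ?g \<le> \<eta>\<^sup>2" by (simp add: e_def)
    from mollified_measure[OF s(1) g1 \<eta>(1,2) this] obtain \<nu> where
      \<nu>: "\<nu> \<in> prob_measures" "FI \<nu> \<le> ereal (e / (1 - 3 * \<eta>))"
      "\<And>\<phi> c. \<phi> \<in> borel_measurable borel \<Longrightarrow> (\<And>x. \<bar>\<phi> x\<bar> \<le> c) \<Longrightarrow> \<bar>(\<integral>x. \<phi> x \<partial>\<nu>) - (\<integral>x. \<phi> x * (?g x)\<^sup>2 \<partial>\<mu>)\<bar> \<le> 6 * c * \<eta>"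
      unfolding e_def by blast
    \<comment> \<open>Here \<open>3 * \<eta> * e\<close> is at most \<open>\<epsilon> / 4\<close>
      because \<open>e < 2 * C\<close>, and \<open>1 - 3 * \<eta>\<close> is at least
      \<open>1 / 4\<close>.\<close>
    have fe: "e / (1 - 3 * \<eta>) \<le> e + \<epsilon>"
    proof -
      have "3 * \<eta> * e \<le> 3 * \<eta> * (2 * C)" using False \<eta> by (intro mult_left_mono) auto
      also have "\<dots> \<le> \<epsilon> * (1 / 4)" using \<eta>(4) by (simp add: ac_simps)
      also have "\<dots> \<le> \<epsilon> * (1 - 3 * \<eta>)" using \<eta> \<epsilon> by (intro mult_left_mono) auto
      finally have "e \<le> (e + \<epsilon>) * (1 - 3 * \<eta>)" by (simp add: algebra_simps)
      then show ?thesis using \<eta> by (simp add: pos_divide_le_eq)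
    qed
    have fi: "FI \<nu> \<le> ereal (e + \<epsilon>)" using \<nu>(2) fe order_trans by fastforce
    have close: "F (emp_measure n x) \<le> S + (e + \<epsilon>) + 2 * \<epsilon>" if x: "u x \<noteq> 0" for x
    proof (rule near[OF _ _ \<nu>(1) emp_measure_prob[OF n] fi])
      show "\<forall>\<phi>\<in>\<Phi>. \<bar>(\<integral>y. \<phi> y \<partial>emp_measure n x) - (\<integral>x. \<phi> x \<partial>\<nu>)\<bar> < r"
      proof
      fix \<phi> assume \<phi>: "\<phi> \<in> \<Phi>"
      have \<phi>m: "\<phi> \<in> borel_measurable borel" using \<Phi>(2)[OF \<phi>] by (rule bcont_measurable)
      let ?m = "emp_mean n \<phi>"
      have mm: "?m \<in> meas n" using \<phi>m by (rule emp_mean_measurable)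
      have mi: "integrable (M n) (\<lambda>y. ?m y * (u y)\<^sup>2)"
        using emp_mean_bound[OF \<Phi>(3)[OF \<phi>] n] mm by (intro integrable_bounded_mult[OF u2i, where b=b]) auto
      have "\<bar>?m x - (\<integral>y. ?m y * (u y)\<^sup>2 \<partial>M n)\<bar> = \<bar>\<integral>y. (?m x - ?m y) * (u y)\<^sup>2 \<partial>M n\<bar>"
        using mi u2i u2 by (simp add: left_diff_distrib)
      also have "\<dots> \<le> (\<integral>y. (r / 4) * (u y)\<^sup>2 \<partial>M n)"
      proof (rule order_trans[OF integral_abs_bound integral_mono])
        show "integrable (M n) (\<lambda>y. \<bar>(?m x - ?m y) * (u y)\<^sup>2\<bar>)" using mi u2i by (simp add: left_diff_distrib)
        show "integrable (M n) (\<lambda>y. (r / 4) * (u y)\<^sup>2)" using u2i by simp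
        fix y
        show "\<bar>(?m x - ?m y) * (u y)\<^sup>2\<bar> \<le> (r / 4) * (u y)\<^sup>2"
        proof (cases "u y = 0")
          case False
          then have "\<bar>?m x - ?m y\<bar> \<le> r / 4" using loc \<phi> x unfolding localized_def by fastforce
          then show ?thesis unfolding abs_mult abs_power2 by (rule mult_right_mono) simp
        qed simp
      qed
      also have "\<dots> = r / 4" using u2 by simp
      \<comment> \<open>Localization contributes \<open>2 * (r / 8)\<close> and mollification at
        most \<open>r / 4\<close>, together less than \<open>r\<close>.\<close>
      finally have 1: "\<bar>?m x - (\<integral>z. \<phi> z * (?g z)\<^sup>2 \<partial>\<mu>)\<bar> \<le> r / 4"
        unfolding gphi[OF \<phi>m \<Phi>(3)[OF \<phi>]] .
      have 2: "\<bar>(\<integral>x. \<phi> x \<partial>\<nu>) - (\<integral>x. \<phi> x * (?g x)\<^sup>2 \<partial>\<mu>)\<bar> \<le> r / 4"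
        using \<nu>(3)[OF \<phi>m \<Phi>(3)[OF \<phi>]] \<eta>(3) by linarith
      have 3: "(\<integral>y. \<phi> y \<partial>emp_measure n x) = ?m x"
        unfolding emp_mean_def by (rule integral_emp_measure[OF n \<phi>m])
      show "\<bar>(\<integral>y. \<phi> y \<partial>emp_measure n x) - (\<integral>x. \<phi> x \<partial>\<nu>)\<bar> < r"
        unfolding 3 using 1 2 r by linarith
      qed
    qed (use False e0 \<epsilon> in auto)
    show ?thesis
    proof (rule total[of "S + C + 3 * \<epsilon> + e"])
      show "0 \<le> S + C + 3 * \<epsilon> + e" using SC \<epsilon> e0 by linarith
      show "F (emp_measure n x) + C \<le> S + C + 3 * \<epsilon> + e" if "u x \<noteq> 0" for x using close[OF that] by linarith
    qed simp
  qed
qed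

lemma phi_scale: "0 \<le> a \<Longrightarrow> u \<in> meas n \<Longrightarrow> phi n (\<lambda>x. ennreal (a * u x)) \<tau> = ennreal (a\<^sup>2) * phi n (\<lambda>x. ennreal (u x)) \<tau>"
  if "\<And>i. 0 \<le> \<tau> i" "\<And>x. 0 \<le> u x" for u :: "(nat \<Rightarrow> 'a) \<Rightarrow> real"
proof -
  assume a: "0 \<le> a" and u: "u \<in> meas n"
  have um: "(\<lambda>x. ennreal (u x)) \<in> meas n" using u by measurable
  have um': "(\<lambda>x. ennreal (u x)) \<in> borel_measurable (N n \<tau> x)" for x using um by (simp cong: measurable_cong_sets)
  have m: "(\<lambda>x. ennreal (u x) * (\<integral>\<^sup>+y. ennreal (u y) \<partial>N n \<tau> x)) \<in> borel_measurable (M n)"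
    using um N_measurable[OF that(1) um] by simp
  have "phi n (\<lambda>x. ennreal (a * u x)) \<tau> = (\<integral>\<^sup>+x. ennreal (a\<^sup>2) * (ennreal (u x) * (\<integral>\<^sup>+y. ennreal (u y) \<partial>N n \<tau> x)) \<partial>M n)"
    unfolding phi_def using a that(2)
    by (intro nn_integral_cong) (simp add: ennreal_mult nn_integral_cmult[OF um'] power2_eq_square ac_simps)
  also have "\<dots> = ennreal (a\<^sup>2) * phi n (\<lambda>x. ennreal (u x)) \<tau>"
    unfolding phi_def by (rule nn_integral_cmult[OF m])
  finally show ?thesis .
qed

text \<open>Both sides are quadratic in \<open>u\<close>, so normalization suffices; a function of
  norm zero is treated apart since it cannot be normalized.\<close>

lemma Psi_homogeneous:
  assumes s: "0 \<le> s" and w[measurable]: "w \<in> meas n"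
    and unit: "\<And>u. good n u \<Longrightarrow> localized n \<delta> \<Phi> u \<Longrightarrow> (sqnorm n u) = 1 \<Longrightarrow> Psi n s w u \<le> A"
    and u: "good n u" and loc: "localized n \<delta> \<Phi> u"
  shows "Psi n s w u \<le> A * sqnorm n u"
proof -
  interpret Mn: prob_space "M n" by (rule prob_M)
  obtain U where um[measurable]: "u \<in> meas n" and u0: "\<And>x. 0 \<le> u x" and uU: "\<And>x. u x \<le> U"
    using u by (auto simp: good_def)
  have ue: "(\<lambda>x. ennreal (u x)) \<in> meas n" by measurable
  let ?q = "sqnorm n u"
  have "?q \<le> (\<integral>\<^sup>+x. ennreal (U\<^sup>2) \<partial>M n)"
    using power_mono[OF uU u0, of _ 2] by (intro nn_integral_mono ennreal_leI) auto
  also have "\<dots> < \<infinity>" using Mn.emeasure_space_1 by simp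
  finally obtain Q where Q: "?q = ennreal Q" "0 \<le> Q" by (cases ?q) auto
  show ?thesis
  proof (cases "Q = 0")
    case True
    then have z: "?q = 0" using Q by simp
    have "phi n (\<lambda>x. ennreal (u x)) (single i s) = 0" for i
      using phi_le[of "single i s", OF single_nonneg[OF s] ue] z u0 by (simp add: ennreal_power)
    moreover have "(\<integral>\<^sup>+x. w x * ennreal ((u x)\<^sup>2) \<partial>M n) = 0"
    proof -
      have "AE x in M n. ennreal ((u x)\<^sup>2) = 0" using z by (subst (asm) nn_integral_0_iff_AE) auto
      then have "AE x in M n. w x * ennreal ((u x)\<^sup>2) = 0" by eventually_elim simp
      then show ?thesis by (subst nn_integral_0_iff_AE) auto
    qed
    ultimately show ?thesis by (simp add: Psi_def)
  next
    case False
    then have Qp: "0 < Q" using Q by simp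
    define a where "a = 1 / sqrt Q"
    have a: "0 < a" "a\<^sup>2 = 1 / Q" using Qp by (auto simp: a_def power_divide)
    let ?v = "\<lambda>x. a * u x"
    have v: "good n ?v"
      unfolding good_def using a u0 uU by (auto intro!: mult_left_mono exI[of _ "a * U"])
    have lv: "localized n \<delta> \<Phi> ?v" using loc a unfolding localized_def by auto
    have sq: "ennreal ((?v x)\<^sup>2) = ennreal (1 / Q) * ennreal ((u x)\<^sup>2)" for x
      using Qp by (simp add: power_mult_distrib a ennreal_mult[symmetric] del: times_divide_eq_left)
    have v1: "sqnorm n ?v = 1"
    proof -
      have "sqnorm n ?v = ennreal (1 / Q) * ?q"
        unfolding sq by (rule nn_integral_cmult) measurable
      also have "\<dots> = ennreal (1 / Q * Q)" unfolding Q(1) using Qp by (intro ennreal_mult[symmetric]) auto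
      finally show ?thesis using Qp by simp
    qed
    have "Psi n s w ?v = ennreal (1 / Q) * Psi n s w u"
    proof -
      have 1: "phi n (\<lambda>x. ennreal (?v x)) (single i s) = ennreal (1 / Q) * phi n (\<lambda>x. ennreal (u x)) (single i s)" for i
        using phi_scale[of "single i s" u a n, OF single_nonneg[OF s] u0] a by simp
      have 2: "(\<integral>\<^sup>+x. w x * ennreal ((?v x)\<^sup>2) \<partial>M n) = ennreal (1 / Q) * (\<integral>\<^sup>+x. w x * ennreal ((u x)\<^sup>2) \<partial>M n)"
        unfolding sq by (subst nn_integral_cmult[symmetric]) (auto simp: ac_simps)
      show ?thesis unfolding Psi_def 1 2 by (simp add: sum_distrib_left distrib_left)
    qed
    then have "ennreal (1 / Q) * Psi n s w u \<le> A" using unit[OF v lv v1] by simp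
    then have "ennreal Q * (ennreal (1 / Q) * Psi n s w u) \<le> ennreal Q * A" by (rule mult_left_mono) simp
    moreover have "ennreal Q * (ennreal (1 / Q) * Psi n s w u) = Psi n s w u"
      using Qp by (simp add: mult.assoc[symmetric] ennreal_mult[symmetric])
    ultimately show ?thesis using Q by (simp add: mult.commute)
  qed
qed

text \<open>The potential is added to the comparison of one short step with single long moves. After
  division by \<open>2 ^ k\<close> this gives the form bound with 1 + h (\<Lambda> - f), the shift
  \<open>c\<close> and the padding terms having cancelled. Then 1 + x \<le> exp x separates exp(h
  \<Lambda>) from the weight exp(- h f) that \<open>norm_from_form\<close> expects.\<close>

lemma phi_form_bound:
  fixes f :: "(nat \<Rightarrow> 'a) \<Rightarrow> real"
  assumes s: "0 < s" and n: "n \<le> 2 ^ k" and f[measurable]: "f \<in> meas n" and fb: "\<And>x. \<bar>f x\<bar> \<le> c"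
    and A: "0 \<le> A" and Psi: "\<And>u. good n u \<Longrightarrow> Psi n s (\<lambda>x. ennreal (s * (f x + c))) u \<le> ennreal (real n + s * (\<Lambda> + c)) * sqnorm n u"
    and A_def: "A = real n + s * (\<Lambda> + c)" and h: "h = s / 2 ^ k" and v: "v \<in> meas n"
  shows "phi n v (\<lambda>_. h) \<le> ennreal (exp (h * \<Lambda>)) * (\<integral>\<^sup>+x. ennreal (exp (- h * f x)) * (v x)\<^sup>2 \<partial>M n)"
proof -
  interpret Mn: prob_space "M n" by (rule prob_M)
  have h0: "0 < h" using s h by simp
  have h': "\<And>i::nat. 0 \<le> h" using h0 by simp
  have bounded: "phi n (\<lambda>x. ennreal (u x)) (\<lambda>_. h) \<le> ennreal (exp (h * \<Lambda>)) * (\<integral>\<^sup>+x. ennreal (exp (- h * f x)) * ennreal ((u x)\<^sup>2) \<partial>M n)"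
    if u: "good n u" for u
  proof -
    obtain U where um[measurable]: "u \<in> meas n" and u0: "\<And>x. 0 \<le> u x" and uU: "\<And>x. u x \<le> U"
      using u by (auto simp: good_def)
    have ue: "(\<lambda>x. ennreal (u x)) \<in> meas n" by measurable
    have u2b: "\<bar>(u x)\<^sup>2\<bar> \<le> U\<^sup>2" for x using power_mono[OF uU u0, of x 2] by simp
    have u2i: "integrable (M n) (\<lambda>x. (u x)\<^sup>2)" using u2b by (intro Mn.integrable_const_bound[where B="U\<^sup>2"]) auto
    have bi: "integrable (M n) (\<lambda>x. z x * (u x)\<^sup>2)" if z: "z \<in> meas n" "\<And>x. \<bar>z x\<bar> \<le> d" for z d
      by (rule integrable_bounded_mult[OF u2i _ z(2)]) (use z(1) in simp)
    have hfi: "integrable (M n) (\<lambda>x. h * (f x + c) * (u x)\<^sup>2)"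
    proof (rule bi)
      show "\<bar>h * (f x + c)\<bar> \<le> h * (2 * c)" for x using fb[of x] h0 by (auto simp: abs_mult intro!: mult_left_mono)
    qed measurable
    define Q where "Q = (\<integral>x. (u x)\<^sup>2 \<partial>M n)"
    have Q: "sqnorm n u = ennreal Q" "0 \<le> Q"
      unfolding Q_def using u2i by (auto intro!: nn_integral_eq_integral)
    define W where "W = (\<integral>x. s * (f x + c) * (u x)\<^sup>2 \<partial>M n)"
    have fc: "0 \<le> f x + c" "\<bar>s * (f x + c)\<bar> \<le> s * (2 * c)" for x
      using fb[of x] s by (auto simp: abs_mult intro!: mult_left_mono)
    have Wi: "integrable (M n) (\<lambda>x. s * (f x + c) * (u x)\<^sup>2)" using fc(2) by (intro bi) auto
    have W: "(\<integral>\<^sup>+x. ennreal (s * (f x + c)) * ennreal ((u x)\<^sup>2) \<partial>M n) = ennreal W" "0 \<le> W"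
    proof -
      have "(\<integral>\<^sup>+x. ennreal (s * (f x + c)) * ennreal ((u x)\<^sup>2) \<partial>M n) = (\<integral>\<^sup>+x. ennreal (s * (f x + c) * (u x)\<^sup>2) \<partial>M n)"
        using fc s by (intro nn_integral_cong ennreal_mult[symmetric]) auto
      also have "\<dots> = ennreal W" unfolding W_def using fc s by (intro nn_integral_eq_integral Wi) auto
      finally show "(\<integral>\<^sup>+x. ennreal (s * (f x + c)) * ennreal ((u x)\<^sup>2) \<partial>M n) = ennreal W" .
      show "0 \<le> W" unfolding W_def using fc s by (intro integral_nonneg_AE AE_I2) auto
    qed
    have "phi n (\<lambda>x. ennreal (u x)) (\<lambda>_. h) \<le> ennreal Q"
      using phi_le[of "\<lambda>_. h", OF h' ue] u0 Q by (simp add: ennreal_power)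
    then obtain p where p: "phi n (\<lambda>x. ennreal (u x)) (\<lambda>_. h) = ennreal p" "0 \<le> p"
      by (cases "phi n (\<lambda>x. ennreal (u x)) (\<lambda>_. h)") (auto simp: top_unique)
    have p0: "phi n (\<lambda>x. ennreal (u x)) (\<lambda>_. 0) = ennreal Q"
      using phi_0[OF ue] u0 Q by (simp add: ennreal_power)
    have sh: "2 ^ k * h = s" using h by simp
    have "ennreal (2 ^ k * p + W) = 2 ^ k * phi n (\<lambda>x. ennreal (u x)) (\<lambda>_. h) + ennreal W"
      unfolding p(1) using p(2) W(2) by (subst ennreal_plus) (auto simp: ennreal_mult ennreal_power[symmetric])
    also have "\<dots> \<le> (\<Sum>i<n. phi n (\<lambda>x. ennreal (u x)) (single i s)) + of_nat (2 ^ k - n) * ennreal Q + ennreal W"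
      using phi_all_le_singles[OF less_imp_le[OF h0] n ue] unfolding sh p0 by (rule add_right_mono)
    also have "\<dots> = Psi n s (\<lambda>x. ennreal (s * (f x + c))) u + of_nat (2 ^ k - n) * ennreal Q"
      unfolding Psi_def W by (simp add: ac_simps)
    also have "\<dots> \<le> ennreal A * ennreal Q + of_nat (2 ^ k - n) * ennreal Q"
      using Psi[OF u] unfolding Q A_def by (rule add_right_mono)
    also have "\<dots> = ennreal ((A + real (2 ^ k - n)) * Q)"
      using A Q(2) by (simp add: ennreal_mult distrib_right ennreal_plus ennreal_of_nat_eq_real_of_nat)
    finally have "2 ^ k * p + W \<le> (A + real (2 ^ k - n)) * Q"
      using A Q(2) by (subst (asm) ennreal_le_iff) auto
    also have "real (2 ^ k - n) = 2 ^ k - real n" using n by (simp add: of_nat_diff)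
    finally have "2 ^ k * p + W \<le> (s * (\<Lambda> + c) + 2 ^ k) * Q" by (simp add: A_def)
    then have "p \<le> ((s * (\<Lambda> + c) + 2 ^ k) * Q - W) / 2 ^ k" by (simp add: pos_le_divide_eq mult.commute)
    also have "\<dots> = (1 + h * (\<Lambda> + c)) * Q - W / 2 ^ k"
      by (simp add: h diff_divide_distrib add_divide_distrib distrib_right)
    also have "W / 2 ^ k = (\<integral>x. h * (f x + c) * (u x)\<^sup>2 \<partial>M n)"
      unfolding W_def h by simp
    also have "(1 + h * (\<Lambda> + c)) * Q - (\<integral>x. h * (f x + c) * (u x)\<^sup>2 \<partial>M n)
      = (\<integral>x. (1 + h * (\<Lambda> + c)) * (u x)\<^sup>2 - h * (f x + c) * (u x)\<^sup>2 \<partial>M n)"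
      using u2i hfi by (simp add: Q_def)
    also have "\<dots> \<le> (\<integral>x. exp (h * \<Lambda>) * (exp (- h * f x) * (u x)\<^sup>2) \<partial>M n)"
    proof (rule integral_mono)
      have hf: "\<bar>exp (- h * f x)\<bar> \<le> exp (h * c)" for x
      proof -
        have "- h * f x \<le> h * c" using mult_left_mono[of "- f x" c h] fb[of x] h0 by simp
        then show ?thesis by simp
      qed
      show "integrable (M n) (\<lambda>x. exp (h * \<Lambda>) * (exp (- h * f x) * (u x)\<^sup>2))"
        using bi[OF _ hf] by simp
      show "integrable (M n) (\<lambda>x. (1 + h * (\<Lambda> + c)) * (u x)\<^sup>2 - h * (f x + c) * (u x)\<^sup>2)"
        using u2i hfi by simp
      fix x
      have "(1 + h * (\<Lambda> + c)) * (u x)\<^sup>2 - h * (f x + c) * (u x)\<^sup>2 = (1 + (h * \<Lambda> + - h * f x)) * (u x)\<^sup>2"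
        by (simp add: algebra_simps)
      also have "\<dots> \<le> exp (h * \<Lambda> + - h * f x) * (u x)\<^sup>2"
        by (intro mult_right_mono exp_ge_add_one_self) auto
      finally show "(1 + h * (\<Lambda> + c)) * (u x)\<^sup>2 - h * (f x + c) * (u x)\<^sup>2 \<le> exp (h * \<Lambda>) * (exp (- h * f x) * (u x)\<^sup>2)"
        by (simp only: exp_add mult.assoc)
    qed
    finally have "ennreal p \<le> ennreal (\<integral>x. exp (h * \<Lambda>) * (exp (- h * f x) * (u x)\<^sup>2) \<partial>M n)" by (rule ennreal_leI)
    also have "\<dots> \<le> (\<integral>\<^sup>+x. ennreal (exp (h * \<Lambda>) * (exp (- h * f x) * (u x)\<^sup>2)) \<partial>M n)"
      by (subst integral_eq_nn_integral) (auto simp: ennreal_enn2real_if)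
    also have "\<dots> = ennreal (exp (h * \<Lambda>)) * (\<integral>\<^sup>+x. ennreal (exp (- h * f x)) * ennreal ((u x)\<^sup>2) \<partial>M n)"
      by (subst nn_integral_cmult[symmetric]) (auto simp: ennreal_mult)
    finally show ?thesis unfolding p(1) .
  qed
  let ?R = "ennreal (exp (h * \<Lambda>)) * (\<integral>\<^sup>+x. ennreal (exp (- h * f x)) * (v x)\<^sup>2 \<partial>M n)"
  \<comment> \<open>Truncation brings a general \<open>ennreal\<close> function within the reach of
    \<open>good\<close>; monotone convergence undoes it.\<close>
  define vj where "vj j x = min (v x) (of_nat j)" for j :: nat and x
  have vjm[measurable]: "vj j \<in> meas n" for j unfolding vj_def[abs_def] using v by measurable
  have vjm': "vj j \<in> borel_measurable (Nt n h x)" for j x using vjm[of j] by (simp cong: measurable_cong_sets)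
  have vmono: "vj a x \<le> vj b x" if "a \<le> b" for a b x unfolding vj_def using that by (intro min.mono) auto
  have vinc: "incseq vj" unfolding vj_def[abs_def] by (auto intro!: incseq_SucI le_funI min.mono)
  have vsup: "(SUP j. vj j x) = v x" for x unfolding vj_def by (rule SUP_min_of_nat_ennreal)
  have vfin: "vj j x \<noteq> top" for j x unfolding vj_def by (metis ennreal_of_nat_neq_top min.cobounded2 top_unique)
  have step: "phi n (vj j) (\<lambda>_. h) \<le> ?R" for j
  proof -
    define u where "u x = enn2real (vj j x)" for x
    have eu: "ennreal (u x) = vj j x" for x unfolding u_def using vfin[of j x] by (simp add: less_top)
    have "u x \<le> real j" for x
      unfolding u_def vj_def by (metis enn2real_leI ennreal_of_nat_eq_real_of_nat min.cobounded2 of_nat_0_le_iff)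
    moreover have "u \<in> meas n" unfolding u_def[abs_def] by measurable
    moreover have "0 \<le> u x" for x by (simp add: u_def)
    ultimately have gu: "good n u" unfolding good_def by blast
    have "phi n (vj j) (\<lambda>_. h) \<le> ennreal (exp (h * \<Lambda>)) * (\<integral>\<^sup>+x. ennreal (exp (- h * f x)) * ennreal ((u x)\<^sup>2) \<partial>M n)"
      using bounded[OF gu] unfolding eu .
    also have "\<dots> \<le> ?R"
    proof (intro mult_left_mono nn_integral_mono)
      fix x
      have "ennreal ((u x)\<^sup>2) = (vj j x)\<^sup>2" using eu[of x] by (simp add: ennreal_power[symmetric] u_def)
      also have "\<dots> \<le> (v x)\<^sup>2" by (intro power_mono) (auto simp: vj_def)
      finally show "ennreal ((u x)\<^sup>2) \<le> (v x)\<^sup>2" .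
    qed auto
    finally show ?thesis .
  qed
  let ?G = "\<lambda>j x. \<integral>\<^sup>+y. vj j y \<partial>Nt n h x"
  have inner: "PP n h v x = (SUP l. ?G l x)" for x
    unfolding vsup[symmetric] by (rule nn_integral_monotone_convergence_SUP[OF vinc vjm'])
  \<comment> \<open>Both factors increase with the truncation level, so the double supremum is
    bounded by the diagonal one.\<close>
  have diag: "v x * PP n h v x \<le> (SUP j. vj j x * ?G j x)" for x
  proof -
    have "vj j x * ?G l x \<le> (SUP j. vj j x * ?G j x)" for j l
      by (rule SUP_upper2[of "max j l"]) (auto intro!: mult_mono vmono nn_integral_mono)
    then have "(SUP j. vj j x) * (SUP l. ?G l x) \<le> (SUP j. vj j x * ?G j x)"
      by (simp add: SUP_mult_right_ennreal SUP_mult_left_ennreal SUP_le_iff)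
    then show ?thesis unfolding inner vsup .
  qed
  have "phi n v (\<lambda>_. h) \<le> (\<integral>\<^sup>+x. (SUP j. vj j x * ?G j x) \<partial>M n)"
    unfolding phi_def by (rule nn_integral_mono[OF diag])
  also have "\<dots> = (SUP j. phi n (vj j) (\<lambda>_. h))"
    unfolding phi_def
  proof (rule nn_integral_monotone_convergence_SUP)
    show "incseq (\<lambda>j x. vj j x * ?G j x)"
      by (intro incseq_SucI le_funI mult_mono nn_integral_mono vmono) auto
    show "(\<lambda>x. vj j x * ?G j x) \<in> borel_measurable (M n)" for j
      using N_measurable[of "\<lambda>_. h", OF h' vjm[of j]] by simp
  qed
  also have "\<dots> \<le> ?R" by (rule SUP_least[OF step])
  finally show ?thesis .
qed

text \<open>Order of choices: \<open>\<epsilon>\<close> fixes the test functions,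
  \<open>\<eta>\<close> and the long time \<open>s\<close>. At fixed \<open>n\<close> the short step
  \<open>s / 2 ^ k\<close> tends to 0, which removes the boundary error of the grid; only then does
  \<open>n\<close> grow, which removes the localization error.\<close>

lemma upper_bound:
  fixes F :: "'a measure \<Rightarrow> real"
  assumes t: "0 < t" and K: "\<And>c::real. compactin weak_topology {\<nu> \<in> prob_measures. FI \<nu> \<le> ereal c}"
    and F: "usc_on weak_topology F" and bdd: "bounded (F ` prob_measures)"
  shows "limsup (\<lambda>n. ereal (ln (fkn n t (\<lambda>y. real n * F (emp_measure n y))) / (real n * t)))
    \<le> (SUP \<nu>\<in>prob_measures. ereal (F \<nu>) - FI \<nu>)"
proof -
  let ?S = "SUP \<nu>\<in>prob_measures. ereal (F \<nu>) - FI \<nu>"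
  obtain C0 where C0: "\<forall>x\<in>F ` prob_measures. norm x \<le> C0" using bdd by (auto simp: bounded_iff)
  define C where "C = max 1 C0"
  have C: "0 < C" "\<And>\<nu>. \<nu> \<in> prob_measures \<Longrightarrow> \<bar>F \<nu>\<bar> \<le> C" using C0 by (auto simp: C_def le_max_iff_disj)
  have SC: "?S \<le> ereal C"
  proof (rule SUP_least)
    fix \<nu> :: "'a measure" assume "\<nu> \<in> prob_measures"
    then have "ereal (F \<nu>) \<le> ereal C" using C(2)[of \<nu>] by auto
    then show "ereal (F \<nu>) - FI \<nu> \<le> ereal C"
      using fisher_nonneg[of \<nu>] by (metis diff_zero ereal_minus_mono minus_ereal_def order_trans zero_ereal_def ereal_diff_le_self)
  qed
  \<comment> \<open>Together with \<open>SC\<close> this makes the supremum a real number.\<close>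
  have CS: "ereal (- C) \<le> ?S"
  proof -
    obtain \<nu> where \<nu>: "\<nu> \<in> prob_measures" "FI \<nu> \<le> 0" using exists_fisher_zero by blast
    then have "FI \<nu> = 0" using fisher_nonneg[of \<nu>] by simp
    then have "ereal (- C) \<le> ereal (F \<nu>) - FI \<nu>" using C(2)[OF \<nu>(1)] by auto
    also have "\<dots> \<le> ?S" by (rule SUP_upper[OF \<nu>(1)])
    finally show ?thesis .
  qed
  obtain S where S: "?S = ereal S" using SC CS by (cases ?S) auto
  have SC': "- C \<le> S" using CS S by simp
  have Sle: "F \<nu> \<le> S + e" if "\<nu> \<in> prob_measures" "FI \<nu> \<le> ereal e" for \<nu> e
  proof -
    have "ereal (F \<nu>) - ereal e \<le> ereal (F \<nu>) - FI \<nu>" using that(2) by (intro ereal_minus_mono) auto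
    also have "\<dots> \<le> ereal S" unfolding S[symmetric] by (rule SUP_upper[OF that(1)])
    finally show ?thesis by simp
  qed
  have main: "limsup (\<lambda>n. ereal (ln (fkn n t (\<lambda>y. real n * F (emp_measure n y))) / (real n * t))) \<le> ereal (S + 4 * \<epsilon>)"
    if \<epsilon>: "0 < \<epsilon>" for \<epsilon>
  proof -
    obtain \<Phi> r where \<Phi>: "finite \<Phi>" "\<And>\<phi>. \<phi> \<in> \<Phi> \<Longrightarrow> bcont \<phi>" and r: "0 < r"
      and near: "\<And>e \<nu> \<rho>. 0 \<le> e \<Longrightarrow> e \<le> 2 * C + \<epsilon> \<Longrightarrow> \<nu> \<in> prob_measures \<Longrightarrow> \<rho> \<in> prob_measures \<Longrightarrow> FI \<nu> \<le> ereal e \<Longrightarrow>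
        (\<forall>\<phi>\<in>\<Phi>. \<bar>(\<integral>x. \<phi> x \<partial>\<rho>) - (\<integral>x. \<phi> x \<partial>\<nu>)\<bar> < r) \<Longrightarrow> F \<rho> \<le> S + e + 2 * \<epsilon>"
      using usc_near_sublevels[OF K F Sle \<epsilon>, of "2 * C + \<epsilon>"] by blast
    have "\<forall>\<phi>\<in>\<Phi>. \<exists>c. \<forall>x. \<bar>\<phi> x\<bar> \<le> c" using \<Phi>(2) bcontE by metis
    then obtain cb where cb: "\<And>\<phi> x. \<phi> \<in> \<Phi> \<Longrightarrow> \<bar>\<phi> x\<bar> \<le> cb \<phi>" by metis
    define b where "b = Max (insert 1 (cb ` \<Phi>))"
    have b: "0 < b" unfolding b_def using \<Phi>(1) by (subst Max_gr_iff) auto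
    have \<Phi>b: "\<bar>\<phi> x\<bar> \<le> b" if "\<phi> \<in> \<Phi>" for \<phi> x
      using cb[OF that, of x] that \<Phi>(1) unfolding b_def by (auto intro: order_trans Max_ge)
    \<comment> \<open>The three bounds serve the normalization in \<open>mollified_measure\<close>,
      the closeness of test integrals, and the inflation of the energy.\<close>
    define \<eta> where "\<eta> = min (1 / 4) (min (r / (24 * b)) (\<epsilon> / (24 * C)))"
    have \<eta>: "0 < \<eta>" "\<eta> \<le> 1 / 4" unfolding \<eta>_def using r b \<epsilon> C by auto
    have \<eta>3: "6 * b * \<eta> \<le> r / 4"
    proof -
      have "\<eta> \<le> r / (24 * b)" by (simp add: \<eta>_def)
      then show ?thesis using b by (simp add: field_simps)
    qed
    have \<eta>4: "24 * C * \<eta> \<le> \<epsilon>"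
    proof -
      have "\<eta> \<le> \<epsilon> / (24 * C)" by (simp add: \<eta>_def)
      then show ?thesis using C by (simp add: field_simps)
    qed
    \<comment> \<open>\<open>s\<close> is a dyadic fraction of \<open>t\<close>, so that
      \<open>t\<close> is a multiple of every later step; its smallness allows mollification at all
      energies below \<open>2 * C\<close>.\<close>
    obtain a :: nat where a: "t * (2 * C) / \<eta>\<^sup>2 < 2 ^ a" using real_arch_pow[of 2] by auto
    define s where "s = t / 2 ^ a"
    have s: "0 < s" using t by (simp add: s_def)
    have s2: "s * (2 * C) \<le> \<eta>\<^sup>2" using a \<eta> by (simp add: s_def field_simps)
    define Z where "Z = \<lceil>b / (r / 8)\<rceil>"
    define c where "c = real (card \<Phi>) * (real (card {-Z-1..Z+1}) * (pi * b / (r / 8))\<^sup>2 / 2)"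
    have c0: "0 \<le> c" by (simp add: c_def)
    have bound: "ln (fkn n t (\<lambda>y. real n * F (emp_measure n y))) \<le> t * (real n * (S + 3 * \<epsilon>) + c / (s * real n))" if n: "0 < n" for n
    proof -
      let ?f = "\<lambda>y. real n * F (emp_measure n y)" and ?c = "real n * C"
      \<comment> \<open>The cutting error \<open>c / n\<close> belongs to moves of length
        \<open>s\<close>, so it enters the rate divided by \<open>s\<close>.\<close>
      define \<Lambda> where "\<Lambda> = real n * (S + 3 * \<epsilon>) + c / (s * real n)"
      have fm: "?f \<in> meas n" using usc_emp_measurable[OF n F] by (simp add: B_def)
      have fb: "\<bar>?f y\<bar> \<le> ?c" for y using C(2)[OF emp_measure_prob[OF n], of y] by (simp add: abs_mult mult_left_mono)
      let ?w = "\<lambda>x. ennreal (s * (?f x + ?c))"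
      have weq: "?w = (\<lambda>x. ennreal (s * real n * (F (emp_measure n x) + C)))" by (auto simp: algebra_simps)
      have wm: "?w \<in> meas n" using fm by measurable
      let ?A = "real n + s * real n * (S + C + 3 * \<epsilon>)"
      have "0 \<le> S + C + 3 * \<epsilon>" using SC' \<epsilon> by linarith
      then have "0 \<le> s * real n * (S + C + 3 * \<epsilon>)" using s by (intro mult_nonneg_nonneg[of "s * real n"]) auto
      then have A0: "0 \<le> ?A" by (rule add_nonneg_nonneg[OF of_nat_0_le_iff])
      have Psi: "Psi n s ?w u \<le> ennreal (real n + s * (\<Lambda> + ?c)) * sqnorm n u" if u: "good n u" for u
      proof -
        have "Psi n s ?w u \<le> ennreal (?A + c / real n) * sqnorm n u"
          unfolding c_def
        proof (rule Psi_from_localized[where \<delta>="r/8" and b=b and Z=Z and \<Phi>=\<Phi> and A="?A" and w="?w", OF n s wm _ _ \<Phi>(1) _ _ A0 _ u])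
          show "\<bar>\<phi> x\<bar> \<le> b" if "\<phi> \<in> \<Phi>" for \<phi> x using that by (rule \<Phi>b)
          show "0 < r / 8" using r by simp
          show "b / (r / 8) \<le> real_of_int Z" unfolding Z_def by (rule le_of_int_ceiling)
          show "\<phi> \<in> borel_measurable borel" if "\<phi> \<in> \<Phi>" for \<phi> using \<Phi>(2)[OF that] by (rule bcont_measurable)
          fix u' assume u': "good n u'" "localized n (r / 8) \<Phi> u'"
          show "Psi n s ?w u' \<le> ennreal ?A * sqnorm n u'"
          proof (rule Psi_homogeneous[OF less_imp_le[OF s] wm _ u'])
            fix u'' assume u'': "good n u''" "localized n (r / 8) \<Phi> u''" "sqnorm n u'' = 1"
            show "Psi n s ?w u'' \<le> ennreal ?A"
              unfolding weq
              by (rule localized_bound[where \<Phi>=\<Phi> and b=b and F=F and C=C and S=S and \<epsilon>=\<epsilon> and r=r and \<eta>=\<eta> and n=n and s=s and u=u'']) (fact n F C SC' \<epsilon> \<Phi> \<Phi>b b r near \<eta> \<eta>3 \<eta>4 s s2 u'')+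
          qed
        qed
        also have "?A + c / real n = real n + s * (\<Lambda> + ?c)"
          using s n by (simp add: \<Lambda>_def field_simps)
        finally show ?thesis .
      qed
      have A0': "0 \<le> real n + s * (\<Lambda> + ?c)"
      proof -
        have "real n + s * (\<Lambda> + ?c) = ?A + c / real n" using s n by (simp add: \<Lambda>_def field_simps)
        moreover have "0 \<le> c / real n" using c0 by simp
        ultimately show ?thesis using A0 by linarith
      qed
      have ev: "ln (fkn n t ?f) \<le> t * \<Lambda> + s / 2 ^ k * (?c - \<Lambda>)" if k: "n \<le> 2 ^ k" for k
      proof -
        obtain m where m: "(2::nat) ^ (a + k) = Suc m" by (metis Suc_pred zero_less_numeral zero_less_power)
        have h0: "0 < s / 2 ^ k" using s by simp
        have "real (Suc m) = 2 ^ (a + k)" unfolding m[symmetric] by simp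
        then have tt: "t = real (Suc m) * (s / 2 ^ k)" by (simp add: s_def power_add)
        show ?thesis
          by (rule fk_norm_upper[OF fm fb h0 tt]) (rule phi_form_bound[OF s k fm fb A0' Psi refl refl])
      qed
      have "(\<lambda>k. t * \<Lambda> + s * (?c - \<Lambda>) * (1 / 2) ^ k) \<longlonglongrightarrow> t * \<Lambda> + s * (?c - \<Lambda>) * 0"
        by (intro tendsto_intros LIMSEQ_power_zero) simp
      then have lim: "(\<lambda>k. t * \<Lambda> + s / 2 ^ k * (?c - \<Lambda>)) \<longlonglongrightarrow> t * \<Lambda>"
        by (simp add: power_divide mult.commute)
      have "n \<le> 2 ^ k" if "n \<le> k" for k using that less_exp[of k] by linarith
      then have "\<exists>k0. \<forall>k\<ge>k0. ln (fkn n t ?f) \<le> t * \<Lambda> + s / 2 ^ k * (?c - \<Lambda>)" using ev by blast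
      then show ?thesis unfolding \<Lambda>_def[symmetric] by (rule LIMSEQ_le_const[OF lim])
    qed
    have "(\<lambda>n. c / s * (1 / real n)) \<longlonglongrightarrow> c / s * 0" by (intro tendsto_intros lim_1_over_n)
    then have "\<forall>\<^sub>F n in sequentially. c / s * (1 / real n) < \<epsilon>" by (rule order_tendstoD) (use \<epsilon> in simp)
    then have "\<forall>\<^sub>F n in sequentially. ereal (ln (fkn n t (\<lambda>y. real n * F (emp_measure n y))) / (real n * t)) \<le> ereal (S + 4 * \<epsilon>)"
      using eventually_gt_at_top[of 0]
    proof eventually_elim
      case (elim n)
      have n1: "1 \<le> real n" using elim(2) by simp
      have "ln (fkn n t (\<lambda>y. real n * F (emp_measure n y))) / (real n * t) \<le> (t * (real n * (S + 3 * \<epsilon>) + c / (s * real n))) / (real n * t)"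
        using bound[OF elim(2)] t n1 by (intro divide_right_mono) auto
      also have "\<dots> = S + 3 * \<epsilon> + c / s * (1 / real n) * (1 / real n)"
        using t n1 s by (simp add: field_simps)
      also have "c / s * (1 / real n) * (1 / real n) \<le> c / s * (1 / real n) * 1"
        using n1 c0 s by (intro mult_left_mono) auto
      finally show ?case using elim(1) by simp
    qed
    then show ?thesis by (rule Limsup_bounded)
  qed
  show ?thesis unfolding S
  proof (rule ereal_le_epsilon2)
    fix e :: real assume "0 < e"
    then show "limsup (\<lambda>n. ereal (ln (fkn n t (\<lambda>y. real n * F (emp_measure n y))) / (real n * t))) \<le> ereal S + ereal e"
      using main[of "e / 4"] by simp
  qed
qed

end

subsection \<open>The lower bound\<close>

lemma nn_integral_uniform_reflect:
  fixes H :: "real \<Rightarrow> ennreal"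
  assumes [measurable]: "H \<in> borel_measurable borel" and h: "0 < h"
  shows "(\<integral>\<^sup>+r. H (h - r) \<partial>unif h) = (\<integral>\<^sup>+r. H r \<partial>unif h)"
proof -
  have "(\<integral>\<^sup>+r. H r * indicator {0..<h} r \<partial>lborel) = (\<integral>\<^sup>+r. H (h - r) * indicator {0..<h} (h - r) \<partial>lborel)"
    using nn_integral_real_affine[of "\<lambda>r. H r * indicator {0..<h} r" "-1" h] by simp
  also have "\<dots> = (\<integral>\<^sup>+r. H (h - r) * indicator {0..<h} r \<partial>lborel)"
  proof (rule nn_integral_cong_AE)
    show "AE r in lborel. H (h - r) * indicator {0..<h} (h - r) = H (h - r) * indicator {0..<h} r"
      using AE_lborel_singleton[of 0] AE_lborel_singleton[of h] by eventually_elim (auto split: split_indicator)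
  qed
  finally show ?thesis by (simp add: nn_integral_uniform_measure)
qed

context markov_setting
begin

text \<open>\<open>block n h \<psi>\<close> averages \<open>P\<^sub>r \<psi> P\<^bsub>h-r\<^esub>\<close> over \<open>0 \<le> r < h\<close>; the substitution \<open>r \<mapsto> h - r\<close> makes it symmetric.\<close>

definition block_kernel :: "nat \<Rightarrow> real \<Rightarrow> ((nat \<Rightarrow> 'a) \<Rightarrow> ennreal) \<Rightarrow> ((nat \<Rightarrow> 'a) \<Rightarrow> ennreal) \<Rightarrow> real \<Rightarrow> (nat \<Rightarrow> 'a) \<Rightarrow> ennreal" where
  "block_kernel n h \<psi> V r x = (\<integral>\<^sup>+\<omega>. \<psi> (Xn n (max 0 r) \<omega>) * V (Xn n h \<omega>) \<partial>Pn n x)"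

definition block :: "nat \<Rightarrow> real \<Rightarrow> ((nat \<Rightarrow> 'a) \<Rightarrow> ennreal) \<Rightarrow> ((nat \<Rightarrow> 'a) \<Rightarrow> ennreal) \<Rightarrow> (nat \<Rightarrow> 'a) \<Rightarrow> ennreal" where
  "block n h \<psi> V x = (\<integral>\<^sup>+r. block_kernel n h \<psi> V r x \<partial>unif h)"

lemma block_kernel_measurable:
  assumes h: "0 \<le> h" and \<psi>: "\<psi> \<in> meas n" and V: "V \<in> meas n"
  shows "(\<lambda>z. block_kernel n h \<psi> V (fst z) (snd z)) \<in> borel_measurable (borel \<Otimes>\<^sub>M B n)"
  unfolding block_kernel_def
proof (rule nn_integral_measurable_subprob_algebra2[where N="paths n"])
  have 1: "(\<lambda>z. \<psi> (Xn n (max 0 (fst (fst z))) (snd z))) \<in> borel_measurable ((borel \<Otimes>\<^sub>M B n) \<Otimes>\<^sub>M paths n)"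
    by (rule measurable_Xn_shift[OF \<psi>]) measurable
  have 2: "(\<lambda>z. V (Xn n h (snd z))) \<in> borel_measurable ((borel \<Otimes>\<^sub>M B n) \<Otimes>\<^sub>M paths n)"
    by (rule measurable_compose[OF measurable_snd measurable_compose[OF Xn_measurable[OF h] V]])
  show "(\<lambda>(z, \<omega>). \<psi> (Xn n (max 0 (fst z)) \<omega>) * V (Xn n h \<omega>)) \<in> borel_measurable ((borel \<Otimes>\<^sub>M B n) \<Otimes>\<^sub>M paths n)"
    using 1[measurable] 2[measurable] by (simp add: case_prod_beta')
  show "(\<lambda>z. Pn n (snd z)) \<in> borel \<Otimes>\<^sub>M B n \<rightarrow>\<^sub>M subprob_algebra (paths n)"
    by (rule measurable_compose[OF measurable_snd measurable_prob_algebraD[OF Pn_kernel]])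
qed

lemma block_kernel_measurable_uniform:
  assumes h: "0 \<le> h" and \<psi>: "\<psi> \<in> meas n" and V: "V \<in> meas n"
    and g: "g \<in> L \<rightarrow>\<^sub>M B n"
  shows "(\<lambda>z. block_kernel n h \<psi> V (fst z) (g (snd z))) \<in> borel_measurable (unif h \<Otimes>\<^sub>M L)"
proof -
  have "(\<lambda>z. (fst z, g (snd z))) \<in> borel \<Otimes>\<^sub>M L \<rightarrow>\<^sub>M borel \<Otimes>\<^sub>M B n" using g by measurable
  from measurable_compose[OF this block_kernel_measurable[OF h \<psi> V]] show ?thesis
    by (simp cong: measurable_cong_sets sets_pair_measure_cong)
qed

lemma block_measurable:
  assumes h: "0 < h" and \<psi>: "\<psi> \<in> meas n" and V: "V \<in> meas n"
  shows "block n h \<psi> V \<in> meas n"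
proof -
  interpret U: prob_space "unif h" by (rule prob_space_uniform_Ico[OF h])
  have "(\<lambda>z. block_kernel n h \<psi> V (fst z) (snd z)) \<in> borel_measurable (unif h \<Otimes>\<^sub>M B n)"
    using block_kernel_measurable_uniform[OF less_imp_le[OF h] \<psi> V measurable_ident] by simp
  then have "(\<lambda>z. block_kernel n h \<psi> V (snd z) (fst z)) \<in> borel_measurable (B n \<Otimes>\<^sub>M unif h)"
    using measurable_compose[OF measurable_pair_swap', of "\<lambda>z. block_kernel n h \<psi> V (fst z) (snd z)"] by (simp add: case_prod_beta')
  then show ?thesis unfolding block_def[abs_def]
    by (intro U.borel_measurable_nn_integral) (simp add: case_prod_beta')
qed

lemma block_kernel_eq:
  assumes r: "0 \<le> r" "r \<le> h" and \<psi>[measurable]: "\<psi> \<in> meas n" and V: "V \<in> meas n"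
  shows "block_kernel n h \<psi> V r x = (\<integral>\<^sup>+y. \<psi> y * PP n (h - r) V y \<partial>Nt n r x)"
proof -
  have hr: "0 \<le> h - r" and hr': "\<And>i::nat. 0 \<le> h - r" using r by auto
  have Y: "(\<lambda>\<omega>. \<psi> (Xn n r \<omega>)) \<in> borel_measurable (pasts n r)"
    by (rule measurable_compose[OF Xn_measurable_past \<psi>]) (use r in auto)
  have [measurable]: "PP n (h - r) V \<in> meas n" by (rule N_measurable[OF hr' V])
  have "block_kernel n h \<psi> V r x = (\<integral>\<^sup>+\<omega>. \<psi> (Xn n r \<omega>) * V (Xn n (r + (h - r)) \<omega>) \<partial>Pn n x)"
    using r by (simp add: block_kernel_def max_def)
  also have "\<dots> = (\<integral>\<^sup>+\<omega>. \<psi> (Xn n r \<omega>) * PP n (h - r) V (Xn n r \<omega>) \<partial>Pn n x)"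
    by (rule markov_Pn[OF r(1) hr Y V])
  also have "\<dots> = (\<integral>\<^sup>+y. \<psi> y * PP n (h - r) V y \<partial>Nt n r x)"
    by (rule nn_integral_Pn[OF r(1)]) measurable
  finally show ?thesis .
qed

lemma sets_past_mono: "s \<le> r \<Longrightarrow> sets (past s) \<subseteq> sets (past r)"
proof -
  assume s: "s \<le> r"
  have G: "{X u -` A \<inter> space \<Omega> | u A. u \<in> {0..v} \<and> A \<in> sets borel} \<subseteq> Pow (space \<Omega>)" for v by blast
  have "{X u -` A \<inter> space \<Omega> | u A. u \<in> {0..s} \<and> A \<in> sets borel} \<subseteq> {X u -` A \<inter> space \<Omega> | u A. u \<in> {0..r} \<and> A \<in> sets borel}"
  proof (rule subsetI, elim CollectE exE conjE)
    fix Z u A assume "Z = X u -` A \<inter> space \<Omega>" "u \<in> {0..s}" "A \<in> sets borel"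
    moreover from this s have "u \<in> {0..r}" unfolding atLeastAtMost_iff by linarith
    ultimately show "Z \<in> {X u -` A \<inter> space \<Omega> | u A. u \<in> {0..r} \<and> A \<in> sets borel}" by (rule_tac CollectI, rule_tac exI, rule_tac exI, intro conjI)
  qed
  then show ?thesis unfolding past_def nat_filt_def sets_measure_of[OF G] by (rule sigma_sets_mono')
qed

lemma measurable_PiM_coarser:
  assumes id: "(\<lambda>\<omega>. \<omega>) \<in> A \<rightarrow>\<^sub>M A'" and Y: "Y \<in> PiM I (\<lambda>_. A') \<rightarrow>\<^sub>M L"
  shows "Y \<in> PiM I (\<lambda>_. A) \<rightarrow>\<^sub>M L"
proof -
  have "(\<lambda>\<omega>. \<omega>) \<in> PiM I (\<lambda>_. A) \<rightarrow>\<^sub>M PiM I (\<lambda>_. A')"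
  proof (rule measurable_PiM_single')
    show "(\<lambda>\<omega>. \<omega> i) \<in> PiM I (\<lambda>_. A) \<rightarrow>\<^sub>M A'" if "i \<in> I" for i
      by (rule measurable_PiM_coordinate[OF that, where f="\<lambda>\<omega>. \<omega>"]) (rule id)
    show "(\<lambda>\<omega>. \<omega>) \<in> space (PiM I (\<lambda>_. A)) \<rightarrow> (\<Pi>\<^sub>E i\<in>I. space A')"
      using measurable_space[OF id] unfolding space_PiM by (intro Pi_I PiE_I) (auto simp: PiE_iff extensional_def)
  qed
  from measurable_compose[OF this Y] show ?thesis .
qed

lemma measurable_PiM_past_mono:
  assumes s: "s \<le> r" and Y: "Y \<in> pasts n s \<rightarrow>\<^sub>M L"
  shows "Y \<in> pasts n r \<rightarrow>\<^sub>M L"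
proof (rule measurable_PiM_coarser[OF _ Y])
  show "(\<lambda>\<omega>. \<omega>) \<in> past r \<rightarrow>\<^sub>M past s"
    using sets_past_mono[OF s] by (auto simp: measurable_def dest: sets.sets_into_space)
qed

lemma block_markov_step:
  assumes s: "0 \<le> s" and r: "0 \<le> r" "r \<le> h" and \<psi>[measurable]: "\<psi> \<in> meas n" and V: "V \<in> meas n"
    and Y: "Y \<in> borel_measurable (pasts n s)"
  shows "(\<integral>\<^sup>+\<omega>. Y \<omega> * (\<psi> (Xn n (s + r) \<omega>) * V (Xn n (s + h) \<omega>)) \<partial>Pn n x)
    = (\<integral>\<^sup>+\<omega>. Y \<omega> * block_kernel n h \<psi> V r (Xn n s \<omega>) \<partial>Pn n x)"
proof -
  have hr: "0 \<le> h - r" and hr': "\<And>i::nat. 0 \<le> h - r" and sr: "0 \<le> s + r" using r s by auto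
  have Y': "Y \<in> borel_measurable (pasts n (s + r))"
    by (rule measurable_PiM_past_mono[OF _ Y]) (use r in simp)
  have [measurable]: "(\<lambda>\<omega>. \<psi> (Xn n (s + r) \<omega>)) \<in> borel_measurable (pasts n (s + r))"
    by (rule measurable_compose[OF Xn_measurable_past \<psi>]) (use sr in auto)
  have [measurable]: "PP n (h - r) V \<in> meas n" by (rule N_measurable[OF hr' V])
  note Y'[measurable]
  have "(\<integral>\<^sup>+\<omega>. Y \<omega> * (\<psi> (Xn n (s + r) \<omega>) * V (Xn n (s + h) \<omega>)) \<partial>Pn n x)
    = (\<integral>\<^sup>+\<omega>. (Y \<omega> * \<psi> (Xn n (s + r) \<omega>)) * V (Xn n ((s + r) + (h - r)) \<omega>) \<partial>Pn n x)" by (simp add: mult.assoc)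
  also have "\<dots> = (\<integral>\<^sup>+\<omega>. (Y \<omega> * \<psi> (Xn n (s + r) \<omega>)) * PP n (h - r) V (Xn n (s + r) \<omega>) \<partial>Pn n x)"
    by (rule markov_Pn[OF sr hr _ V]) measurable
  also have "\<dots> = (\<integral>\<^sup>+\<omega>. Y \<omega> * (\<lambda>y. \<psi> y * PP n (h - r) V y) (Xn n (s + r) \<omega>) \<partial>Pn n x)"
    by (simp add: mult.assoc)
  also have "\<dots> = (\<integral>\<^sup>+\<omega>. Y \<omega> * (\<integral>\<^sup>+y. \<psi> y * PP n (h - r) V y \<partial>Nt n r (Xn n s \<omega>)) \<partial>Pn n x)"
    by (rule markov_Pn[OF s r(1) Y]) measurable
  finally show ?thesis unfolding block_kernel_eq[OF r \<psi> V] .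
qed

text \<open>Each block contributes a time average, so its offset \<open>r\<close> can be integrated
  last. For fixed \<open>r\<close> the factor of the first block joins the past up to
  \<open>s + h\<close>, the remaining blocks are handled by induction, and
  \<open>block_markov_step\<close> closes the first block.\<close>

lemma block_markov:
  assumes h: "0 < h" and \<psi>: "\<psi> \<in> meas n" and V: "V \<in> meas n"
    and s: "0 \<le> s" and Y: "Y \<in> borel_measurable (pasts n s)"
  shows "(\<integral>\<^sup>+\<omega>. Y \<omega> * ((\<Prod>k<m. \<integral>\<^sup>+r. \<psi> (Xn n (max 0 (s + real k * h + r)) \<omega>) \<partial>unif h)
      * V (Xn n (s + real m * h) \<omega>)) \<partial>Pn n x)
    = (\<integral>\<^sup>+\<omega>. Y \<omega> * (block n h \<psi> ^^ m) V (Xn n s \<omega>) \<partial>Pn n x)"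
  using s Y
proof (induction m arbitrary: s Y)
  case 0
  then show ?case by simp
next
  case (Suc m)
  let ?U = "unif h"
  let ?W = "(block n h \<psi> ^^ m) V"
  let ?R = "\<lambda>s m \<omega>. (\<Prod>k<m. \<integral>\<^sup>+r. \<psi> (Xn n (max 0 (s + real k * h + r)) \<omega>) \<partial>?U)"
  interpret U: prob_space ?U by (rule prob_space_uniform_Ico[OF h])
  interpret Q: prob_space "Pn n x" by (rule prob_Pn)
  interpret UQ: pair_sigma_finite ?U "Pn n x" ..
  have W: "?W \<in> meas n" by (induction m) (auto intro: V block_measurable[OF h \<psi>])
  have Y: "Y \<in> borel_measurable (paths n)" by (rule measurable_PiM_coarser[OF measurable_id_past Suc.prems(2)])
  have sh: "0 \<le> s + h" using Suc.prems h by simp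
  have Xs: "(\<lambda>\<omega>. v (Xn n u \<omega>)) \<in> borel_measurable (Pn n x)" if "0 \<le> u" "v \<in> meas n" for u and v :: "(nat \<Rightarrow> 'a) \<Rightarrow> ennreal"
    using measurable_compose[OF Xn_measurable that(2)] that(1) by (simp cong: measurable_cong_sets)
  have Xr: "(\<lambda>z. \<psi> (Xn n (max 0 (c + fst z)) (snd z))) \<in> borel_measurable (?U \<Otimes>\<^sub>M Pn n x)" for c
  proof -
    have "(\<lambda>z. \<psi> (Xn n (max 0 (c + fst z)) (snd z))) \<in> borel_measurable (borel \<Otimes>\<^sub>M paths n)"
      by (rule measurable_Xn_shift[OF \<psi>]) measurable
    then show ?thesis by (simp cong: measurable_cong_sets sets_pair_measure_cong)
  qed
  have Xa: "(\<lambda>\<omega>. \<integral>\<^sup>+r. \<psi> (Xn n (max 0 (c + r)) \<omega>) \<partial>?U) \<in> borel_measurable (Pn n x)" for c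
    using measurable_compose[OF measurable_pair_swap' Xr[of c]] by (intro U.borel_measurable_nn_integral) (simp add: case_prod_beta')
  have Xo: "(\<lambda>r. \<psi> (Xn n (max 0 (c + r)) \<omega>)) \<in> borel_measurable ?U" if "\<omega> \<in> space (Pn n x)" for c \<omega>
    using measurable_compose[OF measurable_Pair2'[OF that] Xr[of c]] by simp
  have pull: "(\<integral>\<^sup>+r. a * \<psi> (Xn n (max 0 (c + r)) \<omega>) * d \<partial>?U) = a * (\<integral>\<^sup>+r. \<psi> (Xn n (max 0 (c + r)) \<omega>) \<partial>?U) * d"
    if "\<omega> \<in> space (Pn n x)" for a c d \<omega>
    by (subst nn_integral_multc[OF borel_measurable_times_ennreal[OF borel_measurable_const Xo[OF that]]])
      (subst nn_integral_cmult[OF Xo[OF that]], simp)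
  let ?rest = "\<lambda>\<omega>. ?R (s + h) m \<omega> * V (Xn n (s + h + real m * h) \<omega>)"
  have rest: "?rest \<in> borel_measurable (Pn n x)"
  proof -
    have "0 \<le> s + h + real m * h" using sh h by simp
    from Xs[OF this V] show ?thesis using Xa by measurable
  qed
  have Ym: "Y \<in> borel_measurable (Pn n x)" using Y by (simp cong: measurable_cong_sets)
  have time: "s + h + real k * h = s + real (Suc k) * h" for k by (simp add: algebra_simps)
  have split: "?R s (Suc m) \<omega> = (\<integral>\<^sup>+r. \<psi> (Xn n (max 0 (s + r)) \<omega>) \<partial>?U) * ?R (s + h) m \<omega>" for \<omega>
    unfolding prod.lessThan_Suc_shift time by simp
  have "(\<integral>\<^sup>+\<omega>. Y \<omega> * (?R s (Suc m) \<omega> * V (Xn n (s + real (Suc m) * h) \<omega>)) \<partial>Pn n x)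
    = (\<integral>\<^sup>+\<omega>. \<integral>\<^sup>+r. Y \<omega> * \<psi> (Xn n (max 0 (s + r)) \<omega>) * ?rest \<omega> \<partial>?U \<partial>Pn n x)"
    unfolding split time[symmetric]
    by (intro nn_integral_cong) (use Xo in \<open>simp only: pull, simp add: mult.assoc\<close>)
  \<comment> \<open>The offset is moved outside, so that for almost every \<open>r\<close> the
    Markov property is applied at deterministic times.\<close>
  also have "\<dots> = (\<integral>\<^sup>+r. \<integral>\<^sup>+\<omega>. Y \<omega> * \<psi> (Xn n (max 0 (s + r)) \<omega>) * ?rest \<omega> \<partial>Pn n x \<partial>?U)"
    by (rule UQ.Fubini') (use Xr[of s] Ym rest in \<open>simp add: case_prod_beta'\<close>)
  also have "\<dots> = (\<integral>\<^sup>+r. \<integral>\<^sup>+\<omega>. Y \<omega> * block_kernel n h \<psi> ?W r (Xn n s \<omega>) \<partial>Pn n x \<partial>?U)"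
  proof (rule nn_integral_cong_AE, use AE_uniform_Ico[of h] in eventually_elim)
    case (elim r)
    then have r: "0 \<le> r" "r \<le> h" and mx: "max 0 (s + r) = s + r" using Suc.prems by auto
    have "Y \<in> borel_measurable (pasts n (s + h))"
      by (rule measurable_PiM_past_mono[OF _ Suc.prems(2)]) (use h in simp)
    moreover have "(\<lambda>\<omega>. \<psi> (Xn n (s + r) \<omega>)) \<in> borel_measurable (pasts n (s + h))"
      by (rule measurable_compose[OF Xn_measurable_past \<psi>]) (use Suc.prems r in auto)
    ultimately have Y': "(\<lambda>\<omega>. Y \<omega> * \<psi> (Xn n (s + r) \<omega>)) \<in> borel_measurable (pasts n (s + h))" by measurable
    show ?case unfolding mx Suc.IH[OF sh Y'] using block_markov_step[OF Suc.prems(1) r \<psi> W Suc.prems(2)] by (simp add: mult.assoc)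
  qed
  also have "\<dots> = (\<integral>\<^sup>+\<omega>. \<integral>\<^sup>+r. Y \<omega> * block_kernel n h \<psi> ?W r (Xn n s \<omega>) \<partial>?U \<partial>Pn n x)"
  proof (rule UQ.Fubini'[symmetric])
    have "Xn n s \<in> Pn n x \<rightarrow>\<^sub>M B n" using Xn_measurable[OF Suc.prems(1)] by (simp cong: measurable_cong_sets)
    from block_kernel_measurable_uniform[OF less_imp_le[OF h] \<psi> W this] Ym
    show "(\<lambda>(r, \<omega>). Y \<omega> * block_kernel n h \<psi> ?W r (Xn n s \<omega>)) \<in> borel_measurable (?U \<Otimes>\<^sub>M Pn n x)"
      by (simp add: case_prod_beta')
  qed
  also have "\<dots> = (\<integral>\<^sup>+\<omega>. Y \<omega> * (block n h \<psi> ^^ Suc m) V (Xn n s \<omega>) \<partial>Pn n x)"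
  proof (rule nn_integral_cong)
    fix \<omega> assume w: "\<omega> \<in> space (Pn n x)"
    have "Xn n s \<in> Pn n x \<rightarrow>\<^sub>M B n" using Xn_measurable[OF Suc.prems(1)] by (simp cong: measurable_cong_sets)
    from measurable_compose[OF measurable_Pair2'[OF w] block_kernel_measurable_uniform[OF less_imp_le[OF h] \<psi> W this]]
    have "(\<lambda>r. block_kernel n h \<psi> ?W r (Xn n s \<omega>)) \<in> borel_measurable ?U" by simp
    then show "(\<integral>\<^sup>+r. Y \<omega> * block_kernel n h \<psi> ?W r (Xn n s \<omega>) \<partial>?U) = Y \<omega> * (block n h \<psi> ^^ Suc m) V (Xn n s \<omega>)"
      by (simp add: nn_integral_cmult block_def)
  qed
  finally show ?case .
qed

text \<open>Symmetry of the kernels turns <V, Q W>, with Q the block operator, into the mean over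
  \<open>r\<close> of integrals of \<psi> times V evolved for time r and W evolved for time h - r.
  Reflecting \<open>r\<close> exchanges the roles of \<open>V\<close> and \<open>W\<close>.\<close>

lemma block_symmetric:
  assumes h: "0 < h" and \<psi>[measurable]: "\<psi> \<in> meas n" and V: "V \<in> meas n" and W: "W \<in> meas n"
  shows block_inner: "(\<integral>\<^sup>+x. V x * block n h \<psi> W x \<partial>M n) = (\<integral>\<^sup>+r. (\<integral>\<^sup>+x. \<psi> x * PP n r V x * PP n (h - r) W x \<partial>M n) \<partial>unif h)"
    and "(\<integral>\<^sup>+x. V x * block n h \<psi> W x \<partial>M n) = (\<integral>\<^sup>+x. W x * block n h \<psi> V x \<partial>M n)"
proof -
  let ?U = "unif h"
  let ?G = "\<lambda>V W r. \<integral>\<^sup>+x. \<psi> x * PP n r V x * PP n (h - r) W x \<partial>M n"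
  interpret U: prob_space ?U by (rule prob_space_uniform_Ico[OF h])
  interpret Mn: prob_space "M n" by (rule prob_M)
  interpret UM: pair_sigma_finite ?U "M n" ..
  have kernel: "(\<integral>\<^sup>+x. V x * block_kernel n h \<psi> W r x \<partial>M n) = ?G V W r"
    if r: "0 \<le> r" "r \<le> h" and V: "V \<in> meas n" and W: "W \<in> meas n" for r V W
  proof -
    have r1: "\<And>i::nat. 0 \<le> r" and r2: "\<And>i::nat. 0 \<le> h - r" using r by auto
    have [measurable]: "PP n (h - r) W \<in> meas n" by (rule N_measurable[OF r2 W])
    show ?thesis unfolding block_kernel_eq[OF r \<psi> W]
      by (subst N_symmetric[OF r1 V]) (auto simp: mult_ac intro!: nn_integral_cong)
  qed
  have inner: "(\<integral>\<^sup>+x. V x * block n h \<psi> W x \<partial>M n) = (\<integral>\<^sup>+r. \<integral>\<^sup>+x. V x * block_kernel n h \<psi> W r x \<partial>M n \<partial>?U)"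
    if V: "V \<in> meas n" and W: "W \<in> meas n" for V W
  proof -
    have id: "(\<lambda>x. x) \<in> M n \<rightarrow>\<^sub>M B n" by (rule measurable_ident_sets) simp
    note m = block_kernel_measurable_uniform[OF less_imp_le[OF h] \<psi> W id]
    have "(\<integral>\<^sup>+x. V x * block n h \<psi> W x \<partial>M n) = (\<integral>\<^sup>+x. \<integral>\<^sup>+r. V x * block_kernel n h \<psi> W r x \<partial>?U \<partial>M n)"
    proof (rule nn_integral_cong)
      fix x assume x: "x \<in> space (M n)"
      from measurable_compose[OF measurable_Pair2'[OF x] m]
      have "(\<lambda>r. block_kernel n h \<psi> W r x) \<in> borel_measurable ?U" by simp
      then show "V x * block n h \<psi> W x = (\<integral>\<^sup>+r. V x * block_kernel n h \<psi> W r x \<partial>?U)"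
        by (simp add: nn_integral_cmult block_def)
    qed
    also have "\<dots> = (\<integral>\<^sup>+r. \<integral>\<^sup>+x. V x * block_kernel n h \<psi> W r x \<partial>M n \<partial>?U)"
    proof (rule UM.Fubini')
      have "V \<in> borel_measurable (M n)" using V by (simp cong: measurable_cong_sets)
      then show "(\<lambda>(r, x). V x * block_kernel n h \<psi> W r x) \<in> borel_measurable (?U \<Otimes>\<^sub>M M n)"
        using m by (simp add: case_prod_beta')
    qed
    finally show ?thesis .
  qed
  have G: "(\<integral>\<^sup>+x. V x * block n h \<psi> W x \<partial>M n) = (\<integral>\<^sup>+r. ?G V W r \<partial>?U)"
    if V: "V \<in> meas n" and W: "W \<in> meas n" for V W
    unfolding inner[OF V W] by (rule nn_integral_cong_AE, use AE_uniform_Ico[of h] in eventually_elim) (simp add: kernel V W)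
  show "(\<integral>\<^sup>+x. V x * block n h \<psi> W x \<partial>M n) = (\<integral>\<^sup>+r. ?G V W r \<partial>?U)" by (rule G[OF V W])
  let ?H = "\<lambda>V W r. \<integral>\<^sup>+x. V x * block_kernel n h \<psi> W r x \<partial>M n"
  have Hm: "(\<lambda>r. ?H V W r) \<in> borel_measurable borel"
  proof -
    have "V \<in> borel_measurable (M n)" using V by (simp cong: measurable_cong_sets)
    moreover have "(\<lambda>z. block_kernel n h \<psi> W (fst z) (snd z)) \<in> borel_measurable (borel \<Otimes>\<^sub>M M n)"
      using block_kernel_measurable[OF less_imp_le[OF h] \<psi> W] by (simp cong: measurable_cong_sets sets_pair_measure_cong)
    ultimately show ?thesis by (intro Mn.borel_measurable_nn_integral) (simp add: case_prod_beta')
  qed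
  have "(\<integral>\<^sup>+x. V x * block n h \<psi> W x \<partial>M n) = (\<integral>\<^sup>+r. ?H V W (h - r) \<partial>?U)"
    unfolding inner[OF V W] by (rule nn_integral_uniform_reflect[OF Hm h, symmetric])
  also have "\<dots> = (\<integral>\<^sup>+r. ?G W V r \<partial>?U)"
    by (rule nn_integral_cong_AE, use AE_uniform_Ico[of h] in eventually_elim) (simp add: kernel V W mult_ac)
  also have "\<dots> = (\<integral>\<^sup>+x. W x * block n h \<psi> V x \<partial>M n)" by (rule G[OF W V, symmetric])
  finally show "(\<integral>\<^sup>+x. V x * block n h \<psi> W x \<partial>M n) = (\<integral>\<^sup>+x. W x * block n h \<psi> V x \<partial>M n)" .
qed

end

text \<open>A vector of norm at most 1 whose overlap with the unit vector \<open>g\<close> is at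
  least \<open>1 - \<delta>\<close> lies within sqrt(2\<delta>) of \<open>g\<close>. Replacing
  \<open>u\<close> and \<open>v\<close> by \<open>g\<close> one after the other costs b
  sqrt(2\<delta>) each time.\<close>

lemma weighted_overlap:
  fixes f u v g :: "'b \<Rightarrow> real"
  assumes f[measurable]: "f \<in> borel_measurable M" and b: "\<And>x. \<bar>f x\<bar> \<le> b"
    and L: "L2 M u" "L2 M v" "L2 M g"
    and u: "(\<integral>x. (u x)\<^sup>2 \<partial>M) \<le> 1" and v: "(\<integral>x. (v x)\<^sup>2 \<partial>M) \<le> 1" and g: "(\<integral>x. (g x)\<^sup>2 \<partial>M) = 1"
    and gu: "1 - \<delta> \<le> (\<integral>x. g x * u x \<partial>M)" and gv: "1 - \<delta> \<le> (\<integral>x. g x * v x \<partial>M)"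
  shows "(\<integral>x. f x * (g x)\<^sup>2 \<partial>M) - 2 * b * sqrt (2 * \<delta>) \<le> (\<integral>x. f x * (u x * v x) \<partial>M)"
proof -
  have b0: "0 \<le> b" using b[of undefined] by linarith
  have near: "(\<integral>x. (w x - g x)\<^sup>2 \<partial>M) \<le> 2 * \<delta>"
    if w: "L2 M w" "(\<integral>x. (w x)\<^sup>2 \<partial>M) \<le> 1" "1 - \<delta> \<le> (\<integral>x. g x * w x \<partial>M)" for w
  proof -
    have "(\<integral>x. (w x - g x)\<^sup>2 \<partial>M) = (\<integral>x. (w x)\<^sup>2 - 2 * (g x * w x) + (g x)\<^sup>2 \<partial>M)"
      by (intro Bochner_Integration.integral_cong refl) (simp add: power2_diff)
    also have "\<dots> = (\<integral>x. (w x)\<^sup>2 \<partial>M) - 2 * (\<integral>x. g x * w x \<partial>M) + (\<integral>x. (g x)\<^sup>2 \<partial>M)"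
      using L2_square[OF w(1)] L2_square[OF L(3)] L2_mult_integrable[OF L(3) w(1)] by simp
    finally show ?thesis using w g by linarith
  qed
  have prod: "\<bar>\<integral>x. f x * (p x * q x) \<partial>M\<bar> \<le> b * sqrt (2 * \<delta>)" and fpq: "integrable M (\<lambda>x. f x * (p x * q x))"
    if p: "L2 M p" "(\<integral>x. (p x)\<^sup>2 \<partial>M) \<le> 1" and q: "L2 M q" "(\<integral>x. (q x)\<^sup>2 \<partial>M) \<le> 2 * \<delta>" for p q
  proof -
    have fp: "L2 M (\<lambda>x. f x * p x)" and fp2: "(\<integral>x. (f x * p x)\<^sup>2 \<partial>M) \<le> b\<^sup>2"
    proof -
      have le: "(f x * p x)\<^sup>2 \<le> b\<^sup>2 * (p x)\<^sup>2" for x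
        unfolding power_mult_distrib using power_mono[OF b[of x], of 2] by (intro mult_right_mono) auto
      have [measurable]: "p \<in> borel_measurable M" by (rule L2_measurable[OF p(1)])
      have i: "integrable M (\<lambda>x. b\<^sup>2 * (p x)\<^sup>2)" using L2_square[OF p(1)] by simp
      have j: "integrable M (\<lambda>x. (f x * p x)\<^sup>2)"
        by (rule Bochner_Integration.integrable_bound[OF i]) (use le in auto)
      then show "L2 M (\<lambda>x. f x * p x)" by (simp add: L2_def)
      have "(\<integral>x. (f x * p x)\<^sup>2 \<partial>M) \<le> (\<integral>x. b\<^sup>2 * (p x)\<^sup>2 \<partial>M)" by (rule integral_mono[OF j i le])
      also have "\<dots> \<le> b\<^sup>2 * 1" using p(2) by (simp add: mult_left_le)
      finally show "(\<integral>x. (f x * p x)\<^sup>2 \<partial>M) \<le> b\<^sup>2" by simp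
    qed
    have "\<bar>\<integral>x. (f x * p x) * q x \<partial>M\<bar> \<le> sqrt (\<integral>x. (f x * p x)\<^sup>2 \<partial>M) * sqrt (\<integral>x. (q x)\<^sup>2 \<partial>M)"
      by (rule L2_cauchy_schwarz[OF fp q(1)])
    also have "\<dots> \<le> sqrt (b\<^sup>2) * sqrt (2 * \<delta>)" using fp2 q(2) by (intro mult_mono real_sqrt_le_mono) auto
    finally show "\<bar>\<integral>x. f x * (p x * q x) \<partial>M\<bar> \<le> b * sqrt (2 * \<delta>)" using b0 by (simp add: mult.assoc)
    show "integrable M (\<lambda>x. f x * (p x * q x))" using L2_mult_integrable[OF fp q(1)] by (simp add: mult.assoc)
  qed
  note Lu = L2_diff[OF L(1,3)] and Lv = L2_diff[OF L(2,3)]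
  note nu = near[OF L(1) u gu] and nv = near[OF L(2) v gv]
  have gg: "integrable M (\<lambda>x. f x * (g x)\<^sup>2)"
    by (rule integrable_bounded_mult[OF L2_square[OF L(3)] f b])
  have "(\<integral>x. f x * (u x * v x) \<partial>M) = (\<integral>x. f x * (g x)\<^sup>2 + f x * (u x * (v x - g x)) + f x * (g x * (u x - g x)) \<partial>M)"
    by (intro Bochner_Integration.integral_cong refl) (simp add: algebra_simps power2_eq_square)
  also have "\<dots> = (\<integral>x. f x * (g x)\<^sup>2 \<partial>M) + (\<integral>x. f x * (u x * (v x - g x)) \<partial>M) + (\<integral>x. f x * (g x * (u x - g x)) \<partial>M)"
    using gg fpq[OF L(1) u Lv nv] fpq[OF L(3) _ Lu nu] g by simp
  finally show ?thesis using prod[OF L(1) u Lv nv] prod[OF L(3) _ Lu nu] g by linarith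
qed

lemma Cauchy_Schwarz_unit:
  fixes u w :: "'b \<Rightarrow> ennreal"
  assumes [measurable]: "u \<in> borel_measurable M" "w \<in> borel_measurable M" and u: "(\<integral>\<^sup>+x. (u x)\<^sup>2 \<partial>M) \<le> 1"
  shows "(\<integral>\<^sup>+x. u x * w x \<partial>M)\<^sup>2 \<le> (\<integral>\<^sup>+x. (w x)\<^sup>2 \<partial>M)"
proof -
  have "(\<integral>\<^sup>+x. u x * w x \<partial>M)\<^sup>2 \<le> (\<integral>\<^sup>+x. (u x)\<^sup>2 \<partial>M) * (\<integral>\<^sup>+x. (w x)\<^sup>2 \<partial>M)"
    by (rule Cauchy_Schwarz_nn_integral) auto
  also have "\<dots> \<le> 1 * (\<integral>\<^sup>+x. (w x)\<^sup>2 \<partial>M)" using u by (rule mult_right_mono) simp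
  finally show ?thesis by simp
qed

context markov_setting
begin

section \<open>Powers of the block operator\<close>

lemma block_power_measurable:
  assumes "0 < h" "\<psi> \<in> meas n" "V \<in> meas n"
  shows "(block n h \<psi> ^^ m) V \<in> meas n"
  by (induction m) (auto intro: assms block_measurable)

lemma block_power_symmetric:
  assumes h: "0 < h" and \<psi>: "\<psi> \<in> meas n" and "V \<in> meas n" "W \<in> meas n"
  shows "(\<integral>\<^sup>+x. V x * (block n h \<psi> ^^ m) W x \<partial>M n) = (\<integral>\<^sup>+x. W x * (block n h \<psi> ^^ m) V x \<partial>M n)"
  using assms(3,4)
proof (induction m arbitrary: V)
  case 0
  then show ?case by (simp add: mult.commute)
next
  case (Suc m)
  have W: "(block n h \<psi> ^^ m) W \<in> meas n" by (rule block_power_measurable[OF h \<psi> Suc.prems(2)])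
  have V: "block n h \<psi> V \<in> meas n" by (rule block_measurable[OF h \<psi> Suc.prems(1)])
  have "(\<integral>\<^sup>+x. V x * (block n h \<psi> ^^ Suc m) W x \<partial>M n) = (\<integral>\<^sup>+x. block n h \<psi> V x * (block n h \<psi> ^^ m) W x \<partial>M n)"
    using block_symmetric[OF h \<psi> Suc.prems(1) W] by (simp add: mult.commute)
  also have "\<dots> = (\<integral>\<^sup>+x. W x * (block n h \<psi> ^^ m) (block n h \<psi> V) x \<partial>M n)" by (rule Suc.IH[OF V Suc.prems(2)])
  finally show ?case by (simp only: funpow_Suc_right comp_def)
qed

text \<open>For R = Q^(2^k), with Q the block operator, symmetry and Cauchy--Schwarz give <V, R V>^2
  \<le> |R V|^2 = <V, R^2 V>; each squaring doubles the number of blocks. This accounts for the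
  block length \<open>t / 2 ^ k\<close>.\<close>

lemma block_power_form:
  assumes h: "0 < h" and \<psi>: "\<psi> \<in> meas n" and V: "V \<in> meas n" and V1: "(\<integral>\<^sup>+x. (V x)\<^sup>2 \<partial>M n) \<le> 1"
  shows "(\<integral>\<^sup>+x. V x * block n h \<psi> V x \<partial>M n) ^ 2 ^ k \<le> (\<integral>\<^sup>+x. V x * (block n h \<psi> ^^ 2 ^ k) V x \<partial>M n)"
proof (induction k)
  case 0
  then show ?case by simp
next
  case (Suc k)
  let ?W = "(block n h \<psi> ^^ 2 ^ k) V"
  have W: "?W \<in> meas n" by (rule block_power_measurable[OF h \<psi> V])
  have "(\<integral>\<^sup>+x. V x * block n h \<psi> V x \<partial>M n) ^ 2 ^ Suc k \<le> (\<integral>\<^sup>+x. V x * ?W x \<partial>M n)\<^sup>2"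
    using power_mono[OF Suc, of 2] by (simp add: power_mult[symmetric] mult.commute)
  also have "\<dots> \<le> (\<integral>\<^sup>+x. (?W x)\<^sup>2 \<partial>M n)"
    using V W V1 by (intro Cauchy_Schwarz_unit) (auto cong: measurable_cong_sets)
  also have "\<dots> = (\<integral>\<^sup>+x. V x * (block n h \<psi> ^^ 2 ^ k) ?W x \<partial>M n)"
    unfolding power2_eq_square by (rule block_power_symmetric[OF h \<psi> W V])
  also have "(block n h \<psi> ^^ 2 ^ k) ?W = (block n h \<psi> ^^ 2 ^ Suc k) V" by (simp add: mult_2 funpow_add)
  finally show ?case .
qed

text \<open>On each block exp x \<ge> 1 + x, where x is \<open>h\<close> times the mean of
  \<open>f\<close> over the block. The condition \<open>h * b \<le> 1\<close> keeps all factors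
  nonnegative, so that the inequalities can be multiplied.\<close>

lemma fk_op_ge_block:
  fixes f g :: "(nat \<Rightarrow> 'a) \<Rightarrow> real"
  assumes f[measurable]: "f \<in> meas n" and b: "\<And>x. \<bar>f x\<bar> \<le> b" and h: "0 < h" and hb: "h * b \<le> 1"
    and g[measurable]: "g \<in> meas n" and g0: "\<And>x. 0 \<le> g x" and x: "x \<in> space (B n)"
  shows "(block n h (\<lambda>x. ennreal (1 + h * f x)) ^^ m) (\<lambda>x. ennreal (g x)) x \<le> fk n (real m * h) f g x"
proof -
  let ?U = "unif h"
  let ?\<psi> = "\<lambda>x. ennreal (1 + h * f x)"
  let ?V = "\<lambda>x. ennreal (g x)"
  interpret U: prob_space ?U by (rule prob_space_uniform_Ico[OF h])
  have \<psi>: "?\<psi> \<in> meas n" and V: "?V \<in> meas n" by measurable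
  have hf: "\<bar>h * f y\<bar> \<le> 1" for y
  proof -
    have "\<bar>h * f y\<bar> \<le> h * b" unfolding abs_mult using b[of y] h by (intro mult_mono) auto
    then show ?thesis using hb by linarith
  qed
  have path: "(\<Prod>k<m. \<integral>\<^sup>+r. ?\<psi> (Xn n (max 0 (0 + real k * h + r)) \<omega>) \<partial>?U)
    \<le> ennreal (exp (\<integral>s\<in>{0..real m * h}. f (Xn n s \<omega>) \<partial>lborel))" if w: "\<omega> \<in> space (paths n)" for \<omega>
  proof -
    define \<Psi> where "\<Psi> s = f (Xn n (max 0 s) \<omega>)" for s
    have \<Psi>[measurable]: "\<Psi> \<in> borel_measurable borel" unfolding \<Psi>_def by (rule path_measurable[OF f w])
    have b\<Psi>: "\<bar>\<Psi> s\<bar> \<le> b" and h\<Psi>: "\<bar>h * \<Psi> s\<bar> \<le> 1" for s unfolding \<Psi>_def by (rule b, rule hf)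
    define y where "y k = (\<integral>r. \<Psi> (real k * h + r) \<partial>?U)" for k
    have i\<Psi>: "integrable ?U (\<lambda>r. \<Psi> (real k * h + r))" for k
      by (rule U.integrable_const_bound[where B=b]) (use b\<Psi> in auto)
    have block: "(\<integral>\<^sup>+r. ?\<psi> (Xn n (max 0 (0 + real k * h + r)) \<omega>) \<partial>?U) = ennreal (1 + h * y k) \<and> 0 \<le> 1 + h * y k" for k
    proof -
      have pos: "0 \<le> 1 + h * \<Psi> s" for s using h\<Psi>[of s] by linarith
      have "(\<integral>\<^sup>+r. ennreal (1 + h * \<Psi> (real k * h + r)) \<partial>?U) = ennreal (\<integral>r. 1 + h * \<Psi> (real k * h + r) \<partial>?U)"
        by (rule nn_integral_eq_integral) (use i\<Psi> pos in auto)
      moreover have "(\<integral>r. 1 + h * \<Psi> (real k * h + r) \<partial>?U) = 1 + h * y k"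
        unfolding y_def using i\<Psi>[of k] U.prob_space by simp
      moreover have "0 \<le> (\<integral>r. 1 + h * \<Psi> (real k * h + r) \<partial>?U)" using pos by (intro Bochner_Integration.integral_nonneg)
      ultimately show ?thesis by (simp add: \<Psi>_def)
    qed
    have eq: "(\<integral>s\<in>{0..real m * h}. f (Xn n s \<omega>) \<partial>lborel) = (\<Sum>k<m. h * y k)"
      unfolding path_integral_blocks[OF f b h w] y_def \<Psi>_def ..
    have "(\<Prod>k<m. \<integral>\<^sup>+r. ?\<psi> (Xn n (max 0 (0 + real k * h + r)) \<omega>) \<partial>?U) = ennreal (\<Prod>k<m. 1 + h * y k)"
      using block by (simp add: prod_ennreal)
    also have "\<dots> \<le> ennreal (\<Prod>k<m. exp (h * y k))"
      using block by (intro ennreal_leI prod_mono) (auto simp: exp_ge_add_one_self)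
    also have "\<dots> = ennreal (exp (\<integral>s\<in>{0..real m * h}. f (Xn n s \<omega>) \<partial>lborel))" unfolding eq by (simp add: exp_sum)
    finally show ?thesis .
  qed
  have "(block n h ?\<psi> ^^ m) ?V x = (\<integral>\<^sup>+\<omega>. 1 * (block n h ?\<psi> ^^ m) ?V (Xn n 0 \<omega>) \<partial>Pn n x)"
    unfolding mult_1_left nn_integral_Pn[OF order_refl block_power_measurable[OF h \<psi> V]]
    by (simp add: N_0[OF x] nn_integral_return[OF x block_power_measurable[OF h \<psi> V]])
  also have "\<dots> = (\<integral>\<^sup>+\<omega>. 1 * ((\<Prod>k<m. \<integral>\<^sup>+r. ?\<psi> (Xn n (max 0 (0 + real k * h + r)) \<omega>) \<partial>?U) * ?V (Xn n (0 + real m * h) \<omega>)) \<partial>Pn n x)"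
    by (rule block_markov[OF h \<psi> V, symmetric]) auto
  also have "\<dots> \<le> fk n (real m * h) f g x"
    unfolding fk_op_eq
  proof (rule nn_integral_mono)
    fix \<omega> assume "\<omega> \<in> space (Pn n x)"
    then have w: "\<omega> \<in> space (paths n)" by simp
    show "1 * ((\<Prod>k<m. \<integral>\<^sup>+r. ?\<psi> (Xn n (max 0 (0 + real k * h + r)) \<omega>) \<partial>?U) * ?V (Xn n (0 + real m * h) \<omega>))
      \<le> ennreal (g (Xn n (real m * h) \<omega>) * exp (\<integral>s\<in>{0..real m * h}. f (Xn n s \<omega>) \<partial>lborel))"
      using mult_right_mono[OF path[OF w], of "?V (Xn n (real m * h) \<omega>)"] g0 by (simp add: ennreal_mult mult.commute)
  qed
  finally show ?thesis .
qed

text \<open>\<open>enn2real\<close> sends the infinite value to 0, so a lower bound survives the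
  definition of \<open>fk_norm\<close> only if the supremum is finite. One step of length
  \<open>t\<close> with the trivial rate \<open>b\<close> shows this.\<close>

lemma fk_sup_finite:
  fixes f :: "(nat \<Rightarrow> 'a) \<Rightarrow> real"
  assumes f[measurable]: "f \<in> meas n" and b: "\<And>x. \<bar>f x\<bar> \<le> b" and t: "0 < t"
  shows "(SUP g\<in>unit_fun n. \<integral>\<^sup>+y. (fk n t f g y)\<^sup>2 \<partial>M n) < top"
proof -
  have form: "phi n u (\<lambda>_. t) \<le> ennreal (exp (t * b)) * (\<integral>\<^sup>+x. ennreal (exp (- t * f x)) * (u x)\<^sup>2 \<partial>M n)"
    if u[measurable]: "u \<in> meas n" for u
  proof -
    have t': "\<And>i::nat. 0 \<le> t" using t by simp
    have "phi n u (\<lambda>_. t) \<le> (\<integral>\<^sup>+x. (u x)\<^sup>2 \<partial>M n)" by (rule phi_le[OF t' u])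
    also have "\<dots> \<le> (\<integral>\<^sup>+x. ennreal (exp (t * b)) * (ennreal (exp (- t * f x)) * (u x)\<^sup>2) \<partial>M n)"
    proof (rule nn_integral_mono)
      fix x
      have "t * f x \<le> t * b" using b[of x] t by (intro mult_left_mono) auto
      then have "ennreal 1 \<le> ennreal (exp (t * b) * exp (- t * f x))"
        unfolding exp_add[symmetric] by (intro ennreal_leI) simp
      from mult_right_mono[OF this, of "(u x)\<^sup>2"]
      show "(u x)\<^sup>2 \<le> ennreal (exp (t * b)) * (ennreal (exp (- t * f x)) * (u x)\<^sup>2)"
        by (simp add: ennreal_mult mult.assoc)
    qed
    also have "\<dots> = ennreal (exp (t * b)) * (\<integral>\<^sup>+x. ennreal (exp (- t * f x)) * (u x)\<^sup>2 \<partial>M n)"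
      by (rule nn_integral_cmult) measurable
    finally show ?thesis .
  qed
  have "(SUP g\<in>unit_fun n. \<integral>\<^sup>+y. (fk n t f g y)\<^sup>2 \<partial>M n) \<le> (ennreal (exp (t * b)) * ennreal (exp (t * b)) ^ 0)\<^sup>2"
  proof (rule SUP_least)
    fix g assume "g \<in> unit_fun n"
    then show "(\<integral>\<^sup>+y. (fk n t f g y)\<^sup>2 \<partial>M n) \<le> (ennreal (exp (t * b)) * ennreal (exp (t * b)) ^ 0)\<^sup>2"
      using fk_op_norm_le[OF f b t _ _ _ form, of g 0] by (auto simp: unit_fun_def)
  qed
  also have "\<dots> < top" by (simp add: ennreal_power)
  finally show ?thesis .
qed

text \<open>The norm of the block power applied to \<open>g\<close> is at least its form at
  \<open>g\<close>, and the Feynman--Kac operator dominates the block power pointwise.\<close>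

lemma fk_norm_ge_block_form:
  fixes f g :: "(nat \<Rightarrow> 'a) \<Rightarrow> real"
  assumes f[measurable]: "f \<in> meas n" and b: "\<And>x. \<bar>f x\<bar> \<le> b" and t: "0 < t" and hb: "t / 2 ^ k * b \<le> 1"
    and g: "g \<in> unit_fun n" and c: "0 \<le> c"
    and form: "ennreal c \<le> (\<integral>\<^sup>+x. ennreal (g x) * block n (t / 2 ^ k) (\<lambda>x. ennreal (1 + t / 2 ^ k * f x)) (\<lambda>x. ennreal (g x)) x \<partial>M n)"
  shows "c ^ 2 ^ k \<le> fkn n t f"
proof -
  let ?h = "t / 2 ^ k"
  let ?Q = "block n ?h (\<lambda>x. ennreal (1 + ?h * f x))"
  let ?S = "SUP g\<in>unit_fun n. \<integral>\<^sup>+y. (fk n t f g y)\<^sup>2 \<partial>M n"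
  have h: "0 < ?h" using t by simp
  have th: "real (2 ^ k) * ?h = t" by simp
  have g': "g \<in> meas n" "\<And>x. 0 \<le> g x" using g by (auto simp: unit_fun_def)
  have V: "(\<lambda>x. ennreal (g x)) \<in> meas n" using g'(1) by measurable
  have \<psi>: "(\<lambda>x. ennreal (1 + ?h * f x)) \<in> meas n" by measurable
  have V1: "(\<integral>\<^sup>+x. (ennreal (g x))\<^sup>2 \<partial>M n) \<le> 1" using g g'(2) by (simp add: unit_fun_def ennreal_power)
  let ?W = "(?Q ^^ 2 ^ k) (\<lambda>x. ennreal (g x))"
  have "ennreal c ^ 2 ^ k \<le> (\<integral>\<^sup>+x. ennreal (g x) * ?Q (\<lambda>x. ennreal (g x)) x \<partial>M n) ^ 2 ^ k"
    by (rule power_mono[OF form]) simp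
  also have "\<dots> \<le> (\<integral>\<^sup>+x. ennreal (g x) * ?W x \<partial>M n)"
    by (rule block_power_form[OF h \<psi> V V1])
  finally have "(ennreal c ^ 2 ^ k)\<^sup>2 \<le> (\<integral>\<^sup>+x. ennreal (g x) * ?W x \<partial>M n)\<^sup>2" by (intro power_mono) auto
  also have "\<dots> \<le> (\<integral>\<^sup>+x. (?W x)\<^sup>2 \<partial>M n)"
    using V block_power_measurable[OF h \<psi> V] V1 by (intro Cauchy_Schwarz_unit) (auto cong: measurable_cong_sets)
  also have "\<dots> \<le> (\<integral>\<^sup>+x. (fk n t f g x)\<^sup>2 \<partial>M n)"
    using fk_op_ge_block[OF f b h hb g', of _ "2 ^ k", unfolded th] by (intro nn_integral_mono power_mono) auto
  also have "\<dots> \<le> ?S" by (rule SUP_upper[OF g])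
  finally have "ennreal ((c ^ 2 ^ k)\<^sup>2) \<le> ?S" using c by (simp add: ennreal_power)
  from enn2real_mono[OF this fk_sup_finite[OF f b t]] have "(c ^ 2 ^ k)\<^sup>2 \<le> enn2real ?S" by simp
  then show ?thesis unfolding fk_norm_eq by (rule real_le_rsqrt)
qed

text \<open>The block form is \<open>phi\<close> at time \<open>h\<close> plus \<open>h\<close>
  times a mean of f-weighted products of \<open>g\<close> evolved for times r and h - r. The first
  term loses at most \<open>h * D\<close>. Both evolved functions overlap with \<open>g\<close> by
  at least \<open>1 - h * D\<close>, so \<open>weighted_overlap\<close> replaces them by
  \<open>g\<close> with an error that vanishes with \<open>h\<close>.\<close>

lemma block_form_ge:
  fixes f g :: "(nat \<Rightarrow> 'a) \<Rightarrow> real"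
  assumes f[measurable]: "f \<in> meas n" and b: "\<And>x. \<bar>f x\<bar> \<le> b" and h: "0 < h" and hb: "h * b \<le> 1" and D: "0 \<le> D"
    and g[measurable]: "g \<in> meas n" and g0: "\<And>x. 0 \<le> g x" and g1: "sqnorm n g = 1"
    and form: "\<And>r. 0 \<le> r \<Longrightarrow> ennreal (1 - r * D) \<le> phi n (\<lambda>x. ennreal (g x)) (\<lambda>_. r)"
  shows "ennreal (1 + h * ((\<integral>x. f x * (g x)\<^sup>2 \<partial>M n) - D - 2 * b * sqrt (2 * (h * D))))
    \<le> (\<integral>\<^sup>+x. ennreal (g x) * block n h (\<lambda>x. ennreal (1 + h * f x)) (\<lambda>x. ennreal (g x)) x \<partial>M n)"
proof -
  let ?U = "unif h"
  let ?V = "\<lambda>x. ennreal (g x)"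
  let ?N = "\<lambda>r x. PP n r ?V x"
  let ?c = "1 + h * ((\<integral>x. f x * (g x)\<^sup>2 \<partial>M n) - D - 2 * b * sqrt (2 * (h * D)))"
  interpret U: prob_space ?U by (rule prob_space_uniform_Ico[OF h])
  have \<psi>: "(\<lambda>x. ennreal (1 + h * f x)) \<in> meas n" and V: "?V \<in> meas n" by measurable
  have hf: "0 \<le> 1 + h * f y" for y
  proof -
    have "\<bar>h * f y\<bar> \<le> h * b" unfolding abs_mult using b[of y] h by (intro mult_mono) auto
    then show ?thesis using hb by linarith
  qed
  \<comment> \<open>Real-valued representative of the evolved function, which is finite almost
    everywhere by contraction.\<close>
  define u where "u r x = enn2real (?N r x)" for r x
  have V2: "(\<integral>\<^sup>+x. (?V x)\<^sup>2 \<partial>M n) = 1" using g1 g0 by (simp add: ennreal_power)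
  have u: "AE x in M n. ?N r x = ennreal (u r x)" "u r \<in> borel_measurable (M n)" "L2 (M n) (u r)" "(\<integral>x. (u r x)\<^sup>2 \<partial>M n) \<le> 1" if r: "0 \<le> r" for r
  proof -
    have r': "\<And>i::nat. 0 \<le> r" using r by simp
    have m: "?N r \<in> borel_measurable (M n)" using N_measurable[OF r' V] by (simp cong: measurable_cong_sets)
    have le: "(\<integral>\<^sup>+x. (?N r x)\<^sup>2 \<partial>M n) \<le> 1" using N_contraction[OF r' V] unfolding V2 .
    then have "(\<integral>\<^sup>+x. (?N r x)\<^sup>2 \<partial>M n) \<noteq> \<infinity>" using neq_top_trans by force
    then have "AE x in M n. (?N r x)\<^sup>2 \<noteq> \<infinity>" using m by (intro nn_integral_noteq_infinite) auto
    then show ae: "AE x in M n. ?N r x = ennreal (u r x)"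
      by eventually_elim (auto simp: u_def less_top power2_eq_square ennreal_mult_eq_top_iff)
    show um: "u r \<in> borel_measurable (M n)" unfolding u_def using m by measurable
    have u0: "0 \<le> u r x" for x by (simp add: u_def)
    have "sqnorm n (u r) = (\<integral>\<^sup>+x. (?N r x)\<^sup>2 \<partial>M n)"
      by (rule nn_integral_cong_AE, use ae in eventually_elim) (simp add: ennreal_power u0)
    then have le': "sqnorm n (u r) \<le> ennreal 1" using le by simp
    then have i: "integrable (M n) (\<lambda>x. (u r x)\<^sup>2)"
      using um by (intro integrableI_bounded) (auto simp: le_less_trans[OF le'])
    then show "L2 (M n) (u r)" using um by (simp add: L2_def)
    show "(\<integral>x. (u r x)\<^sup>2 \<partial>M n) \<le> 1"
      using le' unfolding nn_integral_eq_integral[OF i AE_I2[OF zero_le_power2]] by simp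
  qed
  have gi: "integrable (M n) (\<lambda>x. (g x)\<^sup>2)"
    using g1 by (intro integrableI_bounded) (auto cong: measurable_cong_sets)
  have gL: "L2 (M n) g" using gi by (auto simp: L2_def cong: measurable_cong_sets)
  have gg: "(\<integral>x. (g x)\<^sup>2 \<partial>M n) = 1"
    using g1 unfolding nn_integral_eq_integral[OF gi AE_I2[OF zero_le_power2]] by simp
  have pair: "(\<integral>\<^sup>+x. ennreal (p x) * ennreal (q x) \<partial>M n) = ennreal (\<integral>x. p x * q x \<partial>M n)"
    if "L2 (M n) p" "L2 (M n) q" "\<And>x. 0 \<le> p x" "\<And>x. 0 \<le> q x" for p q
    unfolding ennreal_mult[OF that(3,4), symmetric]
    by (rule nn_integral_eq_integral[OF L2_mult_integrable[OF that(1,2)]]) (simp add: that)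
  have u0: "0 \<le> u r x" for r x by (simp add: u_def)
  have gu: "1 - h * D \<le> (\<integral>x. g x * u r x \<partial>M n)" if r: "0 \<le> r" "r \<le> h" for r
  proof -
    have "ennreal (1 - r * D) \<le> (\<integral>\<^sup>+x. ?V x * ?N r x \<partial>M n)" using form[OF r(1)] by (simp add: phi_def)
    also have "\<dots> = (\<integral>\<^sup>+x. ennreal (g x) * ennreal (u r x) \<partial>M n)"
      by (rule nn_integral_cong_AE, use u(1)[OF r(1)] in eventually_elim) simp
    also have "\<dots> = ennreal (\<integral>x. g x * u r x \<partial>M n)" by (rule pair[OF gL u(3)[OF r(1)] g0 u0])
    finally have "1 - r * D \<le> (\<integral>x. g x * u r x \<partial>M n)"
      using Bochner_Integration.integral_nonneg[of "M n" "\<lambda>x. g x * u r x"] g0 u0 by (simp add: ennreal_le_iff)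
    moreover have "r * D \<le> h * D" using r D by (intro mult_right_mono)
    ultimately show ?thesis by linarith
  qed
  have main: "ennreal ?c \<le> (\<integral>\<^sup>+x. ennreal (1 + h * f x) * ?N r x * ?N (h - r) x \<partial>M n)" if r: "0 \<le> r" "r \<le> h" for r
  proof -
    have hr: "0 \<le> h - r" "h - r \<le> h" and r': "\<And>i::nat. 0 \<le> r" and hr': "\<And>i::nat. 0 \<le> h - r" using r by auto
    note L = u(3)[OF r(1)] u(3)[OF hr(1)]
    have fm: "f \<in> borel_measurable (M n)" by (simp cong: measurable_cong_sets)
    have uv: "integrable (M n) (\<lambda>x. u r x * u (h - r) x)" by (rule L2_mult_integrable[OF L])
    have fuv: "integrable (M n) (\<lambda>x. f x * (u r x * u (h - r) x))"
      by (rule integrable_bounded_mult[OF uv fm b])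
    have "ennreal (1 - h * D) \<le> phi n ?V (\<lambda>_. r + (h - r))" using form[of h] h by simp
    also have "\<dots> = (\<integral>\<^sup>+x. ?N r x * ?N (h - r) x \<partial>M n)" by (rule phi_add[OF r' hr' V])
    also have "\<dots> = (\<integral>\<^sup>+x. ennreal (u r x) * ennreal (u (h - r) x) \<partial>M n)"
      by (rule nn_integral_cong_AE, use u(1)[OF r(1)] u(1)[OF hr(1)] in eventually_elim) simp
    also have "\<dots> = ennreal (\<integral>x. u r x * u (h - r) x \<partial>M n)" by (rule pair[OF L u0 u0])
    finally have 1: "1 - h * D \<le> (\<integral>x. u r x * u (h - r) x \<partial>M n)"
      using Bochner_Integration.integral_nonneg[of "M n" "\<lambda>x. u r x * u (h - r) x"] u0 by (simp add: ennreal_le_iff)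
    have 2: "(\<integral>x. f x * (g x)\<^sup>2 \<partial>M n) - 2 * b * sqrt (2 * (h * D)) \<le> (\<integral>x. f x * (u r x * u (h - r) x) \<partial>M n)"
      by (rule weighted_overlap[OF fm b L gL u(4)[OF r(1)] u(4)[OF hr(1)] gg gu[OF r] gu[OF hr]])
    have "?c = 1 - h * D + h * ((\<integral>x. f x * (g x)\<^sup>2 \<partial>M n) - 2 * b * sqrt (2 * (h * D)))" by (simp add: algebra_simps)
    also have "\<dots> \<le> (\<integral>x. u r x * u (h - r) x \<partial>M n) + h * (\<integral>x. f x * (u r x * u (h - r) x) \<partial>M n)"
      using 1 2 h by (intro add_mono mult_left_mono) auto
    also have "\<dots> = (\<integral>x. (1 + h * f x) * (u r x * u (h - r) x) \<partial>M n)"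
      using uv fuv by (simp add: distrib_right mult.assoc)
    finally have "ennreal ?c \<le> ennreal (\<integral>x. (1 + h * f x) * (u r x * u (h - r) x) \<partial>M n)" by (rule ennreal_leI)
    also have "\<dots> = (\<integral>\<^sup>+x. ennreal ((1 + h * f x) * (u r x * u (h - r) x)) \<partial>M n)"
    proof (rule nn_integral_eq_integral[symmetric])
      show "integrable (M n) (\<lambda>x. (1 + h * f x) * (u r x * u (h - r) x))"
        using uv fuv by (simp add: distrib_right mult.assoc)
      show "AE x in M n. 0 \<le> (1 + h * f x) * (u r x * u (h - r) x)"
        by (intro AE_I2 mult_nonneg_nonneg hf u0)
    qed
    also have "\<dots> = (\<integral>\<^sup>+x. ennreal (1 + h * f x) * ?N r x * ?N (h - r) x \<partial>M n)"
      by (rule nn_integral_cong_AE, use u(1)[OF r(1)] u(1)[OF hr(1)] in eventually_elim)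
        (simp add: ennreal_mult hf u0 mult.assoc)
    finally show ?thesis .
  qed
  have "ennreal ?c = (\<integral>\<^sup>+r. ennreal ?c \<partial>?U)" using U.emeasure_space_1 by simp
  also have "\<dots> \<le> (\<integral>\<^sup>+r. (\<integral>\<^sup>+x. ennreal (1 + h * f x) * ?N r x * ?N (h - r) x \<partial>M n) \<partial>?U)"
    by (rule nn_integral_mono_AE, use AE_uniform_Ico[of h] in eventually_elim) (rule main, auto)
  also have "\<dots> = (\<integral>\<^sup>+x. ?V x * block n h (\<lambda>x. ennreal (1 + h * f x)) ?V x \<partial>M n)"
    by (rule block_inner[OF h \<psi> V V, symmetric])
  finally show ?thesis .
qed

text \<open>With blocks of length \<open>t / 2 ^ k\<close> the norm dominates the power
  \<open>2 ^ k\<close> of a number 1 + h y, and the logarithm of this power tends to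
  \<open>t\<close> times the limit of y.\<close>

lemma fk_norm_lower:
  fixes f g :: "(nat \<Rightarrow> 'a) \<Rightarrow> real"
  assumes f: "f \<in> meas n" and b: "\<And>x. \<bar>f x\<bar> \<le> b" and t: "0 < t" and D: "0 \<le> D"
    and g: "g \<in> meas n" and g0: "\<And>x. 0 \<le> g x" and g1: "sqnorm n g = 1"
    and form: "\<And>r. 0 \<le> r \<Longrightarrow> ennreal (1 - r * D) \<le> phi n (\<lambda>x. ennreal (g x)) (\<lambda>_. r)"
  shows "t * ((\<integral>x. f x * (g x)\<^sup>2 \<partial>M n) - D) \<le> ln (fkn n t f)"
proof -
  define h where "h k = t / 2 ^ k" for k :: nat
  define y where "y k = (\<integral>x. f x * (g x)\<^sup>2 \<partial>M n) - D - 2 * b * sqrt (2 * (h k * D))" for k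
  have h0: "0 < h k" for k using t by (simp add: h_def)
  have hlim: "h \<longlonglongrightarrow> 0"
  proof -
    have "(\<lambda>k. t * (1 / 2) ^ k) \<longlonglongrightarrow> t * 0" by (intro tendsto_intros LIMSEQ_power_zero) simp
    then show ?thesis by (simp add: h_def[abs_def] power_divide)
  qed
  have ylim: "y \<longlonglongrightarrow> (\<integral>x. f x * (g x)\<^sup>2 \<partial>M n) - D - 2 * b * sqrt (2 * (0 * D))"
    unfolding y_def by (intro tendsto_intros hlim)
  then have ylim: "y \<longlonglongrightarrow> (\<integral>x. f x * (g x)\<^sup>2 \<partial>M n) - D" by simp
  have unit: "g \<in> unit_fun n" using g g0 g1 by (simp add: unit_fun_def)
  have hylim: "(\<lambda>k. h k * y k) \<longlonglongrightarrow> 0" using tendsto_mult[OF hlim ylim] by simp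
  have "(\<lambda>k. h k * b) \<longlonglongrightarrow> 0" using tendsto_mult_right[OF hlim, of b] by simp
  then have "\<forall>\<^sub>F k in sequentially. h k * b < 1" by (rule order_tendstoD) simp
  moreover have "\<forall>\<^sub>F k in sequentially. - (1/2) < h k * y k" by (rule order_tendstoD[OF hylim]) simp
  moreover have "\<forall>\<^sub>F k in sequentially. h k * y k < 1/2" by (rule order_tendstoD[OF hylim]) simp
  ultimately have ev: "\<forall>\<^sub>F k in sequentially. t * y k - 2 * t * (h k * y k) * y k \<le> ln (fkn n t f)"
  proof eventually_elim
    case (elim k)
    let ?z = "h k * y k"
    have z: "\<bar>?z\<bar> \<le> 1/2" using elim by linarith
    have pos: "0 < 1 + ?z" using elim by linarith
    have hb: "h k * b \<le> 1" using elim by simp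
    have "ennreal (1 + ?z) \<le> (\<integral>\<^sup>+x. ennreal (g x) * block n (h k) (\<lambda>x. ennreal (1 + h k * f x)) (\<lambda>x. ennreal (g x)) x \<partial>M n)"
      unfolding y_def by (rule block_form_ge[OF f b h0 hb D g g0 g1 form])
    from fk_norm_ge_block_form[OF f b t hb[unfolded h_def] unit less_imp_le[OF pos, unfolded h_def[of k]] this[unfolded h_def[of k]]]
    have le: "(1 + ?z) ^ 2 ^ k \<le> fkn n t f" unfolding h_def .
    have "t * y k - 2 * t * ?z * y k = 2 ^ k * (?z - 2 * ?z\<^sup>2)"
      unfolding h_def by (simp add: field_simps power2_eq_square)
    \<comment> \<open>ln(1 + z) \<ge> z - 2z^2 for |z| \<le> 1/2; the quadratic loss is of second
      order in the block length and disappears after multiplication by \<open>2 ^ k\<close>.\<close>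
    also have "\<dots> \<le> 2 ^ k * ln (1 + ?z)"
      using abs_ln_one_plus_x_minus_x_bound[OF z] by (intro mult_left_mono) auto
    also have "\<dots> = ln ((1 + ?z) ^ 2 ^ k)" using pos by (simp add: ln_realpow)
    also have "\<dots> \<le> ln (fkn n t f)" using le pos by (intro ln_mono) auto
    finally show ?case .
  qed
  have "(\<lambda>k. t * y k - 2 * t * (h k * y k) * y k) \<longlonglongrightarrow> t * ((\<integral>x. f x * (g x)\<^sup>2 \<partial>M n) - D) - 2 * t * 0 * ((\<integral>x. f x * (g x)\<^sup>2 \<partial>M n) - D)"
    by (intro tendsto_intros ylim hylim)
  from tendsto_upperbound[OF this ev] show ?thesis by simp
qed

section \<open>Product test functions\<close>

lemma P_form_eq:
  assumes r: "0 \<le> r" and g: "L2m g" and g0: "\<And>x. 0 \<le> g x"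
  shows "(\<integral>\<^sup>+x. ennreal (g x) * P r (\<lambda>x. ennreal (g x)) x \<partial>\<mu>) = ennreal (\<integral>x. g x * T r g x \<partial>\<mu>)"
proof -
  have [measurable]: "g \<in> borel_measurable borel" by (rule L2m_measurable[OF g])
  have "(\<integral>\<^sup>+x. ennreal (g x) * P r (\<lambda>x. ennreal (g x)) x \<partial>\<mu>) = (\<integral>\<^sup>+z. ennreal (g (fst z) * g (snd z)) \<partial>J r)"
    by (subst nn_integral_J[OF r]) (auto simp: ennreal_mult g0 nn_integral_cmult)
  also have "\<dots> = ennreal (\<integral>z. g (fst z) * g (snd z) \<partial>J r)"
    by (rule nn_integral_eq_integral[OF L2_mult_integrable[OF L2_J[OF r g]]]) (simp add: g0)
  finally show ?thesis unfolding T_inner[OF r g g] .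
qed

text \<open>Independence factorizes both the evolution of a product function and its integral under
  \<open>M n\<close>.\<close>

lemma phi_tensor:
  assumes r: "0 \<le> r" and g[measurable]: "g \<in> borel_measurable borel" and g0: "\<And>x. 0 \<le> g x"
  shows "phi n (\<lambda>x. ennreal (\<Prod>i<n. g (x i))) (\<lambda>_. r) = (\<integral>\<^sup>+x. ennreal (g x) * P r (\<lambda>x. ennreal (g x)) x \<partial>\<mu>) ^ n"
proof -
  have [measurable]: "P r (\<lambda>x. ennreal (g x)) \<in> borel_measurable borel" using r by (intro P_measurable) auto
  have "phi n (\<lambda>x. ennreal (\<Prod>i<n. g (x i))) (\<lambda>_. r) = (\<integral>\<^sup>+x. (\<Prod>i<n. ennreal (g (x i)) * P r (\<lambda>x. ennreal (g x)) (x i)) \<partial>M n)"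
    unfolding phi_def
  proof (rule nn_integral_cong)
    fix x
    have "(\<integral>\<^sup>+y. ennreal (\<Prod>i<n. g (y i)) \<partial>Nt n r x) = (\<integral>\<^sup>+y. (\<Prod>i<n. ennreal (g (y i))) \<partial>Nt n r x)"
      by (simp add: prod_ennreal g0)
    also have "\<dots> = (\<Prod>i<n. P r (\<lambda>x. ennreal (g x)) (x i))"
      unfolding N_def by (rule nn_integral_PiM_prod) (use prob_K[OF r] in auto)
    finally show "ennreal (\<Prod>i<n. g (x i)) * (\<integral>\<^sup>+y. ennreal (\<Prod>i<n. g (y i)) \<partial>Nt n r x)
      = (\<Prod>i<n. ennreal (g (x i)) * P r (\<lambda>x. ennreal (g x)) (x i))"
      by (simp add: prod.distrib prod_ennreal g0)
  qed
  also have "\<dots> = (\<Prod>i<n. \<integral>\<^sup>+x. ennreal (g x) * P r (\<lambda>x. ennreal (g x)) x \<partial>\<mu>)"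
    unfolding M_def by (rule nn_integral_PiM_prod) (use prob_mu in auto)
  finally show ?thesis by simp
qed

text \<open>The test function is the n-fold tensor power of sqrt(d\<nu>/d\<mu>), whose square times
  \<mu>^n is \<nu>^n. The one-particle form bound 1 - r I becomes 1 - r n I by Bernoulli's
  inequality, so the energies add up.\<close>

lemma lower_bound_at:
  fixes F :: "'a measure \<Rightarrow> real"
  assumes t: "0 < t" and F: "lsc_on weak_topology F" and C: "\<And>\<rho>. \<rho> \<in> prob_measures \<Longrightarrow> \<bar>F \<rho>\<bar> \<le> C"
    and \<nu>: "\<nu> \<in> prob_measures" and I: "FI \<nu> = ereal I" and n: "0 < n"
  shows "(\<integral>x. F (emp_measure n x) \<partial>PiM {..<n} (\<lambda>_. \<nu>)) - I
    \<le> ln (fkn n t (\<lambda>y. real n * F (emp_measure n y))) / (real n * t)"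
proof -
  interpret m: prob_space \<mu> by (rule prob_mu)
  interpret v: prob_space \<nu> by (rule prob_measuresD[OF \<nu>])
  define g where "g x = sqrt (enn2real (RN_deriv \<mu> \<nu> x))" for x
  have ac: "absolutely_continuous \<mu> \<nu>" and dom: "ddom g" and Ig: "dfm g = I"
    using I unfolding fisher_def Let_def g_def by (auto split: if_splits)
  have I0: "0 \<le> I" using fisher_nonneg[of \<nu>] I by simp
  have g0: "0 \<le> g x" for x by (simp add: g_def)
  have gm[measurable]: "g \<in> borel_measurable borel"
    unfolding g_def[abs_def] using borel_measurable_RN_deriv[of \<mu> \<nu>] by (simp cong: measurable_cong_sets)
  have sets: "sets \<nu> = sets \<mu>" using prob_measuresD[OF \<nu>] by simp
  have dens: "density \<mu> (\<lambda>x. ennreal ((g x)\<^sup>2)) = \<nu>"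
  proof -
    \<comment> \<open>Finiteness almost everywhere makes \<open>enn2real\<close> in the definition
      of \<open>g\<close> lossless.\<close>
    have fin: "AE x in \<mu>. RN_deriv \<mu> \<nu> x \<noteq> \<infinity>"
      by (rule m.RN_deriv_finite[OF _ ac sets]) (rule v.sigma_finite_measure_axioms)
    have "density \<mu> (\<lambda>x. ennreal ((g x)\<^sup>2)) = density \<mu> (RN_deriv \<mu> \<nu>)"
    proof (rule density_cong)
      show "AE x in \<mu>. ennreal ((g x)\<^sup>2) = RN_deriv \<mu> \<nu> x"
        using fin by eventually_elim (simp add: g_def less_top)
    qed auto
    then show ?thesis using m.density_RN_deriv[OF ac sets] by simp
  qed
  have g1: "(\<integral>\<^sup>+x. ennreal ((g x)\<^sup>2) \<partial>\<mu>) = 1"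
  proof -
    have "emeasure \<nu> UNIV = (\<integral>\<^sup>+x. ennreal ((g x)\<^sup>2) \<partial>\<mu>)"
      unfolding dens[symmetric] by (subst emeasure_density) auto
    then show ?thesis using v.emeasure_space_1 space_prob_measures[OF \<nu>] by simp
  qed
  have g2i: "integrable \<mu> (\<lambda>x. (g x)\<^sup>2)" using g1 by (intro integrableI_bounded) auto
  have gL: "L2m g" using g2i by (simp add: L2_def)
  have g2: "(\<integral>x. (g x)\<^sup>2 \<partial>\<mu>) = 1" using g1 unfolding nn_integral_eq_integral[OF g2i AE_I2[OF zero_le_power2]] by simp
  have form1: "ennreal (1 - r * I) \<le> (\<integral>\<^sup>+x. ennreal (g x) * P r (\<lambda>x. ennreal (g x)) x \<partial>\<mu>)" if r: "0 \<le> r" for r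
  proof (cases "r = 0")
    case True
    then show ?thesis using g1 g0 by (simp add: P_0 power2_eq_square ennreal_mult)
  next
    case False
    then have r0: "0 < r" using r by simp
    have "En r g \<le> I" using En_le_dform[OF dom r0] Ig by simp
    then have "1 - (\<integral>x. g x * T r g x \<partial>\<mu>) \<le> r * I"
      unfolding En_eq[OF r0 gL] g2 using r0 by (simp add: field_simps)
    then show ?thesis unfolding P_form_eq[OF r gL g0] by (intro ennreal_leI) simp
  qed
  let ?g = "\<lambda>x. \<Prod>i<n. g (x i)" and ?f = "\<lambda>x. real n * F (emp_measure n x)"
  have fm: "?f \<in> meas n" using lsc_emp_measurable[OF n F] by (simp add: B_def)
  have fb: "\<bar>?f x\<bar> \<le> real n * C" for x
    using C[OF emp_measure_prob[OF n], of x] by (simp add: abs_mult mult_left_mono)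
  have gn: "?g \<in> meas n" unfolding B_def by measurable
  have gn0: "0 \<le> ?g x" for x by (simp add: g0 prod_nonneg)
  have gn2: "ennreal ((?g x)\<^sup>2) = (\<Prod>i<n. ennreal ((g (x i))\<^sup>2))" for x
    by (simp add: prod_ennreal prod_power_distrib)
  have gn1: "sqnorm n ?g = 1"
  proof -
    have "(\<integral>\<^sup>+x. (\<Prod>i<n. ennreal ((g (x i))\<^sup>2)) \<partial>M n) = (\<Prod>i<n. \<integral>\<^sup>+x. ennreal ((g x)\<^sup>2) \<partial>\<mu>)"
      unfolding M_def by (rule nn_integral_PiM_prod) (use prob_mu in auto)
    then show ?thesis unfolding gn2 g1 by simp
  qed
  have form: "ennreal (1 - r * (real n * I)) \<le> phi n (\<lambda>x. ennreal (?g x)) (\<lambda>_. r)" if r: "0 \<le> r" for r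
  proof (cases "r * I \<le> 1")
    case True
    have "1 + real n * (- (r * I)) \<le> (1 + (- (r * I))) ^ n" by (rule Bernoulli_inequality) (use True in simp)
    then have "ennreal (1 - r * (real n * I)) \<le> ennreal ((1 - r * I) ^ n)"
      by (intro ennreal_leI) (simp add: algebra_simps)
    also have "\<dots> = ennreal (1 - r * I) ^ n" using True by (simp add: ennreal_power)
    also have "\<dots> \<le> phi n (\<lambda>x. ennreal (?g x)) (\<lambda>_. r)"
      unfolding phi_tensor[OF r gm g0] by (rule power_mono[OF form1[OF r]]) simp
    finally show ?thesis .
  next
    case False
    \<comment> \<open>Outside the range of Bernoulli's inequality the left-hand side is
      \<open>ennreal\<close> of a nonpositive number, hence 0.\<close>
    have "1 * 1 \<le> real n * (r * I)" using n False by (intro mult_mono) auto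
    then have "1 - r * (real n * I) \<le> 0" by (simp add: mult_ac)
    then show ?thesis by (simp add: ennreal_neg)
  qed
  have "(\<integral>x. ?f x * (?g x)\<^sup>2 \<partial>M n) = real n * (\<integral>x. F (emp_measure n x) \<partial>PiM {..<n} (\<lambda>_. \<nu>))"
  proof -
    have "PiM {..<n} (\<lambda>_. \<nu>) = density (M n) (\<lambda>x. \<Prod>i<n. ennreal ((g (x i))\<^sup>2))"
      unfolding M_def by (subst dens[symmetric], rule PiM_density) (use prob_mu g1 in auto)
    also have "\<dots> = density (M n) (\<lambda>x. ennreal ((?g x)\<^sup>2))" unfolding gn2 ..
    finally have eq: "PiM {..<n} (\<lambda>_. \<nu>) = density (M n) (\<lambda>x. ennreal ((?g x)\<^sup>2))" .
    have Fm: "(\<lambda>x. F (emp_measure n x)) \<in> borel_measurable (M n)"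
      using lsc_emp_measurable[OF n F] by (simp add: B_def[symmetric] cong: measurable_cong_sets)
    have "(\<lambda>x. (?g x)\<^sup>2) \<in> borel_measurable (M n)" using gn by (simp cong: measurable_cong_sets)
    from integral_density[OF Fm this] show ?thesis unfolding eq by (simp add: mult_ac)
  qed
  with fk_norm_lower[OF fm fb t _ gn gn0 gn1 form] I0
  have "t * (real n * (\<integral>x. F (emp_measure n x) \<partial>PiM {..<n} (\<lambda>_. \<nu>)) - real n * I) \<le> ln (fkn n t ?f)" by simp
  then have "((\<integral>x. F (emp_measure n x) \<partial>PiM {..<n} (\<lambda>_. \<nu>)) - I) * (real n * t) \<le> ln (fkn n t ?f)"
    by (simp add: algebra_simps)
  then show ?thesis using t n by (subst pos_le_divide_eq) auto
qed

text \<open>Measures of infinite Fisher information contribute minus infinity to the supremum; for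
  the others \<open>lower_bound_at\<close> reduces the claim to the law of large numbers under
  \<nu>^n.\<close>

lemma lower_bound:
  fixes F :: "'a measure \<Rightarrow> real"
  assumes t: "0 < t" and F: "lsc_on weak_topology F" and bdd: "bounded (F ` prob_measures)"
  shows "(SUP \<nu>\<in>prob_measures. ereal (F \<nu>) - FI \<nu>)
    \<le> liminf (\<lambda>n. ereal (ln (fkn n t (\<lambda>y. real n * F (emp_measure n y))) / (real n * t)))"
proof (rule SUP_least)
  fix \<nu> :: "'a measure" assume \<nu>: "\<nu> \<in> prob_measures"
  obtain C where C: "\<And>\<rho>. \<rho> \<in> prob_measures \<Longrightarrow> \<bar>F \<rho>\<bar> \<le> C" using bdd by (auto simp: bounded_iff)
  let ?l = "liminf (\<lambda>n. ereal (ln (fkn n t (\<lambda>y. real n * F (emp_measure n y))) / (real n * t)))"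
  show "ereal (F \<nu>) - FI \<nu> \<le> ?l"
  proof (cases "FI \<nu>")
    case (real I)
    have "ereal (F \<nu> - I) \<le> ?l + ereal e" if e: "0 < e" for e
    proof -
      have "\<forall>\<^sub>F n in sequentially. F \<nu> - e < (\<integral>x. F (emp_measure n x) \<partial>PiM {..<n} (\<lambda>_. \<nu>))"
        by (rule lsc_emp_measure_lln[where C=C]) (fact \<nu>, fact F, fact C, use e in linarith)
      then have "\<forall>\<^sub>F n in sequentially. ereal (F \<nu> - e - I) \<le> ereal (ln (fkn n t (\<lambda>y. real n * F (emp_measure n y))) / (real n * t))"
        using eventually_gt_at_top[of 0]
      proof eventually_elim
        case (elim n)
        then show ?case using lower_bound_at[OF t F C \<nu> real elim(2)] by simp
      qed
      then have "ereal (F \<nu> - e - I) \<le> ?l" by (rule Liminf_bounded)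
      then have "ereal (F \<nu> - e - I) + ereal e \<le> ?l + ereal e" by (rule add_right_mono)
      then show ?thesis by simp
    qed
    then show ?thesis unfolding real using ereal_le_epsilon2 by simp
  next
    case PInf
    then show ?thesis by simp
  next
    case MInf
    then show ?thesis using fisher_nonneg[of \<nu>] by simp
  qed
qed

end

theorem mainTheorem2:
  fixes Px :: "'a::polish_space \<Rightarrow> 'w measure" and X :: "real \<Rightarrow> 'w \<Rightarrow> 'a"
    and \<mu> :: "'a measure" and t :: real
  assumes "markov_process Px X"
    and "\<mu> \<in> prob_measures"
    and "reversible Px X \<mu>"
    and "ergodic Px X \<mu>"
    and "strongly_continuous_L2 Px X \<mu>"
    and "t > 0"
  shows "(\<forall>F :: 'a measure \<Rightarrow> real. bounded (F ` prob_measures) \<and> lsc_on weak_topology F \<longrightarrow>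
            (SUP \<nu>\<in>prob_measures. ereal (F \<nu>) - fisher Px X \<mu> \<nu>)
              \<le> liminf (\<lambda>n. ereal (ln (fk_norm Px X \<mu> n t (\<lambda>y. real n * F (emp_measure n y))) / (real n * t))))
       \<and> ((\<forall>c::real. compactin weak_topology {\<nu> \<in> prob_measures. fisher Px X \<mu> \<nu> \<le> ereal c}) \<longrightarrow>
          (\<forall>F :: 'a measure \<Rightarrow> real. bounded (F ` prob_measures) \<and> usc_on weak_topology F \<longrightarrow>
            limsup (\<lambda>n. ereal (ln (fk_norm Px X \<mu> n t (\<lambda>y. real n * F (emp_measure n y))) / (real n * t)))
              \<le> (SUP \<nu>\<in>prob_measures. ereal (F \<nu>) - fisher Px X \<mu> \<nu>)))"
proof -
  interpret markov_setting Px X \<mu> by unfold_locales fact+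
  show ?thesis using lower_bound[OF \<open>t > 0\<close>] upper_bound[OF \<open>t > 0\<close>] by blast
qed

end
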